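(* Let $\Gamma=G\star H$ be the free product of two Kleinian groups $G,H$ acting on $\mathbb H^{d+1}$ ($d\ge1$) in Schottky position, with $\delta_G>\delta_H$ and $G$ divergent. Let $x\in\mathbb H^{d+1}$ and let $R>0$ be such that $B(x,R)$ meets $\pi(\widetilde\Omega)$ and $$\forall g\in\Gamma_G,\ \forall h\in\Gamma_H,\quad [g(x);h(x)]\cap B(x,R)\neq\emptyset .$$ Then, for the potential $F=0$, the pair $(\Gamma,\widetilde F)$ is positive recurrent with respect to $\widetilde W=B(x,R)$, that is, $\Gamma$ is divergent and $$\sum_{\gamma\in\Gamma_{\widetilde W}}d(x,\gamma x)\,e^{-\delta_\Gamma d(x,\gamma x)}<+\infty ,$$ and therefore the Bowen–Margulis measure $m_0$ of $T^1(\Gamma\backslash\mathbb H^{d+1})$ is finite.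
   Context: A Kleinian group here is a nonelementary discrete torsion-free group of orientation-preserving isometries of the hyperbolic space $\mathbb H^{d+1}$ of curvature $-1$, with boundary $\mathbb S^d$. $G$ and $H$ are in Schottky position if there are disjoint closed sets $F_G,F_H\subset\mathbb S^d$ with $G^\star(\mathbb S^d\setminus F_G)\subset F_G$ and $H^\star(\mathbb S^d\setminus F_H)\subset F_H$, where $G^\star=G\setminus\{\mathrm{id}\}$, $H^\star=H\setminus\{\mathrm{id}\}$; then the group $\Gamma$ generated by $G$ and $H$ is their free product. $\Gamma_G$ (resp. $\Gamma_H$) is the set of elements of $\Gamma$ whose reduced word in the free product begins with a letter of $G^\star$ (resp. $H^\star$), so $\Gamma=\Gamma_G\sqcup\Gamma_H\sqcup\{\mathrm{id}\}$. $\delta_G,\delta_H,\delta_\Gamma$ are the critical exponents of the Poincaré series $\sum_{g}e^{-s\,d(x,gx)}$ over $G$, $H$, $\Gamma$; a group is divergent if its Poincaré series diverges at its critical exponent. $\delta_\Gamma$ is the pressure $P(0)$ of the zero potential. $[y;z]$ is the geodesic segment from $y$ to $z$. $\pi$ is the base-point projection; $\widetilde\Omega$ is the set of unit vectors whose geodesic has both endpoints in the limit set $\Lambda(\Gamma)$. $\Gamma_{\widetilde W}$ is the set of $\gamma\in\Gamma$ for which there exist $y,y'\in\widetilde W$ such that for every $g\in\Gamma$: if $[y;\gamma y']\cap g\widetilde W\neq\emptyset$ then $\overline{\widetilde W}\cap g\overline{\widetilde W}\neq\emptyset$ or $\gamma\overline{\widetilde W}\cap g\overline{\widetilde W}\neq\emptyset$.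 The Bowen–Margulis measure $m_0$ is the measure on $T^1(\Gamma\backslash\mathbb H^{d+1})$ induced by the measure on $T^1\mathbb H^{d+1}$ given in Hopf coordinates $(v_-,v_+,t)$ (endpoints of the geodesic of $v$ and algebraic distance along it from the projection of a base point $x_0$) by $D(v_-,v_+)^{-2}\,d\mu_{x_0}(v_-)\,d\mu_{x_0}(v_+)\,dt$, where $(\mu_y)_y$ is the Patterson–Sullivan density of dimension $\delta_\Gamma$ of $\Gamma$ and $D(\xi,\eta)=\exp\big(-\frac{\delta_\Gamma}2\lim_{t\to\infty}(d(x_0,\eta_t)-d(\xi_t,\eta_t)+d(\xi_t,x_0))\big)$, with $\xi_t,\eta_t$ geodesic rays converging to $\xi,\eta$. *)

theory Defs
  imports "HOL-Analysis.Analysis" "HOL-Algebra.Bij" "HOL-Algebra.Generated_Groups"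
begin

section \<open>Hyperbolic space\<close>

text \<open>
  We use the Poincare ball model: hyperbolic space is the open unit ball of \<open>real ^ 'n\<close>, with
  \<open>CARD('n) = d + 1\<close>, its boundary is the Euclidean unit sphere, and the Riemannian metric is
  \<open>4 |dp|\<^sup>2 / (1 - |p|\<^sup>2)\<^sup>2\<close>, which has curvature \<open>-1\<close>.
\<close>

abbreviation hyp :: "(real ^ 'n) set" where
  "hyp \<equiv> ball 0 1"

abbreviation hyp_bdry :: "(real ^ 'n) set" where
  "hyp_bdry \<equiv> sphere 0 1"

definition hyp_dist :: "real ^ 'n \<Rightarrow> real ^ 'n \<Rightarrow> real" where
  "hyp_dist y z = arcosh (1 + 2 * (norm (y - z))\<^sup>2 / ((1 - (norm y)\<^sup>2) * (1 - (norm z)\<^sup>2)))"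

definition hyp_ball :: "real ^ 'n \<Rightarrow> real \<Rightarrow> (real ^ 'n) set" where
  "hyp_ball y r = {z \<in> hyp. hyp_dist y z < r}"

definition geodesic_on :: "real set \<Rightarrow> (real \<Rightarrow> real ^ 'n) \<Rightarrow> bool" where
  "geodesic_on I c \<longleftrightarrow>
     (\<forall>t\<in>I. c t \<in> hyp) \<and> (\<forall>s\<in>I. \<forall>t\<in>I. hyp_dist (c s) (c t) = \<bar>s - t\<bar>)"

definition geodesic_segment :: "real ^ 'n \<Rightarrow> real ^ 'n \<Rightarrow> (real ^ 'n) set" where
  "geodesic_segment y z =
     {w. \<exists>c l. 0 \<le> l \<and> geodesic_on {0..l} c \<and> c 0 = y \<and> c l = z \<and> w \<in> c ` {0..l}}"

definition geodesic_ray_to :: "real ^ 'n \<Rightarrow> (real \<Rightarrow> real ^ 'n) \<Rightarrow> bool" where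
  "geodesic_ray_to \<xi> c \<longleftrightarrow> geodesic_on {0..} c \<and> (c \<longlongrightarrow> \<xi>) at_top"

definition busemann :: "real ^ 'n \<Rightarrow> real ^ 'n \<Rightarrow> real ^ 'n \<Rightarrow> real" where
  "busemann \<xi> y z =
     (THE b. \<forall>c. geodesic_ray_to \<xi> c \<longrightarrow> ((\<lambda>t. hyp_dist y (c t) - hyp_dist z (c t)) \<longlongrightarrow> b) at_top)"


section \<open>Kleinian groups\<close>

text \<open>
  Isometries are kept as elements of the library group \<open>BijGroup hyp\<close>: they are \<open>undefined\<close>
  outside the open ball, and their action on the sphere is the continuous extension
  \<open>bdry_act\<close>.
\<close>

definition orientation_preserving_isometries :: "(real ^ 'n \<Rightarrow> real ^ 'n) set" where
  "orientation_preserving_isometries =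
     {f \<in> Bij hyp. (\<forall>y\<in>hyp. \<forall>z\<in>hyp. hyp_dist (f y) (f z) = hyp_dist y z) \<and>
        (\<forall>y\<in>hyp. \<exists>A. (f has_derivative ((*v) A)) (at y) \<and> det A > 0)}"

definition bdry_act :: "(real ^ 'n \<Rightarrow> real ^ 'n) \<Rightarrow> real ^ 'n \<Rightarrow> real ^ 'n" where
  "bdry_act g \<xi> = Lim (at \<xi> within hyp) g"

definition limit_set :: "(real ^ 'n \<Rightarrow> real ^ 'n) set \<Rightarrow> (real ^ 'n) set" where
  "limit_set \<Gamma> = hyp_bdry \<inter> closure ((\<lambda>g. g 0) ` \<Gamma>)"

text \<open>
  In \<open>kleinian\<close>, discreteness refers to the topology of pointwise convergence, which is the library
  topology of the function type (all elements of \<open>Bij hyp\<close> agree outside \<open>hyp\<close>) and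
  coincides on the isometry group with the compact-open topology. Nonelementary means that the
  limit set is infinite.
\<close>

definition kleinian :: "(real ^ 'n \<Rightarrow> real ^ 'n) set \<Rightarrow> bool" where
  "kleinian \<Gamma> \<longleftrightarrow>
     subgroup \<Gamma> (BijGroup hyp) \<and>
     \<Gamma> \<subseteq> orientation_preserving_isometries \<and>
     discrete \<Gamma> \<and>
     (\<forall>g\<in>\<Gamma>. \<forall>n::nat. n > 0 \<and> g [^]\<^bsub>BijGroup hyp\<^esub> n = \<one>\<^bsub>BijGroup hyp\<^esub>
        \<longrightarrow> g = \<one>\<^bsub>BijGroup hyp\<^esub>) \<and>
     infinite (limit_set \<Gamma>)"

abbreviation star :: "(real ^ 'n \<Rightarrow> real ^ 'n) set \<Rightarrow> (real ^ 'n \<Rightarrow> real ^ 'n) set" where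
  "star G \<equiv> G - {\<one>\<^bsub>BijGroup hyp\<^esub>}"

definition schottky_position ::
    "(real ^ 'n \<Rightarrow> real ^ 'n) set \<Rightarrow> (real ^ 'n \<Rightarrow> real ^ 'n) set \<Rightarrow> bool" where
  "schottky_position G H \<longleftrightarrow>
     (\<exists>F\<^sub>G F\<^sub>H. closed F\<^sub>G \<and> closed F\<^sub>H \<and> F\<^sub>G \<subseteq> hyp_bdry \<and> F\<^sub>H \<subseteq> hyp_bdry \<and> F\<^sub>G \<inter> F\<^sub>H = {} \<and>
        (\<forall>g\<in>star G. bdry_act g ` (hyp_bdry - F\<^sub>G) \<subseteq> F\<^sub>G) \<and>
        (\<forall>h\<in>star H. bdry_act h ` (hyp_bdry - F\<^sub>H) \<subseteq> F\<^sub>H))"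

definition generated_group ::
    "(real ^ 'n \<Rightarrow> real ^ 'n) set \<Rightarrow> (real ^ 'n \<Rightarrow> real ^ 'n) set \<Rightarrow> (real ^ 'n \<Rightarrow> real ^ 'n) set" where
  "generated_group G H = generate (BijGroup hyp) (G \<union> H)"

fun alternating_word :: "'a set \<Rightarrow> 'a set \<Rightarrow> 'a list \<Rightarrow> bool" where
  "alternating_word A B [] \<longleftrightarrow> True"
| "alternating_word A B (a # w) \<longleftrightarrow> a \<in> A \<and> alternating_word B A w"

text \<open>
  The elements of the group generated by \<open>G\<close> and \<open>H\<close> whose reduced word begins with a letter of
  \<open>G\<close>: this is \<open>\<Gamma>\<^sub>G\<close>, and \<open>\<Gamma>\<^sub>H\<close> is \<open>words_beginning_in H G\<close>.
\<close>

definition words_beginning_in ::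
    "(real ^ 'n \<Rightarrow> real ^ 'n) set \<Rightarrow> (real ^ 'n \<Rightarrow> real ^ 'n) set \<Rightarrow> (real ^ 'n \<Rightarrow> real ^ 'n) set" where
  "words_beginning_in G H =
     {foldr (\<otimes>\<^bsub>BijGroup hyp\<^esub>) w \<one>\<^bsub>BijGroup hyp\<^esub> | w. w \<noteq> [] \<and> alternating_word (star G) (star H) w}"


section \<open>Poincare series and positive recurrence\<close>

text \<open>
  By the triangle inequality, convergence of the Poincare series does not depend on the base
  point; the centre of the ball is used here.
\<close>

definition poincare_convergent :: "(real ^ 'n \<Rightarrow> real ^ 'n) set \<Rightarrow> real \<Rightarrow> bool" where
  "poincare_convergent \<Gamma> s \<longleftrightarrow> (\<lambda>g. exp (- s * hyp_dist 0 (g 0))) summable_on \<Gamma>"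

definition critical_exponent :: "(real ^ 'n \<Rightarrow> real ^ 'n) set \<Rightarrow> real" where
  "critical_exponent \<Gamma> = Inf {s. poincare_convergent \<Gamma> s}"

definition divergent_group :: "(real ^ 'n \<Rightarrow> real ^ 'n) set \<Rightarrow> bool" where
  "divergent_group \<Gamma> \<longleftrightarrow> \<not> poincare_convergent \<Gamma> (critical_exponent \<Gamma>)"

definition Gamma_W :: "(real ^ 'n \<Rightarrow> real ^ 'n) set \<Rightarrow> (real ^ 'n) set \<Rightarrow> (real ^ 'n \<Rightarrow> real ^ 'n) set" where
  "Gamma_W \<Gamma> W =
     {\<gamma> \<in> \<Gamma>. \<exists>y\<in>W. \<exists>y'\<in>W. \<forall>g\<in>\<Gamma>. geodesic_segment y (\<gamma> y') \<inter> g ` W \<noteq> {} \<longrightarrow>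
        closure W \<inter> g ` closure W \<noteq> {} \<or> \<gamma> ` closure W \<inter> g ` closure W \<noteq> {}}"

text \<open>
  Positive recurrence with respect to \<open>W\<close> for the zero potential, whose pressure is the critical
  exponent; \<open>x\<close> is the base point of the series.
\<close>

definition positive_recurrent ::
    "(real ^ 'n \<Rightarrow> real ^ 'n) set \<Rightarrow> real ^ 'n \<Rightarrow> (real ^ 'n) set \<Rightarrow> bool" where
  "positive_recurrent \<Gamma> x W \<longleftrightarrow>
     divergent_group \<Gamma> \<and>
     (\<lambda>\<gamma>. hyp_dist x (\<gamma> x) * exp (- critical_exponent \<Gamma> * hyp_dist x (\<gamma> x)))
       summable_on Gamma_W \<Gamma> W"


section \<open>The unit tangent bundle\<close>

text \<open>
  A tangent vector is a pair of base point and Euclidean vector. Its Riemannian norm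
  \<open>2 |u| / (1 - |p|\<^sup>2)\<close> is \<open>1\<close> on the unit tangent bundle. Isometries act by their derivative.
\<close>

definition unit_tangent :: "((real ^ 'n) \<times> (real ^ 'n)) set" where
  "unit_tangent = {(p, u). p \<in> hyp \<and> 2 * norm u = 1 - (norm p)\<^sup>2}"

definition tangent_act ::
    "(real ^ 'n \<Rightarrow> real ^ 'n) \<Rightarrow> (real ^ 'n) \<times> (real ^ 'n) \<Rightarrow> (real ^ 'n) \<times> (real ^ 'n)" where
  "tangent_act g v = (g (fst v), frechet_derivative g (at (fst v)) (snd v))"

definition geodesic_of :: "(real ^ 'n) \<times> (real ^ 'n) \<Rightarrow> real \<Rightarrow> real ^ 'n" where
  "geodesic_of v =
     (THE c. geodesic_on UNIV c \<and> c 0 = fst v \<and> (c has_vector_derivative snd v) (at 0))"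

definition v_minus :: "(real ^ 'n) \<times> (real ^ 'n) \<Rightarrow> real ^ 'n" where
  "v_minus v = Lim at_bot (geodesic_of v)"

definition v_plus :: "(real ^ 'n) \<times> (real ^ 'n) \<Rightarrow> real ^ 'n" where
  "v_plus v = Lim at_top (geodesic_of v)"

definition Omega :: "(real ^ 'n \<Rightarrow> real ^ 'n) set \<Rightarrow> ((real ^ 'n) \<times> (real ^ 'n)) set" where
  "Omega \<Gamma> = {v \<in> unit_tangent. v_minus v \<in> limit_set \<Gamma> \<and> v_plus v \<in> limit_set \<Gamma>}"

text \<open>
  The projection of \<open>x\<^sub>0\<close> to the geodesic of \<open>v\<close> is its nearest point; the vector \<open>v\<close> lies at
  algebraic distance \<open>t\<close> from it precisely when it is \<open>geodesic_of v (- t)\<close>.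
\<close>

definition hopf_time :: "real ^ 'n \<Rightarrow> (real ^ 'n) \<times> (real ^ 'n) \<Rightarrow> real" where
  "hopf_time x\<^sub>0 v =
     (THE t. \<forall>s. hyp_dist x\<^sub>0 (geodesic_of v (- t)) \<le> hyp_dist x\<^sub>0 (geodesic_of v s))"

definition hopf :: "real ^ 'n \<Rightarrow> (real ^ 'n) \<times> (real ^ 'n) \<Rightarrow> (real ^ 'n) \<times> (real ^ 'n) \<times> real" where
  "hopf x\<^sub>0 v = (v_minus v, v_plus v, hopf_time x\<^sub>0 v)"


section \<open>The Bowen-Margulis measure\<close>

text \<open>A Patterson-Sullivan density: a conformal density of dimension the critical exponent, carried
  by the limit set.\<close>

definition patterson_sullivan_density ::
    "(real ^ 'n \<Rightarrow> real ^ 'n) set \<Rightarrow> (real ^ 'n \<Rightarrow> (real ^ 'n) measure) \<Rightarrow> bool" where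
  "patterson_sullivan_density \<Gamma> \<mu> \<longleftrightarrow>
     (\<forall>y\<in>hyp. finite_measure (\<mu> y) \<and>
        sets (\<mu> y) = sets (restrict_space borel hyp_bdry) \<and>
        emeasure (\<mu> y) hyp_bdry \<noteq> 0 \<and>
        emeasure (\<mu> y) (hyp_bdry - limit_set \<Gamma>) = 0) \<and>
     (\<forall>g\<in>\<Gamma>. \<forall>y\<in>hyp. distr (\<mu> y) (restrict_space borel hyp_bdry) (bdry_act g) = \<mu> (g y)) \<and>
     (\<forall>y\<in>hyp. \<forall>z\<in>hyp.
        \<mu> y = density (\<mu> z) (\<lambda>\<xi>. ennreal (exp (- critical_exponent \<Gamma> * busemann \<xi> y z))))"

definition bm_gap :: "(real ^ 'n \<Rightarrow> real ^ 'n) set \<Rightarrow> real ^ 'n \<Rightarrow> real ^ 'n \<Rightarrow> real ^ 'n \<Rightarrow> real" where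
  "bm_gap \<Gamma> x\<^sub>0 \<xi> \<eta> = exp (- (critical_exponent \<Gamma> / 2) *
     (THE l. \<forall>a b. geodesic_ray_to \<xi> a \<and> geodesic_ray_to \<eta> b \<longrightarrow>
        ((\<lambda>t. hyp_dist x\<^sub>0 (b t) - hyp_dist (a t) (b t) + hyp_dist (a t) x\<^sub>0) \<longlongrightarrow> l) at_top))"

definition bm_hopf ::
    "(real ^ 'n \<Rightarrow> real ^ 'n) set \<Rightarrow> (real ^ 'n \<Rightarrow> (real ^ 'n) measure) \<Rightarrow> real ^ 'n
       \<Rightarrow> ((real ^ 'n) \<times> (real ^ 'n) \<times> real) measure" where
  "bm_hopf \<Gamma> \<mu> x\<^sub>0 =
     density
       (restrict_space (\<mu> x\<^sub>0 \<Otimes>\<^sub>M (\<mu> x\<^sub>0 \<Otimes>\<^sub>M lborel)) {(\<xi>, \<eta>, t). \<xi> \<noteq> \<eta>})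
       (\<lambda>(\<xi>, \<eta>, t). ennreal (bm_gap \<Gamma> x\<^sub>0 \<xi> \<eta> powr - 2))"

text \<open>Hopf coordinates are a bijection from the unit tangent bundle onto the triples
  \<open>(\<xi>, \<eta>, t)\<close> with distinct \<open>\<xi>\<close> and \<open>\<eta>\<close> on the sphere, whence the inverse.\<close>

definition bm_lift ::
    "(real ^ 'n \<Rightarrow> real ^ 'n) set \<Rightarrow> (real ^ 'n \<Rightarrow> (real ^ 'n) measure) \<Rightarrow> real ^ 'n
       \<Rightarrow> ((real ^ 'n) \<times> (real ^ 'n)) measure" where
  "bm_lift \<Gamma> \<mu> x\<^sub>0 =
     distr (bm_hopf \<Gamma> \<mu> x\<^sub>0) (restrict_space borel unit_tangent) (inv_into unit_tangent (hopf x\<^sub>0))"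

text \<open>
  The measure induced on a quotient. For an orbit map \<open>p\<close> of a free, properly discontinuous action
  preserving \<open>M\<close>, it is the unique measure on the quotient \<open>\<sigma>\<close>-algebra giving \<open>p ` A\<close> the mass
  of \<open>A\<close> for all measurable \<open>A\<close> on which \<open>p\<close> is injective. The supremum below is
  always a measure; it is attained on the intersection of \<open>p -` B\<close> with a Borel fundamental domain.
\<close>

definition quotient_measure :: "'a measure \<Rightarrow> ('a \<Rightarrow> 'b) \<Rightarrow> 'b measure" where
  "quotient_measure M p =
     measure_of (p ` space M) {B. B \<subseteq> p ` space M \<and> p -` B \<inter> space M \<in> sets M}
       (\<lambda>B. SUP A\<in>{A \<in> sets M. A \<subseteq> p -` B \<and> inj_on p A}. emeasure M A)"

lemma sigma_algebra_quotient:
  "sigma_algebra (p ` space M) {B. B \<subseteq> p ` space M \<and> p -` B \<inter> space M \<in> sets M}"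
proof (rule sigma_algebra_iff2[THEN iffD2], intro conjI ballI allI impI)
  fix B assume "B \<in> {B. B \<subseteq> p ` space M \<and> p -` B \<inter> space M \<in> sets M}"
  then have "space M - (p -` B \<inter> space M) \<in> sets M" by (intro sets.compl_sets) simp
  moreover have "p -` (p ` space M - B) \<inter> space M = space M - (p -` B \<inter> space M)" by auto
  ultimately show "p ` space M - B \<in> {B. B \<subseteq> p ` space M \<and> p -` B \<inter> space M \<in> sets M}"
    by (metis (no_types, lifting) Diff_subset mem_Collect_eq)
next
  fix B :: "nat \<Rightarrow> _" assume *: "range B \<subseteq> {B. B \<subseteq> p ` space M \<and> p -` B \<inter> space M \<in> sets M}"
  have "p -` (\<Union>i. B i) \<inter> space M = (\<Union>i. p -` B i \<inter> space M)" by auto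
  moreover have "(\<Union>i. p -` B i \<inter> space M) \<in> sets M"
    using * by (intro sets.countable_UN') auto
  ultimately show "(\<Union>i. B i) \<in> {B. B \<subseteq> p ` space M \<and> p -` B \<inter> space M \<in> sets M}"
    using * by auto
qed auto

lemma space_quotient_measure: "space (quotient_measure M p) = p ` space M"
  unfolding quotient_measure_def by (rule space_measure_of) auto

lemma sets_quotient_measure:
  "sets (quotient_measure M p) = {B. B \<subseteq> p ` space M \<and> p -` B \<inter> space M \<in> sets M}"
  unfolding quotient_measure_def by (rule sigma_algebra.sets_measure_of_eq[OF sigma_algebra_quotient])

lemma emeasure_quotient_measure:
  assumes "B \<in> sets (quotient_measure M p)"
  shows "emeasure (quotient_measure M p) B =
    (SUP A\<in>{A \<in> sets M. A \<subseteq> p -` B \<and> inj_on p A}. emeasure M A)"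
proof -
  define S where "S = {B. B \<subseteq> p ` space M \<and> p -` B \<inter> space M \<in> sets M}"
  define F where "F B = {A \<in> sets M. A \<subseteq> p -` B \<and> inj_on p A}" for B
  define m where "m B = (SUP A\<in>F B. emeasure M A)" for B
  have Fne: "{} \<in> F B" for B by (auto simp: F_def)
  have "countably_additive S m"
  proof (rule countably_additiveI)
    fix B :: "nat \<Rightarrow> _" assume B: "range B \<subseteq> S" "disjoint_family B"
    have fin: "(\<Sum>i<n. m (B i)) \<le> m (\<Union>i. B i)" for n :: nat
    proof -
      have "\<exists>A\<in>F (\<Union>i<n. B i). c < emeasure M A" if "c < (\<Sum>i<n. m (B i))" for c
        using that
      proof (induction n arbitrary: c)
        case 0 then show ?case by simp
      next
        case (Suc n)
        let ?m = "\<Sum>i<n. m (B i)"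
        have "?m \<le> (SUP A\<in>F (\<Union>i<n. B i). emeasure M A)"
          by (intro le_SUP_iff[THEN iffD2] allI impI Suc.IH)
        then have "?m + m (B n) \<le> (SUP A\<in>F (\<Union>i<n. B i). emeasure M A) + m (B n)"
          by (rule add_right_mono)
        also have "\<dots> = (SUP A\<in>F (\<Union>i<n. B i). emeasure M A + m (B n))"
          by (rule ennreal_SUP_add_left[symmetric]) (use Fne in blast)
        finally have "c < (SUP A\<in>F (\<Union>i<n. B i). emeasure M A + m (B n))"
          using Suc.prems by (simp add: order.strict_trans2)
        then obtain A where A: "A \<in> F (\<Union>i<n. B i)" "c < emeasure M A + m (B n)"
          by (auto simp only: less_SUP_iff)
        have "m (B n) + emeasure M A = (SUP C\<in>F (B n). emeasure M C + emeasure M A)"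
          unfolding m_def by (rule ennreal_SUP_add_left[symmetric]) (use Fne in blast)
        with A(2) have "c < (SUP C\<in>F (B n). emeasure M C + emeasure M A)"
          by (simp add: add.commute)
        then obtain C where C: "C \<in> F (B n)" "c < emeasure M A + emeasure M C"
          by (auto simp only: less_SUP_iff add.commute)
        have "B i \<inter> B n = {}" if "i < n" for i
          using that by (intro disjoint_family_onD[OF B(2)]) auto
        then have dis: "(\<Union>i<n. B i) \<inter> B n = {}" by blast
        have "A \<union> C \<in> F (\<Union>i<Suc n. B i)"
        proof -
          have AC: "A \<subseteq> p -` (\<Union>i<n. B i)" "C \<subseteq> p -` B n"
            and inj: "inj_on p A" "inj_on p C" and sets: "A \<in> sets M" "C \<in> sets M"
            using A(1) C(1) by (auto simp: F_def)
          have "p ` (A - C) \<subseteq> (\<Union>i<n. B i)" "p ` (C - A) \<subseteq> B n"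
            using AC by (auto simp del: UN_iff)
          then have "p ` (A - C) \<inter> p ` (C - A) = {}" using dis by blast
          then have "inj_on p (A \<union> C)" using inj by (simp add: inj_on_Un)
          moreover have "p -` (\<Union>i<n. B i) \<union> p -` B n = p -` (\<Union>i<Suc n. B i)"
            unfolding lessThan_Suc by blast
          then have "A \<union> C \<subseteq> p -` (\<Union>i<Suc n. B i)" using Un_mono[OF AC] by simp
          ultimately show ?thesis using sets by (simp add: F_def)
        qed
        moreover have "emeasure M A + emeasure M C = emeasure M (A \<union> C)"
        proof (rule plus_emeasure)
          show "A \<in> sets M" "C \<in> sets M" using A(1) C(1) by (auto simp: F_def)
          have "A \<subseteq> p -` (\<Union>i<n. B i)" "C \<subseteq> p -` B n" using A(1) C(1) by (auto simp: F_def)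
          with dis show "A \<inter> C = {}" by blast
        qed
        ultimately show ?case using C(2) by auto
      qed
      then have "(\<Sum>i<n. m (B i)) \<le> m (\<Union>i<n. B i)"
        unfolding m_def[of "\<Union>i<n. B i"] by (intro le_SUP_iff[THEN iffD2] allI impI)
      also have "\<dots> \<le> m (\<Union>i. B i)"
        unfolding m_def by (rule SUP_subset_mono) (fastforce simp: F_def)+
      finally show ?thesis .
    qed
    have le: "m (\<Union>i. B i) \<le> (\<Sum>i. m (B i))"
      unfolding m_def[of "\<Union>i. B i"]
    proof (rule SUP_least)
      fix A assume A: "A \<in> F (\<Union>i. B i)"
      have Am: "A \<inter> p -` B i \<in> sets M" for i
      proof -
        have "A \<inter> p -` B i = A \<inter> (p -` B i \<inter> space M)"
          using A sets.sets_into_space[of A M] by (auto simp: F_def)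
        moreover have "A \<in> sets M" "p -` B i \<inter> space M \<in> sets M"
          using A B(1) by (auto simp: F_def S_def)
        ultimately show ?thesis using sets.Int by metis
      qed
      have "A = (\<Union>i. A \<inter> p -` B i)" using A unfolding F_def by blast
      moreover have "disjoint_family (\<lambda>i. A \<inter> p -` B i)"
        unfolding disjoint_family_on_def
      proof (intro ballI impI)
        fix i j :: nat assume "i \<noteq> j"
        then have "B i \<inter> B j = {}" by (intro disjoint_family_onD[OF B(2)]) auto
        then show "A \<inter> p -` B i \<inter> (A \<inter> p -` B j) = {}" by blast
      qed
      then have "(\<Sum>i. emeasure M (A \<inter> p -` B i)) = emeasure M (\<Union>i. A \<inter> p -` B i)"
        using Am by (intro suminf_emeasure) auto
      ultimately have "emeasure M A = (\<Sum>i. emeasure M (A \<inter> p -` B i))"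
        by simp
      also have "\<dots> \<le> (\<Sum>i. m (B i))"
        unfolding m_def
      proof (intro suminf_le SUP_upper)
        show "A \<inter> p -` B i \<in> F (B i)" for i
          using A Am[of i] by (auto simp: F_def intro: inj_on_subset)
      qed auto
      finally show "emeasure M A \<le> (\<Sum>i. m (B i))" .
    qed
    have "(\<Sum>i. m (B i)) \<le> m (\<Union>i. B i)"
      by (rule suminf_le_const) (use fin in auto)
    with le show "(\<Sum>i. m (B i)) = m (\<Union>i. B i)" by simp
  qed
  moreover have "positive S m"
    by (auto simp: positive_def m_def F_def intro!: antisym SUP_least)
  moreover have "B \<in> S"
    using assms unfolding sets_quotient_measure S_def .
  moreover have "quotient_measure M p = measure_of (p ` space M) S m"
    unfolding quotient_measure_def S_def m_def F_def ..
  ultimately have "emeasure (quotient_measure M p) B = m B"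
    using emeasure_measure_of_sigma[of "p ` space M" S m B] sigma_algebra_quotient[of p M]
    unfolding S_def by simp
  then show ?thesis by (simp add: m_def F_def)
qed

text \<open>The space of the quotient measure is the set of \<open>\<Gamma>\<close>-orbits in the unit tangent bundle, that
  is, the unit tangent bundle of the quotient of \<open>hyp\<close> by \<open>\<Gamma>\<close>.\<close>

definition bowen_margulis ::
    "(real ^ 'n \<Rightarrow> real ^ 'n) set \<Rightarrow> (real ^ 'n \<Rightarrow> (real ^ 'n) measure) \<Rightarrow> real ^ 'n
       \<Rightarrow> ((real ^ 'n) \<times> (real ^ 'n)) set measure" where
  "bowen_margulis \<Gamma> \<mu> x\<^sub>0 =
     quotient_measure (bm_lift \<Gamma> \<mu> x\<^sub>0) (\<lambda>v. (\<lambda>g. tangent_act g v) ` \<Gamma>)"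

end

theory Submission
  imports Defs "HOL-Real_Asymp.Real_Asymp"
begin

text \<open>
  The crossing property gives \<open>d(g x, h x) \<ge> d(x, g x) + d(x, h x) - 2 R\<close> for \<open>g \<in> \<Gamma>\<^sub>G\<close> and
  \<open>h \<in> \<Gamma>\<^sub>H\<close>, so the displacement of a reduced word is the sum of those of its letters up to an error
  linear in the word length. Regarding reduced words as words over the alphabet of pairs of letters,
  divergence of \<open>G\<close> makes the exponent of \<open>\<Gamma>\<close> larger than \<open>\<delta>\<^sub>G\<close>; it is the value at which the
  series of one-letter words is critical, and \<open>\<Gamma>\<close> diverges there. Forbidding a suitable pattern of
  letters strictly lowers the exponent, and an element of \<open>\<Gamma>\<^sub>W\<close> avoids the pattern up to its end
  letters, because every occurrence forces each admissible geodesic through a translate of the ball.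

  For the Bowen-Margulis measure, almost every limit point is coded by an infinite reduced word: the
  limit sets of the factors and their translates are null since infinitely many disjoint translates
  would otherwise have masses bounded below by a divergent series. Cutting a geodesic at its
  crossings between \<open>g x\<close> and \<open>g a x\<close>, with \<open>a\<close> a letter, moves it into a set of mass at most
  a constant times \<open>\<Sum> d(x, a x) exp (- \<delta> d(x, a x))\<close>, summed over the letters \<open>a\<close>, and this is finite since \<open>\<delta> > \<delta>\<^sub>G\<close>.
\<close>

text \<open>The delicate point is the pattern. Crossings of the open ball are assumed only for
  geodesics between orbit points of \<open>x\<close>, whereas \<open>Gamma_W\<close> admits
  arbitrary \<open>y\<close> and \<open>y'\<close> in the ball. A geodesic from \<open>p\<close> to
  \<open>q\<close> meets the ball as soon as \<open>visual x p q\<close> exceeds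
  \<open>2 / (cosh R)\<^sup>2\<close>, which is 1 - cos of the angle under which \<open>x\<close>
  sees a line at distance \<open>R\<close>. In the limit of distant end points the crossings give
  only the weak inequality, which does not survive a perturbation of the end points. A pattern is a
  pair of words for which the inequality is robust; its existence is a statement about dimension,
  since equality in all the limits involved would produce more nonzero orthogonal vectors than the
  space can hold.

  The second recurring device is to converge strictly below \<delta>: a series that converges at
  some \<open>s\<close> < \<delta> still converges at \<delta> after multiplication by the
  displacement, because \<open>t\<close> is at most
  \<open>exp ((\<delta> - s) * t) / (\<delta> - s)\<close>. Hence the emphasis on strict
  inequalities between exponents.\<close>

section \<open>The hyperboloid model and its geodesics\<close>

definition mink :: "real \<times> (real ^ 'n) \<Rightarrow> real \<times> (real ^ 'n) \<Rightarrow> real" where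
  "mink v w = fst v * fst w - snd v \<bullet> snd w"

text \<open>Inverse stereographic projection of the ball onto the upper sheet of the hyperboloid
  \<open>mink v v = 1\<close>. There \<open>cosh\<close> of the distance is bilinear and geodesics
  span planes, so metric statements become linear algebra.\<close>

definition lor :: "real ^ 'n \<Rightarrow> real \<times> (real ^ 'n)" where
  "lor y = ((1 + (norm y)\<^sup>2) / (1 - (norm y)\<^sup>2), (2 / (1 - (norm y)\<^sup>2)) *\<^sub>R y)"

lemma mink_commute: "mink v w = mink w v"
  by (simp add: mink_def inner_commute)

lemma mink_add_left [simp]: "mink (u + v) w = mink u w + mink v w"
  and mink_diff_left [simp]: "mink (u - v) w = mink u w - mink v w"
  and mink_scaleR_left [simp]: "mink (r *\<^sub>R u) w = r * mink u w"
  and mink_add_right [simp]: "mink w (u + v) = mink w u + mink w v"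
  and mink_diff_right [simp]: "mink w (u - v) = mink w u - mink w v"
  and mink_scaleR_right [simp]: "mink w (r *\<^sub>R u) = r * mink w u"
  by (auto simp: mink_def algebra_simps inner_add_left inner_add_right inner_diff_left inner_diff_right)

lemma one_minus_norm2_pos: "y \<in> hyp \<Longrightarrow> 0 < 1 - (norm y)\<^sup>2"
  by (simp add: power_less_one_iff)

lemma mink_lor:
  assumes "y \<in> hyp" "z \<in> hyp"
  shows "mink (lor y) (lor z) = 1 + 2 * (norm (y - z))\<^sup>2 / ((1 - (norm y)\<^sup>2) * (1 - (norm z)\<^sup>2))"
proof -
  have n: "(norm (y - z))\<^sup>2 = (norm y)\<^sup>2 + (norm z)\<^sup>2 - 2 * (y \<bullet> z)"
    by (simp add: power2_norm_eq_inner algebra_simps inner_commute inner_diff_left inner_diff_right)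
  show ?thesis
    using one_minus_norm2_pos[OF assms(1)] one_minus_norm2_pos[OF assms(2)]
    unfolding mink_def lor_def n by (simp add: divide_simps) (simp add: algebra_simps)
qed

lemma cosh_hyp_dist:
  assumes "y \<in> hyp" "z \<in> hyp"
  shows "cosh (hyp_dist y z) = 1 + 2 * (norm (y - z))\<^sup>2 / ((1 - (norm y)\<^sup>2) * (1 - (norm z)\<^sup>2))"
    and "hyp_dist y z \<ge> 0"
proof -
  have "2 * (norm (y - z))\<^sup>2 / ((1 - (norm y)\<^sup>2) * (1 - (norm z)\<^sup>2)) \<ge> 0"
    using one_minus_norm2_pos[OF assms(1)] one_minus_norm2_pos[OF assms(2)] by simp
  then have *: "1 + 2 * (norm (y - z))\<^sup>2 / ((1 - (norm y)\<^sup>2) * (1 - (norm z)\<^sup>2)) \<ge> 1" by simp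
  show "cosh (hyp_dist y z) = 1 + 2 * (norm (y - z))\<^sup>2 / ((1 - (norm y)\<^sup>2) * (1 - (norm z)\<^sup>2))"
    unfolding hyp_dist_def by (rule cosh_arcosh_real[OF *])
  show "hyp_dist y z \<ge> 0"
    unfolding hyp_dist_def by (rule arcosh_nonneg_real[OF *])
qed

lemma mink_lor_cosh: "y \<in> hyp \<Longrightarrow> z \<in> hyp \<Longrightarrow> mink (lor y) (lor z) = cosh (hyp_dist y z)"
  by (simp add: mink_lor cosh_hyp_dist)

lemma mink_lor_self [simp]: "y \<in> hyp \<Longrightarrow> mink (lor y) (lor y) = 1"
  by (simp add: mink_lor)

lemma hyp_dist_eqI:
  assumes "y \<in> hyp" "z \<in> hyp" "mink (lor y) (lor z) = cosh t" "t \<ge> 0"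
  shows "hyp_dist y z = t"
  using assms mink_lor_cosh[OF assms(1,2)] cosh_hyp_dist(2)[OF assms(1,2)]
  by (metis arcosh_cosh_real)

lemma fst_lor_ge_1: "y \<in> hyp \<Longrightarrow> fst (lor y) \<ge> 1"
  using one_minus_norm2_pos[of y] by (simp add: lor_def)

lemma fst_lor: "y \<in> hyp \<Longrightarrow> fst (lor y) = cosh (hyp_dist 0 y)"
  by (subst cosh_hyp_dist) (use one_minus_norm2_pos[of y] in \<open>auto simp: lor_def field_simps\<close>)

lemma one_plus_fst_lor: "y \<in> hyp \<Longrightarrow> 1 + fst (lor y) = 2 / (1 - (norm y)\<^sup>2)"
  using one_minus_norm2_pos[of y] by (simp add: lor_def field_simps)

lemma lor_ball_coordinate:
  assumes "y \<in> hyp"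
  shows "y = (1 / (1 + fst (lor y))) *\<^sub>R snd (lor y)"
  proof -
  have "1 / (2 / (1 - (norm y)\<^sup>2)) * (2 / (1 - (norm y)\<^sup>2)) = 1"
    using one_minus_norm2_pos[OF assms] by simp
  then show ?thesis unfolding one_plus_fst_lor[OF assms] by (simp only: lor_def snd_conv scaleR_scaleR scaleR_one)
qed

lemma lor_inj: "y \<in> hyp \<Longrightarrow> z \<in> hyp \<Longrightarrow> lor y = lor z \<Longrightarrow> y = z"
  by (metis lor_ball_coordinate)

lemma lor_surj:
  assumes "mink v v = 1" "fst v > 0"
  defines "y \<equiv> (1 / (1 + fst v)) *\<^sub>R snd v"
  shows "y \<in> hyp" "lor y = v"
proof -
  obtain a b where v: "v = (a, b)" by (cases v)
  have a: "a > 0" and b: "b \<bullet> b = a * a - 1" using assms(1,2) by (auto simp: mink_def v)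
  have "(norm y)\<^sup>2 = (b \<bullet> b) / (1 + a)\<^sup>2"
    using a by (simp add: y_def v power_divide power2_norm_eq_inner)
  also have "\<dots> = (a - 1) / (1 + a)"
    unfolding b using a by (simp add: divide_simps power2_eq_square) (simp add: algebra_simps)
  finally have n: "(norm y)\<^sup>2 = (a - 1) / (1 + a)" .
  have n1: "1 - (norm y)\<^sup>2 = 2 / (1 + a)" "1 + (norm y)\<^sup>2 = 2 * a / (1 + a)"
    unfolding n using a by (auto simp: field_simps)
  then have "(norm y)\<^sup>2 < 1" using a by (simp add: n)
  then show "y \<in> hyp" by (simp add: power_less_one_iff abs_square_less_1)
  show "lor y = v"
    unfolding lor_def n1 using a by (simp add: y_def v)
qed

text \<open>The form is negative definite on the orthogonal complement of a timelike unit vector.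
  Orthogonality reads \<open>a * c = b \<bullet> d\<close>; with
  \<open>d \<bullet> d = c * c - 1\<close>, Cauchy-Schwarz bounds the time part of \<open>v\<close>
  by its space part, with a surplus that leaves only \<open>v = 0\<close> in the case of
  equality.\<close>

lemma mink_orthogonal:
  assumes w: "mink w w = 1" and o: "mink v w = 0"
  shows "mink v v \<le> 0" and "mink v v = 0 \<Longrightarrow> v = 0"
proof -
  obtain a b where v: "v = (a, b)" by (cases v)
  obtain c d where w': "w = (c, d)" by (cases w)
  have cd: "d \<bullet> d = c * c - 1" and ac: "a * c = b \<bullet> d" using w o by (auto simp: mink_def v w')
  have "(b \<bullet> d)\<^sup>2 \<le> (b \<bullet> b) * (d \<bullet> d)" by (rule Cauchy_Schwarz_ineq)
  then have cs: "(a * c) * (a * c) \<le> (b \<bullet> b) * (c * c - 1)" unfolding cd ac[symmetric] by (simp add: power2_eq_square)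
  have c: "c * c \<ge> 1" using cd inner_ge_zero[of d] by linarith
  have key: "(b \<bullet> b - a * a) * (c * c) \<ge> b \<bullet> b" using cs by (simp add: algebra_simps)
  then have "(b \<bullet> b - a * a) * (c * c) \<ge> 0" using inner_ge_zero[of b] by linarith
  then show "mink v v \<le> 0" using c by (simp add: mink_def v zero_le_mult_iff)
  assume "mink v v = 0"
  then have "b \<bullet> b - a * a = 0" by (simp add: mink_def v)
  with key have "b \<bullet> b \<le> 0" by simp
  then have "b \<bullet> b = 0" using inner_ge_zero[of b] by linarith
  then have "b = 0" by simp
  with \<open>b \<bullet> b - a * a = 0\<close> show "v = 0" by (simp add: v zero_prod_def)
qed

text \<open>Cauchy-Schwarz for the definite form of \<open>mink_orthogonal\<close>, applied to the
  component \<open>z\<close> of \<open>u\<close> orthogonal to \<open>v\<close>.\<close>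

lemma mink_orthogonal_CS:
  assumes w: "mink w w = 1" and "mink u w = 0" "mink v w = 0"
  shows "(mink u v)\<^sup>2 \<le> mink u u * mink v v"
proof (cases "mink v v = 0")
  case True
  then have "v = 0" using mink_orthogonal(2)[OF w] assms by blast
  then show ?thesis by (simp add: mink_def)
next
  case False
  then have neg: "mink v v < 0" using mink_orthogonal(1)[OF w assms(3)] by simp
  define z where "z = u - (mink u v / mink v v) *\<^sub>R v"
  have "mink z w = 0" using assms by (simp add: z_def)
  then have "mink z z \<le> 0" using mink_orthogonal(1)[OF w] by blast
  moreover have "mink z z = mink u u - (mink u v)\<^sup>2 / mink v v"
    using False by (simp add: z_def mink_commute[of v u] field_simps power2_eq_square)
  ultimately show ?thesis using neg by (simp add: field_simps)
qed

lemma hyp_dist_commute: "hyp_dist y z = hyp_dist z y"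
  by (simp add: hyp_dist_def norm_minus_commute mult.commute)

lemma hyp_dist_self [simp]: "hyp_dist y y = 0"
  by (simp add: hyp_dist_def)

lemma hyp_dist_eq_0: "y \<in> hyp \<Longrightarrow> z \<in> hyp \<Longrightarrow> hyp_dist y z = 0 \<longleftrightarrow> y = z"
  using cosh_hyp_dist(1)[of y z] one_minus_norm2_pos[of y] one_minus_norm2_pos[of z] by auto

text \<open>The components \<open>u\<close> and \<open>v\<close> of \<open>lor p\<close> and
  \<open>lor q\<close> orthogonal to \<open>lor w\<close> have square \<open>- sinh\<^sup>2\<close>
  of the distances to \<open>w\<close>. Hence \<open>cosh (hyp_dist p q)\<close> is
  \<open>cosh ?a * cosh ?b + mink u v\<close>, the law of cosines, and Cauchy-Schwarz bounds it by
  \<open>cosh (?a + ?b)\<close>.\<close>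

lemma hyp_dist_triangle:
  assumes "p \<in> hyp" "w \<in> hyp" "q \<in> hyp"
  shows "hyp_dist p q \<le> hyp_dist p w + hyp_dist w q"
proof -
  let ?a = "hyp_dist p w" and ?b = "hyp_dist w q"
  define u where "u = lor p - cosh ?a *\<^sub>R lor w"
  define v where "v = lor q - cosh ?b *\<^sub>R lor w"
  note m = mink_lor_cosh[OF assms(1,2)] mink_lor_cosh[OF assms(2,3)] mink_lor_cosh[OF assms(1,3)]
    mink_commute[of "lor w" "lor p"] mink_commute[of "lor q" "lor w"]  mink_commute[of "lor q" "lor p"]
  have uw: "mink u (lor w) = 0" "mink v (lor w) = 0" using m assms by (auto simp: u_def v_def)
  have uu: "mink u u = - (sinh ?a)\<^sup>2" "mink v v = - (sinh ?b)\<^sup>2"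
    using m assms cosh_square_eq[of ?a] cosh_square_eq[of ?b]
    by (auto simp: u_def v_def power2_eq_square algebra_simps)
  have "(mink u v)\<^sup>2 \<le> (sinh ?a * sinh ?b)\<^sup>2"
    using mink_orthogonal_CS[OF mink_lor_self[OF assms(2)] uw] uu by (simp add: power_mult_distrib)
  moreover have nn: "?a \<ge> 0" "?b \<ge> 0" "hyp_dist p q \<ge> 0" using assms by (auto intro: cosh_hyp_dist(2))
  ultimately have "mink u v \<le> sinh ?a * sinh ?b"
    by (meson abs_le_square_iff abs_le_D1 abs_of_nonneg mult_nonneg_nonneg order_trans sinh_real_nonneg_iff power2_le_imp_le)
  moreover have "mink u v = cosh (hyp_dist p q) - cosh ?a * cosh ?b"
    using m assms by (simp add: u_def v_def algebra_simps)
  ultimately have "cosh (hyp_dist p q) \<le> cosh (?a + ?b)" by (simp add: cosh_add)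
  then show ?thesis using nn by (simp add: cosh_real_nonneg_le_iff)
qed

text \<open>The difference \<open>v\<close> of the two sides is orthogonal to all three points,
  hence a null vector orthogonal to \<open>lor w\<close>, hence zero. The distances enter through
  \<open>cosh\<close> so that \<open>t\<close> may be negative or exceed \<open>l\<close>.\<close>

lemma lor_on_geodesic_line:
  assumes "p \<in> hyp" "q \<in> hyp" "w \<in> hyp" and l: "l \<noteq> 0"
    and d: "cosh (hyp_dist p q) = cosh l" "cosh (hyp_dist p w) = cosh t" "cosh (hyp_dist w q) = cosh (l - t)"
  shows "lor w = (sinh (l - t) / sinh l) *\<^sub>R lor p + (sinh t / sinh l) *\<^sub>R lor q"
proof -
  define \<alpha> where "\<alpha> = sinh (l - t) / sinh l"
  define \<beta> where "\<beta> = sinh t / sinh l"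
  have sl: "sinh l \<noteq> 0" using l by simp
  have 1: "\<alpha> + \<beta> * cosh l = cosh t"
    using sl by (simp add: \<alpha>_def \<beta>_def sinh_diff field_simps)
  have c2: "cosh l * cosh l = 1 + sinh l * sinh l"
    using cosh_square_eq[of l] by (simp add: power2_eq_square)
  have "\<alpha> * cosh l + \<beta> = (sinh l * cosh t * cosh l - cosh l * cosh l * sinh t + sinh t) / sinh l"
    using sl by (simp add: \<alpha>_def \<beta>_def sinh_diff field_simps)
  also have "\<dots> = cosh (l - t)"
    unfolding c2 using sl by (simp add: cosh_diff field_simps)
  finally have 2: "\<alpha> * cosh l + \<beta> = cosh (l - t)" .
  have 3: "\<alpha> * cosh t + \<beta> * cosh (l - t) = 1"
  proof -
    have "sinh (l - t) * cosh t + sinh t * cosh (l - t) = sinh l"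
      using sinh_add[of "l - t" t] by (simp add: mult.commute)
    then show ?thesis using sl by (simp add: \<alpha>_def \<beta>_def field_simps)
  qed
  define v where "v = lor w - (\<alpha> *\<^sub>R lor p + \<beta> *\<^sub>R lor q)"
  have m: "mink (lor p) (lor q) = cosh l" "mink (lor q) (lor p) = cosh l" 
    "mink (lor p) (lor w) = cosh t" "mink (lor w) (lor p) = cosh t"
    "mink (lor q) (lor w) = cosh (l - t)" "mink (lor w) (lor q) = cosh (l - t)"
    using d assms(1-3) mink_lor_cosh mink_commute by metis+
  have vw: "mink v (lor w) = 0" and vp: "mink v (lor p) = 0" and vq: "mink v (lor q) = 0"
    using m assms(1-3) 1 2 3 by (auto simp: v_def algebra_simps)
  have "mink v v = mink v (lor w) - (\<alpha> * mink v (lor p) + \<beta> * mink v (lor q))"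
    by (subst (2) v_def) simp
  then have "mink v v = 0" using vw vp vq by simp
  then have "v = 0" using mink_orthogonal(2)[OF mink_lor_self[OF assms(3)] vw] by simp
  then show ?thesis by (simp add: v_def \<alpha>_def \<beta>_def)
qed

lemma fst_lor_comb_pos:
  assumes "p \<in> hyp" "q \<in> hyp" "\<alpha> \<ge> 0" "\<beta> \<ge> 0" "\<alpha> > 0 \<or> \<beta> > 0"
  shows "fst (\<alpha> *\<^sub>R lor p + \<beta> *\<^sub>R lor q) > 0"
proof -
  have "fst (lor p) > 0" "fst (lor q) > 0" using fst_lor_ge_1 assms by (auto intro: less_le_trans[OF zero_less_one])
  then show ?thesis using assms(3-5) by (auto intro: add_pos_nonneg add_nonneg_pos)
qed

text \<open>The formula is forced by \<open>lor_on_geodesic_line\<close>. The identity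
  \<open>mink (v s) (v t) = cosh (s - t)\<close> makes it a unit speed geodesic, and positivity of
  the time component keeps it on the upper sheet.\<close>

lemma geodesic_exists:
  assumes "p \<in> hyp" "q \<in> hyp" "p \<noteq> q"
  defines "l \<equiv> hyp_dist p q"
  obtains c where "geodesic_on {0..l} c" "c 0 = p" "c l = q"
    "\<And>t. t \<in> {0..l} \<Longrightarrow> lor (c t) = (sinh (l - t) / sinh l) *\<^sub>R lor p + (sinh t / sinh l) *\<^sub>R lor q"
proof -
  have l: "l > 0" using assms(1-3) cosh_hyp_dist(2)[of p q] hyp_dist_eq_0[of p q] by (auto simp: l_def less_le)
  then have sl: "sinh l > 0" by simp
  define v where "v t = (sinh (l - t) / sinh l) *\<^sub>R lor p + (sinh t / sinh l) *\<^sub>R lor q" for t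
  define c where "c t = (1 / (1 + fst (v t))) *\<^sub>R snd (v t)" for t
  have mpq: "mink (lor p) (lor q) = cosh l" "mink (lor q) (lor p) = cosh l"
    using assms mink_lor_cosh by (auto simp: mink_commute[of "lor q"])
  have vv: "mink (v s) (v t) = cosh (s - t)" for s t
  proof -
    have "mink (v s) (v t) * (sinh l)\<^sup>2 = sinh (l - s) * sinh (l - t) + sinh s * sinh t
       + cosh l * (sinh (l - s) * sinh t + sinh s * sinh (l - t))"
      using assms(1,2) mpq sl by (simp add: v_def power2_eq_square field_simps)
    also have "\<dots> = cosh (s - t) * (sinh l)\<^sup>2"
    proof -
      have c2: "cosh l * cosh l = 1 + sinh l * sinh l"
        using cosh_square_eq[of l] by (simp add: power2_eq_square)
      have "sinh (l - s) * sinh (l - t) + sinh s * sinh t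
       + cosh l * (sinh (l - s) * sinh t + sinh s * sinh (l - t))
       = sinh l * sinh l * cosh s * cosh t + (sinh s * sinh t - (cosh l * cosh l) * sinh s * sinh t)"
        by (simp add: sinh_diff algebra_simps)
      also have "\<dots> = cosh (s - t) * (sinh l)\<^sup>2"
        unfolding c2 by (simp add: cosh_diff power2_eq_square algebra_simps)
      finally show ?thesis .
    qed
    finally show ?thesis using sl by simp
  qed
  have pos: "fst (v t) > 0" if "t \<in> {0..l}" for t
    unfolding v_def by (rule fst_lor_comb_pos) (use that assms(1,2) sl l in \<open>auto simp: zero_less_divide_iff less_le\<close>)
  have c: "c t \<in> hyp" "lor (c t) = v t" if "t \<in> {0..l}" for t
    using lor_surj[of "v t"] pos[OF that] vv[of t t] by (auto simp: c_def)
  show ?thesis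
  proof
    show "geodesic_on {0..l} c"
      unfolding geodesic_on_def
    proof (intro conjI ballI)
      fix s t assume st: "s \<in> {0..l}" "t \<in> {0..l}"
      show "hyp_dist (c s) (c t) = \<bar>s - t\<bar>"
        by (rule hyp_dist_eqI) (use st c vv[of s t] in \<open>auto simp: cosh_real_abs\<close>)
    qed (use c in auto)
    show "c 0 = p" "c l = q"
      using c[of 0] c[of l] l sl assms(1,2) by (auto intro!: lor_inj simp: v_def)
  qed (use c in \<open>auto simp: v_def\<close>)
qed

lemma geodesic_segment_dist:
  assumes "w \<in> geodesic_segment p q"
  shows "p \<in> hyp" "q \<in> hyp" "w \<in> hyp" "hyp_dist p w + hyp_dist w q = hyp_dist p q"
  using assms unfolding geodesic_segment_def geodesic_on_def by fastforce+

text \<open>The numbers are the coordinates of a point of the segment in the basis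
  \<open>lor p\<close>, \<open>lor q\<close>: the equation says that it lies on the hyperboloid, the
  inequality that it lies in the ball.\<close>

lemma segment_meets_ball_D:
  assumes x: "x \<in> hyp" and "geodesic_segment p q \<inter> hyp_ball x R \<noteq> {}" and R: "R > 0"
  obtains \<alpha> \<beta> where "\<alpha> \<ge> 0" "\<beta> \<ge> 0" "\<alpha>\<^sup>2 + \<beta>\<^sup>2 + 2 * \<alpha> * \<beta> * cosh (hyp_dist p q) = 1"
    "\<alpha> * cosh (hyp_dist x p) + \<beta> * cosh (hyp_dist x q) < cosh R"
proof -
  obtain w where w: "w \<in> geodesic_segment p q" "hyp_dist x w < R"
    using assms by (auto simp: hyp_ball_def)
  note h = geodesic_segment_dist[OF w(1)]
  have cw: "cosh (hyp_dist x w) < cosh R"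
    using w(2) cosh_hyp_dist(2)[OF x h(3)] by (simp add: cosh_real_nonneg_less_iff)
  show ?thesis
  proof (cases "p = q")
    case True
    have "hyp_dist p w \<ge> 0" "hyp_dist w q \<ge> 0" using h by (auto intro: cosh_hyp_dist(2))
    with h(4) True have "hyp_dist p w = 0" by simp
    then have "w = p" using h hyp_dist_eq_0 by auto
    with cw True show ?thesis by (intro that[of 1 0]) auto
  next
    case False
    define l where "l = hyp_dist p q"
    define t where "t = hyp_dist p w"
    have l: "l > 0" using False h cosh_hyp_dist(2)[of p q] hyp_dist_eq_0[of p q] by (auto simp: l_def less_le)
    have t: "0 \<le> t" "t \<le> l" "hyp_dist w q = l - t"
      using h cosh_hyp_dist(2)[of p w] cosh_hyp_dist(2)[of w q] by (auto simp: t_def l_def)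
    have eq: "lor w = (sinh (l - t) / sinh l) *\<^sub>R lor p + (sinh t / sinh l) *\<^sub>R lor q"
      by (rule lor_on_geodesic_line) (use h l t in \<open>auto simp: l_def t_def\<close>)
    show ?thesis
    proof (rule that)
      let ?a = "sinh (l - t) / sinh l" and ?b = "sinh t / sinh l"
      show "?a \<ge> 0" "?b \<ge> 0" using l t by auto
      have "mink (lor w) (lor w) = 1" using h by simp
      then show "?a\<^sup>2 + ?b\<^sup>2 + 2 * ?a * ?b * cosh (hyp_dist p q) = 1"
        unfolding eq using h mink_lor_cosh[of p q] mink_commute[of "lor q" "lor p"]
        by (simp add: power2_eq_square algebra_simps)
      have "mink (lor x) (lor w) < cosh R" using cw x h by (simp add: mink_lor_cosh)
      then show "?a * cosh (hyp_dist x p) + ?b * cosh (hyp_dist x q) < cosh R"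
        unfolding eq using x h mink_lor_cosh[of x] by simp
    qed
  qed
qed

text \<open>The converse of \<open>segment_meets_ball_D\<close> in homogeneous form, so that weights
  can be chosen without normalizing them.\<close>

lemma segment_meets_ball_I:
  assumes x: "x \<in> hyp" and pq: "p \<in> hyp" "q \<in> hyp" and R: "R > 0"
    and ab: "\<alpha> > 0" "\<beta> > 0"
    and less: "(\<alpha> * cosh (hyp_dist x p) + \<beta> * cosh (hyp_dist x q))\<^sup>2
      < (cosh R)\<^sup>2 * (\<alpha>\<^sup>2 + \<beta>\<^sup>2 + 2 * \<alpha> * \<beta> * cosh (hyp_dist p q))"
  shows "geodesic_segment p q \<inter> hyp_ball x R \<noteq> {}"
proof (cases "p = q")
  case True
  have "((\<alpha> + \<beta>) * cosh (hyp_dist x p))\<^sup>2 < ((\<alpha> + \<beta>) * cosh R)\<^sup>2"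
    using less True by (simp add: power_mult_distrib power2_eq_square algebra_simps)
  then have "cosh (hyp_dist x p) < cosh R" using ab by (auto dest!: power2_less_imp_less)
  then have "hyp_dist x p < R" using R cosh_hyp_dist(2)[OF x pq(1)] by (simp add: cosh_real_nonneg_less_iff)
  moreover have "p \<in> geodesic_segment p q"
    unfolding geodesic_segment_def geodesic_on_def
    using True pq by (auto intro!: exI[of _ "\<lambda>_. p"] exI[of _ 0])
  ultimately show ?thesis using pq by (auto simp: hyp_ball_def)
next
  case False
  define l where "l = hyp_dist p q"
  have l: "l > 0" using False pq cosh_hyp_dist(2)[of p q] hyp_dist_eq_0[of p q] by (auto simp: l_def less_le)
  obtain c where c: "geodesic_on {0..l} c" "c 0 = p" "c l = q"
    "\<And>t. t \<in> {0..l} \<Longrightarrow> lor (c t) = (sinh (l - t) / sinh l) *\<^sub>R lor p + (sinh t / sinh l) *\<^sub>R lor q"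
    using geodesic_exists[OF pq False] unfolding l_def by blast
  \<comment> \<open>The point of the segment whose coordinates are in the ratio \<alpha> : \<beta>;
    these coordinates are proportional to \<open>sinh (l - t)\<close> and
    \<open>sinh t\<close>.\<close>
  have "\<exists>t\<ge>0. t \<le> l \<and> \<alpha> * sinh t - \<beta> * sinh (l - t) = 0"
    by (rule IVT') (use l ab in \<open>auto intro!: continuous_intros\<close>)
  then obtain t where t: "0 \<le> t" "t \<le> l" "\<alpha> * sinh t = \<beta> * sinh (l - t)" by auto
  have tpos: "t > 0"
    using t l ab by (cases "t = 0") auto
  define k where "k = sinh t / (\<beta> * sinh l)"
  have k: "k > 0" using tpos l ab by (simp add: k_def)
  have kk: "sinh (l - t) / sinh l = k * \<alpha>" "sinh t / sinh l = k * \<beta>"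
    using t ab l by (auto simp: k_def field_simps)
  have cw: "c t \<in> hyp" using c(1) t by (auto simp: geodesic_on_def)
  have eq: "lor (c t) = (k * \<alpha>) *\<^sub>R lor p + (k * \<beta>) *\<^sub>R lor q" using c(4)[of t] t kk by simp
  have "mink (lor (c t)) (lor (c t)) = 1" using cw by simp
  then have n: "k\<^sup>2 * (\<alpha>\<^sup>2 + \<beta>\<^sup>2 + 2 * \<alpha> * \<beta> * cosh (hyp_dist p q)) = 1"
    unfolding eq using pq mink_lor_cosh[of p q] mink_commute[of "lor q" "lor p"]
    by (simp add: power2_eq_square algebra_simps)
  have "(cosh (hyp_dist x (c t)))\<^sup>2 = (mink (lor x) (lor (c t)))\<^sup>2" using x cw by (simp add: mink_lor_cosh)
  also have "\<dots> = k\<^sup>2 * (\<alpha> * cosh (hyp_dist x p) + \<beta> * cosh (hyp_dist x q))\<^sup>2"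
    unfolding eq using x pq mink_lor_cosh[of x] by (simp add: power2_eq_square algebra_simps)
  also have "\<dots> < k\<^sup>2 * ((cosh R)\<^sup>2 * (\<alpha>\<^sup>2 + \<beta>\<^sup>2 + 2 * \<alpha> * \<beta> * cosh (hyp_dist p q)))"
    using less k by (intro mult_strict_left_mono) auto
  also have "\<dots> = (cosh R)\<^sup>2 * (k\<^sup>2 * (\<alpha>\<^sup>2 + \<beta>\<^sup>2 + 2 * \<alpha> * \<beta> * cosh (hyp_dist p q)))"
    by (simp only: ac_simps)
  also have "\<dots> = (cosh R)\<^sup>2" unfolding n by simp
  finally have "cosh (hyp_dist x (c t)) < cosh R" using power2_less_imp_less cosh_real_nonneg by blast
  then have "hyp_dist x (c t) < R" using R cosh_hyp_dist(2)[OF x cw] by (simp add: cosh_real_nonneg_less_iff)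
  moreover have "c t \<in> geodesic_segment p q"
    unfolding geodesic_segment_def using c(1-3) t l by (auto intro!: exI[of _ c] exI[of _ l])
  ultimately show ?thesis using cw by (auto simp: hyp_ball_def)
qed


section \<open>The angle under which two points are seen from \<open>x\<close>\<close>

text \<open>Up to constant factors this is \<open>exp\<close> of minus twice the Gromov product of
  \<open>p\<close> and \<open>q\<close> at \<open>x\<close>. In the Klein chart centred at
  \<open>x\<close> it equals one minus an inner product, so for points tending to the sphere it
  tends to 1 - cos of the angle at \<open>x\<close>.\<close>

definition visual :: "real ^ 'n \<Rightarrow> real ^ 'n \<Rightarrow> real ^ 'n \<Rightarrow> real" where
  "visual x p q = cosh (hyp_dist p q) / (cosh (hyp_dist x p) * cosh (hyp_dist x q))"

lemma visual_commute: "visual x p q = visual x q p"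
  by (simp add: visual_def hyp_dist_commute mult.commute)

text \<open>With \<open>a\<close> = \<alpha>\<open>P\<close> and \<open>b\<close> =
  \<beta>\<open>Q\<close> one has \<open>a + b < cosh R\<close>, so \<open>4 * (a * b)\<close> is at
  most \<open>(cosh R)\<^sup>2\<close>. Inserted into the normalization of \<alpha>, \<beta> this
  bounds \<open>visual\<close> from below; the two subtracted terms disappear as \<open>p\<close>
  and \<open>q\<close> go to infinity.\<close>

lemma visual_meets_ball:
  assumes x: "x \<in> hyp" and "geodesic_segment p q \<inter> hyp_ball x R \<noteq> {}" and R: "R > 0"
  shows "visual x p q \<ge> 2 / (cosh R)\<^sup>2 * (1 - (cosh R / cosh (hyp_dist x p))\<^sup>2 - (cosh R / cosh (hyp_dist x q))\<^sup>2)"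
proof -
  obtain \<alpha> \<beta> where ab: "\<alpha> \<ge> 0" "\<beta> \<ge> 0" "\<alpha>\<^sup>2 + \<beta>\<^sup>2 + 2 * \<alpha> * \<beta> * cosh (hyp_dist p q) = 1"
    "\<alpha> * cosh (hyp_dist x p) + \<beta> * cosh (hyp_dist x q) < cosh R"
    using segment_meets_ball_D[OF assms] by metis
  define P Q where "P = cosh (hyp_dist x p)" and "Q = cosh (hyp_dist x q)"
  define a b where "a = \<alpha> * P" and "b = \<beta> * Q"
  have PQ: "P > 0" "Q > 0" by (auto simp: P_def Q_def cosh_real_pos)
  have nn: "a \<ge> 0" "b \<ge> 0" "a + b < cosh R" using ab PQ by (auto simp: a_def b_def P_def Q_def)
  have vis: "visual x p q = cosh (hyp_dist p q) / (P * Q)" by (simp add: visual_def P_def Q_def)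
  have vpos: "visual x p q \<ge> 0" using PQ by (simp add: vis)
  have e: "(a / P)\<^sup>2 + (b / Q)\<^sup>2 + 2 * (a * b) * visual x p q = 1"
    using ab(3) PQ by (simp add: a_def b_def vis field_simps)
  have ale: "a \<le> cosh R" and ble: "b \<le> cosh R" using nn by auto
  have "(a / P)\<^sup>2 \<le> (cosh R / P)\<^sup>2" "(b / Q)\<^sup>2 \<le> (cosh R / Q)\<^sup>2"
    using nn PQ ale ble by (auto intro!: power_mono divide_right_mono)
  moreover have "2 * (a * b) \<le> (cosh R)\<^sup>2 / 2"
  proof -
    have "4 * (a * b) \<le> (a + b)\<^sup>2" using sum_squares_bound[of a b] by (simp add: power2_sum)
    also have "\<dots> \<le> (cosh R)\<^sup>2" using nn by (intro power_mono) auto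
    finally show ?thesis by simp
  qed
  then have "2 * (a * b) * visual x p q \<le> (cosh R)\<^sup>2 / 2 * visual x p q"
    using vpos by (rule mult_right_mono)
  ultimately have "1 - (cosh R / P)\<^sup>2 - (cosh R / Q)\<^sup>2 \<le> (cosh R)\<^sup>2 / 2 * visual x p q" using e by linarith
  then have "2 / (cosh R)\<^sup>2 * (1 - (cosh R / P)\<^sup>2 - (cosh R / Q)\<^sup>2) \<le> 2 / (cosh R)\<^sup>2 * ((cosh R)\<^sup>2 / 2 * visual x p q)"
    by (rule mult_left_mono) auto
  then show ?thesis by (simp add: P_def Q_def)
qed

text \<open>The upper counterpart of \<open>visual_meets_ball\<close>, with the same threshold but
  no error term.\<close>

lemma visual_misses_ball:
  assumes x: "x \<in> hyp" and pq: "p \<in> hyp" "q \<in> hyp" and "geodesic_segment p q \<inter> hyp_ball x R = {}" and R: "R > 0"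
  shows "visual x p q \<le> 2 / (cosh R)\<^sup>2"
proof -
  define P Q where "P = cosh (hyp_dist x p)" and "Q = cosh (hyp_dist x q)"
  have PQ: "P > 0" "Q > 0" by (auto simp: P_def Q_def cosh_real_pos)
  have vis: "visual x p q = cosh (hyp_dist p q) / (P * Q)" by (simp add: visual_def P_def Q_def)
  \<comment> \<open>These weights make both summands of the distance bound equal to 1, which is the
    case of equality in the estimate of \<open>a * b\<close> above.\<close>
  have "\<not> (1 / P * P + 1 / Q * Q)\<^sup>2
      < (cosh R)\<^sup>2 * ((1 / P)\<^sup>2 + (1 / Q)\<^sup>2 + 2 * (1 / P) * (1 / Q) * cosh (hyp_dist p q))"
    using segment_meets_ball_I[OF x pq R, of "1 / P" "1 / Q"] assms(4) PQ unfolding P_def Q_def by auto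
  then have "(cosh R)\<^sup>2 * ((1 / P)\<^sup>2 + (1 / Q)\<^sup>2 + 2 * visual x p q) \<le> 4"
    using PQ by (simp add: vis)
  moreover have "(cosh R)\<^sup>2 * ((1 / P)\<^sup>2 + (1 / Q)\<^sup>2) \<ge> 0" by simp
  ultimately have "(cosh R)\<^sup>2 * (2 * visual x p q) \<le> 4" unfolding distrib_left by linarith
  then show ?thesis by (simp add: field_simps)
qed

text \<open>The Klein model centred at \<open>x\<close>, obtained from the Lorentz reflection that swaps \<open>lor x\<close>
  and \<open>lor 0\<close>.\<close>

lemma klein_chart:
  fixes x :: "real ^ 'n"
  assumes x: "x \<in> hyp"
  obtains k :: "real ^ 'n \<Rightarrow> real ^ 'n" where
    "\<And>y z. y \<in> hyp \<Longrightarrow> z \<in> hyp \<Longrightarrow> k y \<bullet> k z = 1 - visual x y z"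
    "\<And>y. y \<in> hyp \<Longrightarrow> norm (k y) < 1"
proof -
  define e where "e = ((1, 0) :: real \<times> (real ^ 'n))"
  have ee: "mink e e = 1" and fe: "mink u e = fst u" "mink e u = fst u" and fste: "fst e = 1" for u
    by (auto simp: e_def mink_def)
  obtain S :: "real \<times> (real ^ 'n) \<Rightarrow> real \<times> (real ^ 'n)"
    where S: "\<And>u w. mink (S u) (S w) = mink u w" "S (lor x) = e"
  proof (cases "lor x = e")
    case True
    then show ?thesis by (intro that[of "\<lambda>u. u"]) auto
  next
    case False
    define v where "v = lor x - e"
    have vv: "mink v v = 2 - 2 * fst (lor x)"
      using x fste by (simp add: v_def fe)
    have "fst (lor x) \<noteq> 1"
    proof
      assume "fst (lor x) = 1"
      then have "mink v v = 0" "mink v e = 0" using vv using fste by (auto simp: v_def fe)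
      then have "v = 0" using mink_orthogonal(2)[OF ee] by blast
      with False show False by (simp add: v_def)
    qed
    then have nz: "mink v v \<noteq> 0" using vv by simp
    define S where "S u = u - (2 * mink u v / mink v v) *\<^sub>R v" for u
    have "mink (S u) (S w) = mink u w" for u w
      using nz by (simp add: S_def mink_commute[of v w] field_simps)
    moreover have "2 * mink (lor x) v = mink v v"
      using x vv by (simp add: v_def fe)
    then have "S (lor x) = e" using nz by (simp add: S_def) (simp add: v_def)
    ultimately show ?thesis using that by blast
  qed
  have fS: "fst (S (lor y)) = cosh (hyp_dist x y)" if "y \<in> hyp" for y
    using S(1)[of "lor x" "lor y"] unfolding S(2) fe using mink_lor_cosh[OF x that] by simp
  define k where "k y = (1 / cosh (hyp_dist x y)) *\<^sub>R snd (S (lor y))" for y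
  have k: "k y \<bullet> k z = 1 - visual x y z" if "y \<in> hyp" "z \<in> hyp" for y z
  proof -
    have "cosh (hyp_dist y z) = cosh (hyp_dist x y) * cosh (hyp_dist x z) - snd (S (lor y)) \<bullet> snd (S (lor z))"
      using S(1)[of "lor y" "lor z"] fS that mink_lor_cosh[OF that] by (simp add: mink_def)
    then show ?thesis by (simp add: k_def visual_def field_simps)
  qed
  moreover have "norm (k y) < 1" if "y \<in> hyp" for y
  proof -
    have "(norm (k y))\<^sup>2 = 1 - visual x y y" using k[OF that that] by (simp add: power2_norm_eq_inner)
    also have "\<dots> < 1" by (simp add: visual_def cosh_real_pos)
    finally show ?thesis by (simp add: power_less_one_iff abs_square_less_1)
  qed
  ultimately show ?thesis using that by blast
qed

lemma cosh_le_exp: "(t::real) \<ge> 0 \<Longrightarrow> cosh t \<le> exp t"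
  by (simp add: cosh_def field_simps)

lemma exp_le_2_cosh: "exp t \<le> 2 * cosh (t::real)"
  by (simp add: cosh_def)

lemma visual_le_exp:
  assumes "p \<in> hyp" "q \<in> hyp" 
  shows "visual x p q \<le> 4 * exp (hyp_dist p q - hyp_dist x p - hyp_dist x q)"
proof -
  have "visual x p q \<le> exp (hyp_dist p q) / (exp (hyp_dist x p) / 2 * (exp (hyp_dist x q) / 2))"
    unfolding visual_def
    using exp_le_2_cosh[of "hyp_dist x p"] exp_le_2_cosh[of "hyp_dist x q"] assms
    by (intro frac_le mult_mono cosh_le_exp cosh_hyp_dist mult_pos_pos) auto
  also have "\<dots> = 4 * exp (hyp_dist p q - hyp_dist x p - hyp_dist x q)"
    by (simp add: exp_diff)
  finally show ?thesis .
qed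

lemma visual_ge_exp:
  assumes "x \<in> hyp" "p \<in> hyp" "q \<in> hyp" 
  shows "visual x p q \<ge> exp (hyp_dist p q - hyp_dist x p - hyp_dist x q) / 2"
proof -
  have "visual x p q \<ge> (exp (hyp_dist p q) / 2) / (exp (hyp_dist x p) * exp (hyp_dist x q))"
    unfolding visual_def
    using exp_le_2_cosh[of "hyp_dist p q"] assms
    by (intro frac_le mult_mono cosh_le_exp cosh_hyp_dist mult_pos_pos) (auto simp: cosh_real_pos)
  then show ?thesis by (simp add: exp_diff)
qed

text \<open>The hypothesis says that the Gromov product of \<open>x\<close> and \<open>y\<close> at
  \<open>z\<close> is at most \<open>C / 2\<close>, that is, \<open>z\<close> lies near the geodesic
  from \<open>x\<close> to \<open>y\<close>. Then \<open>y\<close> and \<open>z\<close> are seen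
  from \<open>x\<close> in directions that differ by the order of
  \<open>exp (- hyp_dist x z)\<close>.\<close>

lemma klein_chart_close:
  assumes k: "\<And>y z. y \<in> hyp \<Longrightarrow> z \<in> hyp \<Longrightarrow> k y \<bullet> k z = 1 - visual x y z"
    and yz: "y \<in> hyp" "z \<in> hyp" and d: "hyp_dist y z \<le> hyp_dist x y - hyp_dist x z + C"
  shows "norm (k y - k z) \<le> 3 * exp (C / 2 - hyp_dist x z)"
proof -
  have "(norm (k y - k z))\<^sup>2 = k y \<bullet> k y + k z \<bullet> k z - 2 * (k y \<bullet> k z)"
    by (simp add: power2_norm_eq_inner inner_diff_left inner_diff_right inner_commute)
  also have "\<dots> \<le> 2 * visual x y z"
    proof -
    have "visual x y y \<ge> 0" "visual x z z \<ge> 0" by (simp_all add: visual_def)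
    then show ?thesis using k[OF yz] k[of y y] k[of z z] yz by linarith
  qed
  also have "\<dots> \<le> 8 * exp (hyp_dist y z - hyp_dist x y - hyp_dist x z)"
    using visual_le_exp[OF yz] by simp
  also have "\<dots> \<le> 9 * exp (C - 2 * hyp_dist x z)"
    using d by (intro mult_mono) auto
  also have "\<dots> = (3 * exp (C / 2 - hyp_dist x z))\<^sup>2"
    by (simp add: power_mult_distrib exp_double[symmetric] algebra_simps)
  finally show ?thesis by (rule power2_le_imp_le) simp
qed

lemma norm_diff_hyp:
  assumes "y \<in> hyp" "z \<in> hyp"
  shows "(norm (y - z))\<^sup>2 = (cosh (hyp_dist y z) - 1) / 2 * ((1 - (norm y)\<^sup>2) * (1 - (norm z)\<^sup>2))"
  using one_minus_norm2_pos[OF assms(1)] one_minus_norm2_pos[OF assms(2)] 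
  by (simp add: cosh_hyp_dist(1)[OF assms])

lemma one_minus_norm2_hyp: "y \<in> hyp \<Longrightarrow> 1 - (norm y)\<^sup>2 = 2 / (1 + cosh (hyp_dist 0 y))"
  using one_plus_fst_lor[of y] one_minus_norm2_pos[of y] by (simp add: fst_lor)

section \<open>Auxiliary facts on orthogonality, subsequences and sums\<close>

text \<open>The differences \<open>p i - q i\<close> would be more nonzero, pairwise orthogonal
  vectors than the dimension admits.\<close>

lemma no_equidistant_pairs:
  fixes p q :: "nat \<Rightarrow> 'a::euclidean_space"
  assumes ne: "\<And>i. i \<le> DIM('a) \<Longrightarrow> p i \<noteq> q i"
    and eq: "\<And>i j. i \<le> DIM('a) \<Longrightarrow> j \<le> DIM('a) \<Longrightarrow> i \<noteq> j \<Longrightarrow> p i \<bullet> p j = q i \<bullet> p j \<and> p i \<bullet> q j = q i \<bullet> q j"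
  shows False
proof -
  define v where "v i = p i - q i" for i
  have o: "v i \<bullet> v j = 0" if "i \<le> DIM('a)" "j \<le> DIM('a)" "i \<noteq> j" for i j
    using eq[OF that] by (simp add: v_def inner_diff_left inner_diff_right)
  have nz: "v i \<noteq> 0" if "i \<le> DIM('a)" for i using ne[OF that] by (simp add: v_def)
  have inj: "inj_on v {..DIM('a)}"
    by (rule inj_onI) (metis o nz atMost_iff inner_eq_zero_iff)
  have "pairwise orthogonal (v ` {..DIM('a)})"
    by (auto simp: pairwise_def orthogonal_def intro: o)
  moreover have "0 \<notin> v ` {..DIM('a)}" using nz by auto
  ultimately have "independent (v ` {..DIM('a)})" by (rule pairwise_orthogonal_independent)
  then have "card (v ` {..DIM('a)}) \<le> DIM('a)" using independent_bound by blast
  with inj show False by (simp add: card_image)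
qed

lemma common_convergent_subsequence:
  fixes f :: "'i \<Rightarrow> nat \<Rightarrow> 'a::euclidean_space"
  assumes "finite I" and "\<And>i. i \<in> I \<Longrightarrow> bounded (range (f i))"
  shows "\<exists>r. strict_mono r \<and> (\<forall>i\<in>I. convergent (f i \<circ> r))"
  using assms
proof (induction I rule: finite_induct)
  case empty
  then show ?case by (auto intro: exI[of _ id] strict_monoI)
next
  case (insert i I)
  have "\<exists>r. strict_mono r \<and> (\<forall>i\<in>I. convergent (f i \<circ> r))" using insert by blast
  then obtain r where r: "strict_mono r" "\<forall>i\<in>I. convergent (f i \<circ> r)" by blast
  have "bounded (range (f i \<circ> r))" using insert.prems[of i] by (auto elim!: bounded_subset)
  then obtain l s where s: "strict_mono s" "(f i \<circ> r \<circ> s) \<longlonglongrightarrow> l"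
    using bounded_imp_convergent_subsequence by blast
  have "convergent (f j \<circ> (r \<circ> s))" if "j \<in> insert i I" for j
    using that r(2) s convergent_subseq_convergent[of "f j \<circ> r" s] by (auto simp: convergent_def o_assoc)
  then show ?case using strict_mono_o[OF r(1) s(1)] by blast
qed

lemma has_sum_product_real:
  fixes f :: "'a \<Rightarrow> real" and g :: "'b \<Rightarrow> real"
  assumes f: "f summable_on X" "\<And>x. x \<in> X \<Longrightarrow> f x \<ge> 0" and g: "g summable_on Y" "\<And>y. y \<in> Y \<Longrightarrow> g y \<ge> 0"
  shows "((\<lambda>(x, y). f x * g y) has_sum (infsum f X * infsum g Y)) (X \<times> Y)"
proof -
  have s: "(\<lambda>(x, y). f x * g y) summable_on X \<times> Y"
  proof (rule summable_on_SigmaI)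
    show "((\<lambda>y. case (x, y) of (x, y) \<Rightarrow> f x * g y) has_sum f x * infsum g Y) Y" if "x \<in> X" for x
      using has_sum_infsum[OF g(1)] by (simp add: has_sum_cmult_right)
    show "(\<lambda>x. f x * infsum g Y) summable_on X" by (rule summable_on_cmult_left[OF f(1)])
  qed (use f g in auto)
  then have "infsum (\<lambda>(x, y). f x * g y) (X \<times> Y) = infsum (\<lambda>x. infsum (\<lambda>y. f x * g y) Y) X"
    using infsum_Sigma_banach[OF s] by simp
  also have "\<dots> = infsum f X * infsum g Y"
    by (simp add: infsum_cmult_right' infsum_cmult_left')
  finally show ?thesis using s by (metis has_sum_infsum)
qed

text \<open>For a map \<open>h\<close> with repetitions: one preimage of each value is kept by means
  of \<open>inv_into\<close>, and the sum over the kept indices is a subsum.\<close>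

lemma summable_on_image_real:
  fixes f :: "'b \<Rightarrow> real"
  assumes "(\<lambda>i. f (h i)) summable_on I"
  shows "f summable_on h ` I"
proof -
  define J where "J = inv_into I h ` h ` I"
  have J: "J \<subseteq> I" by (auto simp: J_def inv_into_into)
  have inj: "inj_on h J" by (auto simp: J_def inj_on_def f_inv_into_f)
  have hJ: "h ` J = h ` I" by (force simp: J_def image_image f_inv_into_f)
  have "(f \<circ> h) summable_on J" using assms J by (auto simp: o_def intro: summable_on_subset)
  then show ?thesis using summable_on_reindex[OF inj, of f] hJ by simp
qed

section \<open>Exponential growth of words with quasi-additive length\<close>

text \<open>Abstracts the displacement of reduced words. It is used for the alphabet of pairs of
  letters, for the alphabet of blocks of pairs, and for either with a letter removed.\<close>

locale quasi_additive =
  fixes A :: "'a set" and len :: "'a list \<Rightarrow> real" and c :: real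
  assumes c_nonneg: "c \<ge> 0"
    and len_Nil: "len [] = 0"
    and len_nonneg: "w \<in> lists A \<Longrightarrow> len w \<ge> 0"
    and len_append_le: "u \<in> lists A \<Longrightarrow> v \<in> lists A \<Longrightarrow> len (u @ v) \<le> len u + len v"
    and len_append_ge: "u \<in> lists A \<Longrightarrow> v \<in> lists A \<Longrightarrow> len u + len v - c \<le> len (u @ v)"
begin

definition words :: "nat \<Rightarrow> 'a list set" where
  "words k = {w \<in> lists A. length w = k}"

definition mass :: "real \<Rightarrow> nat \<Rightarrow> real" where
  "mass s k = infsum (\<lambda>w. exp (- s * len w)) (words k)"

lemma words_subset: "words k \<subseteq> lists A"
  by (auto simp: words_def)

lemma words_0: "words 0 = {[]}"
  by (auto simp: words_def)

lemma mass_0: "mass s 0 = 1"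
  by (simp add: mass_def words_0 len_Nil)

lemma bij_betw_append: "bij_betw (\<lambda>(u, v). u @ v) (words i \<times> words j) (words (i + j))"
  unfolding bij_betw_def
proof
  show "inj_on (\<lambda>(u, v). u @ v) (words i \<times> words j)" by (auto simp: inj_on_def words_def)
  have "\<exists>u v. w = u @ v \<and> u \<in> words i \<and> v \<in> words j" if "w \<in> words (i + j)" for w
    using that by (intro exI[of _ "take i w"] exI[of _ "drop i w"])
      (auto simp: words_def dest: in_set_takeD in_set_dropD)
  then show "(\<lambda>(u, v). u @ v) ` (words i \<times> words j) = words (i + j)" by (force simp: words_def)
qed

text \<open>The factor \<open>exp (s * c)\<close> pays for the defect in
  \<open>len_append_ge\<close>. The lower bound has no factor because \<open>len\<close> is
  subadditive; this asymmetry is what lets \<open>mass_le_1\<close> have the sharp constant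
  1.\<close>

lemma append_sum:
  assumes s: "s \<ge> 0" and X: "X \<subseteq> lists A" and Y: "Y \<subseteq> lists A"
    and sX: "(\<lambda>w. exp (- s * len w)) summable_on X" and sY: "(\<lambda>w. exp (- s * len w)) summable_on Y"
  shows "(\<lambda>(u, v). exp (- s * len (u @ v))) summable_on X \<times> Y"
    and "infsum (\<lambda>(u, v). exp (- s * len (u @ v))) (X \<times> Y)
      \<le> exp (s * c) * (infsum (\<lambda>w. exp (- s * len w)) X * infsum (\<lambda>w. exp (- s * len w)) Y)"
    and "infsum (\<lambda>w. exp (- s * len w)) X * infsum (\<lambda>w. exp (- s * len w)) Y
      \<le> infsum (\<lambda>(u, v). exp (- s * len (u @ v))) (X \<times> Y)"
proof -
  let ?e = "\<lambda>w. exp (- s * len w)"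
  have P: "((\<lambda>(u, v). ?e u * ?e v) has_sum (infsum ?e X * infsum ?e Y)) (X \<times> Y)"
    by (rule has_sum_product_real[OF sX _ sY]) auto
  have P': "((\<lambda>z. exp (s * c) * (case z of (u, v) \<Rightarrow> ?e u * ?e v)) has_sum (exp (s * c) * (infsum ?e X * infsum ?e Y))) (X \<times> Y)"
    by (rule has_sum_cmult_right[OF P])
  have up: "exp (- s * len (u @ v)) \<le> exp (s * c) * (?e u * ?e v)" if "u \<in> X" "v \<in> Y" for u v
  proof -
    have "s * (len u + len v - c) \<le> s * len (u @ v)"
      using that X Y s by (intro mult_left_mono len_append_ge) auto
    then show ?thesis by (simp flip: exp_add add: algebra_simps)
  qed
  have lo: "?e u * ?e v \<le> exp (- s * len (u @ v))" if "u \<in> X" "v \<in> Y" for u v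
  proof -
    have "s * len (u @ v) \<le> s * (len u + len v)"
      using that X Y s by (intro mult_left_mono len_append_le) auto
    then show ?thesis by (simp flip: exp_add add: algebra_simps)
  qed
  show S: "(\<lambda>(u, v). exp (- s * len (u @ v))) summable_on X \<times> Y"
    by (rule summable_on_comparison_test[OF has_sum_imp_summable[OF P']]) (use up in auto)
  show "infsum (\<lambda>(u, v). exp (- s * len (u @ v))) (X \<times> Y) \<le> exp (s * c) * (infsum ?e X * infsum ?e Y)"
    by (rule has_sum_mono[OF has_sum_infsum[OF S] P']) (use up in auto)
  show "infsum ?e X * infsum ?e Y \<le> infsum (\<lambda>(u, v). exp (- s * len (u @ v))) (X \<times> Y)"
    by (rule has_sum_mono[OF P has_sum_infsum[OF S]]) (use lo in auto)
qed

lemma summable_words: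
  assumes s: "s \<ge> 0" and 1: "(\<lambda>a. exp (- s * len [a])) summable_on A"
  shows "(\<lambda>w. exp (- s * len w)) summable_on words k"
proof (induction k)
  case (Suc k)
  have "words 1 = (\<lambda>a. [a]) ` A" by (auto simp: words_def length_Suc_conv)
  then have 1: "(\<lambda>w. exp (- s * len w)) summable_on words 1"
    using summable_on_image_real[of "\<lambda>w. exp (- s * len w)" "\<lambda>a. [a]" A] 1 by simp
  have "(\<lambda>z. exp (- s * len (case z of (u, v) \<Rightarrow> u @ v))) summable_on words k \<times> words 1"
    using append_sum(1)[OF s words_subset words_subset Suc.IH 1] by (simp add: case_prod_unfold)
  then show ?case
    using summable_on_reindex_bij_betw[OF bij_betw_append[of k 1], of "\<lambda>w. exp (- s * len w)"] by simp
qed (simp add: words_0)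

lemma disjoint_words: "disjoint_family_on words I"
  by (auto simp: disjoint_family_on_def words_def)

lemma mass_nonneg: "mass s k \<ge> 0"
  by (auto simp: mass_def intro: infsum_nonneg)

context
  fixes s assumes s: "s \<ge> 0" and 1: "(\<lambda>a. exp (- s * len [a])) summable_on A"
begin

lemma mass_add: "mass s (i + j) \<le> exp (s * c) * (mass s i * mass s j)" "mass s i * mass s j \<le> mass s (i + j)"
proof -
  note as = append_sum(2,3)[OF s words_subset words_subset summable_words[OF s 1] summable_words[OF s 1], of i j]
  have "mass s (i + j) = infsum (\<lambda>(u, v). exp (- s * len (u @ v))) (words i \<times> words j)"
    unfolding mass_def using infsum_reindex_bij_betw[OF bij_betw_append[of i j], of "\<lambda>w. exp (- s * len w)"]
    by (simp add: case_prod_unfold)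
  with as show "mass s (i + j) \<le> exp (s * c) * (mass s i * mass s j)" "mass s i * mass s j \<le> mass s (i + j)"
    unfolding mass_def by auto
qed

lemma has_sum_words: "((\<lambda>w. exp (- s * len w)) has_sum mass s k) (words k)"
  unfolding mass_def by (rule has_sum_infsum[OF summable_words[OF s 1]])

lemma summable_lists_if_mass_summable:
  assumes "summable (mass s)"
  shows "(\<lambda>w. exp (- s * len w)) summable_on lists A"
proof -
  have "mass s summable_on UNIV"
    using assms by (intro norm_summable_imp_summable_on) (simp add: mass_nonneg)
  then have "(\<lambda>w. exp (- s * len w)) summable_on (\<Union>k\<in>UNIV. words k)"
    using summable_on_Union_iff[OF has_sum_words _ disjoint_words] by simp
  moreover have "(\<Union>k\<in>UNIV. words k) = lists A" by (auto simp: words_def)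
  ultimately show ?thesis by simp
qed

lemma mass_summable_if_summable_lists:
  assumes "(\<lambda>w. exp (- s * len w)) summable_on lists A"
  shows "summable (mass s)"
proof -
  have "(\<Union>k\<in>UNIV. words k) = lists A" by (auto simp: words_def)
  with assms have "(\<lambda>w. exp (- s * len w)) summable_on (\<Union>k\<in>UNIV. words k)" by simp
  then have "mass s summable_on UNIV"
    using summable_on_Union_iff[OF has_sum_words _ disjoint_words] by simp
  then show ?thesis by (rule summable_on_imp_summable)
qed

text \<open>\<open>V\<close> is submultiplicative, so a single value below 1 forces geometric decay
  of all masses.\<close>

lemma summable_lists_if_contracting:
  assumes k: "k \<ge> 1" and lt: "exp (s * c) * mass s k < 1"
  shows "(\<lambda>w. exp (- s * len w)) summable_on lists A"
proof -
  define V where "V i = exp (s * c) * mass s i" for i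
  have V0: "V i \<ge> 0" for i by (simp add: V_def mass_nonneg)
  have Vadd: "V (i + j) \<le> V i * V j" for i j
    using mult_left_mono[OF mass_add(1)[of i j], of "exp (s * c)"] by (simp add: V_def ac_simps)
  \<comment> \<open>The maximum with 1/2 keeps \<open>q\<close> positive, so that its root is
    positive and division by \<open>q\<close> is harmless.\<close>
  define q where "q = max (V k) (1 / 2)"
  have q: "0 < q" "q < 1" "V k \<le> q" using lt by (auto simp: q_def V_def)
  have Vj: "V (j * k + r) \<le> q ^ j * V r" for j r
  proof (induction j)
    case (Suc j)
    have "V (Suc j * k + r) = V (k + (j * k + r))" by (simp add: algebra_simps)
    also have "\<dots> \<le> V k * V (j * k + r)" by (rule Vadd)
    also have "\<dots> \<le> q * (q ^ j * V r)" using Suc q V0 by (intro mult_mono) auto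
    finally show ?case by simp
  qed simp
  define C where "C = Max (V ` {..<k})"
  have C: "V r \<le> C" if "r < k" for r using that by (simp add: C_def)
  have C0: "C \<ge> 0" using C[of 0] V0[of 0] k by linarith
  \<comment> \<open>The decay rate per letter; the incomplete block of \<open>n mod k\<close>
    letters costs at most the factor \<open>1 / q\<close>.\<close>
  define z where "z = root k q"
  have z: "0 < z" "z < 1" "z ^ k = q" using q k by (auto simp: z_def real_root_pow_pos2)
  have "V n \<le> C / q * z ^ n" for n
  proof -
    have "V n \<le> q ^ (n div k) * V (n mod k)" using Vj[of "n div k" "n mod k"] by simp
    also have "\<dots> \<le> q ^ (n div k) * C" using q k by (intro mult_left_mono C) auto
    also have "q ^ (n div k) = z ^ (k * (n div k))" by (simp add: power_mult z)
    also have "\<dots> \<le> z ^ n / q"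
    proof -
      have "z ^ n * 1 = z ^ (k * (n div k)) * z ^ (n mod k)" by (simp flip: power_add)
      moreover have "z ^ (n mod k) \<ge> q" unfolding z(3)[symmetric] using z k by (intro power_decreasing) (auto simp: less_imp_le)
      then have "z ^ (k * (n div k)) * z ^ (n mod k) \<ge> z ^ (k * (n div k)) * q"
        using z by (intro mult_left_mono) auto
      ultimately show ?thesis using q by (simp add: field_simps)
    qed
    finally show ?thesis using C0 by (simp add: mult_right_mono field_simps)
  qed
  then have le: "norm (mass s n) \<le> exp (- (s * c)) * (C / q) * z ^ n" for n
    using mult_left_mono[of "V n" "C / q * z ^ n" "exp (- (s * c))"]
    by (simp add: V_def mass_nonneg exp_minus mult.assoc[symmetric])
  have "summable (\<lambda>n. z ^ n)" by (rule summable_geometric) (use z in simp)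
  then have "summable (\<lambda>n. exp (- (s * c)) * (C / q) * z ^ n)" by (rule summable_mult)
  then have "summable (mass s)" by (rule summable_comparison_test'[where N = 0]) (rule le)
  then show ?thesis by (rule summable_lists_if_mass_summable)
qed

end

text \<open>A sum of exponentials is convex in the exponent. The chord between \<open>s1\<close> and
  \<open>d\<close> bounds the mass slightly below \<open>d\<close>, in place of a continuity
  argument for an infinite sum.\<close>

lemma mass_convex:
  assumes "s1 \<ge> 0" "s1 \<le> d" "0 \<le> t" "t \<le> 1" 
    and 1: "(\<lambda>a. exp (- s1 * len [a])) summable_on A"
  shows "mass (d - t * (d - s1)) k \<le> (1 - t) * mass d k + t * mass s1 k"
proof -
  let ?s = "d - t * (d - s1)"
  have mono: "(\<lambda>a. exp (- s * len [a])) summable_on A" if "s \<ge> s1" for s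
    by (rule summable_on_comparison_test[OF 1]) (use that len_nonneg in \<open>auto intro!: mult_right_mono\<close>)
  have "s1 \<le> ?s" using assms mult_right_mono[of t 1 "d - s1"] by auto
  then have S: "(\<lambda>w. exp (- ?s * len w)) summable_on words k"
    using assms by (intro summable_words mono) auto
  have Sd: "(\<lambda>w. exp (- d * len w)) summable_on words k" "(\<lambda>w. exp (- s1 * len w)) summable_on words k"
    by (rule summable_words, use assms in simp, rule mono, use assms in simp)+
  have up: "((\<lambda>w. (1 - t) * exp (- d * len w) + t * exp (- s1 * len w)) has_sum ((1 - t) * mass d k + t * mass s1 k)) (words k)"
    unfolding mass_def by (intro has_sum_add has_sum_cmult_right has_sum_infsum Sd)
  have lo: "((\<lambda>w. exp (- ?s * len w)) has_sum mass ?s k) (words k)"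
    unfolding mass_def by (rule has_sum_infsum[OF S])
  show ?thesis
  proof (rule has_sum_mono[OF lo up])
    fix w
    have "convex_on UNIV (exp :: real \<Rightarrow> real)" by (rule exp_convex)
    then have "exp ((1 - t) *\<^sub>R (- d * len w) + t *\<^sub>R (- s1 * len w)) \<le> (1 - t) * exp (- d * len w) + t * exp (- s1 * len w)"
      using assms by (intro convex_onD) auto
    moreover have "(1 - t) *\<^sub>R (- d * len w) + t *\<^sub>R (- s1 * len w) = - ?s * len w" by (simp add: algebra_simps)
    ultimately show "exp (- ?s * len w) \<le> (1 - t) * exp (- d * len w) + t * exp (- s1 * len w)" by simp
  qed
qed

text \<open>Contraction is a strict inequality, so by \<open>mass_convex\<close> it persists for
  some exponent below \<open>d\<close>. This is the source of every strict drop of an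
  exponent.\<close>

lemma summable_below_if_contracting:
  assumes s1: "s1 \<ge> 0" "s1 < d" "(\<lambda>a. exp (- s1 * len [a])) summable_on A"
    and k: "k \<ge> 1" and lt: "exp (d * c) * mass d k < 1"
  obtains s where "s1 \<le> s" "s < d" "(\<lambda>w. exp (- s * len w)) summable_on lists A"
proof -
  \<comment> \<open>The chord bound for the exponent \<open>d - t * (d - s1)\<close>; it is
    continuous in \<open>t\<close> and at 0 is the contracting value.\<close>
  define F where "F t = exp (d * c) * ((1 - t) * mass d k + t * mass s1 k)" for t
  have "(F \<longlongrightarrow> exp (d * c) * ((1 - 0) * mass d k + 0 * mass s1 k)) (at_right 0)"
    unfolding F_def by (intro tendsto_intros)
  then have "eventually (\<lambda>t. F t < 1) (at_right 0)"
    by (rule order_tendstoD) (use lt in simp)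
  moreover have "eventually (\<lambda>t::real. t \<in> {0<..<1}) (at_right 0)" by (rule eventually_at_right_real) simp
  ultimately have "eventually (\<lambda>t. F t < 1 \<and> t \<in> {0<..<1}) (at_right 0)" by eventually_elim simp
  then obtain t where t: "F t < 1" "0 < t" "t < 1"
    using eventually_happens'[of "at_right (0::real)"] by auto
  define s where "s = d - t * (d - s1)"
  have "t * (d - s1) \<le> 1 * (d - s1)" using t s1 by (intro mult_right_mono) auto
  moreover have "0 < t * (d - s1)" using t s1 by simp
  ultimately have s: "s1 \<le> s" "s < d" by (auto simp: s_def)
  have "exp (s * c) * mass s k \<le> exp (d * c) * mass s k"
    using s c_nonneg by (intro mult_right_mono mass_nonneg) (auto intro!: mult_right_mono)
  also have "\<dots> \<le> F t" unfolding F_def s_def using t s1 by (intro mult_left_mono mass_convex) auto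
  finally have "exp (s * c) * mass s k < 1" using t by simp
  moreover have "(\<lambda>a. exp (- s * len [a])) summable_on A"
    by (rule summable_on_comparison_test[OF s1(3)]) (use s len_nonneg in \<open>auto intro!: mult_right_mono\<close>)
  ultimately have "(\<lambda>w. exp (- s * len w)) summable_on lists A"
    using summable_lists_if_contracting[of s k] s s1 k by simp
  with s show ?thesis using that by blast
qed

text \<open>Above \<open>d\<close>, a mass greater than 1 would by supermultiplicativity keep the
  masses of all multiples of \<open>k\<close> at least 1, contrary to summability.\<close>

lemma mass_le_1:
  assumes d: "d \<ge> 0" and k: "k \<ge> 1"
    and fin: "\<And>s. s > d \<Longrightarrow> (\<lambda>w. exp (- s * len w)) summable_on lists A"
    and 1: "(\<lambda>a. exp (- d * len [a])) summable_on A"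
  shows "mass d k \<le> 1"
proof -
  have *: "mass s k \<le> 1" if s: "s > d" for s
  proof (rule ccontr)
    assume "\<not> mass s k \<le> 1"
    have s0: "s \<ge> 0" and s1: "(\<lambda>a. exp (- s * len [a])) summable_on A"
      using s d by simp (rule summable_on_comparison_test[OF 1], use s len_nonneg in \<open>auto intro!: mult_right_mono\<close>)
    have "mass s (j * k) \<ge> 1" for j
    proof (induction j)
      case (Suc j)
      have "1 * 1 \<le> mass s k * mass s (j * k)"
        using Suc \<open>\<not> mass s k \<le> 1\<close> by (intro mult_mono) auto
      also have "\<dots> \<le> mass s (k + j * k)" by (rule mass_add(2)[OF s0 s1])
      finally show ?case by simp
    qed (simp add: mass_0)
    moreover have "mass s \<longlonglongrightarrow> 0"
      using mass_summable_if_summable_lists[OF s0 s1 fin[OF s]] by (rule summable_LIMSEQ_zero)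
    then have "eventually (\<lambda>n. mass s n < 1) sequentially" by (rule order_tendstoD) simp
    then obtain N where N: "\<And>n. n \<ge> N \<Longrightarrow> mass s n < 1" by (auto simp: eventually_sequentially)
    ultimately have "mass s (N * k) \<ge> 1" "mass s (N * k) < 1" using k by auto
    then show False by simp
  qed
  \<comment> \<open>The passage to \<open>d\<close> itself is made for finite partial sums, which
    are continuous in the exponent.\<close>
  have "sum (\<lambda>w. exp (- d * len w)) F \<le> 1" if F: "finite F" "F \<subseteq> words k" for F
  proof (rule tendsto_upperbound)
    show "((\<lambda>s. sum (\<lambda>w. exp (- s * len w)) F) \<longlongrightarrow> sum (\<lambda>w. exp (- d * len w)) F) (at_right d)"
      by (intro tendsto_intros)
    show "\<forall>\<^sub>F s in at_right d. sum (\<lambda>w. exp (- s * len w)) F \<le> 1"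
      unfolding eventually_at_right_field
    proof (intro exI[of _ "d + 1"] conjI allI impI)
      fix s assume s: "d < s" 
      have "(\<lambda>w. exp (- s * len w)) summable_on words k"
        by (rule summable_on_subset[OF fin[OF s] words_subset])
      then have "sum (\<lambda>w. exp (- s * len w)) F \<le> mass s k"
        unfolding mass_def using F by (intro finite_sum_le_infsum) auto
      with *[OF s] show "sum (\<lambda>w. exp (- s * len w)) F \<le> 1" by simp
    qed simp
  qed simp
  then show ?thesis
    unfolding mass_def using summable_words[OF d 1] by (intro infsum_le_finite_sums) auto
qed

lemma quasi_additive_subset: "B \<subseteq> A \<Longrightarrow> quasi_additive B len c"
proof -
  assume "B \<subseteq> A"
  then have "\<And>w. w \<in> lists B \<Longrightarrow> w \<in> lists A" using lists_mono by blast
  then show ?thesis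
    by unfold_locales (blast intro: c_nonneg len_Nil len_nonneg len_append_le len_append_ge)+
qed

lemma quasi_additive_blocks: "quasi_additive (words m) (\<lambda>ws. len (concat ws)) c"
proof -
  have *: "concat ws \<in> lists A" if "ws \<in> lists (words m)" for ws
    using that by (fastforce simp: words_def)
  show ?thesis
    by unfold_locales (use * in \<open>auto intro: c_nonneg len_Nil len_nonneg len_append_le len_append_ge\<close>)
qed

text \<open>Counting the words that contain a letter exactly once shows that forbidding this letter
  strictly lowers the exponent.\<close>

lemma summable_below_without_letter:
  assumes p: "p \<in> A" and s1: "s1 \<ge> 0" "s1 < d" "(\<lambda>a. exp (- s1 * len [a])) summable_on A"
    and le1: "\<And>k. mass d k \<le> 1"
  obtains s where "s1 \<le> s" "s < d" "(\<lambda>w. exp (- s * len w)) summable_on lists (A - {p})"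
proof -
  define B where "B = A - {p}"
  have BA: "B \<subseteq> A" and pB: "p \<notin> B" by (auto simp: B_def)
  interpret B: quasi_additive B len c by (rule quasi_additive_subset[OF BA])
  have s1B: "(\<lambda>a. exp (- s1 * len [a])) summable_on B"
    by (rule summable_on_subset[OF s1(3) BA])
  have d0: "d \<ge> 0" using s1 by simp
  have d1: "(\<lambda>a. exp (- d * len [a])) summable_on A"
    by (rule summable_on_comparison_test[OF s1(3)]) (use s1 len_nonneg in \<open>auto intro!: mult_right_mono\<close>)
  have d1B: "(\<lambda>a. exp (- d * len [a])) summable_on B"
    by (rule summable_on_subset[OF d1 BA])
  have "\<exists>k\<ge>1. exp (d * c) * B.mass d k < 1"
  proof (rule ccontr)
    assume no: "\<not> (\<exists>k\<ge>1. exp (d * c) * B.mass d k < 1)"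
    define \<epsilon> where "\<epsilon> = exp (- (d * c))"
    have \<epsilon>: "\<epsilon> > 0" by (simp add: \<epsilon>_def)
    have T: "B.mass d k \<ge> \<epsilon>" for k
    proof (cases "k = 0")
      case True
      then show ?thesis using d0 c_nonneg by (simp add: B.mass_0 \<epsilon>_def)
    next
      case False
      then have "exp (d * c) * B.mass d k \<ge> 1" using no by (metis One_nat_def Suc_leI neq0_conv not_less)
      then show ?thesis by (simp add: \<epsilon>_def exp_minus field_simps)
    qed
    define \<pi> where "\<pi> = exp (- d * len [p])"
    have \<pi>: "\<pi> > 0" by (simp add: \<pi>_def)
    \<comment> \<open>The words of length \<open>N + 1\<close> whose only \<open>p\<close> stands at
      index \<open>i\<close>. The \<open>N + 1\<close> sets are disjoint and each has mass at least
      \<pi> times the square of \<epsilon>, while all words of this length together have mass at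
      most 1; this fails for large \<open>N\<close>.\<close>
    define X where "X N i = (\<lambda>(u, v). u @ p # v) ` (B.words i \<times> B.words (N - i))" for N i
    have inj: "inj_on (\<lambda>(u, v). u @ p # v) (B.words i \<times> B.words j)" for i j
      by (auto simp: inj_on_def B.words_def)
    have XA: "X N i \<subseteq> words (Suc N)" if "i \<le> N" for N i
    proof
      fix w assume w: "w \<in> X N i"
      obtain z where z: "w = (case z of (u, v) \<Rightarrow> u @ p # v)" "z \<in> B.words i \<times> B.words (N - i)"
        using w unfolding X_def image_iff ..
      obtain u v where "z = (u, v)" by (cases z)
      with z have uv: "w = u @ p # v" "u \<in> lists B" "length u = i" "v \<in> lists B" "length v = N - i"
        by (auto simp: B.words_def)
      have "u \<in> lists A" "v \<in> lists A" using uv(2,4) lists_mono[OF BA] by blast+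
      with uv p that show "w \<in> words (Suc N)" by (simp add: words_def)
    qed
    have dis: "disjoint_family_on (X N) {..N}" for N
    proof (unfold disjoint_family_on_def, intro ballI impI)
      fix i j :: nat assume "i \<noteq> j"
      have tw: "takeWhile (\<lambda>a. a \<noteq> p) (u @ p # v) = u" if "u \<in> B.words k" for u v k
      proof -
        have "\<forall>a\<in>set u. a \<noteq> p" using that pB by (auto simp: B.words_def)
        then show ?thesis by (induction u) auto
      qed
      have "length (takeWhile (\<lambda>a. a \<noteq> p) w) = k" if w: "w \<in> X N k" for w k
      proof -
        obtain z where z: "w = (case z of (u, v) \<Rightarrow> u @ p # v)" "z \<in> B.words k \<times> B.words (N - k)"
          using w unfolding X_def image_iff ..
        obtain u v where "z = (u, v)" by (cases z)
        with z have "w = u @ p # v" "u \<in> B.words k" by auto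
        then show ?thesis using tw[of u k v] by (simp add: B.words_def)
      qed
      then show "X N i \<inter> X N j = {}" using \<open>i \<noteq> j\<close> by (metis disjoint_iff)
    qed
    have SA: "(\<lambda>w. exp (- d * len w)) summable_on words k" for k by (rule summable_words[OF d0 d1])
    have SB: "(\<lambda>w. exp (- d * len w)) summable_on B.words k" for k by (rule B.summable_words[OF d0 d1B])
    have XS: "infsum (\<lambda>w. exp (- d * len w)) (X N i) \<ge> \<pi> * \<epsilon> * \<epsilon>" if "i \<le> N" for N i
    proof -
      let ?e = "\<lambda>w. exp (- d * len w)"
      have S: "?e summable_on X N i" by (rule summable_on_subset[OF SA XA[OF that]])
      have S': "(\<lambda>(u, v). ?e (u @ p # v)) summable_on (B.words i \<times> B.words (N - i))"
        using S summable_on_reindex[OF inj, of ?e i "N - i"] by (simp add: X_def o_def case_prod_unfold)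
      have "\<pi> * \<epsilon> * \<epsilon> \<le> \<pi> * (B.mass d i * B.mass d (N - i))"
        using mult_mono[OF T[of i] T[of "N - i"]] \<pi> \<epsilon> B.mass_nonneg by simp
      also have "\<dots> \<le> infsum (\<lambda>(u, v). ?e (u @ p # v)) (B.words i \<times> B.words (N - i))"
      proof (rule has_sum_mono[OF _ has_sum_infsum[OF S']])
        show "((\<lambda>z. \<pi> * (case z of (u, v) \<Rightarrow> ?e u * ?e v)) has_sum (\<pi> * (B.mass d i * B.mass d (N - i))))
            (B.words i \<times> B.words (N - i))"
          unfolding B.mass_def by (intro has_sum_cmult_right has_sum_product_real SB) auto
        fix z assume z: "z \<in> B.words i \<times> B.words (N - i)"
        obtain u v where uv: "z = (u, v)" by (cases z)
        have l: "u \<in> lists A" "v \<in> lists A" "[p] \<in> lists A" "[p] @ v \<in> lists A"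
          using z p lists_mono[OF BA] unfolding uv B.words_def by auto
        have "len (u @ [p] @ v) \<le> len u + (len [p] + len v)"
          using len_append_le[OF l(1,4)] len_append_le[OF l(3,2)] by linarith
        from mult_left_mono[OF this d0]
        show "\<pi> * (case z of (u, v) \<Rightarrow> ?e u * ?e v) \<le> (case z of (u, v) \<Rightarrow> ?e (u @ p # v))"
          by (simp add: uv \<pi>_def flip: exp_add) (simp add: algebra_simps)
      qed
      also have "\<dots> = infsum ?e (X N i)"
        unfolding X_def by (subst infsum_reindex[OF inj]) (simp add: o_def case_prod_unfold)
      finally show ?thesis .
    qed
    have upper: "real (Suc N) * (\<pi> * \<epsilon> * \<epsilon>) \<le> 1" for N
    proof -
      let ?e = "\<lambda>w. exp (- d * len w)"
      have S: "?e summable_on X N i" if "i \<le> N" for i by (rule summable_on_subset[OF SA XA[OF that]])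
      have "real (Suc N) * (\<pi> * \<epsilon> * \<epsilon>) = (\<Sum>i\<le>N. \<pi> * \<epsilon> * \<epsilon>)" by simp
      also have "\<dots> \<le> (\<Sum>i\<le>N. infsum ?e (X N i))" by (intro sum_mono XS) auto
      also have "\<dots> = infsum ?e (\<Union>i\<in>{..N}. X N i)"
        using dis[of N] S by (intro sum_infsum) (auto simp: disjoint_family_on_def)
      also have "\<dots> \<le> mass d (Suc N)"
        unfolding mass_def using XA
        by (intro infsum_mono2 SA summable_on_subset[OF SA[of "Suc N"]]) auto
      also have "\<dots> \<le> 1" by (rule le1)
      finally show ?thesis .
    qed
    obtain N :: nat where "1 / (\<pi> * \<epsilon> * \<epsilon>) < N" using reals_Archimedean2 by blast
    then have "1 < real N * (\<pi> * \<epsilon> * \<epsilon>)" using \<pi> \<epsilon> by (simp add: pos_divide_less_eq)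
    also have "\<dots> \<le> real (Suc N) * (\<pi> * \<epsilon> * \<epsilon>)" using \<pi> \<epsilon> by (intro mult_right_mono) auto
    finally have "real (Suc N) * (\<pi> * \<epsilon> * \<epsilon>) > 1" .
    then show False using upper[of N] by linarith
  qed
  then obtain k where "k \<ge> 1" "exp (d * c) * B.mass d k < 1" by blast
  then obtain s where "s1 \<le> s" "s < d" "(\<lambda>w. exp (- s * len w)) summable_on lists B"
    using B.summable_below_if_contracting[OF s1(1,2) s1B] by blast
  then show ?thesis unfolding B_def by (rule that)
qed

end

section \<open>The group of isometries\<close>

text \<open>Keeps membership in \<open>hyp\<close> atomic instead of rewriting it to a norm
  inequality.\<close>

declare mem_ball [simp del] mem_ball_0 [simp del]

lemma zero_in_hyp [simp]: "0 \<in> hyp" by (simp add: mem_ball)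

abbreviation hmult :: "(real ^ 'n \<Rightarrow> real ^ 'n) \<Rightarrow> (real ^ 'n \<Rightarrow> real ^ 'n) \<Rightarrow> real ^ 'n \<Rightarrow> real ^ 'n"
    (infixr "\<diamondop>" 70) where
  "f \<diamondop> g \<equiv> f \<otimes>\<^bsub>BijGroup hyp\<^esub> g"

abbreviation hone :: "real ^ 'n \<Rightarrow> real ^ 'n" where "hone \<equiv> \<one>\<^bsub>BijGroup hyp\<^esub>"

abbreviation hinv :: "(real ^ 'n \<Rightarrow> real ^ 'n) \<Rightarrow> real ^ 'n \<Rightarrow> real ^ 'n" where
  "hinv f \<equiv> inv\<^bsub>BijGroup hyp\<^esub> f"

text \<open>Orientation and smoothness are dropped: the geometry uses distances alone, and
  differentiability returns only for the action on tangent vectors.\<close>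

definition hyp_isometries :: "(real ^ 'n \<Rightarrow> real ^ 'n) set" where
  "hyp_isometries = {f \<in> Bij hyp. \<forall>y\<in>hyp. \<forall>z\<in>hyp. hyp_dist (f y) (f z) = hyp_dist y z}"

interpretation BG: group "BijGroup (hyp :: (real ^ 'n) set)" by (rule group_BijGroup)

lemma carrier_hyp [simp]: "carrier (BijGroup hyp) = Bij hyp" by (simp add: BijGroup_def)

lemma hmult_apply [simp]: "f \<in> Bij hyp \<Longrightarrow> g \<in> Bij hyp \<Longrightarrow> y \<in> hyp \<Longrightarrow> (f \<diamondop> g) y = f (g y)"
  by (simp add: BijGroup_def compose_def)

lemma hone_apply [simp]: "y \<in> hyp \<Longrightarrow> hone y = y" by (simp add: BijGroup_def)

lemma isom_Bij [simp]: "f \<in> hyp_isometries \<Longrightarrow> f \<in> Bij hyp" by (simp add: hyp_isometries_def)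

lemma isom_in: "f \<in> hyp_isometries \<Longrightarrow> y \<in> hyp \<Longrightarrow> f y \<in> hyp"
  by (rule funcset_mem[OF Bij_imp_funcset[OF isom_Bij]])

lemma isom_dist: "f \<in> hyp_isometries \<Longrightarrow> y \<in> hyp \<Longrightarrow> z \<in> hyp \<Longrightarrow> hyp_dist (f y) (f z) = hyp_dist y z"
  unfolding hyp_isometries_def by blast

lemma isom_mult [simp]: "f \<in> hyp_isometries \<Longrightarrow> g \<in> hyp_isometries \<Longrightarrow> f \<diamondop> g \<in> hyp_isometries"
proof -
  assume fg: "f \<in> hyp_isometries" "g \<in> hyp_isometries"
  have "f \<diamondop> g \<in> Bij hyp" using BG.m_closed[of f g] fg by simp
  moreover have "\<forall>y\<in>hyp. \<forall>z\<in>hyp. hyp_dist ((f \<diamondop> g) y) ((f \<diamondop> g) z) = hyp_dist y z"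
    using fg isom_dist[OF fg(1)] isom_dist[OF fg(2)] isom_in[OF fg(2)] by simp
  ultimately show ?thesis unfolding hyp_isometries_def by blast
qed

lemma isom_one [simp]: "hone \<in> hyp_isometries"
  unfolding hyp_isometries_def using BG.one_closed by simp

lemma hinv_apply:
  assumes "f \<in> Bij hyp" "y \<in> hyp"
  shows "f (hinv f y) = y" "hinv f (f y) = y" "hinv f y \<in> hyp"
proof -
  have c: "hinv f \<in> Bij hyp" using assms BG.inv_closed[of f] by simp
  have "f y \<in> hyp" by (rule funcset_mem[OF Bij_imp_funcset[OF assms(1)] assms(2)])
  show "hinv f y \<in> hyp" by (rule funcset_mem[OF Bij_imp_funcset[OF c] assms(2)])
  have "f \<diamondop> hinv f = hone" "hinv f \<diamondop> f = hone"
    using BG.r_inv[of f] BG.l_inv[of f] assms by simp_all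
  then show "f (hinv f y) = y" "hinv f (f y) = y"
    using hmult_apply[OF assms(1) c assms(2)] hmult_apply[OF c assms] hone_apply[OF assms(2)] by simp_all
qed

lemma isom_inv [simp]: "f \<in> hyp_isometries \<Longrightarrow> hinv f \<in> hyp_isometries"
proof -
  assume f: "f \<in> hyp_isometries"
  have "hyp_dist (hinv f y) (hinv f z) = hyp_dist y z" if "y \<in> hyp" "z \<in> hyp" for y z
    using isom_dist[OF f, of "hinv f y" "hinv f z"] hinv_apply[of f] f that by simp
  moreover have "hinv f \<in> Bij hyp" using BG.inv_closed[of f] f by simp
  ultimately show ?thesis unfolding hyp_isometries_def by blast
qed

lemma isom_hinv_apply:
  assumes "f \<in> hyp_isometries" "y \<in> hyp"
  shows "f (hinv f y) = y" "hinv f (f y) = y"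
  using hinv_apply(1,2)[OF isom_Bij[OF assms(1)] assms(2)] .

lemma isom_dist_inv: "f \<in> hyp_isometries \<Longrightarrow> y \<in> hyp \<Longrightarrow> z \<in> hyp \<Longrightarrow> hyp_dist (hinv f y) z = hyp_dist y (f z)"
  using isom_dist[of f "hinv f y" z] isom_hinv_apply(1)[of f y] isom_in[of "hinv f" y] by simp

lemma isom_left_cancel:
  assumes "f \<in> hyp_isometries" "g \<in> hyp_isometries" "h \<in> hyp_isometries"
  shows "f \<diamondop> g = f \<diamondop> h \<longleftrightarrow> g = h"
  using BG.Units_l_cancel[of f g h] assms BG.Units_eq by simp

section \<open>Discrete groups of isometries\<close>

text \<open>Two elements that nearly agree on \<open>Q\<close> are equal, so their values on \<open>Q\<close> cannot accumulate.\<close>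

lemma finite_bounded_displacement:
  fixes S :: "(real ^ 'n \<Rightarrow> real ^ 'n) set"
  assumes S: "subgroup S (BijGroup hyp)" "S \<subseteq> hyp_isometries"
    and Q: "finite Q" "Q \<subseteq> hyp" and \<epsilon>: "\<epsilon> > 0"
    and sep: "\<And>g. g \<in> S \<Longrightarrow> (\<forall>q\<in>Q. hyp_dist (g q) q < \<epsilon>) \<Longrightarrow> g = hone"
    and y: "y \<in> hyp"
  shows "finite {g \<in> S. hyp_dist y (g y) \<le> r}"
proof (rule ccontr)
  assume "infinite {g \<in> S. hyp_dist y (g y) \<le> r}"
  from infinite_countable_subset[OF this]
  obtain e :: "nat \<Rightarrow> _" where e: "inj e" "range e \<subseteq> {g \<in> S. hyp_dist y (g y) \<le> r}"
    by (elim exE conjE)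
  have eS: "e n \<in> S" "e n \<in> hyp_isometries" "hyp_dist y (e n y) \<le> r" for n using e(2) S(2) by auto
  note eh = isom_in[OF eS(2)] and ed = isom_dist[OF eS(2)]
  have "\<exists>s. strict_mono s \<and> (\<forall>q\<in>Q. convergent ((\<lambda>n. e n q) \<circ> s))"
  proof (rule common_convergent_subsequence[OF Q(1)])
    fix q assume "q \<in> Q"
    then have "range (\<lambda>n. e n q) \<subseteq> hyp" using Q eh by blast
    then show "bounded (range (\<lambda>n. e n q))" using bounded_ball bounded_subset by blast
  qed
  then obtain s where s: "strict_mono s" "\<And>q. q \<in> Q \<Longrightarrow> convergent (\<lambda>n. e (s n) q)" by (auto simp: o_def)
  have "\<forall>\<^sub>F n in sequentially. hyp_dist (e (s n) q) (e (s (Suc n)) q) < \<epsilon>" if q: "q \<in> Q" for q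
  proof -
    have qh: "q \<in> hyp" using q Q by auto
    \<comment> \<open>A bound for the distance from 0 to \<open>e n q\<close> for all
      \<open>n\<close>. The points thus stay where the conformal factor is at least \<kappa>, and
      Euclidean convergence there implies hyperbolic closeness.\<close>
    define M where "M = hyp_dist 0 y + r + hyp_dist y q"
    define \<kappa> where "\<kappa> = 2 / (1 + cosh M)"
    have \<kappa>: "\<kappa> > 0" unfolding \<kappa>_def by (intro divide_pos_pos add_pos_pos) auto
    have le: "1 - (norm (e n q))\<^sup>2 \<ge> \<kappa>" for n
    proof -
      have h: "e n q \<in> hyp" "e n y \<in> hyp" using eh qh y by auto
      have "hyp_dist 0 (e n q) \<le> hyp_dist 0 y + hyp_dist y (e n y) + hyp_dist (e n y) (e n q)"
        using hyp_dist_triangle[of 0 y "e n q"] hyp_dist_triangle[of y "e n y" "e n q"] h y by simp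
      also have "\<dots> \<le> M" using eS(3)[of n] ed[OF y qh, of n] by (simp add: M_def)
      finally have "cosh (hyp_dist 0 (e n q)) \<le> cosh M"
        using cosh_hyp_dist(2)[of 0 "e n q"] h by (simp add: cosh_real_nonneg_le_iff)
      then show ?thesis unfolding one_minus_norm2_hyp[OF h(1)] \<kappa>_def
        by (intro divide_left_mono mult_pos_pos add_pos_pos) auto
    qed
    obtain l where l: "(\<lambda>n. e (s n) q) \<longlonglongrightarrow> l" using s(2)[OF q] by (auto simp: convergent_def)
    have "(\<lambda>n. 1 + 2 * (norm (e (s n) q - e (s (Suc n)) q))\<^sup>2 / (\<kappa> * \<kappa>)) \<longlonglongrightarrow> 1 + 2 * (norm (l - l))\<^sup>2 / (\<kappa> * \<kappa>)"
      using LIMSEQ_Suc[OF l] l \<kappa> by (intro tendsto_intros) auto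
    then have "\<forall>\<^sub>F n in sequentially. 1 + 2 * (norm (e (s n) q - e (s (Suc n)) q))\<^sup>2 / (\<kappa> * \<kappa>) < cosh \<epsilon>"
      using \<epsilon> cosh_real_nonneg_less_iff[of 0 \<epsilon>] by (intro order_tendstoD) auto
    then show ?thesis
    proof eventually_elim
      case (elim n)
      have h: "e (s n) q \<in> hyp" "e (s (Suc n)) q \<in> hyp" using eh qh by auto
      have "cosh (hyp_dist (e (s n) q) (e (s (Suc n)) q)) \<le> 1 + 2 * (norm (e (s n) q - e (s (Suc n)) q))\<^sup>2 / (\<kappa> * \<kappa>)"
        unfolding cosh_hyp_dist(1)[OF h] using le \<kappa>
        using one_minus_norm2_pos[OF h(1)] one_minus_norm2_pos[OF h(2)]
        by (intro add_left_mono divide_left_mono mult_mono mult_pos_pos) auto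
      with elim have "cosh (hyp_dist (e (s n) q) (e (s (Suc n)) q)) < cosh \<epsilon>" by linarith
      then show ?case using \<epsilon> cosh_hyp_dist(2)[OF h] by (simp add: cosh_real_nonneg_less_iff)
    qed
  qed
  then have "\<forall>\<^sub>F n in sequentially. \<forall>q\<in>Q. hyp_dist (e (s n) q) (e (s (Suc n)) q) < \<epsilon>"
    using Q(1) by (simp add: eventually_ball_finite_distrib)
  then obtain n where n: "\<forall>q\<in>Q. hyp_dist (e (s n) q) (e (s (Suc n)) q) < \<epsilon>"
    by (auto simp: eventually_sequentially)
  \<comment> \<open>Consecutive members of the subsequence nearly agree on \<open>Q\<close>, so
    their quotient nearly fixes \<open>Q\<close> and must be the identity, although the members are
    distinct.\<close>
  let ?g = "hinv (e (s n)) \<diamondop> e (s (Suc n))"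
  have "?g \<in> S" using S(1) eS by (simp add: subgroup.m_closed subgroup.m_inv_closed)
  moreover have "\<forall>q\<in>Q. hyp_dist (?g q) q < \<epsilon>"
  proof
    fix q assume q: "q \<in> Q"
    then have "q \<in> hyp" using Q by auto
    then have "hyp_dist (?g q) q = hyp_dist (e (s (Suc n)) q) (e (s n) q)"
      using eS eh by (simp add: isom_dist_inv)
    with n q show "hyp_dist (?g q) q < \<epsilon>" by (simp add: hyp_dist_commute)
  qed
  ultimately have "?g = hone" by (rule sep)
  then have "e (s n) = e (s (Suc n))" using eS by (metis BG.inv_equality BG.inv_inv BG.inv_closed carrier_hyp isom_Bij)
  then have "s n = s (Suc n)" using e(1) by (simp add: inj_eq)
  moreover have "s n < s (Suc n)" using s(1) by (simp add: strict_mono_less)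
  ultimately show False by simp
qed

lemma kleinian_isometries: "kleinian S \<Longrightarrow> S \<subseteq> hyp_isometries"
  unfolding kleinian_def orientation_preserving_isometries_def hyp_isometries_def by blast

lemma kleinian_subgroup: "kleinian S \<Longrightarrow> subgroup S (BijGroup hyp)"
  by (simp add: kleinian_def)

text \<open>A basic neighbourhood of the identity in the topology of pointwise convergence
  constrains finitely many points; these form the set \<open>Q\<close> of
  \<open>finite_bounded_displacement\<close>.\<close>

lemma kleinian_finite_bounded_displacement:
  fixes S :: "(real ^ 'n \<Rightarrow> real ^ 'n) set"
  assumes S: "kleinian S" and y: "y \<in> hyp"
  shows "finite {g \<in> S. hyp_dist y (g y) \<le> r}"
proof -
  have "discrete S" and one: "hone \<in> S" using S kleinian_subgroup[OF S] by (auto simp: kleinian_def subgroup.one_closed)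
  then obtain T where T: "open T" "T \<inter> S = {hone}"
    unfolding discrete_def isolated_in_def by blast
  have "openin (product_topology (\<lambda>i. euclidean) UNIV) T" "hone \<in> T" using T unfolding open_fun_def by auto
  from product_topology_open_contains_basis[OF this]
  obtain X where X: "hone \<in> (\<Pi>\<^sub>E i\<in>UNIV. X i)" "\<And>i. open (X i)" "finite {i. X i \<noteq> UNIV}" "(\<Pi>\<^sub>E i\<in>UNIV. X i) \<subseteq> T"
    by auto
  \<comment> \<open>Coordinates outside \<open>hyp\<close> impose nothing, since all elements take
    the same value there.\<close>
  define Q where "Q = {i \<in> hyp. X i \<noteq> UNIV}"
  have Q: "finite Q" "Q \<subseteq> hyp" using X(3) by (auto simp: Q_def elim: rev_finite_subset)
  have "\<exists>e>0. ball q e \<subseteq> X q" if "q \<in> Q" for q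
  proof -
    have "hone q \<in> X q" using X(1) by auto
    then have "q \<in> X q" using that Q by auto
    then show ?thesis using X(2) by (auto simp: open_contains_ball)
  qed
  then obtain e where e: "\<And>q. q \<in> Q \<Longrightarrow> e q > 0" "\<And>q. q \<in> Q \<Longrightarrow> ball q (e q) \<subseteq> X q" by metis
  define \<delta> where "\<delta> = Min (insert 1 (e ` Q))"
  have \<delta>: "\<delta> > 0" "\<And>q. q \<in> Q \<Longrightarrow> \<delta> \<le> e q" using Q e by (auto simp: \<delta>_def)
  \<comment> \<open>Chosen so that hyperbolic distance below \<epsilon> forces Euclidean distance
    below \<delta>: the squared Euclidean distance is at most \<open>(cosh - 1) / 2\<close> of the
    hyperbolic one.\<close>
  define \<epsilon> where "\<epsilon> = arcosh (1 + 2 * \<delta>\<^sup>2)"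
  have \<epsilon>: "cosh \<epsilon> = 1 + 2 * \<delta>\<^sup>2" "\<epsilon> \<ge> 0" unfolding \<epsilon>_def by (auto intro!: cosh_arcosh_real arcosh_nonneg_real)
  then have "\<epsilon> > 0" using \<delta>(1) by (cases "\<epsilon> = 0") auto
  show ?thesis
  proof (rule finite_bounded_displacement[OF kleinian_subgroup[OF S] kleinian_isometries[OF S] Q \<open>\<epsilon> > 0\<close> _ y])
    fix g assume g: "g \<in> S" "\<forall>q\<in>Q. hyp_dist (g q) q < \<epsilon>"
    have gi: "g \<in> hyp_isometries" using g kleinian_isometries[OF S] by auto
    have "g i \<in> X i" for i
    proof (cases "i \<in> Q")
      case True
      then have h: "i \<in> hyp" "g i \<in> hyp" using Q isom_in[OF gi] by auto
      have "cosh (hyp_dist (g i) i) < cosh \<epsilon>" using g True \<epsilon>(2) cosh_hyp_dist(2)[OF h(2,1)] by (simp add: cosh_real_nonneg_less_iff)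
      then have "(cosh (hyp_dist (g i) i) - 1) / 2 < \<delta>\<^sup>2" using \<epsilon> by simp
      moreover have "(norm (g i - i))\<^sup>2 \<le> (cosh (hyp_dist (g i) i) - 1) / 2 * (1 * 1)"
        unfolding norm_diff_hyp[OF h(2,1)] using one_minus_norm2_pos[OF h(1)] one_minus_norm2_pos[OF h(2)] cosh_real_ge_1[of "hyp_dist (g i) i"]
        by (intro mult_left_mono mult_mono) auto
      ultimately have "(norm (g i - i))\<^sup>2 < \<delta>\<^sup>2" by simp
      then have "norm (g i - i) < \<delta>" using \<delta>(1) by (simp add: power_less_imp_less_base)
      then have "g i \<in> ball i (e i)" using \<delta>(2)[OF True] by (simp add: mem_ball dist_norm norm_minus_commute)
      then show ?thesis using e(2)[OF True] by auto
    next
      case False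
      then consider "X i = UNIV" | "i \<notin> hyp" by (auto simp: Q_def)
      then show ?thesis
      proof cases
        case 2
        have "g \<in> extensional hyp" "hone \<in> extensional hyp" using gi isom_Bij Bij_imp_extensional isom_one by blast+
        then have "g i = hone i" using 2 by (metis extensional_arb)
        then show ?thesis using X(1) by auto
      qed simp
    qed
    then have "g \<in> T" using X(4) by auto
    with T(2) g(1) show "g = hone" by auto
  qed
qed

text \<open>A packing argument. The points of the Euclidean ball \<open>B g\<close> are within
  hyperbolic distance 2 of \<open>g 0\<close>, so at most \<open>N\<close> of these balls share a
  point. Their volumes therefore have bounded sum, and they dominate the terms of the
  series.\<close>

lemma poincare_convergent_card:
  fixes S :: "(real ^ 'n \<Rightarrow> real ^ 'n) set"
  assumes S: "subgroup S (BijGroup hyp)" "S \<subseteq> hyp_isometries"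
    and fin: "finite {g \<in> S. hyp_dist 0 (g 0) \<le> 4}"
  shows "poincare_convergent S (real CARD('n))"
proof -
  define e :: "(real ^ 'n \<Rightarrow> real ^ 'n) \<Rightarrow> real" where "e g = 1 - (norm (g 0))\<^sup>2" for g
  define B where "B g = ball (g 0) (e g / 4)" for g
  define N where "N = card {g \<in> S. hyp_dist 0 (g 0) \<le> 4}"
  have gh: "g 0 \<in> hyp" if "g \<in> S" for g by (rule isom_in[OF subsetD[OF S(2) that] zero_in_hyp])
  have e: "0 < e g" "e g \<le> 1" if "g \<in> S" for g using one_minus_norm2_pos[OF gh[OF that]] by (auto simp: e_def)
  have Bclose: "z \<in> hyp \<and> hyp_dist (g 0) z \<le> 2" if g: "g \<in> S" and z: "z \<in> B g" for g z
  proof -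
    have nz: "norm (g 0 - z) < e g / 4" using z by (simp add: B_def mem_ball dist_norm)
    have "norm z \<le> norm (g 0) + e g / 4" using nz norm_triangle_sub[of z "g 0"] by (simp add: norm_minus_commute)
    then have "(norm z)\<^sup>2 \<le> (norm (g 0) + e g / 4)\<^sup>2" by (intro power_mono) auto
    also have "\<dots> = (norm (g 0))\<^sup>2 + norm (g 0) * e g / 2 + e g * e g / 16" by (simp add: power2_eq_square field_simps)
    also have "\<dots> \<le> (norm (g 0))\<^sup>2 + 1 * e g / 2 + 1 * e g / 16"
      using gh[OF g] e[OF g] by (intro add_mono divide_right_mono mult_right_mono) (auto simp: mem_ball)
    finally have "(norm z)\<^sup>2 \<le> (norm (g 0))\<^sup>2 + 1 * e g / 2 + 1 * e g / 16" .
    then have l: "1 - (norm z)\<^sup>2 \<ge> 7 / 16 * e g" using e_def[of g] by linarith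
    then have "1 - (norm z)\<^sup>2 > 0" using e[OF g] by linarith
    then have zh: "z \<in> hyp" by (simp add: mem_ball power_less_one_iff abs_square_less_1)
    have "cosh (hyp_dist (g 0) z) \<le> 1 + 2 * (e g / 4)\<^sup>2 / (e g * (7 / 16 * e g))"
      unfolding cosh_hyp_dist(1)[OF gh[OF g] zh] e_def[symmetric]
      using nz l e[OF g] by (intro add_left_mono frac_le mult_left_mono power_mono mult_pos_pos) auto
    also have "\<dots> = 9 / 7" using e[OF g] by (simp add: power2_eq_square)
    finally have "exp (hyp_dist (g 0) z) \<le> 18 / 7" using exp_le_2_cosh[of "hyp_dist (g 0) z"] by linarith
    also have "\<dots> \<le> exp 2" using exp_ge_add_one_self[of 2] by linarith
    finally show ?thesis using zh by simp
  qed
  have "sum (\<lambda>g. exp (- real CARD('n) * hyp_dist 0 (g 0))) F \<le> 4 ^ CARD('n) * real N"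
    if F: "F \<subseteq> S" "finite F" for F
  proof -
    have mult: "(\<Sum>g\<in>F. indicator (B g) z) \<le> real N * indicator (ball 0 1) z" for z
    proof (cases "\<exists>g1\<in>F. z \<in> B g1")
      case False
      then show ?thesis by (simp add: indicator_def)
    next
      case True
      then obtain g1 where g1: "g1 \<in> F" "z \<in> B g1" by blast
      have g1S: "g1 \<in> S" "g1 \<in> hyp_isometries" using g1 F S by auto
      have zh: "z \<in> hyp" using Bclose[OF g1S(1) g1(2)] by simp
      have "(\<Sum>g\<in>F. indicator (B g) z) = real (card {g \<in> F. z \<in> B g})"
        using F(2) by (simp add: indicator_def sum.If_cases Int_def)
      also have "card {g \<in> F. z \<in> B g} \<le> N"
        unfolding N_def
      proof (rule card_inj_on_le[OF _ _ fin])
        show "inj_on (\<lambda>g. hinv g1 \<diamondop> g) {g \<in> F. z \<in> B g}"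
        proof (rule inj_onI)
          fix g h assume "g \<in> {g \<in> F. z \<in> B g}" "h \<in> {g \<in> F. z \<in> B g}" and eq: "hinv g1 \<diamondop> g = hinv g1 \<diamondop> h"
          then have "g \<in> hyp_isometries" "h \<in> hyp_isometries" using F S by auto
          with eq show "g = h" using g1S by (simp add: isom_left_cancel)
        qed
        show "(\<lambda>g. hinv g1 \<diamondop> g) ` {g \<in> F. z \<in> B g} \<subseteq> {g \<in> S. hyp_dist 0 (g 0) \<le> 4}"
        proof clarify
          fix g assume g: "g \<in> F" "z \<in> B g"
          have gS: "g \<in> S" "g \<in> hyp_isometries" using g F S by auto
          have "hyp_dist 0 ((hinv g1 \<diamondop> g) 0) = hyp_dist (g1 0) (g 0)"
            using gS g1S isom_in[OF gS(2)] by (simp add: isom_dist_inv hyp_dist_commute[of 0] hyp_dist_commute[of "g 0"])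
          also have "\<dots> \<le> hyp_dist (g1 0) z + hyp_dist (g 0) z"
            using hyp_dist_triangle[of "g1 0" z "g 0"] gh[OF gS(1)] gh[OF g1S(1)] zh by (simp add: hyp_dist_commute[of z])
          also have "\<dots> \<le> 4" using Bclose[OF g1S(1) g1(2)] Bclose[OF gS(1) g(2)] by simp
          finally show "hinv g1 \<diamondop> g \<in> S \<and> hyp_dist 0 ((hinv g1 \<diamondop> g) 0) \<le> 4"
            using S(1) gS g1S by (simp add: subgroup.m_closed subgroup.m_inv_closed)
        qed
      qed
      finally show ?thesis using zh by simp
    qed
    have int: "integrable lborel (indicator (ball a r) :: real^'n \<Rightarrow> real)" for a r
      using emeasure_lborel_ball_finite[of a r] by (intro integrable_real_indicator) auto
    have "(\<Sum>g\<in>F. measure lborel (B g)) = (\<integral>z. (\<Sum>g\<in>F. indicator (B g) z) \<partial>lborel)"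
      using int by (subst Bochner_Integration.integral_sum) (auto simp: B_def measure_def)
    also have "\<dots> \<le> (\<integral>z. real N * indicator (ball (0 :: real ^ 'n) 1) z \<partial>lborel)"
    proof (rule Bochner_Integration.integral_mono)
      show "integrable lborel (\<lambda>z. \<Sum>g\<in>F. indicat_real (B g) z)"
        "integrable lborel (\<lambda>z. real N * indicat_real (ball (0 :: real ^ 'n) 1) z)"
        using int by (auto simp: B_def)
    qed (rule mult)
    also have "\<dots> = real N * measure lborel (ball (0::real^'n) 1)" by (simp add: measure_def)
    finally have "(\<Sum>g\<in>F. measure lborel (B g)) \<le> real N * measure lborel (ball (0::real^'n) 1)" .
    moreover have "measure lborel (B g) = (e g / 4) ^ CARD('n) * measure lborel (ball (0::real^'n) 1)" if "g \<in> F" for g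
      using e[of g] that F by (simp add: B_def content_ball less_imp_le subset_iff)
    ultimately have "(\<Sum>g\<in>F. (e g / 4) ^ CARD('n)) * measure lborel (ball (0::real^'n) 1) \<le> real N * measure lborel (ball (0::real^'n) 1)"
      by (simp add: sum_distrib_right)
    then have "(\<Sum>g\<in>F. (e g / 4) ^ CARD('n)) \<le> real N" by (rule mult_right_le_imp_le) simp
    then have "4 ^ CARD('n) * (\<Sum>g\<in>F. (e g / 4) ^ CARD('n)) \<le> 4 ^ CARD('n) * real N" by (intro mult_left_mono) auto
    then have "(\<Sum>g\<in>F. e g ^ CARD('n)) \<le> 4 ^ CARD('n) * real N"
      by (simp add: sum_distrib_left power_divide)
    moreover have "exp (- real CARD('n) * hyp_dist 0 (g 0)) \<le> e g ^ CARD('n)" if "g \<in> F" for g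
    proof -
      have h: "g 0 \<in> hyp" and d0: "hyp_dist 0 (g 0) \<ge> 0" using that F gh cosh_hyp_dist(2)[of 0 "g 0"] by auto
      have "exp (- hyp_dist 0 (g 0)) = 2 / (2 * exp (hyp_dist 0 (g 0)))" by (simp add: exp_minus field_simps)
      also have "\<dots> \<le> 2 / (1 + cosh (hyp_dist 0 (g 0)))"
      proof (intro divide_left_mono mult_pos_pos add_pos_pos)
        have "1 \<le> exp (hyp_dist 0 (g 0))" using d0 by simp
        then show "1 + cosh (hyp_dist 0 (g 0)) \<le> 2 * exp (hyp_dist 0 (g 0))" using cosh_le_exp[OF d0] by linarith
      qed auto
      also have "\<dots> = e g" unfolding e_def one_minus_norm2_hyp[OF h] ..
      finally have "exp (- hyp_dist 0 (g 0)) ^ CARD('n) \<le> e g ^ CARD('n)" by (intro power_mono) auto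
      then show ?thesis by (simp add: exp_of_nat_mult[symmetric])
    qed
    ultimately show ?thesis by (meson order_trans sum_mono)
  qed
  then show ?thesis
    unfolding poincare_convergent_def
    by (intro nonneg_bdd_above_summable_on) (auto simp: bdd_above_def)
qed

section \<open>Displacement and the Poincare series\<close>

definition disp :: "real ^ 'n \<Rightarrow> (real ^ 'n \<Rightarrow> real ^ 'n) \<Rightarrow> real" where
  "disp x g = hyp_dist x (g x)"

lemma disp_nonneg: "x \<in> hyp \<Longrightarrow> g \<in> hyp_isometries \<Longrightarrow> disp x g \<ge> 0"
  by (simp add: disp_def cosh_hyp_dist(2) isom_in)

lemma disp_one [simp]: "x \<in> hyp \<Longrightarrow> disp x hone = 0" by (simp add: disp_def)

lemma disp_inv [simp]: "x \<in> hyp \<Longrightarrow> g \<in> hyp_isometries \<Longrightarrow> disp x (hinv g) = disp x g"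
  using isom_dist_inv[of g x x] by (simp add: disp_def hyp_dist_commute)

lemma disp_mult_le:
  assumes "x \<in> hyp" "g \<in> hyp_isometries" "h \<in> hyp_isometries"
  shows "disp x (g \<diamondop> h) \<le> disp x g + disp x h"
  using hyp_dist_triangle[of x "g x" "g (h x)"] assms isom_in[OF assms(2)] isom_in[OF assms(3)] isom_dist[OF assms(2)] by (simp add: disp_def)

lemma disp_mult_ge:
  assumes "x \<in> hyp" "g \<in> hyp_isometries" "h \<in> hyp_isometries"
  shows "disp x (g \<diamondop> h) \<ge> disp x h - disp x g" "disp x (g \<diamondop> h) \<ge> disp x g - disp x h"
proof -
  show "disp x (g \<diamondop> h) \<ge> disp x h - disp x g"
    using hyp_dist_triangle[of "g x" x "g (h x)"] assms isom_in[OF assms(2)] isom_in[OF assms(3)] isom_dist[OF assms(2)]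
    by (simp add: disp_def hyp_dist_commute)
  show "disp x (g \<diamondop> h) \<ge> disp x g - disp x h"
    using hyp_dist_triangle[of x "g (h x)" "g x"] assms isom_in[OF assms(2)] isom_in[OF assms(3)] isom_dist[OF assms(2)]
    by (simp add: disp_def hyp_dist_commute)
qed

lemma disp_base_change:
  assumes "x \<in> hyp" "y \<in> hyp" "g \<in> hyp_isometries"
  shows "disp x g \<le> disp y g + 2 * hyp_dist x y"
  using hyp_dist_triangle[of x y "g x"] hyp_dist_triangle[of y "g y" "g x"] assms isom_in[OF assms(3)] isom_dist[OF assms(3)]
  by (simp add: disp_def hyp_dist_commute)

lemma poincare_convergent_iff:
  assumes x: "x \<in> hyp" and S: "S \<subseteq> hyp_isometries" and s: "s \<ge> 0"
  shows "poincare_convergent S s \<longleftrightarrow> (\<lambda>g. exp (- s * disp x g)) summable_on S"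
proof -
  have *: "(\<lambda>g. exp (- s * disp b g)) summable_on S"
    if "(\<lambda>g. exp (- s * disp a g)) summable_on S" "a \<in> hyp" "b \<in> hyp" for a b
  proof (rule summable_on_comparison_test)
    show "(\<lambda>g. exp (2 * s * hyp_dist a b) * exp (- s * disp a g)) summable_on S"
      by (rule summable_on_cmult_right[OF that(1)])
    show "exp (- s * disp b g) \<le> exp (2 * s * hyp_dist a b) * exp (- s * disp a g)" if "g \<in> S" for g
    proof -
      have "disp a g \<le> disp b g + 2 * hyp_dist a b" using that S \<open>a \<in> hyp\<close> \<open>b \<in> hyp\<close> by (intro disp_base_change) auto
      from mult_left_mono[OF this s] show ?thesis by (simp flip: exp_add add: algebra_simps)
    qed
  qed simp
  show ?thesis unfolding poincare_convergent_def disp_def[symmetric] using *[of 0 x] *[of x 0] x by auto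
qed

text \<open>The \<open>Inf\<close> in \<open>critical_exponent\<close> is meaningful because the set
  of convergent exponents is nonempty by \<open>poincare_convergent_card\<close> and, for infinite
  \<open>S\<close>, contains no negative number.\<close>

lemma critical_exponent_properties:
  fixes S :: "(real ^ 'n \<Rightarrow> real ^ 'n) set"
  assumes S: "subgroup S (BijGroup hyp)" "S \<subseteq> hyp_isometries" "infinite S"
    and fin: "\<And>r. finite {g \<in> S. hyp_dist 0 (g 0) \<le> r}"
  shows "critical_exponent S \<ge> 0"
    and "s > critical_exponent S \<Longrightarrow> poincare_convergent S s"
    and "s < critical_exponent S \<Longrightarrow> \<not> poincare_convergent S s"
proof -
  let ?C = "{s. poincare_convergent S s}"
  have ne: "?C \<noteq> {}" using poincare_convergent_card[OF S(1,2) fin] by auto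
  have d0: "hyp_dist 0 (g 0) \<ge> 0" if "g \<in> S" for g
    using that S cosh_hyp_dist(2)[OF zero_in_hyp isom_in[of g 0]] by auto
  have pos: "s \<ge> 0" if "s \<in> ?C" for s
  proof (rule ccontr)
    assume "\<not> s \<ge> 0"
    have "(\<lambda>g. 1 :: real) summable_on S"
      by (rule summable_on_comparison_test[OF that[simplified, unfolded poincare_convergent_def]])
        (use d0 \<open>\<not> s \<ge> 0\<close> in \<open>auto simp: mult_nonpos_nonneg\<close>)
    then have "real (card F) \<le> infsum (\<lambda>g. 1) S" if "finite F" "F \<subseteq> S" for F
      using finite_sum_le_infsum[of "\<lambda>_. 1 :: real" S F] that by simp
    moreover obtain n :: nat where "infsum (\<lambda>g. 1 :: real) S < n" using reals_Archimedean2 by blast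
    moreover obtain F where "finite F" "card F = n" "F \<subseteq> S" using infinite_arbitrarily_large[OF S(3)] by blast
    ultimately show False by force
  qed
  then have bdd: "bdd_below ?C" by (auto intro!: bdd_belowI[of _ 0])
  show "critical_exponent S \<ge> 0" unfolding critical_exponent_def using ne pos by (intro cInf_greatest) auto
  show "\<not> poincare_convergent S s" if "s < critical_exponent S"
    using that cInf_lower[OF _ bdd, of s] by (auto simp: critical_exponent_def)
  assume "s > critical_exponent S"
  then obtain t where t: "t \<in> ?C" "t < s" using cInf_lessD[OF ne] by (auto simp: critical_exponent_def)
  show "poincare_convergent S s"
    unfolding poincare_convergent_def
    by (rule summable_on_comparison_test[OF t(1)[simplified, unfolded poincare_convergent_def]])
      (use d0 t in \<open>auto intro: mult_right_mono\<close>)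
qed

lemma geodesic_segment_commute: "geodesic_segment p q = geodesic_segment q p"
proof -
  have *: "geodesic_segment p q \<subseteq> geodesic_segment q p" for p q :: "real^'n"
  proof
    fix w assume "w \<in> geodesic_segment p q"
    then obtain c l t where c: "0 \<le> l" "geodesic_on {0..l} c" "c 0 = p" "c l = q" "t \<in> {0..l}" "w = c t"
      unfolding geodesic_segment_def by auto
    have "geodesic_on {0..l} (\<lambda>t. c (l - t))"
      using c(2) by (auto simp: geodesic_on_def abs_minus_commute)
    moreover have "w \<in> (\<lambda>t. c (l - t)) ` {0..l}" using c by (intro image_eqI[of _ _ "l - t"]) auto
    ultimately show "w \<in> geodesic_segment q p"
      unfolding geodesic_segment_def using c by (intro CollectI exI[of _ "\<lambda>t. c (l - t)"] exI[of _ l]) auto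
  qed
  then show ?thesis by blast
qed

lemma infinite_if_infinite_limit_set:
  assumes "S \<subseteq> hyp_isometries" "infinite (limit_set S)" shows "infinite S"
proof
  assume f: "finite S"
  have "closure ((\<lambda>g. g 0) ` S) = (\<lambda>g. g 0) ` S" using f by (simp add: finite_imp_closed)
  moreover have "norm (g 0) < 1" if "g \<in> S" for g
    using isom_in[OF subsetD[OF assms(1) that] zero_in_hyp] by (simp add: mem_ball)
  then have "(\<lambda>g. g 0) ` S \<inter> hyp_bdry = {}" by (force simp: image_iff)
  ultimately have "limit_set S = {}" unfolding limit_set_def by auto
  with assms show False by simp
qed

section \<open>Free products\<close>

definition word_val :: "(real ^ 'n \<Rightarrow> real ^ 'n) list \<Rightarrow> real ^ 'n \<Rightarrow> real ^ 'n" where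
  "word_val w = foldr (\<otimes>\<^bsub>BijGroup hyp\<^esub>) w hone"

lemma word_val_simps [simp]: "word_val [] = hone" "word_val (a # w) = a \<diamondop> word_val w"
  by (simp_all add: word_val_def)

lemma word_val_isom: "set w \<subseteq> hyp_isometries \<Longrightarrow> word_val w \<in> hyp_isometries"
  by (induction w) auto

lemma word_val_append:
  "set u \<subseteq> hyp_isometries \<Longrightarrow> set v \<subseteq> hyp_isometries \<Longrightarrow> word_val (u @ v) = word_val u \<diamondop> word_val v"
proof (induction u)
  case Nil
  then show ?case using word_val_isom[of v] by simp
next
  case (Cons a u)
  then show ?case using word_val_isom[of u] word_val_isom[of v] by (simp add: BG.m_assoc)
qed

lemma word_val_rev_inv:
  "set w \<subseteq> hyp_isometries \<Longrightarrow> word_val (rev (map (m_inv (BijGroup hyp)) w)) = hinv (word_val w)"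
proof (induction w)
  case (Cons a w)
  have s: "set (rev (map (m_inv (BijGroup hyp)) w)) \<subseteq> hyp_isometries" using Cons.prems by auto
  have "word_val (rev (map (m_inv (BijGroup hyp)) (a # w))) = hinv (word_val w) \<diamondop> hinv a"
    using Cons word_val_append[OF s, of "[hinv a]"] by simp
  also have "\<dots> = hinv (a \<diamondop> word_val w)"
    using Cons.prems word_val_isom[of w] by (simp add: BG.inv_mult_group)
  finally show ?case by simp
qed simp

section \<open>The crossing property: quasi-additivity, freeness and discreteness\<close>

text \<open>Indexing the factors by \<open>bool\<close> proves each statement for both at once, with
  \<open>\<not> b\<close> for the other factor. \<open>K True\<close> will be the divergent
  one.\<close>

locale crossing_pair =
  fixes K :: "bool \<Rightarrow> (real ^ 'n \<Rightarrow> real ^ 'n) set" and x :: "real ^ 'n" and R :: real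
  assumes kleinian: "kleinian (K b)"
    and x: "x \<in> hyp" and R: "R > 0"
    and cross: "g \<in> words_beginning_in (K b) (K (\<not> b)) \<Longrightarrow> h \<in> words_beginning_in (K (\<not> b)) (K b) \<Longrightarrow>
      geodesic_segment (g x) (h x) \<inter> hyp_ball x R \<noteq> {}"
begin

definition alt :: "bool \<Rightarrow> (real ^ 'n \<Rightarrow> real ^ 'n) list \<Rightarrow> bool" where
  "alt b w \<longleftrightarrow> alternating_word (star (K b)) (star (K (\<not> b))) w"

definition Gam :: "bool \<Rightarrow> (real ^ 'n \<Rightarrow> real ^ 'n) set" where
  "Gam b = words_beginning_in (K b) (K (\<not> b))"

definition \<Gamma> :: "(real ^ 'n \<Rightarrow> real ^ 'n) set" where
  "\<Gamma> = generated_group (K True) (K False)"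

lemma alt_Nil [simp]: "alt b []" by (simp add: alt_def)

lemma alt_Cons [simp]: "alt b (a # w) \<longleftrightarrow> a \<in> star (K b) \<and> alt (\<not> b) w"
  by (simp add: alt_def)

lemma Gam_eq: "Gam b = {word_val w | w. w \<noteq> [] \<and> alt b w}"
  by (simp add: Gam_def words_beginning_in_def alt_def word_val_def)

lemma K_sub: "subgroup (K b) (BijGroup hyp)" by (rule kleinian_subgroup[OF kleinian])

lemma K_isom: "g \<in> K b \<Longrightarrow> g \<in> hyp_isometries" using kleinian_isometries[OF kleinian] by blast

lemma K_one: "hone \<in> K b" by (rule subgroup.one_closed[OF K_sub])

lemma K_mult: "g \<in> K b \<Longrightarrow> h \<in> K b \<Longrightarrow> g \<diamondop> h \<in> K b" by (rule subgroup.m_closed[OF K_sub])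

lemma K_inv: "g \<in> K b \<Longrightarrow> hinv g \<in> K b" by (rule subgroup.m_inv_closed[OF K_sub])

lemma hinv_eq_one_iff: "g \<in> hyp_isometries \<Longrightarrow> hinv g = hone \<longleftrightarrow> g = hone"
  using BG.inv_eq_1_iff[of g] by simp

lemma star_inv: "g \<in> star (K b) \<Longrightarrow> hinv g \<in> star (K b)"
  using K_inv K_isom hinv_eq_one_iff by auto

lemma star_mult: "g \<in> K b \<Longrightarrow> h \<in> K b \<Longrightarrow> g \<noteq> hinv h \<Longrightarrow> g \<diamondop> h \<in> star (K b)"
  using K_mult K_isom BG.inv_equality[of g h] by auto

lemma alt_isom: "alt b w \<Longrightarrow> set w \<subseteq> hyp_isometries"
  by (induction w arbitrary: b) (auto dest: K_isom)

text \<open>Types of letters alternate, so \<open>b \<longleftrightarrow> even (length u)\<close> is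
  the type of the letter that follows \<open>u\<close>; with \<open>odd\<close> it is the type of
  the last letter of a nonempty \<open>u\<close>.\<close>

lemma alt_append: "alt b (u @ v) \<longleftrightarrow> alt b u \<and> alt (b \<longleftrightarrow> even (length u)) v"
proof (induction u arbitrary: b)
  case (Cons a u)
  have "((\<not> b) \<longleftrightarrow> even (length u)) = (b \<longleftrightarrow> even (length (a # u)))" by auto
  then show ?case using Cons[of "\<not> b"] by simp
qed simp

lemma alt_rev_inv: "alt b w \<Longrightarrow> alt (b \<longleftrightarrow> odd (length w)) (rev (map (m_inv (BijGroup hyp)) w))"
proof (induction w arbitrary: b)
  case (Cons a w)
  have a: "hinv a \<in> star (K b)" and w: "alt (\<not> b) w" using Cons.prems star_inv by auto
  have "alt (b \<longleftrightarrow> odd (length (a # w))) (rev (map (m_inv (BijGroup hyp)) w))"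
    using Cons.IH[OF w] by (cases b; cases "even (length w)") auto
  moreover have "((b \<longleftrightarrow> odd (length (a # w))) \<longleftrightarrow> even (length (rev (map (m_inv (BijGroup hyp)) w)))) = b"
    by auto
  ultimately show ?case using a by (simp add: alt_append)
qed simp

lemma word_val_inv:
  "alt b w \<Longrightarrow> word_val (rev (map (m_inv (BijGroup hyp)) w)) = hinv (word_val w)"
  using word_val_rev_inv[OF alt_isom] .

lemma alt_val_isom: "alt b w \<Longrightarrow> word_val w \<in> hyp_isometries"
  by (rule word_val_isom[OF alt_isom])

lemma Gam_isom: "g \<in> Gam b \<Longrightarrow> g \<in> hyp_isometries"
  using alt_val_isom by (auto simp: Gam_eq)

lemma val_in_Gam: "alt b w \<Longrightarrow> w \<noteq> [] \<Longrightarrow> word_val w \<in> Gam b" by (auto simp: Gam_eq)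

lemma star_in_Gam: "g \<in> star (K b) \<Longrightarrow> g \<in> Gam b"
  using val_in_Gam[of b "[g]"] K_isom[of g b] by simp

lemma star_mult_Gam: "g \<in> star (K b) \<Longrightarrow> h \<in> Gam (\<not> b) \<Longrightarrow> g \<diamondop> h \<in> Gam b"
proof -
  assume g: "g \<in> star (K b)" and "h \<in> Gam (\<not> b)"
  then obtain w where "alt (\<not> b) w" "h = word_val w" by (auto simp: Gam_eq)
  with g show ?thesis using val_in_Gam[of b "g # w"] by simp
qed

text \<open>The point at which the geodesic crosses the ball splits its length into two distances,
  each of which is within \<open>R\<close> of the distance to \<open>x\<close>.\<close>

lemma dist_Gam:
  assumes "g \<in> Gam b" "h \<in> Gam (\<not> b)"
  shows "hyp_dist (g x) (h x) \<ge> disp x g + disp x h - 2 * R"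
proof -
  obtain w where w: "w \<in> geodesic_segment (g x) (h x)" "w \<in> hyp" "hyp_dist x w < R"
    using cross[of g b h] assms by (auto simp: Gam_def hyp_ball_def)
  note s = geodesic_segment_dist[OF w(1)]
  have "disp x g \<le> hyp_dist x w + hyp_dist (g x) w" "disp x h \<le> hyp_dist x w + hyp_dist w (h x)"
    using hyp_dist_triangle[OF x w(2) s(1)] hyp_dist_triangle[OF x w(2) s(2)]
    by (auto simp: disp_def hyp_dist_commute)
  with w s(4) show ?thesis by linarith
qed

text \<open>The inverse of \<open>u\<close> begins with a letter of the type of the last letter of
  \<open>u\<close>, and \<open>v\<close> begins with the other type. So \<open>dist_Gam\<close>
  applies after moving \<open>x\<close> back by \<open>word_val u\<close>.\<close>

lemma disp_append:
  assumes "alt b (u @ v)"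
  shows "disp x (word_val (u @ v)) \<ge> disp x (word_val u) + disp x (word_val v) - 2 * R"
proof (cases "u = [] \<or> v = []")
  case True
  then show ?thesis using x R by auto
next
  case False
  let ?u = "rev (map (m_inv (BijGroup hyp)) u)"
  have a: "alt b u" "alt (b \<longleftrightarrow> even (length u)) v" using assms by (auto simp: alt_append)
  note ui = alt_val_isom[OF a(1)] and vi = alt_val_isom[OF a(2)]
  have "hinv (word_val u) \<in> Gam (b \<longleftrightarrow> odd (length u))"
    using val_in_Gam[OF alt_rev_inv[OF a(1)]] False word_val_inv[OF a(1)] by simp
  moreover have "word_val v \<in> Gam (\<not> (b \<longleftrightarrow> odd (length u)))"
    using val_in_Gam[OF a(2)] False by (cases b; cases "even (length u)") auto
  ultimately have "hyp_dist (hinv (word_val u) x) (word_val v x) \<ge> disp x (word_val u) + disp x (word_val v) - 2 * R"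
    using dist_Gam[of "hinv (word_val u)" _ "word_val v"] x ui by simp
  moreover have "word_val (u @ v) = word_val u \<diamondop> word_val v"
    by (rule word_val_append[OF alt_isom[OF a(1)] alt_isom[OF a(2)]])
  ultimately show ?thesis
    using ui vi x isom_in[OF vi x] by (simp add: disp_def isom_dist_inv)
qed

lemma infinite_K: "infinite (K b)"
  using infinite_if_infinite_limit_set[OF kleinian_isometries[OF kleinian]] kleinian[of b] by (simp add: kleinian_def)

lemma large_displacement: "infinite {g \<in> star (K b). disp x g > D}"
proof
  assume f: "finite {g \<in> star (K b). disp x g > D}"
  have "finite {g \<in> K b. disp x g \<le> D}"
    unfolding disp_def by (rule kleinian_finite_bounded_displacement[OF kleinian x])
  moreover have "K b \<subseteq> insert hone ({g \<in> star (K b). disp x g > D} \<union> {g \<in> K b. disp x g \<le> D})" by auto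
  ultimately have "finite (K b)" using f by (meson finite_UnI finite_insert finite_subset)
  with infinite_K show False by blast
qed

text \<open>If a nontrivial reduced word moves \<open>x\<close> only a little, then it moves \<open>k x\<close> far away for any
  letter \<open>k\<close> of large displacement that can be appended to it; this is how freeness and
  discreteness follow from the crossing property.\<close>

definition far :: "bool \<Rightarrow> real ^ 'n \<Rightarrow> real ^ 'n" where
  "far b = (SOME k. k \<in> star (K b) \<and> disp x k > R + 1)"

text \<open>A second letter of the same kind: at most one of the two can cancel the last letter of a
  given word.\<close>

definition far' :: "bool \<Rightarrow> real ^ 'n \<Rightarrow> real ^ 'n" where
  "far' b = (SOME k. k \<in> star (K b) \<and> disp x k > R + 1 \<and> k \<noteq> far b)"

lemma far: "far b \<in> star (K b)" "disp x (far b) > R + 1"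
proof -
  have "{g \<in> star (K b). disp x g > R + 1} \<noteq> {}" using infinite_imp_nonempty[OF large_displacement] .
  then have "\<exists>k. k \<in> star (K b) \<and> disp x k > R + 1" by blast
  from someI_ex[OF this] show "far b \<in> star (K b)" "disp x (far b) > R + 1" unfolding far_def by auto
qed

lemma far': "far' b \<in> star (K b)" "disp x (far' b) > R + 1" "far' b \<noteq> far b"
proof -
  have "infinite ({g \<in> star (K b). disp x g > R + 1} - {far b})" using large_displacement[where D="R+1"] by simp
  from infinite_imp_nonempty[OF this]
  have "\<exists>k. k \<in> star (K b) \<and> disp x k > R + 1 \<and> k \<noteq> far b" by blast
  from someI_ex[OF this] show "far' b \<in> star (K b)" "disp x (far' b) > R + 1" "far' b \<noteq> far b"
    unfolding far'_def by auto
qed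

definition testpoints :: "(real ^ 'n) set" where
  "testpoints = {x, far True x, far' True x, far False x, far' False x}"

lemma testpoints: "finite testpoints" "testpoints \<subseteq> hyp"
proof -
  have "far b x \<in> hyp" "far' b x \<in> hyp" for b
    using isom_in[OF K_isom[OF DiffD1[OF far(1)]] x] isom_in[OF K_isom[OF DiffD1[OF far'(1)]] x] by auto
  then show "finite testpoints" "testpoints \<subseteq> hyp" using x by (auto simp: testpoints_def)
qed

text \<open>For a suitable \<open>k\<close> of the type other than \<open>b\<close>, the product
  \<open>word_val w \<diamondop> k\<close> still begins with a letter of type \<open>b\<close>,
  because appending \<open>k\<close> at most modifies the last letter. Then \<open>dist_Gam\<close>
  separates its image of \<open>x\<close> from \<open>k x\<close>.\<close>

lemma moves_testpoint:
  assumes w: "alt b w" "w \<noteq> []"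
  shows "\<exists>q\<in>testpoints. hyp_dist (word_val w q) q \<ge> 1"
proof (cases "disp x (word_val w) \<ge> 1")
  case True
  then show ?thesis by (intro bexI[of _ x]) (auto simp: testpoints_def disp_def hyp_dist_commute)
next
  case False
  obtain u l where ul: "w = u @ [l]" using w(2) by (metis append_butlast_last_id)
  have u: "alt b u" and l: "l \<in> star (K (b \<longleftrightarrow> even (length u)))" using w(1) by (auto simp: ul alt_append)
  note wi = alt_val_isom[OF w(1)]
  have "\<exists>k\<in>{far (\<not> b), far' (\<not> b)}. word_val w \<diamondop> k \<in> Gam b"
  proof (cases "even (length u)")
    case True
    have k: "far (\<not> b) \<in> star (K (\<not> b))" by (rule far)
    have "alt b (w @ [far (\<not> b)])" using w k True by (simp add: alt_append ul)
    moreover have "word_val (w @ [far (\<not> b)]) = word_val w \<diamondop> far (\<not> b)"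
      using word_val_append[OF alt_isom[OF w(1)], of "[far (\<not> b)]"] K_isom[OF DiffD1[OF k]] by simp
    ultimately show ?thesis using val_in_Gam[of b "w @ [far (\<not> b)]"] by auto
  next
    case False
    then have l': "l \<in> star (K (\<not> b))" using l by (cases b) auto
    have li: "l \<in> hyp_isometries" using l' K_isom by blast
    have "\<exists>k\<in>{far (\<not> b), far' (\<not> b)}. l \<noteq> hinv k"
    proof (rule ccontr)
      assume "\<not> ?thesis"
      then have "hinv (far (\<not> b)) = hinv (far' (\<not> b))" by auto
      moreover have "far (\<not> b) \<in> hyp_isometries" "far' (\<not> b) \<in> hyp_isometries" using far(1) far'(1) K_isom by blast+
      ultimately have "far (\<not> b) = far' (\<not> b)" by (metis BG.inv_inv carrier_hyp isom_Bij)
      with far'(3) show False by metis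
    qed
    then obtain k where k: "k \<in> {far (\<not> b), far' (\<not> b)}" "l \<noteq> hinv k" by blast
    have kK: "k \<in> star (K (\<not> b))" using k(1) far(1)[of "\<not> b"] far'(1)[of "\<not> b"] by auto
    have ki: "k \<in> hyp_isometries" using kK K_isom by blast
    have lk: "l \<diamondop> k \<in> star (K (\<not> b))" using star_mult[of l "\<not> b" k] l' kK k by blast
    have "alt b (u @ [l \<diamondop> k])" using u lk False by (cases b) (auto simp: alt_append)
    moreover have "word_val (u @ [l \<diamondop> k]) = word_val w \<diamondop> k"
      using word_val_append[OF alt_isom[OF u], of "[l]"] word_val_append[OF alt_isom[OF u], of "[l \<diamondop> k]"]
        alt_val_isom[OF u] li ki by (simp add: ul BG.m_assoc)
    ultimately show ?thesis using val_in_Gam[of b "u @ [l \<diamondop> k]"] k by auto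
  qed
  then obtain k where k: "k \<in> {far (\<not> b), far' (\<not> b)}" "word_val w \<diamondop> k \<in> Gam b" by blast
  have kK: "k \<in> star (K (\<not> b))" "disp x k > R + 1"
    using k(1) far[of "\<not> b"] far'(1,2)[of "\<not> b"] by auto
  have ki: "k \<in> hyp_isometries" using kK K_isom by blast
  \<comment> \<open>Since \<open>k\<close> displaces \<open>x\<close> by more than
    \<open>R + 1\<close> and \<open>w\<close> by less than 1, the right-hand side exceeds
    \<open>2 * (R + 1) - 1 - 2 * R\<close>, which is 1.\<close>
  have "hyp_dist ((word_val w \<diamondop> k) x) (k x) \<ge> disp x (word_val w \<diamondop> k) + disp x k - 2 * R"
    by (rule dist_Gam[OF k(2) star_in_Gam[OF kK(1)]])
  moreover have "disp x (word_val w \<diamondop> k) \<ge> disp x k - disp x (word_val w)" by (rule disp_mult_ge[OF x wi ki])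
  ultimately have "hyp_dist (word_val w (k x)) (k x) \<ge> 1" using False kK(2) wi ki x by simp
  moreover have "k x \<in> testpoints" using k(1) by (cases b) (auto simp: testpoints_def)
  ultimately show ?thesis by blast
qed

lemma word_val_neq_one:
  assumes w: "alt b w" "w \<noteq> []" shows "word_val w \<noteq> hone"
proof
  assume "word_val w = hone"
  with moves_testpoint[OF assms] testpoints show False by (auto simp: subset_iff)
qed

text \<open>If the first letters differ, then inverting one word and merging the two first letters
  into \<open>m\<close> gives a nonempty reduced word with value the identity, contrary to
  \<open>word_val_neq_one\<close>.\<close>

lemma word_val_inj: "alt b u \<Longrightarrow> alt b v \<Longrightarrow> word_val u = word_val v \<Longrightarrow> u = v"
proof (induction u arbitrary: b v)
  case Nil
  then show ?case using word_val_neq_one by force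
next
  case (Cons a u)
  show ?case
  proof (cases v)
    case Nil
    then show ?thesis using Cons.prems word_val_neq_one[of b "a # u"] by simp
  next
    case (Cons a' v')
    have u: "a \<in> star (K b)" "alt (\<not> b) u" and v: "a' \<in> star (K b)" "alt (\<not> b) v'" using Cons.prems Cons by auto
    note i = K_isom[OF DiffD1[OF u(1)]] K_isom[OF DiffD1[OF v(1)]] alt_val_isom[OF u(2)] alt_val_isom[OF v(2)]
    have eq: "a \<diamondop> word_val u = a' \<diamondop> word_val v'" using Cons.prems(3) Cons by simp
    show ?thesis
    proof (cases "a = a'")
      case True
      then have "word_val u = word_val v'" using eq i by (simp add: isom_left_cancel)
      then show ?thesis using Cons.IH[OF u(2) v(2)] True Cons by simp
    next
      case False
      define m where "m = hinv a \<diamondop> a'"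
      have "hinv a \<noteq> hinv a'" using False i by (metis BG.inv_inv carrier_hyp isom_Bij)
      then have m: "m \<in> star (K b)" unfolding m_def using u v by (intro star_mult K_inv) auto
      have mi: "m \<in> hyp_isometries" using m K_isom by blast
      let ?w = "rev (map (m_inv (BijGroup hyp)) u) @ [m] @ v'"
      let ?u = "rev (map (m_inv (BijGroup hyp)) u)"
      have "((\<not> b) \<longleftrightarrow> odd (length u)) \<longleftrightarrow> even (length u) \<longleftrightarrow> b" by auto
      then have aw: "alt ((\<not> b) \<longleftrightarrow> odd (length u)) ?w"
        using alt_rev_inv[OF u(2)] m v by (auto simp: alt_append)
      have ua: "alt ((\<not> b) \<longleftrightarrow> odd (length u)) ?u" by (rule alt_rev_inv[OF u(2)])
      have "word_val ?w = hinv (word_val u) \<diamondop> (m \<diamondop> word_val v')"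
        using word_val_append[OF alt_isom[OF ua], of "[m] @ v'"] alt_isom[OF v(2)] mi word_val_inv[OF u(2)] by simp
      also have "\<dots> = hinv (word_val u) \<diamondop> (hinv a \<diamondop> (a' \<diamondop> word_val v'))"
        using i mi by (simp add: m_def BG.m_assoc)
      also have "\<dots> = hone" unfolding eq[symmetric] using i by (simp add: BG.m_assoc[symmetric] BG.l_inv)
      finally show ?thesis using word_val_neq_one[OF aw] by simp
    qed
  qed
qed

text \<open>A letter on the left is prepended, merges with the first letter, or cancels it.\<close>

lemma letter_mult:
  assumes a: "a \<in> K c" and w: "alt b w"
  shows "\<exists>b' w'. alt b' w' \<and> a \<diamondop> word_val w = word_val w'"
proof (cases "a = hone")
  case True
  then show ?thesis using w alt_val_isom[OF w] by (intro exI[of _ b] exI[of _ w]) simp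
next
  case False
  then have a': "a \<in> star (K c)" using a by blast
  have ai: "a \<in> hyp_isometries" using a K_isom by blast
  show ?thesis
  proof (cases "alt (\<not> c) w")
    case True
    then show ?thesis using a' by (intro exI[of _ c] exI[of _ "a # w"]) simp
  next
    case F: False
    then obtain l v where lv: "w = l # v" by (cases w) auto
    have bc: "b = c" using F w by (cases b; cases c) auto
    have l: "l \<in> star (K c)" "alt (\<not> c) v" using w lv bc by auto
    have i: "l \<in> hyp_isometries" "word_val v \<in> hyp_isometries" using l K_isom alt_val_isom by blast+
    have eq: "a \<diamondop> word_val w = (a \<diamondop> l) \<diamondop> word_val v" using ai i by (simp add: lv BG.m_assoc)
    show ?thesis
    proof (cases "a = hinv l")
      case True
      then have "(a \<diamondop> l) \<diamondop> word_val v = word_val v" using i by (simp add: BG.l_inv)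
      then show ?thesis using eq l(2) by metis
    next
      case False
      then have "alt c ((a \<diamondop> l) # v)" using star_mult[OF a, of l] l by auto
      then show ?thesis using eq by (intro exI[of _ c] exI[of _ "(a \<diamondop> l) # v"]) simp
    qed
  qed
qed

lemma \<Gamma>_words: "\<gamma> \<in> \<Gamma> \<longleftrightarrow> (\<exists>b w. alt b w \<and> \<gamma> = word_val w)"
proof
  assume "\<gamma> \<in> \<Gamma>"
  then have g: "\<gamma> \<in> generate (BijGroup hyp) (K True \<union> K False)" by (simp add: \<Gamma>_def generated_group_def)
  \<comment> \<open>The induction over \<open>generate\<close> is about left multiplication on all
    reduced words; the representation of \<gamma> results from the empty word.\<close>
  have "\<gamma> \<in> hyp_isometries \<and> (\<forall>b w. alt b w \<longrightarrow> (\<exists>b' w'. alt b' w' \<and> \<gamma> \<diamondop> word_val w = word_val w'))"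
    using g
  proof (induction rule: generate.induct)
    case one
    then show ?case using alt_val_isom by (metis BG.l_one carrier_hyp isom_Bij isom_one)
  next
    case (incl h)
    then show ?case using letter_mult K_isom by blast
  next
    case (inv h)
    then show ?case using letter_mult K_isom K_inv isom_inv by (metis Un_iff)
  next
    case (eng h1 h2)
    have "\<exists>b' w'. alt b' w' \<and> (h1 \<diamondop> h2) \<diamondop> word_val w = word_val w'" if "alt b w" for b w
    proof -
      obtain b2 w2 where 2: "alt b2 w2" "h2 \<diamondop> word_val w = word_val w2" using eng.IH(2) \<open>alt b w\<close> by blast
      obtain b1 w1 where 1: "alt b1 w1" "h1 \<diamondop> word_val w2 = word_val w1" using eng.IH(1) 2(1) by blast
      have "(h1 \<diamondop> h2) \<diamondop> word_val w = h1 \<diamondop> (h2 \<diamondop> word_val w)"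
        using eng.IH alt_val_isom[OF \<open>alt b w\<close>] by (simp add: BG.m_assoc)
      with 1 2 show ?thesis by auto
    qed
    with eng.IH show ?case by auto
  qed
  then obtain b' w' where "alt b' w'" "\<gamma> \<diamondop> word_val [] = word_val w'" "\<gamma> \<in> hyp_isometries" by (metis alt_Nil)
  then show "\<exists>b w. alt b w \<and> \<gamma> = word_val w" by auto
next
  assume "\<exists>b w. alt b w \<and> \<gamma> = word_val w"
  then obtain b w where w: "alt b w" "\<gamma> = word_val w" by blast
  have K: "K b \<subseteq> K True \<union> K False" for b by (cases b) auto
  have "alt b w \<Longrightarrow> word_val w \<in> generate (BijGroup hyp) (K True \<union> K False)" for b
  proof (induction w arbitrary: b)
    case (Cons a w)
    then have "a \<in> generate (BijGroup hyp) (K True \<union> K False)" using K by (auto intro!: generate.incl)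
    then show ?case using Cons by (auto intro: generate.eng)
  qed (auto intro: generate.one)
  with w show "\<gamma> \<in> \<Gamma>" by (simp add: \<Gamma>_def generated_group_def)
qed

lemma \<Gamma>_isom: "\<Gamma> \<subseteq> hyp_isometries"
  using alt_val_isom by (auto simp: \<Gamma>_words)

lemma \<Gamma>_sub: "subgroup \<Gamma> (BijGroup hyp)"
  unfolding \<Gamma>_def generated_group_def using K_isom by (intro BG.generate_is_subgroup) auto

lemma Gam_\<Gamma>: "Gam b \<subseteq> \<Gamma>" unfolding Gam_eq using \<Gamma>_words by blast

lemma \<Gamma>_cases: "\<gamma> \<in> \<Gamma> \<Longrightarrow> \<gamma> = hone \<or> (\<exists>b. \<gamma> \<in> Gam b)"
proof -
  assume "\<gamma> \<in> \<Gamma>"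
  then obtain b w where "alt b w" "\<gamma> = word_val w" by (auto simp: \<Gamma>_words)
  then show ?thesis using val_in_Gam by (cases "w = []") auto
qed

lemma K_\<Gamma>: "K b \<subseteq> \<Gamma>"
proof
  fix g assume g: "g \<in> K b"
  show "g \<in> \<Gamma>"
  proof (cases "g = hone")
    case True
    then show ?thesis using \<Gamma>_words[of g] alt_Nil word_val_simps(1) by metis
  next
    case False
    then show ?thesis using star_in_Gam[of g b] g Gam_\<Gamma> by blast
  qed
qed

lemma infinite_\<Gamma>: "infinite \<Gamma>"
  using infinite_K K_\<Gamma> infinite_super by blast

lemma finite_\<Gamma>:
  assumes y: "y \<in> hyp" shows "finite {g \<in> \<Gamma>. hyp_dist y (g y) \<le> r}"
proof (rule finite_bounded_displacement[OF \<Gamma>_sub \<Gamma>_isom testpoints zero_less_one _ y])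
  fix g assume g: "g \<in> \<Gamma>" "\<forall>q\<in>testpoints. hyp_dist (g q) q < 1"
  show "g = hone"
  proof (rule ccontr)
    assume "g \<noteq> hone"
    obtain b w where w: "alt b w" "g = word_val w" using g(1) by (auto simp: \<Gamma>_words)
    with \<open>g \<noteq> hone\<close> have "w \<noteq> []" by auto
    from moves_testpoint[OF w(1) this] g(2) w(2) show False by force
  qed
qed

text \<open>Reduced words of even length as words over the alphabet of pairs of letters.\<close>

definition pairs :: "((real ^ 'n \<Rightarrow> real ^ 'n) \<times> (real ^ 'n \<Rightarrow> real ^ 'n)) set" where
  "pairs = star (K True) \<times> star (K False)"

definition flat :: "((real ^ 'n \<Rightarrow> real ^ 'n) \<times> (real ^ 'n \<Rightarrow> real ^ 'n)) list \<Rightarrow> (real ^ 'n \<Rightarrow> real ^ 'n) list" where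
  "flat ps = concat (map (\<lambda>(g, h). [g, h]) ps)"

lemma flat_simps [simp]: "flat [] = []" "flat ((g, h) # ps) = g # h # flat ps" "flat (ps @ qs) = flat ps @ flat qs"
  by (auto simp: flat_def)

lemma even_length_flat [simp]: "even (length (flat ps))"
  by (induction ps) auto

lemma flat_eq_Nil [simp]: "flat ps = [] \<longleftrightarrow> ps = []"
  by (cases ps) auto

lemma alt_flat: "ps \<in> lists pairs \<Longrightarrow> alt True (flat ps)"
  by (induction ps) (auto simp: pairs_def)

lemma flat_inj: "flat ps = flat qs \<Longrightarrow> ps = qs"
proof (induction ps arbitrary: qs)
  case Nil
  then show ?case by (cases qs) auto
next
  case (Cons p ps)
  then show ?case by (cases p; cases qs) auto
qed

lemma alt_True_decomp:
  "alt True w \<Longrightarrow> \<exists>ps\<in>lists pairs. w = flat ps \<or> (\<exists>g\<in>star (K True). w = flat ps @ [g])"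
proof (induction w rule: induct_list012)
  case (2 g)
  then show ?case by (intro bexI[of _ "[]"]) auto
next
  case (3 g h w)
  then obtain ps where ps: "ps \<in> lists pairs" "w = flat ps \<or> (\<exists>g\<in>star (K True). w = flat ps @ [g])" by auto
  then show ?case using 3(3) by (intro bexI[of _ "(g, h) # ps"]) (auto simp: pairs_def)
qed (auto intro: bexI[of _ "[]"])

text \<open>Pairs begin with \<open>K True\<close> and end with \<open>K False\<close>, so a reduced
  word may have an unpaired letter at each end; the identity stands for an absent one.\<close>

lemma \<Gamma>_decomp:
  assumes "\<gamma> \<in> \<Gamma>"
  obtains h ps g where "h \<in> K False" "ps \<in> lists pairs" "g \<in> K True"
    "\<gamma> = h \<diamondop> (word_val (flat ps) \<diamondop> g)"
proof -
  have *: "\<exists>ps\<in>lists pairs. \<exists>g\<in>K True. word_val w = word_val (flat ps) \<diamondop> g" if w: "alt True w" for w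
  proof -
    obtain ps where ps: "ps \<in> lists pairs" "w = flat ps \<or> (\<exists>g\<in>star (K True). w = flat ps @ [g])"
      using alt_True_decomp[OF w] by blast
    note pi = alt_isom[OF alt_flat[OF ps(1)]]
    from ps(2) show ?thesis
    proof
      assume "w = flat ps"
      then show ?thesis using ps(1) K_one[of True] word_val_isom[OF pi]
        by (intro bexI[of _ ps] bexI[of _ hone]) auto
    next
      assume "\<exists>g\<in>star (K True). w = flat ps @ [g]"
      then obtain g where g: "g \<in> star (K True)" "w = flat ps @ [g]" by blast
      then have "word_val w = word_val (flat ps) \<diamondop> g"
        using word_val_append[OF pi, of "[g]"] K_isom[of g True] by simp
      then show ?thesis using ps(1) g by blast
    qed
  qed
  obtain b w where w: "alt b w" "\<gamma> = word_val w" using assms by (auto simp: \<Gamma>_words)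
  show thesis
  proof (cases b)
    case True
    then have "alt True w" using w by simp
    then obtain ps g where pg: "ps \<in> lists pairs" "g \<in> K True" "word_val w = word_val (flat ps) \<diamondop> g" using * by blast
    have "word_val (flat ps) \<diamondop> g \<in> hyp_isometries" using alt_val_isom[OF w(1)] pg(3) by simp
    then show thesis using that[OF K_one pg(1,2)] w pg(3) by simp
  next
    case False
    show thesis
    proof (cases w)
      case Nil
      then show thesis using that[OF K_one _ K_one, of "[]"] w by simp
    next
      case (Cons h v)
      then have "h \<in> K False" "alt True v" using w False by auto
      moreover then obtain ps g where "ps \<in> lists pairs" "g \<in> K True" "word_val v = word_val (flat ps) \<diamondop> g" using * by blast
      ultimately show thesis using that[of h ps g] w Cons by simp
    qed
  qed
qed

definition plen :: "((real ^ 'n \<Rightarrow> real ^ 'n) \<times> (real ^ 'n \<Rightarrow> real ^ 'n)) list \<Rightarrow> real" where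
  "plen ps = disp x (word_val (flat ps))"

text \<open>The reason for pairs: any two words of pairs can be concatenated and remain reduced, so
  no condition of parity interferes with the counting.\<close>

sublocale pairs: quasi_additive pairs plen "2 * R"
proof
  show "plen [] = 0" using x by (simp add: plen_def)
  show "plen w \<ge> 0" if "w \<in> lists pairs" for w
    unfolding plen_def by (rule disp_nonneg[OF x alt_val_isom[OF alt_flat[OF that]]])
  fix u v assume uv: "u \<in> lists pairs" "v \<in> lists pairs"
  note au = alt_flat[OF uv(1)] and av = alt_flat[OF uv(2)]
  show "plen (u @ v) \<le> plen u + plen v"
    unfolding plen_def using disp_mult_le[OF x alt_val_isom[OF au] alt_val_isom[OF av]]
    by (simp add: word_val_append[OF alt_isom[OF au] alt_isom[OF av]])
  have "alt True (flat u @ flat v)" using au av by (simp add: alt_append)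
  then show "plen u + plen v - 2 * R \<le> plen (u @ v)"
    unfolding plen_def using disp_append by fastforce
qed (use R in simp)

end

section \<open>A pattern whose occurrence forces the geodesic through the ball\<close>

lemma isom_geodesic_segment:
  assumes f: "f \<in> hyp_isometries"
  shows "f ` geodesic_segment p q \<subseteq> geodesic_segment (f p) (f q)"
proof
  fix w assume "w \<in> f ` geodesic_segment p q"
  then obtain c l t where c: "0 \<le> l" "geodesic_on {0..l} c" "c 0 = p" "c l = q" "t \<in> {0..l}" "w = f (c t)"
    unfolding geodesic_segment_def by auto
  have "geodesic_on {0..l} (\<lambda>t. f (c t))"
    using c(2) isom_in[OF f] isom_dist[OF f] by (simp add: geodesic_on_def)
  then show "w \<in> geodesic_segment (f p) (f q)"
    unfolding geodesic_segment_def using c by (intro CollectI exI[of _ "\<lambda>t. f (c t)"] exI[of _ l]) auto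
qed

text \<open>The closure is Euclidean. The distance from 0 is bounded on the ball, which keeps the
  norm away from 1, so no point of the sphere is added and the distance to \<open>x\<close> is
  continuous up to the closure.\<close>

lemma closure_hyp_ball:
  assumes x: "x \<in> hyp" and z: "z \<in> closure (hyp_ball x R)"
  shows "z \<in> hyp" "hyp_dist x z \<le> R"
proof -
  obtain s where s: "\<And>n. s n \<in> hyp_ball x R" "s \<longlonglongrightarrow> z"
    using z unfolding closure_sequential by blast
  have sh: "s n \<in> hyp" "hyp_dist x (s n) < R" for n using s(1)[of n] by (auto simp: hyp_ball_def)
  define M where "M = hyp_dist 0 x + R"
  have "1 - (norm (s n))\<^sup>2 \<ge> 2 / (1 + cosh M)" for n
  proof -
    have "hyp_dist 0 (s n) \<le> M"
      using hyp_dist_triangle[OF zero_in_hyp x sh(1), of n] sh(2)[of n] by (simp add: M_def)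
    then have "cosh (hyp_dist 0 (s n)) \<le> cosh M"
      using cosh_hyp_dist(2)[OF zero_in_hyp sh(1)[of n]] by (simp add: cosh_real_nonneg_le_iff)
    then show ?thesis unfolding one_minus_norm2_hyp[OF sh(1)]
      by (intro divide_left_mono mult_pos_pos add_pos_pos) auto
  qed
  moreover have "(\<lambda>n. 1 - (norm (s n))\<^sup>2) \<longlonglongrightarrow> 1 - (norm z)\<^sup>2" by (intro tendsto_intros s)
  ultimately have "2 / (1 + cosh M) \<le> 1 - (norm z)\<^sup>2"
    by (intro tendsto_lowerbound[OF _ always_eventually]) auto
  moreover have "2 / (1 + cosh M) > 0" by (intro divide_pos_pos add_pos_pos) auto
  ultimately have pos: "1 - (norm z)\<^sup>2 > 0" by linarith
  then show zh: "z \<in> hyp" by (simp add: mem_ball abs_square_less_1)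
  have R: "R \<ge> 0" using sh(2)[of 0] cosh_hyp_dist(2)[OF x sh(1)[of 0]] by linarith
  have "(\<lambda>n. cosh (hyp_dist x (s n))) \<longlonglongrightarrow> cosh (hyp_dist x z)"
    unfolding cosh_hyp_dist(1)[OF x sh(1)] cosh_hyp_dist(1)[OF x zh]
    using pos one_minus_norm2_pos[OF x] by (intro tendsto_intros s) auto
  moreover have "cosh (hyp_dist x (s n)) \<le> cosh R" for n
    using sh(2)[of n] cosh_hyp_dist(2)[OF x sh(1)[of n]] R by (simp add: cosh_real_nonneg_le_iff)
  ultimately have "cosh (hyp_dist x z) \<le> cosh R"
    by (intro tendsto_upperbound[OF _ always_eventually]) auto
  then show "hyp_dist x z \<le> R" using cosh_hyp_dist(2)[OF x zh] R by (simp add: cosh_real_nonneg_le_iff)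
qed

lemma cosh_add_le: "0 \<le> (b :: real) \<Longrightarrow> cosh (a + b) \<le> exp b * cosh a"
proof -
  assume b: "0 \<le> b"
  have "exp (- a - b) \<le> exp (b - a)" using b by simp
  then show ?thesis by (simp add: cosh_def exp_add exp_diff exp_minus field_simps)
qed

lemma cosh_dist_le:
  assumes "y \<in> hyp" "z \<in> hyp" "w \<in> hyp"
  shows "cosh (hyp_dist y w) \<le> exp (hyp_dist y z) * cosh (hyp_dist z w)"
proof -
  have "cosh (hyp_dist y w) \<le> cosh (hyp_dist z w + hyp_dist y z)"
    using hyp_dist_triangle[of y z w] assms cosh_hyp_dist(2)[of y w] cosh_hyp_dist(2)[of y z] cosh_hyp_dist(2)[of z w]
    by (simp add: cosh_real_nonneg_le_iff)
  also have "\<dots> \<le> exp (hyp_dist y z) * cosh (hyp_dist z w)"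
    using assms by (intro cosh_add_le cosh_hyp_dist(2))
  finally show ?thesis .
qed

lemma visual_base_change:
  assumes "x \<in> hyp" "y \<in> hyp" "p \<in> hyp" "q \<in> hyp"
  shows "visual y p q \<ge> exp (- 2 * hyp_dist x y) * visual x p q"
proof -
  let ?e = "exp (hyp_dist x y)"
  have "cosh (hyp_dist y p) * cosh (hyp_dist y q) \<le> (?e * cosh (hyp_dist x p)) * (?e * cosh (hyp_dist x q))"
    using cosh_dist_le[of y x p] cosh_dist_le[of y x q] assms by (intro mult_mono) (auto simp: hyp_dist_commute)
  then have "cosh (hyp_dist p q) / (cosh (hyp_dist y p) * cosh (hyp_dist y q))
    \<ge> cosh (hyp_dist p q) / ((?e * cosh (hyp_dist x p)) * (?e * cosh (hyp_dist x q)))"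
    by (intro divide_left_mono mult_pos_pos) (auto simp: cosh_real_pos)
  moreover have "exp (- 2 * hyp_dist x y) * (?e * ?e) = 1" by (simp flip: exp_add)
  then have "exp (- 2 * hyp_dist x y) = 1 / (?e * ?e)" by (simp add: eq_divide_eq)
  then have "exp (- 2 * hyp_dist x y) * visual x p q
    = cosh (hyp_dist p q) / ((?e * cosh (hyp_dist x p)) * (?e * cosh (hyp_dist x q)))"
    by (simp add: visual_def)
  ultimately show ?thesis by (simp add: visual_def)
qed

text \<open>Turns smallness of \<open>visual\<close> into Euclidean closeness, the form in which
  limits in the closed ball are taken.\<close>

lemma visual_zero_ge:
  assumes "p \<in> hyp" "q \<in> hyp" shows "visual 0 p q \<ge> (norm (p - q))\<^sup>2 / 2"
proof -
  let ?P = "1 - (norm p)\<^sup>2" and ?Q = "1 - (norm q)\<^sup>2"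
  have P: "?P > 0" "?Q > 0" using assms one_minus_norm2_pos by auto
  have c: "cosh (hyp_dist 0 p) \<le> 2 / ?P" "cosh (hyp_dist 0 q) \<le> 2 / ?Q"
    using one_plus_fst_lor[OF assms(1)] one_plus_fst_lor[OF assms(2)] by (auto simp: fst_lor[OF assms(1)] fst_lor[OF assms(2)])
  have "2 * (norm (p - q))\<^sup>2 / (?P * ?Q) / (2 / ?P * (2 / ?Q)) \<le> visual 0 p q"
    unfolding visual_def cosh_hyp_dist(1)[OF assms]
    using c P by (intro frac_le mult_mono) (auto simp: cosh_real_pos)
  then show ?thesis using P by simp
qed

section \<open>Directions of orbit points and the forced crossing\<close>

context crossing_pair
begin

text \<open>Seen from \<open>x\<close>, the point \<open>z\<close> lies in the shadow of
  \<open>word_val u x\<close>, which is the hypothesis of \<open>klein_chart_close\<close>. The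
  constant \<open>4 * R\<close> consists of \<open>2 * R\<close> from \<open>disp_append\<close> and
  \<open>R\<close> twice for replacing \<open>x\<close> by \<open>y\<close>.\<close>

lemma cone:
  assumes a: "alt b (u @ v)" and y: "y \<in> hyp" "hyp_dist x y < R"
  defines "z \<equiv> word_val (u @ v) y"
  shows "z \<in> hyp" "hyp_dist z (word_val u x) \<le> hyp_dist x z - disp x (word_val u) + 4 * R"
    "hyp_dist x z \<ge> disp x (word_val u) - 3 * R"
proof -
  have au: "alt b u" and av: "alt (b \<longleftrightarrow> even (length u)) v" using a by (auto simp: alt_append)
  note ui = alt_val_isom[OF au] and vi = alt_val_isom[OF av] and wi = alt_val_isom[OF a]
  have eq: "word_val (u @ v) = word_val u \<diamondop> word_val v"
    by (rule word_val_append[OF alt_isom[OF au] alt_isom[OF av]])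
  show zh: "z \<in> hyp" unfolding z_def by (rule isom_in[OF wi y(1)])
  have vh: "word_val v y \<in> hyp" "word_val v x \<in> hyp" using isom_in[OF vi] x y by auto
  have "hyp_dist z (word_val u x) = hyp_dist (word_val v y) x"
    using ui vi x y vh by (simp add: z_def eq isom_dist)
  also have "\<dots> \<le> hyp_dist (word_val v y) (word_val v x) + hyp_dist (word_val v x) x"
    by (rule hyp_dist_triangle[OF vh x])
  also have "\<dots> < R + disp x (word_val v)"
    using y isom_dist[OF vi y(1) x] by (simp add: disp_def hyp_dist_commute)
  finally have 1: "hyp_dist z (word_val u x) \<le> R + disp x (word_val v)" by simp
  have "disp x (word_val (u @ v)) \<le> hyp_dist x z + hyp_dist z (word_val (u @ v) x)"
    unfolding disp_def by (rule hyp_dist_triangle[OF x zh isom_in[OF wi x]])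
  also have "\<dots> < hyp_dist x z + R" using isom_dist[OF wi y(1) x] y(2) by (simp add: z_def hyp_dist_commute)
  finally have 2: "hyp_dist x z \<ge> disp x (word_val u) + disp x (word_val v) - 3 * R"
    using disp_append[OF a] by simp
  with 1 show "hyp_dist z (word_val u x) \<le> hyp_dist x z - disp x (word_val u) + 4 * R" by simp
  show "hyp_dist x z \<ge> disp x (word_val u) - 3 * R" using 2 disp_nonneg[OF x vi] by simp
qed

text \<open>Encodes an optional letter, so that the unpaired end letters of
  \<open>\<Gamma>_decomp\<close> can be treated as words.\<close>

definition letter_word :: "(real ^ 'n \<Rightarrow> real ^ 'n) \<Rightarrow> (real ^ 'n \<Rightarrow> real ^ 'n) list" where
  "letter_word g = (if g = hone then [] else [g])"

lemma letter_word:
  assumes "g \<in> K b" shows "alt b (letter_word g)" "word_val (letter_word g) = g"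
  using assms K_isom[OF assms] by (auto simp: letter_word_def)

lemma alt_left:
  assumes "h \<in> K False" "ps \<in> lists pairs"
  obtains b where "alt b (letter_word h @ flat ps)" "b \<longleftrightarrow> h = hone"
  using assms alt_flat[OF assms(2)] by (cases "h = hone") (auto simp: letter_word_def)

lemma alt_right:
  assumes "g \<in> K True" "ps \<in> lists pairs"
  shows "alt True (flat ps @ letter_word g)"
  using alt_flat[OF assms(2)] letter_word(1)[OF assms(1)] by (simp add: alt_append)

lemma alt_both:
  assumes "h \<in> K False" "ps \<in> lists pairs" "g \<in> K True"
  obtains b where "alt b (letter_word h @ flat ps @ letter_word g)"
proof (cases "h = hone")
  case True
  then show ?thesis using that[of True] alt_right[OF assms(3,2)] by (simp add: letter_word_def)
next
  case False
  then show ?thesis using that[of False] alt_right[OF assms(3,2)] assms(1) by (simp add: letter_word_def)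
qed

lemma left_val:
  assumes "h \<in> K False" "ps \<in> lists pairs"
  shows "word_val (letter_word h @ flat ps) = h \<diamondop> word_val (flat ps)"
proof -
  have "set (letter_word h) \<subseteq> hyp_isometries" using K_isom[OF assms(1)] by (auto simp: letter_word_def)
  from word_val_append[OF this alt_isom[OF alt_flat[OF assms(2)]]] show ?thesis
    using letter_word(2)[OF assms(1)] by simp
qed

lemma right_val:
  assumes "g \<in> K True" "ps \<in> lists pairs"
  shows "word_val (flat ps @ letter_word g) = word_val (flat ps) \<diamondop> g"
proof -
  have "set (letter_word g) \<subseteq> hyp_isometries" using K_isom[OF assms(1)] by (auto simp: letter_word_def)
  from word_val_append[OF alt_isom[OF alt_flat[OF assms(2)]] this] show ?thesis
    using letter_word(2)[OF assms(1)] by simp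
qed

text \<open>Reading the left half backwards from the cut: the inverse is a reduced word whose
  initial part is the inverse of \<open>U\<close>, so \<open>cone\<close> locates its images by
  \<open>U\<close> alone. It begins in \<open>K False\<close>, where the pairs of \<open>U\<close>
  end.\<close>

lemma left_inverse_word:
  assumes h: "h \<in> K False" and a: "a \<in> lists pairs" and U: "U \<in> lists pairs" "U \<noteq> []"
  obtains v where "alt False (rev (map (m_inv (BijGroup hyp)) (flat U)) @ v)"
    "word_val (rev (map (m_inv (BijGroup hyp)) (flat U)) @ v) = hinv (h \<diamondop> word_val (flat (a @ U)))"
    "word_val (rev (map (m_inv (BijGroup hyp)) (flat U))) = hinv (word_val (flat U))"
proof -
  obtain b where b: "alt b (letter_word h @ flat (a @ U))" "b \<longleftrightarrow> h = hone"
    using alt_left[OF h, of "a @ U"] a U by auto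
  have e1: "rev (map (m_inv (BijGroup hyp)) (letter_word h @ flat (a @ U))) =
      rev (map (m_inv (BijGroup hyp)) (flat U)) @ rev (map (m_inv (BijGroup hyp)) (letter_word h @ flat a))"
    by simp
  have e2: "(b \<longleftrightarrow> odd (length (letter_word h @ flat (a @ U)))) = False"
    using b(2) by (auto simp: letter_word_def)
  have aU: "a @ U \<in> lists pairs" using a U by simp
  show thesis
  proof (rule that)
    show "alt False (rev (map (m_inv (BijGroup hyp)) (flat U)) @ rev (map (m_inv (BijGroup hyp)) (letter_word h @ flat a)))"
      using alt_rev_inv[OF b(1), unfolded e2 e1] .
    show "word_val (rev (map (m_inv (BijGroup hyp)) (flat U)) @ rev (map (m_inv (BijGroup hyp)) (letter_word h @ flat a)))
      = hinv (h \<diamondop> word_val (flat (a @ U)))"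
      using word_val_inv[OF b(1), unfolded e1] left_val[OF h aU] by simp
  qed (rule word_val_inv[OF alt_flat[OF U(1)]])
qed

text \<open>A squeeze at the threshold. A missed ball bounds \<open>visual\<close> from above for
  the end points of one geodesic, the crossing property bounds it from below for the orbit points of
  \<open>x\<close>, and by \<open>cone\<close> both pairs of end points have almost the directions
  of \<open>u\<close> and \<open>w\<close>.\<close>

lemma no_pattern_visual:
  assumes no: "\<And>U V. U \<in> lists pairs \<Longrightarrow> V \<in> lists pairs \<Longrightarrow> plen U > 4 * R \<Longrightarrow> plen V > 4 * R \<Longrightarrow>
    \<exists>h\<in>K False. \<exists>a\<in>lists pairs. \<exists>b\<in>lists pairs. \<exists>g\<in>K True. \<exists>y\<in>hyp_ball x R. \<exists>y'\<in>hyp_ball x R.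
      geodesic_segment (hinv (h \<diamondop> word_val (flat (a @ U))) y) ((word_val (flat (V @ b)) \<diamondop> g) y') \<inter> hyp_ball x R = {}"
    and U: "U \<in> lists pairs" "plen U > 4 * R" and V: "V \<in> lists pairs" "plen V > 4 * R"
  shows "\<bar>visual x (hinv (word_val (flat U)) x) (word_val (flat V) x) - 2 / (cosh R)\<^sup>2\<bar>
    \<le> (3 * exp (2 * R) + 8 * exp (6 * R)) * (exp (- plen U) + exp (- plen V))"
proof -
  obtain k :: "real ^ 'n \<Rightarrow> real ^ 'n" where k: "\<And>y z. y \<in> hyp \<Longrightarrow> z \<in> hyp \<Longrightarrow> k y \<bullet> k z = 1 - visual x y z"
    "\<And>y. y \<in> hyp \<Longrightarrow> norm (k y) < 1" by (rule klein_chart[OF x]) blast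
  obtain h a b g y y' where m: "h \<in> K False" "a \<in> lists pairs" "b \<in> lists pairs" "g \<in> K True"
    "y \<in> hyp_ball x R" "y' \<in> hyp_ball x R"
    "geodesic_segment (hinv (h \<diamondop> word_val (flat (a @ U))) y) ((word_val (flat (V @ b)) \<diamondop> g) y') \<inter> hyp_ball x R = {}"
    using no[OF U(1) V(1) U(2) V(2)] by blast
  have ne: "U \<noteq> []" "V \<noteq> []" using U(2) V(2) R x by (auto simp: plen_def)
  obtain v where v: "alt False (rev (map (m_inv (BijGroup hyp)) (flat U)) @ v)"
    "word_val (rev (map (m_inv (BijGroup hyp)) (flat U)) @ v) = hinv (h \<diamondop> word_val (flat (a @ U)))"
    "word_val (rev (map (m_inv (BijGroup hyp)) (flat U))) = hinv (word_val (flat U))"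
    using left_inverse_word[OF m(1,2) U(1) ne(1)] by blast
  define f where "f = hinv (h \<diamondop> word_val (flat (a @ U)))"
  define f' where "f' = word_val (flat (V @ b)) \<diamondop> g"
  define u where "u = hinv (word_val (flat U)) x"
  define w where "w = word_val (flat V) x"
  have Vb: "V @ b \<in> lists pairs" using V m by simp
  have av: "alt True (flat V @ flat b @ letter_word g)" using alt_right[OF m(4) Vb] by simp
  have f'v: "word_val (flat V @ flat b @ letter_word g) = f'" using right_val[OF m(4) Vb] by (simp add: f'_def)
  note Ui = alt_val_isom[OF alt_flat[OF U(1)]] and Vi = alt_val_isom[OF alt_flat[OF V(1)]]
  have dU: "disp x (hinv (word_val (flat U))) = plen U" using Ui x by (simp add: plen_def)
  have uh: "u \<in> hyp" "w \<in> hyp" "hyp_dist x u = plen U" "hyp_dist x w = plen V"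
    using isom_in[OF isom_inv[OF Ui] x] isom_in[OF Vi x] dU by (auto simp: u_def w_def disp_def plen_def)
  have C1: "f z \<in> hyp" "norm (k (f z) - k u) \<le> 3 * exp (2 * R - plen U)" "hyp_dist x (f z) \<ge> plen U - 3 * R"
    if "z \<in> hyp_ball x R" for z
  proof -
    have z: "z \<in> hyp" "hyp_dist x z < R" using that by (auto simp: hyp_ball_def)
    note c = cone[OF v(1) z, unfolded v(2,3), folded f_def u_def, unfolded dU]
    show "f z \<in> hyp" by (rule c(1))
    show "hyp_dist x (f z) \<ge> plen U - 3 * R" by (rule c(3))
    show "norm (k (f z) - k u) \<le> 3 * exp (2 * R - plen U)"
      using klein_chart_close[OF k(1) c(1) uh(1), of "4 * R"] c(2) uh(3) by simp
  qed
  have C2: "f' z \<in> hyp" "norm (k (f' z) - k w) \<le> 3 * exp (2 * R - plen V)" "hyp_dist x (f' z) \<ge> plen V - 3 * R"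
    if "z \<in> hyp_ball x R" for z
  proof -
    have z: "z \<in> hyp" "hyp_dist x z < R" using that by (auto simp: hyp_ball_def)
    note c = cone[OF av z, unfolded f'v, folded plen_def w_def]
    show "f' z \<in> hyp" by (rule c(1))
    show "hyp_dist x (f' z) \<ge> plen V - 3 * R" by (rule c(3))
    show "norm (k (f' z) - k w) \<le> 3 * exp (2 * R - plen V)"
      using klein_chart_close[OF k(1) c(1) uh(2), of "4 * R"] c(2) uh(4) by simp
  qed
  \<comment> \<open>The two chart errors of \<open>klein_chart_close\<close> with
    \<open>C = 4 * R\<close>, one for each end of the geodesic.\<close>
  define E where "E = 3 * exp (2 * R) * (exp (- plen U) + exp (- plen V))"
  have near: "\<bar>visual x (f z) (f' z') - visual x u w\<bar> \<le> E" if z: "z \<in> hyp_ball x R" "z' \<in> hyp_ball x R" for z z'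
  proof -
    have "visual x (f z) (f' z') - visual x u w = (k u - k (f z)) \<bullet> k (f' z') + k u \<bullet> (k w - k (f' z'))"
      using k(1)[OF C1(1)[OF z(1)] C2(1)[OF z(2)]] k(1)[OF uh(1,2)]
      by (simp add: inner_diff_left inner_diff_right)
    also have "\<bar>\<dots>\<bar> \<le> norm (k u - k (f z)) * norm (k (f' z')) + norm (k u) * norm (k w - k (f' z'))"
      by (intro order_trans[OF abs_triangle_ineq] add_mono Cauchy_Schwarz_ineq2)
    also have "\<dots> \<le> norm (k u - k (f z)) * 1 + 1 * norm (k w - k (f' z'))"
      using k(2)[OF C2(1)[OF z(2)]] k(2)[OF uh(1)] by (intro add_mono mult_left_mono mult_right_mono) auto
    also have "\<dots> \<le> 3 * exp (2 * R - plen U) + 3 * exp (2 * R - plen V)"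
      using C1(2)[OF z(1)] C2(2)[OF z(2)] by (simp add: norm_minus_commute)
    finally show ?thesis by (simp add: E_def exp_diff exp_minus field_simps)
  qed
  have "visual x (f y) (f' y') \<le> 2 / (cosh R)\<^sup>2"
    using m(7) by (intro visual_misses_ball[OF x C1(1)[OF m(5)] C2(1)[OF m(6)] _ R]) (simp add: f_def f'_def)
  then have up: "visual x u w \<le> 2 / (cosh R)\<^sup>2 + E" using near[OF m(5,6)] by linarith
  have xW: "x \<in> hyp_ball x R" using x R by (simp add: hyp_ball_def)
  have "f \<in> Gam False" unfolding f_def v(2)[symmetric] using v(1) ne by (intro val_in_Gam) auto
  moreover have "f' \<in> Gam True" unfolding f'v[symmetric] using av ne by (intro val_in_Gam) auto
  ultimately have "geodesic_segment (f x) (f' x) \<inter> hyp_ball x R \<noteq> {}"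
    using cross[of f False f'] by (simp add: Gam_def)
  from visual_meets_ball[OF x this R]
  have lo: "visual x (f x) (f' x) \<ge> 2 / (cosh R)\<^sup>2 * (1 - (cosh R / cosh (hyp_dist x (f x)))\<^sup>2 - (cosh R / cosh (hyp_dist x (f' x)))\<^sup>2)" .
  \<comment> \<open>The correction terms of \<open>visual_meets_ball\<close> decay with the
    displacement of the respective half of the word.\<close>
  have sq: "2 / (cosh R)\<^sup>2 * (cosh R / cosh D)\<^sup>2 \<le> 8 * exp (6 * R) * exp (- p)" if D: "D \<ge> p - 3 * R" "p \<ge> 0" for D p
  proof -
    have "2 / (cosh R)\<^sup>2 * (cosh R / cosh D)\<^sup>2 = 2 / (cosh D)\<^sup>2"
      by (simp add: power_divide cosh_real_nonzero)
    also have "\<dots> \<le> 2 / (exp D / 2)\<^sup>2"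
      using exp_le_2_cosh[of D] by (intro divide_left_mono power_mono) (auto intro!: mult_pos_pos simp: cosh_real_pos)
    also have "\<dots> = 8 / exp (2 * D)" by (simp add: power_divide exp_double)
    also have "\<dots> = 8 * exp (- 2 * D)" by (simp add: exp_minus inverse_eq_divide)
    also have "\<dots> \<le> 8 * exp (6 * R + - p)" using D by simp
    also have "\<dots> = 8 * exp (6 * R) * exp (- p)" by (simp only: exp_add mult.assoc)
    finally show ?thesis .
  qed
  have pU: "plen U \<ge> 0" "plen V \<ge> 0" using U V R by linarith+
  have "2 / (cosh R)\<^sup>2 - 8 * exp (6 * R) * exp (- plen U) - 8 * exp (6 * R) * exp (- plen V) \<le> visual x (f x) (f' x)"
    using lo sq[OF C1(3)[OF xW] pU(1)] sq[OF C2(3)[OF xW] pU(2)] by (simp add: right_diff_distrib)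
  then have lo': "2 / (cosh R)\<^sup>2 - 8 * exp (6 * R) * (exp (- plen U) + exp (- plen V)) - E \<le> visual x u w"
    using near[OF xW xW] by (simp add: distrib_left)
  have "8 * exp (6 * R) * (exp (- plen U) + exp (- plen V)) \<ge> 0" by simp
  with up lo' show ?thesis unfolding u_def[symmetric] w_def[symmetric] E_def abs_le_iff distrib_right by linarith
qed

text \<open>Otherwise the endpoints of all limiting geodesics would subtend the same angle at \<open>x\<close>. The
  images of two limit points of \<open>K True\<close> under many elements of \<open>K False\<close> would then
  form too many mutually equidistant pairs.\<close>

lemma pattern_exists:
  "\<exists>U\<in>lists pairs. \<exists>V\<in>lists pairs. plen U > 4 * R \<and> plen V > 4 * R \<and>
    (\<forall>h\<in>K False. \<forall>a\<in>lists pairs. \<forall>b\<in>lists pairs. \<forall>g\<in>K True. \<forall>y\<in>hyp_ball x R. \<forall>y'\<in>hyp_ball x R.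
      geodesic_segment (hinv (h \<diamondop> word_val (flat (a @ U))) y) ((word_val (flat (V @ b)) \<diamondop> g) y') \<inter> hyp_ball x R \<noteq> {})"
proof (rule ccontr)
  assume contra: "\<not> ?thesis"
  have no: "\<exists>h\<in>K False. \<exists>a\<in>lists pairs. \<exists>b\<in>lists pairs. \<exists>g\<in>K True. \<exists>y\<in>hyp_ball x R. \<exists>y'\<in>hyp_ball x R.
      geodesic_segment (hinv (h \<diamondop> word_val (flat (a @ U))) y) ((word_val (flat (V @ b)) \<diamondop> g) y') \<inter> hyp_ball x R = {}"
    if "U \<in> lists pairs" "V \<in> lists pairs" "plen U > 4 * R" "plen V > 4 * R" for U V
  proof -
    define P where "P U V h a b g y y' \<longleftrightarrow> geodesic_segment (hinv (h \<diamondop> word_val (flat (a @ U))) y)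
      ((word_val (flat (V @ b)) \<diamondop> g) y') \<inter> hyp_ball x R = {}" for U V h a b g y y'
    have contra': "\<not> (\<exists>U\<in>lists pairs. \<exists>V\<in>lists pairs. plen U > 4 * R \<and> plen V > 4 * R \<and>
      (\<forall>h\<in>K False. \<forall>a\<in>lists pairs. \<forall>b\<in>lists pairs. \<forall>g\<in>K True. \<forall>y\<in>hyp_ball x R. \<forall>y'\<in>hyp_ball x R.
        \<not> P U V h a b g y y'))"
      unfolding P_def by (rule contra)
    have "\<not> (\<forall>h\<in>K False. \<forall>a\<in>lists pairs. \<forall>b\<in>lists pairs. \<forall>g\<in>K True. \<forall>y\<in>hyp_ball x R. \<forall>y'\<in>hyp_ball x R.
      \<not> P U V h a b g y y')"
    proof
      let ?all = "\<lambda>U V. \<forall>h\<in>K False. \<forall>a\<in>lists pairs. \<forall>b\<in>lists pairs. \<forall>g\<in>K True. \<forall>y\<in>hyp_ball x R. \<forall>y'\<in>hyp_ball x R.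
        \<not> P U V h a b g y y'"
      assume "?all U V"
      then have "plen U > 4 * R \<and> plen V > 4 * R \<and> ?all U V" by (intro conjI that(3,4))
      then have "\<exists>V\<in>lists pairs. plen U > 4 * R \<and> plen V > 4 * R \<and> ?all U V" by (rule bexI[OF _ that(2)])
      then have "\<exists>U\<in>lists pairs. \<exists>V\<in>lists pairs. plen U > 4 * R \<and> plen V > 4 * R \<and> ?all U V"
        by (rule bexI[OF _ that(1)])
      with contra' show False by (rule notE)
    qed
    then show ?thesis unfolding P_def[symmetric] by (simp only: ball_simps not_not)
  qed
  obtain k :: "real ^ 'n \<Rightarrow> real ^ 'n" where k: "\<And>y z. y \<in> hyp \<Longrightarrow> z \<in> hyp \<Longrightarrow> k y \<bullet> k z = 1 - visual x y z"
    "\<And>y. y \<in> hyp \<Longrightarrow> norm (k y) < 1" by (rule klein_chart[OF x]) blast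
  define \<kappa> where "\<kappa> = 2 / (cosh R)\<^sup>2"
  have \<kappa>: "\<kappa> > 0" using cosh_real_pos[of R] by (simp add: \<kappa>_def)
  have "infinite (limit_set (K True))" using kleinian[of True] by (simp add: kleinian_def)
  then obtain \<zeta> \<zeta>' where z: "\<zeta> \<in> limit_set (K True)" "\<zeta>' \<in> limit_set (K True)" "\<zeta> \<noteq> \<zeta>'"
    by (metis finite.simps finite_subset infinite_imp_nonempty insertI1 singletonI subsetI)
  define \<xi> where "\<xi> c = (if c then \<zeta> else \<zeta>')" for c
  have "\<exists>G. (\<forall>n. G n \<in> K True) \<and> (\<lambda>n. G n 0) \<longlonglongrightarrow> \<xi> c" for c
  proof -
    have "\<xi> c \<in> closure ((\<lambda>g. g 0) ` K True)" using z by (auto simp: \<xi>_def limit_set_def)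
    then obtain s where s: "\<And>n. s n \<in> (\<lambda>g. g 0) ` K True" "s \<longlonglongrightarrow> \<xi> c" unfolding closure_sequential by blast
    then have "\<forall>n. \<exists>g. g \<in> K True \<and> s n = g 0" by auto
    then obtain G where "\<And>n. G n \<in> K True" "\<And>n. s n = G n 0" by metis
    moreover from this(2) have "s = (\<lambda>n. G n 0)" by (intro ext)
    ultimately show ?thesis using s(2) by blast
  qed
  then obtain G where G: "\<And>c n. G c n \<in> K True" "\<And>c. (\<lambda>n. G c n 0) \<longlonglongrightarrow> \<xi> c" by metis
  note Gi = K_isom[OF G(1)]
  have Gh: "G c n 0 \<in> hyp" for c n by (rule isom_in[OF Gi zero_in_hyp])
  obtain h1 where h1: "h1 \<in> star (K False)" using infinite_imp_nonempty[OF large_displacement] by blast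
  obtain g0 where g0: "g0 \<in> star (K True)" using infinite_imp_nonempty[OF large_displacement] by blast
  have h1i: "h1 \<in> hyp_isometries" and g0i: "g0 \<in> hyp_isometries" using h1 g0 K_isom by blast+
  have dG: "filterlim (\<lambda>n. disp x (G c n)) at_top sequentially" for c
  proof -
    have n1: "norm (\<xi> c) = 1" using z by (auto simp: \<xi>_def limit_set_def)
    have "(\<lambda>n. 1 - (norm (G c n 0))\<^sup>2) \<longlonglongrightarrow> 1 - (norm (\<xi> c))\<^sup>2" by (intro tendsto_intros G)
    then have 0: "(\<lambda>n. 1 - (norm (G c n 0))\<^sup>2) \<longlonglongrightarrow> 0" by (simp add: n1)
    have lt: "1 - (norm (G c n 0))\<^sup>2 \<ge> exp (- hyp_dist 0 (G c n 0))" for n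
    proof -
      have d0: "hyp_dist 0 (G c n 0) \<ge> 0" by (rule cosh_hyp_dist(2)[OF zero_in_hyp Gh])
      have "1 \<le> exp (hyp_dist 0 (G c n 0))" using d0 by simp
      then have "1 + cosh (hyp_dist 0 (G c n 0)) \<le> 2 * exp (hyp_dist 0 (G c n 0))" using cosh_le_exp[OF d0] by linarith
      then have "2 / (2 * exp (hyp_dist 0 (G c n 0))) \<le> 1 - (norm (G c n 0))\<^sup>2"
        unfolding one_minus_norm2_hyp[OF Gh] by (intro divide_left_mono mult_pos_pos add_pos_pos) auto
      then show ?thesis by (simp add: exp_minus field_simps)
    qed
    have "(\<lambda>n. exp (- hyp_dist 0 (G c n 0))) \<longlonglongrightarrow> 0"
      by (rule tendsto_sandwich[OF _ _ tendsto_const 0]) (use lt in auto)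
    have "filterlim (\<lambda>n. hyp_dist 0 (G c n 0)) at_top sequentially"
    proof (subst filterlim_at_top_gt[where c = 0], intro allI impI)
      fix Z :: real assume "Z > 0"
      have "\<forall>\<^sub>F n in sequentially. exp (- hyp_dist 0 (G c n 0)) < exp (- Z)"
        by (rule order_tendstoD(2)[OF \<open>(\<lambda>n. exp (- hyp_dist 0 (G c n 0))) \<longlonglongrightarrow> 0\<close>]) simp
      then show "\<forall>\<^sub>F n in sequentially. Z \<le> hyp_dist 0 (G c n 0)" by eventually_elim simp
    qed
    then have "filterlim (\<lambda>n. - 2 * hyp_dist 0 x + hyp_dist 0 (G c n 0)) at_top sequentially"
      by (rule filterlim_tendsto_add_at_top[OF tendsto_const])
    then show ?thesis
    proof (rule filterlim_at_top_mono, intro always_eventually allI)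
      fix n
      show "- 2 * hyp_dist 0 x + hyp_dist 0 (G c n 0) \<le> disp x (G c n)"
        using disp_base_change[OF zero_in_hyp x Gi[of c n]] by (simp add: disp_def)
    qed
  qed
  \<comment> \<open>The letter \<open>h1\<close> completes \<open>G c n\<close> to a pair and moves
    the image of \<open>x\<close> by a bounded distance only.\<close>
  define A where "A c n = G c n (h1 x)" for c n
  define Y where "Y z = cosh (hyp_dist x z)" for z
  have Y: "Y z > 0" for z by (simp add: Y_def cosh_real_pos)
  have h1x: "h1 x \<in> hyp" by (rule isom_in[OF h1i x])
  have Ah: "A c n \<in> hyp" for c n unfolding A_def by (rule isom_in[OF Gi h1x])
  have vis_lim: "(\<lambda>n. visual x (A c n) (\<tau> (A c' n))) \<longlonglongrightarrow> \<kappa>" if \<tau>: "\<tau> \<in> star (K False)" for c c' \<tau>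
  proof -
    have \<tau>i: "\<tau> \<in> hyp_isometries" using \<tau> K_isom by blast
    \<comment> \<open>\<open>V n\<close> carries \<open>x\<close> to \<open>A c n\<close>, and the
      inverse of \<open>U n\<close> carries \<open>x\<close> to \<open>w n\<close>, which stays at
      bounded distance from \<open>\<tau> (A c' n)\<close>. The letter \<open>g0\<close> fills up
      the first pair of \<open>U n\<close>.\<close>
    define V where "V n = [(G c n, h1)]" for n
    define U where "U n = [(hinv g0, hinv h1), (hinv (G c' n), hinv \<tau>)]" for n
    define w where "w n = \<tau> (G c' n (h1 (g0 x)))" for n
    have valV: "word_val (flat (V n)) = G c n \<diamondop> h1" for n using h1i by (simp add: V_def)
    have valU: "word_val (flat (U n)) = hinv (\<tau> \<diamondop> (G c' n \<diamondop> (h1 \<diamondop> g0)))" for n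
      using h1i g0i Gi \<tau>i by (simp add: U_def BG.inv_mult_group BG.m_assoc)
    have ui: "\<tau> \<diamondop> (G c' n \<diamondop> (h1 \<diamondop> g0)) \<in> hyp_isometries" for n using h1i g0i Gi \<tau>i by simp
    have ux: "hinv (word_val (flat (U n))) x = w n" for n
      unfolding valU using ui[of n] h1i g0i Gi \<tau>i x isom_in[OF g0i x] isom_in[OF h1i isom_in[OF g0i x]]
        isom_in[OF Gi isom_in[OF h1i isom_in[OF g0i x]]]
      by (simp add: w_def BG.inv_inv)
    have vx: "word_val (flat (V n)) x = A c n" for n unfolding valV using h1i Gi x by (simp add: A_def)
    have wh: "w n \<in> hyp" for n
      unfolding w_def by (intro isom_in[OF \<tau>i] isom_in[OF Gi] isom_in[OF h1i] isom_in[OF g0i] x)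
    have plV: "plen (V n) \<ge> disp x (G c n) - disp x h1" for n
      unfolding plen_def valV by (rule disp_mult_ge[OF x Gi h1i])
    have plU: "plen (U n) \<ge> disp x (G c' n) - (disp x \<tau> + disp x h1 + disp x g0)" for n
    proof -
      have "plen (U n) = disp x (\<tau> \<diamondop> (G c' n \<diamondop> (h1 \<diamondop> g0)))" unfolding plen_def valU using ui x by simp
      moreover have "\<dots> \<ge> disp x (G c' n \<diamondop> (h1 \<diamondop> g0)) - disp x \<tau>"
        using \<tau>i Gi h1i g0i by (intro disp_mult_ge x) auto
      moreover have "disp x (G c' n \<diamondop> (h1 \<diamondop> g0)) \<ge> disp x (G c' n) - disp x (h1 \<diamondop> g0)"
        using Gi h1i g0i by (intro disp_mult_ge x) auto
      moreover have "disp x (h1 \<diamondop> g0) \<le> disp x h1 + disp x g0" by (rule disp_mult_le[OF x h1i g0i])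
      ultimately show ?thesis by linarith
    qed
    have fV: "filterlim (\<lambda>n. plen (V n)) at_top sequentially"
    proof (rule filterlim_at_top_mono)
      show "filterlim (\<lambda>n. - disp x h1 + disp x (G c n)) at_top sequentially"
        by (rule filterlim_tendsto_add_at_top[OF tendsto_const dG])
      show "\<forall>\<^sub>F n in sequentially. - disp x h1 + disp x (G c n) \<le> plen (V n)"
        by (intro always_eventually allI) (use plV in \<open>simp add: algebra_simps\<close>)
    qed
    have fU: "filterlim (\<lambda>n. plen (U n)) at_top sequentially"
    proof (rule filterlim_at_top_mono)
      show "filterlim (\<lambda>n. - (disp x \<tau> + disp x h1 + disp x g0) + disp x (G c' n)) at_top sequentially"
        by (rule filterlim_tendsto_add_at_top[OF tendsto_const dG])
      show "\<forall>\<^sub>F n in sequentially. - (disp x \<tau> + disp x h1 + disp x g0) + disp x (G c' n) \<le> plen (U n)"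
        by (intro always_eventually allI) (use plU in \<open>simp add: algebra_simps\<close>)
    qed
    have ev: "\<forall>\<^sub>F n in sequentially. disp x (G d n) > 0" for d
      using dG[of d] by (simp add: filterlim_at_top_dense)
    have "\<forall>\<^sub>F n in sequentially. plen (U n) > 4 * R" "\<forall>\<^sub>F n in sequentially. plen (V n) > 4 * R"
      using fU fV by (auto simp: filterlim_at_top_dense)
    with ev[of c] ev[of c'] have bound: "\<forall>\<^sub>F n in sequentially. \<bar>visual x (w n) (A c n) - \<kappa>\<bar>
       \<le> (3 * exp (2 * R) + 8 * exp (6 * R)) * (exp (- plen (U n)) + exp (- plen (V n)))"
    proof eventually_elim
      case (elim n)
      have st: "G d n \<in> star (K True)" if "disp x (G d n) > 0" for d using that G(1) x by auto
      have "U n \<in> lists pairs" "V n \<in> lists pairs"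
        using st[OF elim(1)] star_inv[OF st[OF elim(2)]] star_inv[OF g0] star_inv[OF h1] star_inv[OF \<tau>] h1
        by (auto simp: U_def V_def pairs_def)
      from no_pattern_visual[OF no this(1) elim(3) this(2) elim(4)]
      show ?case unfolding ux vx \<kappa>_def .
    qed
    have e0: "(\<lambda>n. exp (- plen (U n))) \<longlonglongrightarrow> 0" "(\<lambda>n. exp (- plen (V n))) \<longlonglongrightarrow> 0"
      using fU fV by (auto intro!: filterlim_compose[OF exp_at_bot] filterlim_compose[OF filterlim_uminus_at_bot_at_top])
    have "(\<lambda>n. visual x (w n) (A c n) - \<kappa>) \<longlonglongrightarrow> 0"
      by (rule Lim_null_comparison[OF bound[folded real_norm_def]])
        (rule tendsto_eq_intros e0 refl | simp)+
    then have kw: "(\<lambda>n. k (w n) \<bullet> k (A c n)) \<longlonglongrightarrow> 1 - \<kappa>"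
      unfolding k(1)[OF wh Ah] by (auto dest: tendsto_diff[OF tendsto_const[of 1]] intro: tendsto_eq_rhs simp: LIM_zero_iff intro!: tendsto_intros)
    have th: "\<tau> (A c' n) \<in> hyp" for n by (rule isom_in[OF \<tau>i Ah])
    have dw: "hyp_dist (w n) (\<tau> (A c' n)) = disp x g0" for n
      using isom_dist[OF \<tau>i] isom_dist[OF Gi] isom_dist[OF h1i] isom_in[OF g0i x] x isom_in[OF h1i] isom_in[OF Gi]
      by (simp add: w_def A_def disp_def hyp_dist_commute)
    have far': "hyp_dist x (\<tau> (A c' n)) \<ge> disp x (G c' n) - (disp x \<tau> + disp x h1)" for n
    proof -
      have "hyp_dist x (\<tau> (A c' n)) = disp x (\<tau> \<diamondop> (G c' n \<diamondop> h1))"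
        using \<tau>i Gi h1i x h1x isom_in[OF Gi h1x] by (simp add: disp_def A_def)
      moreover have "\<dots> \<ge> disp x (G c' n \<diamondop> h1) - disp x \<tau>" using \<tau>i Gi h1i by (intro disp_mult_ge x) auto
      moreover have "disp x (G c' n \<diamondop> h1) \<ge> disp x (G c' n) - disp x h1" by (rule disp_mult_ge[OF x Gi h1i])
      ultimately show ?thesis by linarith
    qed
    have close: "norm (k (w n) - k (\<tau> (A c' n))) \<le> 3 * exp (disp x g0 - hyp_dist x (\<tau> (A c' n)))" for n
    proof -
      have "hyp_dist x (\<tau> (A c' n)) \<le> hyp_dist x (w n) + hyp_dist (w n) (\<tau> (A c' n))"
        by (rule hyp_dist_triangle[OF x wh th])
      then have "hyp_dist (w n) (\<tau> (A c' n)) \<le> hyp_dist x (w n) - hyp_dist x (\<tau> (A c' n)) + 2 * disp x g0"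
        using dw by simp
      from klein_chart_close[OF k(1) wh th this] show ?thesis by simp
    qed
    have "filterlim (\<lambda>n. - (disp x \<tau> + disp x h1 + disp x g0) + disp x (G c' n)) at_top sequentially"
      by (rule filterlim_tendsto_add_at_top[OF tendsto_const dG])
    then have "(\<lambda>n. exp (- (- (disp x \<tau> + disp x h1 + disp x g0) + disp x (G c' n)))) \<longlonglongrightarrow> 0"
      by (intro filterlim_compose[OF exp_at_bot] filterlim_compose[OF filterlim_uminus_at_bot_at_top])
    then have "(\<lambda>n. 3 * exp (- (- (disp x \<tau> + disp x h1 + disp x g0) + disp x (G c' n)))) \<longlonglongrightarrow> 0"
      by (rule tendsto_mult_right_zero)
    then have kd: "(\<lambda>n. k (w n) - k (\<tau> (A c' n))) \<longlonglongrightarrow> 0"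
    proof (rule Lim_null_comparison[rotated], intro always_eventually allI)
      fix n
      have "3 * exp (disp x g0 - hyp_dist x (\<tau> (A c' n))) \<le> 3 * exp (- (- (disp x \<tau> + disp x h1 + disp x g0) + disp x (G c' n)))"
        using far'[of n] by simp
      then show "norm (k (w n) - k (\<tau> (A c' n))) \<le> 3 * exp (- (- (disp x \<tau> + disp x h1 + disp x g0) + disp x (G c' n)))"
        using close[of n] by linarith
    qed
    have "(\<lambda>n. (k (w n) - k (\<tau> (A c' n))) \<bullet> k (A c n)) \<longlonglongrightarrow> 0"
    proof (rule Lim_null_comparison[OF _ tendsto_norm_zero[OF kd]], intro always_eventually allI)
      fix n
      have "norm ((k (w n) - k (\<tau> (A c' n))) \<bullet> k (A c n)) \<le> norm (k (w n) - k (\<tau> (A c' n))) * norm (k (A c n))"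
        by (simp add: Cauchy_Schwarz_ineq2)
      also have "\<dots> \<le> norm (k (w n) - k (\<tau> (A c' n))) * 1"
        using k(2)[OF Ah[of c n]] by (intro mult_left_mono) auto
      finally show "norm ((k (w n) - k (\<tau> (A c' n))) \<bullet> k (A c n)) \<le> norm (k (w n) - k (\<tau> (A c' n)))" by simp
    qed
    from tendsto_diff[OF kw this] have "(\<lambda>n. k (\<tau> (A c' n)) \<bullet> k (A c n)) \<longlonglongrightarrow> 1 - \<kappa>"
      by (simp add: inner_diff_left)
    from tendsto_diff[OF tendsto_const[of 1] this] show ?thesis
      by (simp add: k(1)[OF th Ah] visual_commute)
  qed
  define N where "N = DIM(real ^ 'n)"
  obtain H :: "nat \<Rightarrow> _" where H: "inj H" "range H \<subseteq> star (K False)"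
    using infinite_countable_subset[of "star (K False)"] infinite_K[of False] by auto
  have Hs: "H i \<in> star (K False)" for i using H(2) by auto
  have Hi: "H i \<in> hyp_isometries" for i using Hs[of i] K_isom by blast
  have HA: "H i (A c n) \<in> hyp" for i c n by (rule isom_in[OF Hi Ah])
  define f where "f ci n = k (H (snd ci) (A (fst ci) n))" for ci :: "bool \<times> nat" and n
  have "\<exists>r. strict_mono r \<and> (\<forall>ci\<in>UNIV \<times> {..N}. convergent (f ci \<circ> r))"
  proof (rule common_convergent_subsequence)
    fix ci :: "bool \<times> nat"
    have "range (f ci) \<subseteq> ball 0 1" using k(2)[OF HA] by (auto simp: f_def mem_ball)
    then show "bounded (range (f ci))" using bounded_ball bounded_subset by blast
  qed simp
  then obtain r where r: "strict_mono r" "\<And>c i. i \<le> N \<Longrightarrow> convergent (\<lambda>n. k (H i (A c (r n))))" by (auto simp: f_def o_def)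
  define L where "L c i = lim (\<lambda>n. k (H i (A c (r n))))" for c i
  have L: "(\<lambda>n. k (H i (A c (r n)))) \<longlonglongrightarrow> L c i" if "i \<le> N" for c i
    using r(2)[OF that] by (simp add: L_def convergent_LIMSEQ_iff)
  have sub: "(\<lambda>n. visual x (A c (r n)) (\<tau> (A c' (r n)))) \<longlonglongrightarrow> \<kappa>" if "\<tau> \<in> star (K False)" for c c' \<tau>
    using LIMSEQ_subseq_LIMSEQ[OF vis_lim[OF that] r(1)] by (simp add: o_def)
  \<comment> \<open>The factor in the invariance of the cross ratio: applying
    \<open>hinv (H i)\<close> preserves the distances in \<open>visual\<close>, so only the
    normalizing \<open>cosh\<close> factors change. It is independent of the map \<open>f\<close>
    and of \<open>c\<close>.\<close>
  define q where "q i n = Y (H i (A True n)) * Y (A False n) / (Y (A True n) * Y (H i (A False n)))" for i n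
  have cross_ratio: "visual x (H i (A True n)) (f (A c n)) * q i n * visual x (A False n) ((hinv (H i) \<diamondop> f) (A c n))
      = visual x (H i (A False n)) (f (A c n)) * visual x (A True n) ((hinv (H i) \<diamondop> f) (A c n))"
    if f: "f \<in> hyp_isometries" for f i c n
  proof -
    let ?z = "(hinv (H i) \<diamondop> f) (A c n)"
    have fz: "f (A c n) \<in> hyp" by (rule isom_in[OF f Ah])
    have zz: "?z = hinv (H i) (f (A c n))" using f Hi Ah by simp
    have d: "hyp_dist (H i (A d n)) (f (A c n)) = hyp_dist (A d n) ?z" for d
      unfolding zz using isom_dist_inv[OF Hi fz Ah, of i d n] by (simp add: hyp_dist_commute)
    have *: "visual x (H i (A d n)) (f (A c n)) = visual x (A d n) ?z * (Y (A d n) * Y ?z / (Y (H i (A d n)) * Y (f (A c n))))" for d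
    proof -
      have "Y ?z \<noteq> 0" "Y (A d n) \<noteq> 0" using Y[of ?z] Y[of "A d n"] by auto
      then show ?thesis unfolding visual_def d Y_def[symmetric] by (simp add: field_simps)
    qed
    show ?thesis unfolding * q_def using Y[of "A True n"] Y[of "A False n"] Y[of "H i (A True n)"] Y[of "H i (A False n)"]
      by (simp add: field_simps)
  qed
  \<comment> \<open>With the identity for \<open>f\<close> all four visual quantities tend to
    \<kappa>, which determines the limit of \<open>q\<close>.\<close>
  have q1: "(\<lambda>n. q i (r n)) \<longlonglongrightarrow> 1" if i: "i \<le> N" for i
  proof -
    have iv: "hinv (H i) \<in> star (K False)" by (rule star_inv[OF Hs])
    have "visual x (H i (A True n)) (A True n) * q i n * visual x (A False n) (hinv (H i) (A True n))
      = visual x (H i (A False n)) (A True n) * visual x (A True n) (hinv (H i) (A True n))" for n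
      using cross_ratio[OF isom_one, of i n True] Ah Hi by simp
    then have eq: "visual x (A True n) (H i (A True n)) * visual x (A False n) (hinv (H i) (A True n)) * q i n
      = visual x (A True n) (H i (A False n)) * visual x (A True n) (hinv (H i) (A True n))" for n
      by (simp add: visual_commute ac_simps)
    have nz: "visual x (A True n) (H i (A True n)) * visual x (A False n) (hinv (H i) (A True n)) \<noteq> 0" for n
      by (simp add: visual_def)
    have "q i n = visual x (A True n) (H i (A False n)) * visual x (A True n) (hinv (H i) (A True n)) /
       (visual x (A True n) (H i (A True n)) * visual x (A False n) (hinv (H i) (A True n)))" for n
      using eq[of n] nz[of n] by (simp add: eq_divide_eq mult.commute)
    moreover have "(\<lambda>n. visual x (A True (r n)) (H i (A False (r n))) * visual x (A True (r n)) (hinv (H i) (A True (r n))) /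
       (visual x (A True (r n)) (H i (A True (r n))) * visual x (A False (r n)) (hinv (H i) (A True (r n))))) \<longlonglongrightarrow> \<kappa> * \<kappa> / (\<kappa> * \<kappa>)"
      using \<kappa> by (intro tendsto_intros sub Hs iv) simp
    ultimately show ?thesis using \<kappa> by simp
  qed
  show False
  proof (rule no_equidistant_pairs[of "L True" "L False"], fold N_def)
    fix i j assume ij: "i \<le> N" "j \<le> N" "i \<noteq> j"
    \<comment> \<open>With \<open>H j\<close> for \<open>f\<close>, two of the four quantities still
      tend to \<kappa> because \<open>hinv (H i) \<diamondop> H j\<close> is a letter; the other two
      must then have equal limits.\<close>
    have "L True i \<bullet> L c j = L False i \<bullet> L c j" for c
    proof -
      have "hinv (H i) \<noteq> hinv (H j)"
        using H(1) ij(3) Hi by (metis BG.inv_inv carrier_hyp injD isom_Bij)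
      then have st: "hinv (H i) \<diamondop> H j \<in> star (K False)"
        using Hs by (intro star_mult K_inv) auto
      have vl: "(\<lambda>n. visual x (H i (A d (r n))) (H j (A c (r n)))) \<longlonglongrightarrow> 1 - L d i \<bullet> L c j" for d
      proof -
        have "(\<lambda>n. 1 - k (H i (A d (r n))) \<bullet> k (H j (A c (r n)))) \<longlonglongrightarrow> 1 - L d i \<bullet> L c j"
          by (intro tendsto_intros L ij)
        then show ?thesis by (simp add: k(1)[OF HA HA])
      qed
      have "(\<lambda>n. visual x (H i (A True (r n))) (H j (A c (r n))) * q i (r n) * visual x (A False (r n)) ((hinv (H i) \<diamondop> H j) (A c (r n))))
          \<longlonglongrightarrow> (1 - L True i \<bullet> L c j) * 1 * \<kappa>"
        by (intro tendsto_mult vl q1 ij sub st)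
      moreover have "(\<lambda>n. visual x (H i (A False (r n))) (H j (A c (r n))) * visual x (A True (r n)) ((hinv (H i) \<diamondop> H j) (A c (r n))))
          \<longlonglongrightarrow> (1 - L False i \<bullet> L c j) * \<kappa>"
        by (intro tendsto_mult vl sub st)
      ultimately have "(1 - L True i \<bullet> L c j) * 1 * \<kappa> = (1 - L False i \<bullet> L c j) * \<kappa>"
        unfolding cross_ratio[OF Hi] by (rule LIMSEQ_unique)
      then show ?thesis using \<kappa> by simp
    qed
    then show "L True i \<bullet> L True j = L False i \<bullet> L True j \<and> L True i \<bullet> L False j = L False i \<bullet> L False j" by blast
  next
    fix i assume i: "i \<le> N"
    \<comment> \<open>The limits lie on the unit sphere, so equality would make
      \<open>visual\<close> of the two sequences tend to 0. It is bounded below because the limit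
      points \<zeta> and \<zeta>' are distinct and bounded displacements change
      \<open>visual\<close> by bounded factors only.\<close>
    show "L True i \<noteq> L False i"
    proof
      assume eq: "L True i = L False i"
      have di: "filterlim (\<lambda>n. hyp_dist x (H i (A True n))) at_top sequentially"
      proof (rule filterlim_at_top_mono)
        show "filterlim (\<lambda>n. - (disp x (H i) + disp x h1) + disp x (G True n)) at_top sequentially"
          by (rule filterlim_tendsto_add_at_top[OF tendsto_const dG])
        show "\<forall>\<^sub>F n in sequentially. - (disp x (H i) + disp x h1) + disp x (G True n) \<le> hyp_dist x (H i (A True n))"
        proof (intro always_eventually allI)
          fix n
          have "hyp_dist x (H i (A True n)) = disp x (H i \<diamondop> (G True n \<diamondop> h1))"
            using Hi Gi h1i x h1x isom_in[OF Gi h1x] by (simp add: disp_def A_def)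
          moreover have "\<dots> \<ge> disp x (G True n \<diamondop> h1) - disp x (H i)" using Hi Gi h1i by (intro disp_mult_ge x) auto
          moreover have "disp x (G True n \<diamondop> h1) \<ge> disp x (G True n) - disp x h1" by (rule disp_mult_ge[OF x Gi h1i])
          ultimately show "- (disp x (H i) + disp x h1) + disp x (G True n) \<le> hyp_dist x (H i (A True n))" by linarith
        qed
      qed
      have "(\<lambda>n. exp (- hyp_dist x (H i (A True n)))) \<longlonglongrightarrow> 0"
        by (intro filterlim_compose[OF exp_at_bot] filterlim_compose[OF filterlim_uminus_at_bot_at_top di])
      then have "(\<lambda>n. 4 * (exp (- hyp_dist x (H i (A True n))))\<^sup>2) \<longlonglongrightarrow> 4 * 0\<^sup>2"
        by (intro tendsto_intros)
      then have lim0: "(\<lambda>n. 4 * (exp (- hyp_dist x (H i (A True n))))\<^sup>2) \<longlonglongrightarrow> 0" by simp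
      have "(\<lambda>n. visual x (H i (A True n)) (H i (A True n))) \<longlonglongrightarrow> 0"
      proof (rule Lim_null_comparison[OF always_eventually[OF allI] lim0])
        fix n
        have "0 \<le> visual x (H i (A True n)) (H i (A True n))" by (simp add: visual_def)
        moreover have "visual x (H i (A True n)) (H i (A True n)) \<le> 4 * (exp (- hyp_dist x (H i (A True n))))\<^sup>2"
          using visual_le_exp[OF HA HA, of x i True n i True n] by (simp add: power2_eq_square flip: exp_add)
        ultimately show "norm (visual x (H i (A True n)) (H i (A True n))) \<le> 4 * (exp (- hyp_dist x (H i (A True n))))\<^sup>2" by simp
      qed
      from LIMSEQ_subseq_LIMSEQ[OF this r(1)]
      have "(\<lambda>n. 1 - visual x (H i (A True (r n))) (H i (A True (r n)))) \<longlonglongrightarrow> 1 - 0"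
        by (intro tendsto_diff tendsto_const) (simp add: o_def)
      moreover have "(\<lambda>n. 1 - visual x (H i (A True (r n))) (H i (A True (r n)))) \<longlonglongrightarrow> L True i \<bullet> L True i"
        unfolding k(1)[OF HA HA, symmetric] by (intro tendsto_intros L i)
      ultimately have one: "L True i \<bullet> L True i = 1" using LIMSEQ_unique by fastforce
      have lower: "visual x (H i (A True n)) (H i (A False n)) \<ge>
         exp (- 2 * hyp_dist 0 (hinv (H i) x)) * (exp (- 4 * hyp_dist 0 (h1 x)) / 8 * ((norm (G True n 0 - G False n 0))\<^sup>2 / 2))" for n
      proof -
        have hx: "hinv (H i) x \<in> hyp" by (rule isom_in[OF isom_inv[OF Hi] x])
        have v1: "visual x (H i (A True n)) (H i (A False n)) = visual (hinv (H i) x) (A True n) (A False n)"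
          using isom_dist[OF Hi Ah Ah] isom_dist_inv[OF Hi x Ah] by (simp add: visual_def)
        have v2: "visual (hinv (H i) x) (A True n) (A False n) \<ge> exp (- 2 * hyp_dist 0 (hinv (H i) x)) * visual 0 (A True n) (A False n)"
          by (rule visual_base_change[OF zero_in_hyp hx Ah Ah])
        have v3: "visual 0 (A True n) (A False n) \<ge> exp (- 4 * hyp_dist 0 (h1 x)) / 8 * ((norm (G True n 0 - G False n 0))\<^sup>2 / 2)"
        proof -
          have dA: "hyp_dist (G d n 0) (A d n) = hyp_dist 0 (h1 x)" for d
            unfolding A_def by (rule isom_dist[OF Gi zero_in_hyp h1x])
          have t1: "hyp_dist 0 (A d n) \<le> hyp_dist 0 (G d n 0) + hyp_dist 0 (h1 x)" for d
            using hyp_dist_triangle[OF zero_in_hyp Gh Ah, of d n d n] dA by simp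
          have t2: "hyp_dist (G True n 0) (G False n 0) \<le> hyp_dist (A True n) (A False n) + 2 * hyp_dist 0 (h1 x)"
            using hyp_dist_triangle[of "G True n 0" "A True n" "G False n 0"] hyp_dist_triangle[of "A True n" "A False n" "G False n 0"]
              dA[of True] dA[of False] Gh Ah by (simp add: hyp_dist_commute)
          have "(norm (G True n 0 - G False n 0))\<^sup>2 / 2 \<le> visual 0 (G True n 0) (G False n 0)"
            by (rule visual_zero_ge[OF Gh Gh])
          also have "\<dots> \<le> 4 * exp (hyp_dist (G True n 0) (G False n 0) - hyp_dist 0 (G True n 0) - hyp_dist 0 (G False n 0))"
            by (rule visual_le_exp[OF Gh Gh])
          also have "\<dots> \<le> 4 * exp (hyp_dist (A True n) (A False n) - hyp_dist 0 (A True n) - hyp_dist 0 (A False n) + 4 * hyp_dist 0 (h1 x))"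
            using t1[of True] t1[of False] t2 by simp
          also have "\<dots> = 8 * exp (4 * hyp_dist 0 (h1 x)) * (exp (hyp_dist (A True n) (A False n) - hyp_dist 0 (A True n) - hyp_dist 0 (A False n)) / 2)"
            by (simp add: exp_add)
          also have "\<dots> \<le> 8 * exp (4 * hyp_dist 0 (h1 x)) * visual 0 (A True n) (A False n)"
            by (intro mult_left_mono visual_ge_exp zero_in_hyp Ah) simp
          finally have "exp (- 4 * hyp_dist 0 (h1 x)) / 8 * ((norm (G True n 0 - G False n 0))\<^sup>2 / 2)
            \<le> exp (- 4 * hyp_dist 0 (h1 x)) / 8 * (8 * exp (4 * hyp_dist 0 (h1 x)) * visual 0 (A True n) (A False n))"
            by (intro mult_left_mono) auto
          also have "\<dots> = visual 0 (A True n) (A False n)"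
            by (simp add: exp_minus)
          finally show ?thesis .
        qed
        show ?thesis unfolding v1 by (rule order_trans[OF mult_left_mono[OF v3] v2]) simp
      qed
      have "(\<lambda>n. exp (- 2 * hyp_dist 0 (hinv (H i) x)) * (exp (- 4 * hyp_dist 0 (h1 x)) / 8 * ((norm (G True (r n) 0 - G False (r n) 0))\<^sup>2 / 2)))
        \<longlonglongrightarrow> exp (- 2 * hyp_dist 0 (hinv (H i) x)) * (exp (- 4 * hyp_dist 0 (h1 x)) / 8 * ((norm (\<xi> True - \<xi> False))\<^sup>2 / 2))"
        using LIMSEQ_subseq_LIMSEQ[OF G(2) r(1)] by (intro tendsto_intros) (auto simp: o_def)
      moreover have "(\<lambda>n. visual x (H i (A True (r n))) (H i (A False (r n)))) \<longlonglongrightarrow> 1 - L True i \<bullet> L False i"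
      proof -
        have "(\<lambda>n. 1 - k (H i (A True (r n))) \<bullet> k (H i (A False (r n)))) \<longlonglongrightarrow> 1 - L True i \<bullet> L False i"
          by (intro tendsto_intros L i)
        then show ?thesis by (simp add: k(1)[OF HA HA])
      qed
      ultimately have "exp (- 2 * hyp_dist 0 (hinv (H i) x)) * (exp (- 4 * hyp_dist 0 (h1 x)) / 8 * ((norm (\<xi> True - \<xi> False))\<^sup>2 / 2)) \<le> 1 - L True i \<bullet> L False i"
        by (rule LIMSEQ_le) (use lower in auto)
      moreover have "norm (\<xi> True - \<xi> False) > 0" using z(3) by (simp add: \<xi>_def)
      then have "exp (- 2 * hyp_dist 0 (hinv (H i) x)) * (exp (- 4 * hyp_dist 0 (h1 x)) / 8 * ((norm (\<xi> True - \<xi> False))\<^sup>2 / 2)) > 0"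
        by simp
      ultimately show False using one eq by simp
    qed
  qed
qed

end

section \<open>Divergence and positive recurrence\<close>

lemma linear_exp_le:
  fixes a t :: real
  assumes "a > 0"
  shows "t \<le> exp (a * t) / a"
proof -
  have "a * t \<le> exp (a * t)" using exp_ge_add_one_self[of "a * t"] by linarith
  then show ?thesis using assms by (simp add: pos_le_divide_eq mult.commute)
qed

locale divergent_pair = crossing_pair +
  assumes exponents: "critical_exponent (K False) < critical_exponent (K True)"
    and divergent: "divergent_group (K True)"
begin

abbreviation \<delta> :: real where "\<delta> \<equiv> critical_exponent \<Gamma>"

lemmas critical_exponent_K = critical_exponent_properties[OF K_sub kleinian_isometries[OF kleinian] infinite_K
    kleinian_finite_bounded_displacement[OF kleinian zero_in_hyp]]

lemmas critical_exponent_\<Gamma> = critical_exponent_properties[OF \<Gamma>_sub \<Gamma>_isom infinite_\<Gamma> finite_\<Gamma>[OF zero_in_hyp]]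

lemma summable_K:
  assumes s: "s > critical_exponent (K True)"
  shows "(\<lambda>g. exp (- s * disp x g)) summable_on K b"
proof -
  have "s > critical_exponent (K b)" using s exponents by (cases b) auto
  then show ?thesis
    using critical_exponent_K(2)[of b s] critical_exponent_K(1)[of b] poincare_convergent_iff[OF x kleinian_isometries[OF kleinian[of b]], of s]
    by auto
qed

lemma disp_decomp:
  assumes "h \<in> K False" "ps \<in> lists pairs" "g \<in> K True"
  shows "disp x (h \<diamondop> (word_val (flat ps) \<diamondop> g)) \<ge> disp x h + plen ps + disp x g - 4 * R"
proof -
  obtain b where b: "alt b (letter_word h @ flat ps @ letter_word g)" using alt_both[OF assms] .
  have r: "alt True (flat ps @ letter_word g)" by (rule alt_right[OF assms(3,2)])
  have i: "h \<in> hyp_isometries" using assms K_isom by blast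
  have lh: "set (letter_word h) \<subseteq> hyp_isometries" using i by (auto simp: letter_word_def)
  have "word_val (letter_word h @ flat ps @ letter_word g) = h \<diamondop> (word_val (flat ps) \<diamondop> g)"
    using word_val_append[OF lh alt_isom[OF r]] letter_word(2)[OF assms(1)] right_val[OF assms(3,2)] by simp
  with disp_append[OF b] disp_append[OF r] letter_word(2)[OF assms(1)] letter_word(2)[OF assms(3)] right_val[OF assms(3,2)]
  show ?thesis by (simp add: plen_def)
qed

lemma plen_pair_ge: "(g, h) \<in> pairs \<Longrightarrow> plen [(g, h)] \<ge> disp x g + disp x h - 2 * R"
  using disp_append[of True "[g]" "[h]"] K_isom[of g True] K_isom[of h False]
  by (auto simp: plen_def pairs_def)

lemma plen_pair_le: "(g, h) \<in> pairs \<Longrightarrow> plen [(g, h)] \<le> disp x g + disp x h"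
  using disp_mult_le[OF x, of g h] K_isom[of g True] K_isom[of h False]
  by (auto simp: plen_def pairs_def)

lemma summable_pairs:
  assumes s: "s > critical_exponent (K True)"
  shows "(\<lambda>a. exp (- s * plen [a])) summable_on pairs"
proof -
  have s0: "s \<ge> 0" using s critical_exponent_K(1)[of True] by simp
  have sub: "(\<lambda>g. exp (- s * disp x g)) summable_on star (K b)" for b
    by (rule summable_on_subset[OF summable_K[OF s]]) auto
  have "(\<lambda>(g, h). exp (- s * disp x g) * exp (- s * disp x h)) summable_on pairs"
    unfolding pairs_def by (rule has_sum_imp_summable[OF has_sum_product_real[OF sub _ sub]]) auto
  then have "(\<lambda>a. exp (2 * R * s) * (case a of (g, h) \<Rightarrow> exp (- s * disp x g) * exp (- s * disp x h))) summable_on pairs"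
    by (rule summable_on_cmult_right)
  then show ?thesis
  proof (rule summable_on_comparison_test)
    fix a assume "a \<in> pairs"
    then obtain g h where a: "a = (g, h)" "(g, h) \<in> pairs" by (cases a) auto
    from mult_left_mono[OF plen_pair_ge[OF a(2)] s0]
    show "exp (- s * plen [a]) \<le> exp (2 * R * s) * (case a of (g, h) \<Rightarrow> exp (- s * disp x g) * exp (- s * disp x h))"
      by (simp add: a(1) flip: exp_add) (simp add: algebra_simps)
  qed simp
qed

lemma inj_flat_val: "inj_on (\<lambda>ps. word_val (flat ps)) (lists pairs)"
  by (rule inj_onI) (metis alt_flat flat_inj word_val_inj)

lemma flat_val_\<Gamma>: "ps \<in> lists pairs \<Longrightarrow> word_val (flat ps) \<in> \<Gamma>"
  using alt_flat \<Gamma>_words by blast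

lemma summable_lists_if_\<Gamma>:
  assumes "s \<ge> 0" "poincare_convergent \<Gamma> s"
  shows "(\<lambda>ps. exp (- s * plen ps)) summable_on lists pairs"
proof -
  have "(\<lambda>g. exp (- s * disp x g)) summable_on \<Gamma>"
    using assms poincare_convergent_iff[OF x \<Gamma>_isom] by blast
  then have "(\<lambda>g. exp (- s * disp x g)) summable_on (\<lambda>ps. word_val (flat ps)) ` lists pairs"
    by (rule summable_on_subset) (use flat_val_\<Gamma> in blast)
  then show ?thesis
    using summable_on_reindex[OF inj_flat_val, of "\<lambda>g. exp (- s * disp x g)"] by (simp add: o_def plen_def)
qed

text \<open>By \<open>disp_decomp\<close> the terms are dominated by products over the left letter,
  the pairs and the right letter, each of which has a convergent series. A possible repetition of
  values is harmless for the image.\<close>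

lemma summable_triples:
  assumes s: "s > critical_exponent (K True)" and W: "W \<subseteq> lists pairs"
    and sW: "(\<lambda>ps. exp (- s * plen ps)) summable_on W"
  shows "(\<lambda>\<gamma>. exp (- s * disp x \<gamma>)) summable_on (\<lambda>(h, ps, g). h \<diamondop> (word_val (flat ps) \<diamondop> g)) ` (K False \<times> W \<times> K True)"
proof (rule summable_on_image_real)
  have s0: "s \<ge> 0" using s critical_exponent_K(1)[of True] by simp
  have "(\<lambda>(ps, g). exp (- s * plen ps) * exp (- s * disp x g)) summable_on W \<times> K True"
    by (rule has_sum_imp_summable[OF has_sum_product_real[OF sW _ summable_K[OF s]]]) auto
  then have "(\<lambda>(h, z). exp (- s * disp x h) * (case z of (ps, g) \<Rightarrow> exp (- s * plen ps) * exp (- s * disp x g)))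
      summable_on K False \<times> (W \<times> K True)"
    by (intro has_sum_imp_summable[OF has_sum_product_real[OF summable_K[OF s]]]) auto
  then have "(\<lambda>i. exp (4 * R * s) * (case i of (h, z) \<Rightarrow> exp (- s * disp x h) * (case z of (ps, g) \<Rightarrow> exp (- s * plen ps) * exp (- s * disp x g))))
      summable_on K False \<times> (W \<times> K True)"
    by (rule summable_on_cmult_right)
  then show "(\<lambda>i. exp (- s * disp x (case i of (h, ps, g) \<Rightarrow> h \<diamondop> (word_val (flat ps) \<diamondop> g)))) summable_on K False \<times> W \<times> K True"
  proof (rule summable_on_comparison_test)
    fix i assume iI: "i \<in> K False \<times> W \<times> K True"
    obtain h ps g where i0: "i = (h, ps, g)" by (cases i) auto
    with iI have "h \<in> K False" "ps \<in> W" "g \<in> K True" by auto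
    with W i0 have i: "i = (h, ps, g)" "h \<in> K False" "ps \<in> lists pairs" "g \<in> K True" by blast+
    from mult_left_mono[OF disp_decomp[OF i(2-4)] s0]
    show "exp (- s * disp x (case i of (h, ps, g) \<Rightarrow> h \<diamondop> (word_val (flat ps) \<diamondop> g)))
      \<le> exp (4 * R * s) * (case i of (h, z) \<Rightarrow> exp (- s * disp x h) * (case z of (ps, g) \<Rightarrow> exp (- s * plen ps) * exp (- s * disp x g)))"
      by (simp add: i(1) flip: exp_add) (simp add: algebra_simps)
  qed simp
qed

lemma \<Gamma>_if_summable_lists:
  assumes s: "s > critical_exponent (K True)" and l: "(\<lambda>ps. exp (- s * plen ps)) summable_on lists pairs"
  shows "poincare_convergent \<Gamma> s"
proof -
  have s0: "s \<ge> 0" using s critical_exponent_K(1)[of True] by simp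
  have "(\<lambda>\<gamma>. exp (- s * disp x \<gamma>)) summable_on \<Gamma>"
  proof (rule summable_on_subset[OF summable_triples[OF s subset_refl l]], rule subsetI)
    fix \<gamma> assume "\<gamma> \<in> \<Gamma>"
    then obtain h ps g where "h \<in> K False" "ps \<in> lists pairs" "g \<in> K True" "\<gamma> = h \<diamondop> (word_val (flat ps) \<diamondop> g)"
      by (rule \<Gamma>_decomp)
    then show "\<gamma> \<in> (\<lambda>(h, ps, g). h \<diamondop> (word_val (flat ps) \<diamondop> g)) ` (K False \<times> lists pairs \<times> K True)"
      by (intro image_eqI[of _ _ "(h, ps, g)"]) auto
  qed
  then show ?thesis using poincare_convergent_iff[OF x \<Gamma>_isom s0] by blast
qed

text \<open>Since the series of \<open>K True\<close> diverges at its exponent, already the one-block words have mass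
  greater than one slightly beyond it.\<close>

lemma exponent_gap: "critical_exponent (K True) < \<delta>"
proof -
  define d where "d = critical_exponent (K True)"
  have d0: "d \<ge> 0" using critical_exponent_K(1) by (simp add: d_def)
  have "\<not> (\<lambda>g. exp (- d * disp x g)) summable_on K True"
    using divergent poincare_convergent_iff[OF x kleinian_isometries[OF kleinian] d0]
    by (auto simp: divergent_group_def d_def)
  then have ns: "\<not> (\<lambda>g. exp (- d * disp x g)) summable_on star (K True)"
    using summable_on_insert_iff[of "\<lambda>g. exp (- d * disp x g)" hone "star (K True)"] K_one[of True]
    by (metis insert_Diff)
  obtain h where h: "h \<in> star (K False)" using infinite_imp_nonempty[OF large_displacement] by blast
  \<comment> \<open>The cost of appending the fixed letter \<open>h\<close> at any exponent up to
    \<open>d + 1\<close>. Divergence at \<open>d\<close> supplies a finite partial sum exceeding it,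
    and this persists for some \<open>s\<close> above \<open>d\<close>.\<close>
  define B where "B = exp ((d + 1) * disp x h)"
  have "\<exists>F. finite F \<and> F \<subseteq> star (K True) \<and> (\<Sum>g\<in>F. exp (- d * disp x g)) > B"
  proof (rule ccontr)
    assume "\<not> ?thesis"
    then have "(\<lambda>g. exp (- d * disp x g)) summable_on star (K True)"
      by (intro nonneg_bdd_above_summable_on) (auto simp: bdd_above_def not_less)
    with ns show False by blast
  qed
  then obtain F where F: "finite F" "F \<subseteq> star (K True)" "(\<Sum>g\<in>F. exp (- d * disp x g)) > B" by blast
  have "((\<lambda>s. \<Sum>g\<in>F. exp (- s * disp x g)) \<longlongrightarrow> (\<Sum>g\<in>F. exp (- d * disp x g))) (at_right d)"
    by (intro tendsto_intros)
  then have "eventually (\<lambda>s. (\<Sum>g\<in>F. exp (- s * disp x g)) > B) (at_right d)"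
    by (rule order_tendstoD(1)) (rule F)
  moreover have "eventually (\<lambda>s. s \<in> {d<..<d + 1}) (at_right d)" by (rule eventually_at_right_real) simp
  ultimately have "eventually (\<lambda>s. (\<Sum>g\<in>F. exp (- s * disp x g)) > B \<and> s \<in> {d<..<d + 1}) (at_right d)"
    by eventually_elim simp
  then obtain s where s: "(\<Sum>g\<in>F. exp (- s * disp x g)) > B" "d < s" "s < d + 1"
    using eventually_happens'[of "at_right d"] by auto
  have s0: "s \<ge> 0" using s d0 by simp
  have hK: "h \<in> K False" and hi: "h \<in> hyp_isometries" using h K_isom by blast+
  have S1: "(\<lambda>a. exp (- s * plen [a])) summable_on pairs" using s by (intro summable_pairs) (simp add: d_def)
  have "1 = B * exp (- (d + 1) * disp x h)" by (simp add: B_def algebra_simps flip: exp_add)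
  also have "\<dots> \<le> (\<Sum>g\<in>F. exp (- s * disp x g)) * exp (- s * disp x h)"
  proof (rule mult_mono)
    have "s * disp x h \<le> (d + 1) * disp x h" using s disp_nonneg[OF x hi] by (intro mult_right_mono) auto
    then show "exp (- (d + 1) * disp x h) \<le> exp (- s * disp x h)" by (simp add: algebra_simps)
  qed (use s in \<open>auto intro: sum_nonneg\<close>)
  also have "\<dots> = (\<Sum>g\<in>F. exp (- s * disp x g) * exp (- s * disp x h))" by (simp add: sum_distrib_right)
  also have "\<dots> \<le> (\<Sum>g\<in>F. exp (- s * plen [(g, h)]))"
  proof (rule sum_mono)
    fix g assume "g \<in> F"
    then have "(g, h) \<in> pairs" using F h by (auto simp: pairs_def)
    from mult_left_mono[OF plen_pair_le[OF this] s0]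
    show "exp (- s * disp x g) * exp (- s * disp x h) \<le> exp (- s * plen [(g, h)])"
      by (simp flip: exp_add) (simp add: algebra_simps)
  qed
  finally have ge1: "1 \<le> (\<Sum>g\<in>F. exp (- s * plen [(g, h)]))" .
  define X where "X = (\<lambda>g. [(g, h)]) ` F"
  have "[(g, h)] \<in> pairs.words 1" if "g \<in> F" for g
  proof -
    have "(g, h) \<in> pairs" unfolding pairs_def using that F(2) h by blast
    then show ?thesis by (simp add: pairs.words_def)
  qed
  then have X: "finite X" "X \<subseteq> pairs.words 1" using F(1) by (auto simp: X_def)
  have "(\<Sum>g\<in>F. exp (- s * plen [(g, h)])) = (\<Sum>w\<in>X. exp (- s * plen w))"
    unfolding X_def by (subst sum.reindex) (auto simp: inj_on_def)
  moreover have "(\<Sum>w\<in>X. exp (- s * plen w)) \<le> pairs.mass s 1"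
    unfolding pairs.mass_def
    by (rule finite_sum_le_infsum[OF pairs.summable_words[OF s0 S1, where k = 1] X]) simp
  ultimately have m1: "pairs.mass s 1 \<ge> 1" using ge1 by linarith
  have "pairs.mass s k \<ge> 1" for k
  proof (induction k)
    case (Suc k)
    have "1 * 1 \<le> pairs.mass s 1 * pairs.mass s k" using m1 Suc by (intro mult_mono) auto
    also have "\<dots> \<le> pairs.mass s (1 + k)" by (rule pairs.mass_add(2)[OF s0 S1])
    finally show ?case by simp
  qed (simp add: pairs.mass_0)
  then have "\<not> pairs.mass s \<longlonglongrightarrow> 0"
    using tendsto_lowerbound[of "pairs.mass s" 0 sequentially 1] by auto
  then have "\<not> summable (pairs.mass s)" using summable_LIMSEQ_zero by blast
  then have "\<not> poincare_convergent \<Gamma> s"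
    using pairs.mass_summable_if_summable_lists[OF s0 S1] summable_lists_if_\<Gamma>[OF s0] by blast
  then have "s \<le> \<delta>" using critical_exponent_\<Gamma>(2)[of s] by force
  then show ?thesis using s by (simp add: d_def)
qed

lemma \<delta>_pos: "\<delta> > 0"
  using exponent_gap critical_exponent_K(1)[of True] by simp

text \<open>Summability at \<delta> makes the masses tend to 0, so some length is contracting;
  contraction persists below \<delta>, where the series of \<Gamma> would then converge.\<close>

lemma not_summable_lists: "\<not> (\<lambda>ps. exp (- \<delta> * plen ps)) summable_on lists pairs"
proof
  assume sl: "(\<lambda>ps. exp (- \<delta> * plen ps)) summable_on lists pairs"
  obtain s1 where s1: "critical_exponent (K True) < s1" "s1 < \<delta>" using exponent_gap dense by blast
  have s10: "s1 \<ge> 0" using s1 critical_exponent_K(1)[of True] by simp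
  have 1: "(\<lambda>a. exp (- \<delta> * plen [a])) summable_on pairs" by (rule summable_pairs[OF exponent_gap])
  have "pairs.mass \<delta> \<longlonglongrightarrow> 0"
    using \<delta>_pos by (intro summable_LIMSEQ_zero pairs.mass_summable_if_summable_lists sl 1) simp
  then have "(\<lambda>k. exp (\<delta> * (2 * R)) * pairs.mass \<delta> k) \<longlonglongrightarrow> exp (\<delta> * (2 * R)) * 0" by (intro tendsto_intros)
  then have "\<forall>\<^sub>F k in sequentially. exp (\<delta> * (2 * R)) * pairs.mass \<delta> k < 1" by (rule order_tendstoD) simp
  then obtain k where k: "k \<ge> 1" "exp (\<delta> * (2 * R)) * pairs.mass \<delta> k < 1"
    unfolding eventually_sequentially by (metis nle_le)
  obtain s where s: "s1 \<le> s" "s < \<delta>" "(\<lambda>w. exp (- s * plen w)) summable_on lists pairs"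
    using pairs.summable_below_if_contracting[OF s10 s1(2) summable_pairs[OF s1(1)] k] .
  then have "poincare_convergent \<Gamma> s" using s1 by (intro \<Gamma>_if_summable_lists) auto
  with critical_exponent_\<Gamma>(3)[OF s(2)] show False by blast
qed

lemma divergent_\<Gamma>: "divergent_group \<Gamma>"
  unfolding divergent_group_def using not_summable_lists summable_lists_if_\<Gamma>[of \<delta>] \<delta>_pos by force

lemma mass_\<delta>_le_1: "pairs.mass \<delta> k \<le> 1"
proof (cases "k = 0")
  case False
  have "(\<lambda>w. exp (- s * plen w)) summable_on lists pairs" if "s > \<delta>" for s
    using that \<delta>_pos by (intro summable_lists_if_\<Gamma> critical_exponent_\<Gamma>(2)) auto
  then show ?thesis using False \<delta>_pos by (intro pairs.mass_le_1 summable_pairs exponent_gap) auto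
qed (simp add: pairs.mass_0)

text \<open>Cutting between \<open>U\<close> and \<open>V\<close> writes the element as
  \<open>p\<close> followed by \<open>q\<close>, and the pattern forces every geodesic in question
  through \<open>p\<close> applied to the ball. Both factors displace \<open>x\<close> by more than
  \<open>2 * R\<close>: each contains a word of displacement above \<open>4 * R\<close> and loses
  \<open>2 * R\<close> at one junction. So the translate is disjoint, even after closure, from the
  balls at both ends.\<close>

lemma pattern_not_in_Gamma_W:
  assumes UV: "U \<in> lists pairs" "V \<in> lists pairs" "plen U > 4 * R" "plen V > 4 * R"
    and pat: "\<forall>h\<in>K False. \<forall>a\<in>lists pairs. \<forall>b\<in>lists pairs. \<forall>g\<in>K True. \<forall>y\<in>hyp_ball x R. \<forall>y'\<in>hyp_ball x R.
      geodesic_segment (hinv (h \<diamondop> word_val (flat (a @ U))) y) ((word_val (flat (V @ b)) \<diamondop> g) y') \<inter> hyp_ball x R \<noteq> {}"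
    and m: "h \<in> K False" "a \<in> lists pairs" "b \<in> lists pairs" "g \<in> K True"
  shows "h \<diamondop> (word_val (flat (a @ U @ V @ b)) \<diamondop> g) \<notin> Gamma_W \<Gamma> (hyp_ball x R)"
proof
  define \<gamma> where "\<gamma> = h \<diamondop> (word_val (flat (a @ U @ V @ b)) \<diamondop> g)"
  define p where "p = h \<diamondop> word_val (flat (a @ U))"
  define q where "q = word_val (flat (V @ b)) \<diamondop> g"
  have aU: "a @ U \<in> lists pairs" and Vb: "V @ b \<in> lists pairs" using UV m by auto
  have hi: "h \<in> hyp_isometries" "g \<in> hyp_isometries" using m K_isom by blast+
  note ia = alt_val_isom[OF alt_flat[OF aU]] and ib = alt_val_isom[OF alt_flat[OF Vb]]
  have pi: "p \<in> hyp_isometries" and qi: "q \<in> hyp_isometries" using hi ia ib by (auto simp: p_def q_def)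
  have p\<Gamma>: "p \<in> \<Gamma>" unfolding p_def
    using m(1) K_\<Gamma> flat_val_\<Gamma>[OF aU] by (intro subgroup.m_closed[OF \<Gamma>_sub]) auto
  have eq: "\<gamma> = p \<diamondop> q"
  proof -
    have "word_val (flat (a @ U @ V @ b)) = word_val (flat (a @ U)) \<diamondop> word_val (flat (V @ b))"
      using word_val_append[OF alt_isom[OF alt_flat[OF aU]] alt_isom[OF alt_flat[OF Vb]]] by simp
    then show ?thesis using hi ia ib by (simp add: \<gamma>_def p_def q_def BG.m_assoc)
  qed
  have dp: "disp x p > 2 * R"
  proof -
    obtain c where c: "alt c (letter_word h @ flat (a @ U))" using alt_left[OF m(1) aU] .
    then have c': "alt c ((letter_word h @ flat a) @ flat U)" by simp
    have "alt c (letter_word h @ flat a)" using c' by (simp add: alt_append)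
    from disp_nonneg[OF x alt_val_isom[OF this]] disp_append[OF c'] UV(3) left_val[OF m(1) aU] show ?thesis
      by (simp add: p_def plen_def)
  qed
  have dq: "disp x q > 2 * R"
  proof -
    have c: "alt True (flat V @ (flat b @ letter_word g))" using alt_right[OF m(4) Vb] by simp
    have "alt True (flat b @ letter_word g)" by (rule alt_right[OF m(4,3)])
    from disp_nonneg[OF x alt_val_isom[OF this]] disp_append[OF c] UV(4) right_val[OF m(4) Vb] show ?thesis
      by (simp add: q_def plen_def)
  qed
  assume "h \<diamondop> (word_val (flat (a @ U @ V @ b)) \<diamondop> g) \<in> Gamma_W \<Gamma> (hyp_ball x R)"
  then have "\<gamma> \<in> Gamma_W \<Gamma> (hyp_ball x R)" by (simp add: \<gamma>_def)
  then obtain y y' where y: "y \<in> hyp_ball x R" "y' \<in> hyp_ball x R"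
    and W: "\<And>g. g \<in> \<Gamma> \<Longrightarrow> geodesic_segment y (\<gamma> y') \<inter> g ` hyp_ball x R \<noteq> {} \<Longrightarrow>
      closure (hyp_ball x R) \<inter> g ` closure (hyp_ball x R) \<noteq> {} \<or> \<gamma> ` closure (hyp_ball x R) \<inter> g ` closure (hyp_ball x R) \<noteq> {}"
    unfolding Gamma_W_def by blast
  have yh: "y \<in> hyp" "y' \<in> hyp" using y by (auto simp: hyp_ball_def)
  have "geodesic_segment (hinv p y) (q y') \<inter> hyp_ball x R \<noteq> {}"
    unfolding p_def q_def using pat m y by blast
  then obtain w where w: "w \<in> geodesic_segment (hinv p y) (q y')" "w \<in> hyp_ball x R" by blast
  have "p w \<in> geodesic_segment (p (hinv p y)) (p (q y'))" using isom_geodesic_segment[OF pi] w(1) by blast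
  then have "p w \<in> geodesic_segment y (\<gamma> y')" using pi qi yh isom_hinv_apply[OF pi yh(1)] by (simp add: eq)
  then have "geodesic_segment y (\<gamma> y') \<inter> p ` hyp_ball x R \<noteq> {}" using w(2) by blast
  from W[OF p\<Gamma> this] show False
  proof
    assume "closure (hyp_ball x R) \<inter> p ` closure (hyp_ball x R) \<noteq> {}"
    then obtain z where z: "z \<in> closure (hyp_ball x R)" "p z \<in> closure (hyp_ball x R)" by blast
    note c = closure_hyp_ball[OF x z(1)] closure_hyp_ball[OF x z(2)]
    have "disp x p \<le> hyp_dist x (p z) + hyp_dist (p z) (p x)"
      unfolding disp_def by (rule hyp_dist_triangle[OF x c(3) isom_in[OF pi x]])
    also have "\<dots> \<le> 2 * R" using c isom_dist[OF pi c(1) x] by (simp add: hyp_dist_commute)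
    finally show False using dp by simp
  next
    assume "\<gamma> ` closure (hyp_ball x R) \<inter> p ` closure (hyp_ball x R) \<noteq> {}"
    then obtain z z' where z: "z \<in> closure (hyp_ball x R)" "z' \<in> closure (hyp_ball x R)" "\<gamma> z = p z'" by blast
    note c = closure_hyp_ball[OF x z(1)] closure_hyp_ball[OF x z(2)]
    have "p (q z) = p z'" using z(3) pi qi c by (simp add: eq)
    then have qz: "q z = z'" using isom_hinv_apply(2)[OF pi] isom_in[OF qi c(1)] c(3) by metis
    have "disp x q \<le> hyp_dist x (q z) + hyp_dist (q z) (q x)"
      unfolding disp_def qz using hyp_dist_triangle[OF x c(3) isom_in[OF qi x]] by simp
    also have "\<dots> \<le> 2 * R" using c isom_dist[OF qi c(1) x] by (simp add: qz hyp_dist_commute)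
    finally show False using dq by simp
  qed
qed

lemma block_decomp:
  assumes m: "m > 0" and w: "w \<in> lists A"
  obtains ws r where "w = concat ws @ r" "ws \<in> lists {u \<in> lists A. length u = m}" "r \<in> lists A" "length r < m"
proof -
  have "\<exists>ws r. w = concat ws @ r \<and> ws \<in> lists {u \<in> lists A. length u = m} \<and> r \<in> lists A \<and> length r < m"
    using w
  proof (induction "length w" arbitrary: w rule: less_induct)
    case less
    show ?case
    proof (cases "length w < m")
      case True
      then show ?thesis using less.prems by (intro exI[of _ "[]"] exI[of _ w]) auto
    next
      case False
      have d: "drop m w \<in> lists A" "take m w \<in> lists A" using less.prems by (auto dest: in_set_dropD in_set_takeD)
      have "length (drop m w) < length w" using False m by auto
      from less.hyps[OF this d(1)] obtain ws r where
        "drop m w = concat ws @ r" "ws \<in> lists {u \<in> lists A. length u = m}" "r \<in> lists A" "length r < m" by blast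
      then show ?thesis using d False by (intro exI[of _ "take m w # ws"] exI[of _ r]) (auto, metis append_take_drop_id)
    qed
  qed
  then show thesis using that by blast
qed

theorem positive_recurrent_\<Gamma>: "positive_recurrent \<Gamma> x (hyp_ball x R)"
proof -
  obtain U V where UV: "U \<in> lists pairs" "V \<in> lists pairs" "plen U > 4 * R" "plen V > 4 * R"
    and pat: "\<forall>h\<in>K False. \<forall>a\<in>lists pairs. \<forall>b\<in>lists pairs. \<forall>g\<in>K True. \<forall>y\<in>hyp_ball x R. \<forall>y'\<in>hyp_ball x R.
      geodesic_segment (hinv (h \<diamondop> word_val (flat (a @ U))) y) ((word_val (flat (V @ b)) \<diamondop> g) y') \<inter> hyp_ball x R \<noteq> {}"
    using pattern_exists by (elim bexE conjE) (rule that)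
  define p where "p = U @ V"
  define m where "m = length p"
  have "U \<noteq> []" using UV(3) R x by (auto simp: plen_def)
  then have m: "m > 0" by (simp add: m_def p_def)
  \<comment> \<open>Forbidding \<open>p\<close> among the consecutive blocks of its own length
    suffices, although it may still occur across block boundaries.\<close>
  define B where "B = pairs.words m"
  have pB: "p \<in> B" using UV by (simp add: B_def pairs.words_def m_def p_def)
  interpret B: quasi_additive B "\<lambda>ws. plen (concat ws)" "2 * R" unfolding B_def by (rule pairs.quasi_additive_blocks)
  obtain s1 where s1: "critical_exponent (K True) < s1" "s1 < \<delta>" using exponent_gap dense by blast
  have s10: "s1 \<ge> 0" using s1 critical_exponent_K(1)[of True] by simp
  have S1: "(\<lambda>u. exp (- s1 * plen (concat [u]))) summable_on B"
    using pairs.summable_words[OF s10 summable_pairs[OF s1(1)]] by (simp add: B_def)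
  have conc: "concat ws \<in> pairs.words (k * m)" if "ws \<in> B.words k" for ws k
    using that
  proof (induction ws arbitrary: k)
    case (Cons u ws)
    then obtain k' where "k = Suc k'" "ws \<in> B.words k'" "u \<in> B" by (cases k) (auto simp: B.words_def)
    with Cons.IH[of k'] show ?case by (auto simp: B_def pairs.words_def)
  qed (auto simp: B.words_def pairs.words_def)
  \<comment> \<open>A sequence of \<open>k\<close> blocks is a word of \<open>k * m\<close> pairs in
    a unique way, so the bound for pairs carries over.\<close>
  have "B.mass \<delta> k \<le> 1" for k
  proof -
    have inj: "inj_on concat (B.words k)"
    proof (rule inj_onI)
      fix us vs assume a: "us \<in> B.words k" "vs \<in> B.words k" "concat us = concat vs"
      have l: "length w = m" if "w \<in> set us \<union> set vs" for w
      proof -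
        have "w \<in> B" using that a(1,2) by (auto simp: B.words_def)
        then show ?thesis unfolding B_def by (simp add: pairs.words_def)
      qed
      have "\<forall>(u, v)\<in>set (zip us vs). length u = length v"
      proof clarify
        fix u v assume "(u, v) \<in> set (zip us vs)"
        then have "u \<in> set us" "v \<in> set vs" by (rule set_zip_leftD, rule set_zip_rightD)
        then show "length u = length v" using l[of u] l[of v] by simp
      qed
      moreover have "length us = length vs" using a(1,2) by (simp add: B.words_def)
      ultimately show "us = vs" using a(3) by (intro concat_injective)
    qed
    have sw: "(\<lambda>w. exp (- \<delta> * plen w)) summable_on pairs.words (k * m)"
      using \<delta>_pos by (intro pairs.summable_words summable_pairs exponent_gap) simp
    have "B.mass \<delta> k = infsum (\<lambda>w. exp (- \<delta> * plen w)) (concat ` B.words k)"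
      unfolding B.mass_def by (subst infsum_reindex[OF inj]) (simp add: o_def)
    also have "\<dots> \<le> pairs.mass \<delta> (k * m)"
      unfolding pairs.mass_def using conc by (intro infsum_mono2 sw summable_on_subset[OF sw]) auto
    also have "\<dots> \<le> 1" by (rule mass_\<delta>_le_1)
    finally show ?thesis .
  qed
  then obtain s where s: "s1 \<le> s" "s < \<delta>" "(\<lambda>ws. exp (- s * plen (concat ws))) summable_on lists (B - {p})"
    using B.summable_below_without_letter[OF pB s10 s1(2) S1] by blast
  have s0: "s \<ge> 0" and sK: "s > critical_exponent (K True)" using s s1 s10 by auto
  \<comment> \<open>The incomplete last block has fewer than \<open>m\<close> pairs, so it
    contributes a finite union of convergent sums.\<close>
  define Rem where "Rem = (\<Union>k<m. pairs.words k)"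
  have "(\<lambda>r. exp (- s * plen r)) summable_on Rem"
  proof -
    have "(\<lambda>r. exp (- s * plen r)) summable_on (\<Union>k<j. pairs.words k)" for j
    proof (induction j)
      case (Suc j)
      have "(\<Union>k<Suc j. pairs.words k) = (\<Union>k<j. pairs.words k) \<union> pairs.words j" by (auto simp: less_Suc_eq)
      then show ?case using Suc pairs.summable_words[OF s0 summable_pairs[OF sK]] by (simp add: summable_on_union)
    qed simp
    then show ?thesis by (simp add: Rem_def)
  qed
  moreover have concl: "concat ws \<in> lists pairs" if "ws \<in> lists (B - {p})" for ws
    using that by (fastforce simp: B_def pairs.words_def)
  moreover have "(\<lambda>w. exp (- s * plen w)) summable_on concat ` lists (B - {p})"
    using s(3) by (rule summable_on_image_real)
  ultimately have "(\<lambda>(u, v). exp (- s * plen (u @ v))) summable_on concat ` lists (B - {p}) \<times> Rem"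
    by (intro pairs.append_sum(1) s0) (auto simp: Rem_def pairs.words_def)
  then have sW: "(\<lambda>w. exp (- s * plen w)) summable_on (\<lambda>(u, v). u @ v) ` (concat ` lists (B - {p}) \<times> Rem)"
    by (intro summable_on_image_real) (simp add: case_prod_unfold)
  define W where "W = (\<lambda>(u, v). u @ v) ` (concat ` lists (B - {p}) \<times> Rem)"
  have W: "W \<subseteq> lists pairs"
  proof
    fix w assume "w \<in> W"
    then obtain z where z: "w = (case z of (u, v) \<Rightarrow> u @ v)" "z \<in> concat ` lists (B - {p}) \<times> Rem"
      unfolding W_def by (rule imageE)
    obtain u r where ur: "z = (u, r)" by (cases z)
    with z have u: "w = u @ r" "u \<in> concat ` lists (B - {p})" "r \<in> Rem" by simp_all
    from u(2) obtain ws where "u = concat ws" "ws \<in> lists (B - {p})" by (rule imageE)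
    with u have w: "w = concat ws @ r" "ws \<in> lists (B - {p})" "r \<in> Rem" by simp_all
    have "r \<in> lists pairs" using w(3) by (auto simp: Rem_def pairs.words_def)
    with concl[OF w(2)] w(1) show "w \<in> lists pairs" by simp
  qed
  have sub: "Gamma_W \<Gamma> (hyp_ball x R) \<subseteq> (\<lambda>(h, ps, g). h \<diamondop> (word_val (flat ps) \<diamondop> g)) ` (K False \<times> W \<times> K True)"
  proof
    fix \<gamma> assume \<gamma>: "\<gamma> \<in> Gamma_W \<Gamma> (hyp_ball x R)"
    then have "\<gamma> \<in> \<Gamma>" by (simp add: Gamma_W_def)
    then obtain h ps g where d: "h \<in> K False" "ps \<in> lists pairs" "g \<in> K True" "\<gamma> = h \<diamondop> (word_val (flat ps) \<diamondop> g)"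
      by (rule \<Gamma>_decomp)
    obtain ws r where wr: "ps = concat ws @ r" "ws \<in> lists {u \<in> lists pairs. length u = m}" "r \<in> lists pairs" "length r < m"
      using block_decomp[OF m d(2)] .
    have wsB: "ws \<in> lists B" using wr(2) by (simp add: B_def pairs.words_def)
    have "p \<notin> set ws"
    proof
      assume "p \<in> set ws"
      then obtain us vs where uv: "ws = us @ p # vs" by (auto dest: split_list)
      have "concat us \<in> lists pairs" "concat vs @ r \<in> lists pairs" using wr uv by fastforce+
      from pattern_not_in_Gamma_W[OF UV pat d(1) this d(3)] \<gamma> show False
        unfolding d(4) wr(1) uv p_def by simp
    qed
    then have "ws \<in> lists (B - {p})" using wsB by auto
    moreover have "r \<in> Rem" using wr by (auto simp: Rem_def pairs.words_def)
    ultimately have "ps \<in> W" unfolding W_def wr(1) by (intro image_eqI[of _ _ "(concat ws, r)"] SigmaI imageI) simp_all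
    with d show "\<gamma> \<in> (\<lambda>(h, ps, g). h \<diamondop> (word_val (flat ps) \<diamondop> g)) ` (K False \<times> W \<times> K True)"
      by (intro image_eqI[of _ _ "(h, ps, g)"] SigmaI) simp_all
  qed
  have "(\<lambda>\<gamma>. exp (- s * disp x \<gamma>)) summable_on Gamma_W \<Gamma> (hyp_ball x R)"
    by (rule summable_on_subset[OF summable_triples[OF sK W] sub]) (use sW in \<open>simp add: W_def\<close>)
  \<comment> \<open>The gap between \<open>s\<close> and \<delta> absorbs the linear factor, by
    \<open>linear_exp_le\<close>.\<close>
  then have "(\<lambda>\<gamma>. 1 / (\<delta> - s) * exp (- s * disp x \<gamma>)) summable_on Gamma_W \<Gamma> (hyp_ball x R)"
    by (rule summable_on_cmult_right)
  then have "(\<lambda>\<gamma>. disp x \<gamma> * exp (- \<delta> * disp x \<gamma>)) summable_on Gamma_W \<Gamma> (hyp_ball x R)"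
  proof (rule summable_on_comparison_test)
    fix \<gamma> assume "\<gamma> \<in> Gamma_W \<Gamma> (hyp_ball x R)"
    then have "\<gamma> \<in> hyp_isometries" using \<Gamma>_isom by (auto simp: Gamma_W_def)
    then show "0 \<le> disp x \<gamma> * exp (- \<delta> * disp x \<gamma>)" using disp_nonneg[OF x] by simp
    have "disp x \<gamma> * exp (- \<delta> * disp x \<gamma>) \<le> exp ((\<delta> - s) * disp x \<gamma>) / (\<delta> - s) * exp (- \<delta> * disp x \<gamma>)"
      using s by (intro mult_right_mono linear_exp_le) auto
    also have "\<dots> = 1 / (\<delta> - s) * (exp ((\<delta> - s) * disp x \<gamma>) * exp (- \<delta> * disp x \<gamma>))" by simp
    also have "exp ((\<delta> - s) * disp x \<gamma>) * exp (- \<delta> * disp x \<gamma>) = exp (- s * disp x \<gamma>)"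
      by (simp flip: exp_add) (simp add: algebra_simps)
    finally show "disp x \<gamma> * exp (- \<delta> * disp x \<gamma>) \<le> 1 / (\<delta> - s) * exp (- s * disp x \<gamma>)" .
  qed
  then show ?thesis unfolding positive_recurrent_def disp_def using divergent_\<Gamma> by blast
qed

end

section \<open>The boundary sphere\<close>

text \<open>The reciprocal of the Poisson kernel; its logarithm is a Busemann function.\<close>

definition horo :: "real ^ 'n \<Rightarrow> real ^ 'n \<Rightarrow> real" where
  "horo \<xi> y = (norm (\<xi> - y))\<^sup>2 / (1 - (norm y)\<^sup>2)"

lemma bdry_norm: "\<xi> \<in> hyp_bdry \<longleftrightarrow> norm \<xi> = 1" by (simp add: dist_norm)

lemma horo_pos: "norm \<xi> = 1 \<Longrightarrow> y \<in> hyp \<Longrightarrow> horo \<xi> y > 0"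
  using one_minus_norm2_pos[of y] by (auto simp: horo_def mem_ball intro!: divide_pos_pos)

text \<open>\<open>cosh\<close> of the distance grows like the reciprocal of the distance to the
  sphere. Multiplied by the conformal factor it has a finite limit, and the factor cancels in
  quotients for two base points.\<close>

lemma cosh_dist_bdry:
  assumes f: "(f \<longlongrightarrow> \<xi>) F" "\<forall>\<^sub>F t in F. f t \<in> hyp" and \<xi>: "norm \<xi> = 1" and y: "y \<in> hyp"
  shows "((\<lambda>t. cosh (hyp_dist y (f t)) * (1 - (norm (f t))\<^sup>2)) \<longlongrightarrow> 2 * horo \<xi> y) F"
proof -
  have "((\<lambda>t. (1 - (norm (f t))\<^sup>2) + 2 * (norm (y - f t))\<^sup>2 / (1 - (norm y)\<^sup>2))
      \<longlongrightarrow> (1 - (norm \<xi>)\<^sup>2) + 2 * (norm (y - \<xi>))\<^sup>2 / (1 - (norm y)\<^sup>2)) F"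
    using one_minus_norm2_pos[OF y] by (intro tendsto_intros f) auto
  then have "((\<lambda>t. (1 - (norm (f t))\<^sup>2) + 2 * (norm (y - f t))\<^sup>2 / (1 - (norm y)\<^sup>2)) \<longlongrightarrow> 2 * horo \<xi> y) F"
    using \<xi> by (simp add: horo_def norm_minus_commute)
  moreover have "\<forall>\<^sub>F t in F. (1 - (norm (f t))\<^sup>2) + 2 * (norm (y - f t))\<^sup>2 / (1 - (norm y)\<^sup>2)
      = cosh (hyp_dist y (f t)) * (1 - (norm (f t))\<^sup>2)"
    using f(2)
  proof eventually_elim
    case (elim t)
    have "1 - (norm (f t))\<^sup>2 \<noteq> 0" using one_minus_norm2_pos[OF elim] by simp
    then show ?case unfolding cosh_hyp_dist(1)[OF y elim] by (simp add: distrib_right)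
  qed
  ultimately show ?thesis by (rule Lim_transform_eventually)
qed

lemma norm_bdry_tendsto:
  "(f \<longlongrightarrow> \<xi>) F \<Longrightarrow> norm \<xi> = 1 \<Longrightarrow> ((\<lambda>t. 1 - (norm (f t))\<^sup>2) \<longlongrightarrow> 0) F"
  using tendsto_diff[OF tendsto_const[of 1] tendsto_power[OF tendsto_norm, of f \<xi> F 2]] by simp

lemma filterlim_at_top_if_cosh:
  fixes D e :: "'a \<Rightarrow> real"
  assumes "((\<lambda>t. cosh (D t) * e t) \<longlongrightarrow> c) F" "(e \<longlongrightarrow> 0) F" "c > 0" "\<forall>\<^sub>F t in F. D t \<ge> 0" "\<forall>\<^sub>F t in F. e t > 0"
  shows "filterlim D at_top F"
proof (subst filterlim_at_top_gt[where c = 0], intro allI impI)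
  fix Z :: real assume Z: "Z > 0"
  have "((\<lambda>t. e t / (cosh (D t) * e t)) \<longlongrightarrow> 0 / c) F" using assms by (intro tendsto_divide) auto
  then have "\<forall>\<^sub>F t in F. e t / (cosh (D t) * e t) < 1 / cosh Z"
    by (rule order_tendstoD) (simp add: cosh_real_pos)
  then show "\<forall>\<^sub>F t in F. Z \<le> D t"
    using assms(4,5)
  proof eventually_elim
    case (elim t)
    have "1 / cosh (D t) < 1 / cosh Z" using elim by simp
    then have "cosh Z < cosh (D t)" using cosh_real_pos[of Z] cosh_real_pos[of "D t"] by (simp add: divide_less_cancel field_simps)
    then show ?case using elim Z by (simp add: cosh_real_nonneg_less_iff)
  qed
qed

text \<open>Allows distances that tend to infinity to be replaced by \<open>ln cosh\<close>, for
  which there is an explicit formula.\<close>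

lemma ln_cosh_tendsto:
  fixes D :: "'a \<Rightarrow> real"
  assumes "filterlim D at_top F"
  shows "((\<lambda>t. D t - ln (cosh (D t))) \<longlongrightarrow> ln 2) F"
proof -
  have "((\<lambda>z::real. z - ln (cosh z)) \<longlongrightarrow> ln 2) at_top"
  proof -
    have "z - ln (cosh z) = ln 2 - ln (1 + exp (- 2 * z))" for z :: real
    proof -
      have "2 * cosh z = exp z * (1 + exp (- 2 * z))" by (simp add: cosh_def distrib_left flip: exp_add)
      moreover have "1 + exp (- 2 * z) > 0" by (intro add_pos_pos) auto
      ultimately have "ln (2 * cosh z) = z + ln (1 + exp (- 2 * z))" by (simp add: ln_mult_pos)
      then show ?thesis by (simp add: ln_mult_pos cosh_real_pos)
    qed
    moreover have "((\<lambda>z::real. ln 2 - ln (1 + exp (- 2 * z))) \<longlongrightarrow> ln 2) at_top" by real_asymp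
    ultimately show ?thesis by simp
  qed
  from filterlim_compose[OF this assms] show ?thesis .
qed

lemma bdry_filterlim_at_top:
  assumes f: "(f \<longlongrightarrow> \<xi>) F" "\<forall>\<^sub>F t in F. f t \<in> hyp" and \<xi>: "norm \<xi> = 1" and y: "y \<in> hyp"
  shows "filterlim (\<lambda>t. hyp_dist y (f t)) at_top F"
proof (rule filterlim_at_top_if_cosh[OF cosh_dist_bdry[OF assms] norm_bdry_tendsto[OF f(1) \<xi>]])
  show "0 < 2 * horo \<xi> y" using horo_pos[OF \<xi> y] by simp
  show "\<forall>\<^sub>F t in F. 0 \<le> hyp_dist y (f t)" using f(2) by eventually_elim (rule cosh_hyp_dist(2)[OF y])
  show "\<forall>\<^sub>F t in F. 0 < 1 - (norm (f t))\<^sup>2" using f(2) by eventually_elim (rule one_minus_norm2_pos)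
qed

lemma dist_diff_tendsto:
  assumes f: "(f \<longlongrightarrow> \<xi>) F" "\<forall>\<^sub>F t in F. f t \<in> hyp" and \<xi>: "norm \<xi> = 1" and y: "y \<in> hyp" and z: "z \<in> hyp"
  shows "((\<lambda>t. hyp_dist y (f t) - hyp_dist z (f t)) \<longlongrightarrow> ln (horo \<xi> y / horo \<xi> z)) F"
proof -
  let ?C = "\<lambda>y t. cosh (hyp_dist y (f t))" and ?e = "\<lambda>t. 1 - (norm (f t))\<^sup>2"
  have "((\<lambda>t. (?C y t * ?e t) / (?C z t * ?e t)) \<longlongrightarrow> 2 * horo \<xi> y / (2 * horo \<xi> z)) F"
    using horo_pos[OF \<xi> z] by (intro tendsto_divide cosh_dist_bdry[OF f \<xi> y] cosh_dist_bdry[OF f \<xi> z]) auto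
  then have "((\<lambda>t. ln ((?C y t * ?e t) / (?C z t * ?e t))) \<longlongrightarrow> ln (2 * horo \<xi> y / (2 * horo \<xi> z))) F"
    using horo_pos[OF \<xi> z] horo_pos[OF \<xi> y] by (intro tendsto_ln) auto
  then have A: "((\<lambda>t. (hyp_dist y (f t) - ln (?C y t)) - (hyp_dist z (f t) - ln (?C z t)) + ln ((?C y t * ?e t) / (?C z t * ?e t)))
      \<longlongrightarrow> ln 2 - ln 2 + ln (2 * horo \<xi> y / (2 * horo \<xi> z))) F"
    by (intro tendsto_add tendsto_diff ln_cosh_tendsto bdry_filterlim_at_top[OF f \<xi>] y z)
  have B: "\<forall>\<^sub>F t in F. (hyp_dist y (f t) - ln (?C y t)) - (hyp_dist z (f t) - ln (?C z t)) + ln ((?C y t * ?e t) / (?C z t * ?e t))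
      = hyp_dist y (f t) - hyp_dist z (f t)"
    using f(2)
  proof eventually_elim
    case (elim t)
    then have "?e t \<noteq> 0" using one_minus_norm2_pos[OF elim] by simp
    then have "(?C y t * ?e t) / (?C z t * ?e t) = ?C y t / ?C z t" by simp
    then show ?case by (simp add: ln_div cosh_real_pos)
  qed
  from Lim_transform_eventually[OF A B] show ?thesis by simp
qed

text \<open>\<open>exp\<close> of twice the Gromov product of \<xi> and \<eta> at \<open>y\<close>.
  Thus \<open>bm_gap\<close> is its power with exponent -\<delta>/2, and the weight of the
  Bowen-Margulis measure is its power with exponent \<delta>.\<close>

definition gromov :: "real ^ 'n \<Rightarrow> real ^ 'n \<Rightarrow> real ^ 'n \<Rightarrow> real" where
  "gromov y \<xi> \<eta> = 4 * horo \<xi> y * horo \<eta> y / (norm (\<xi> - \<eta>))\<^sup>2"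

lemma gromov_pos: "norm \<xi> = 1 \<Longrightarrow> norm \<eta> = 1 \<Longrightarrow> \<xi> \<noteq> \<eta> \<Longrightarrow> y \<in> hyp \<Longrightarrow> gromov y \<xi> \<eta> > 0"
  by (auto simp: gromov_def horo_pos intro!: divide_pos_pos mult_pos_pos)

lemma gromov_tendsto:
  assumes a: "(a \<longlongrightarrow> \<xi>) F" "\<forall>\<^sub>F t in F. a t \<in> hyp" "norm \<xi> = 1"
    and b: "(b \<longlongrightarrow> \<eta>) F" "\<forall>\<^sub>F t in F. b t \<in> hyp" "norm \<eta> = 1" and ne: "\<xi> \<noteq> \<eta>" and y: "y \<in> hyp"
  shows "((\<lambda>t. hyp_dist y (b t) - hyp_dist (a t) (b t) + hyp_dist (a t) y) \<longlongrightarrow> ln (gromov y \<xi> \<eta>)) F"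
proof -
  let ?Ca = "\<lambda>t. cosh (hyp_dist y (a t))" and ?ea = "\<lambda>t. 1 - (norm (a t))\<^sup>2"
  let ?Cb = "\<lambda>t. cosh (hyp_dist y (b t))" and ?eb = "\<lambda>t. 1 - (norm (b t))\<^sup>2"
  let ?C = "\<lambda>t. cosh (hyp_dist (a t) (b t))"
  have pos: "norm (\<xi> - \<eta>) > 0" using ne by simp
  have ev: "\<forall>\<^sub>F t in F. ?ea t > 0 \<and> ?eb t > 0"
    using a(2) b(2) by eventually_elim (use one_minus_norm2_pos in auto)
  have C1: "((\<lambda>t. ?ea t * ?eb t + 2 * (norm (a t - b t))\<^sup>2) \<longlongrightarrow> 0 * 0 + 2 * (norm (\<xi> - \<eta>))\<^sup>2) F"
    by (intro tendsto_intros norm_bdry_tendsto[OF a(1,3)] norm_bdry_tendsto[OF b(1,3)] a(1) b(1))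
  have C2: "\<forall>\<^sub>F t in F. ?ea t * ?eb t + 2 * (norm (a t - b t))\<^sup>2 = ?C t * (?ea t * ?eb t)"
    using ev a(2) b(2)
  proof eventually_elim
    case (elim t)
    then have "?ea t * ?eb t \<noteq> 0" by auto
    then show ?case unfolding cosh_hyp_dist(1)[OF elim(2,3)] by (simp add: distrib_right)
  qed
  have C: "((\<lambda>t. ?C t * (?ea t * ?eb t)) \<longlongrightarrow> 2 * (norm (\<xi> - \<eta>))\<^sup>2) F"
    using Lim_transform_eventually[OF C1 C2] by simp
  have fl: "filterlim (\<lambda>t. hyp_dist (a t) (b t)) at_top F"
  proof (rule filterlim_at_top_if_cosh[OF C])
    show "((\<lambda>t. ?ea t * ?eb t) \<longlongrightarrow> 0) F"
      using tendsto_mult[OF norm_bdry_tendsto[OF a(1,3)] norm_bdry_tendsto[OF b(1,3)]] by simp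
    show "\<forall>\<^sub>F t in F. 0 \<le> hyp_dist (a t) (b t)" using a(2) b(2) by eventually_elim (rule cosh_hyp_dist(2))
    show "\<forall>\<^sub>F t in F. 0 < ?ea t * ?eb t" using ev by eventually_elim simp
  qed (use pos in simp)
  have "((\<lambda>t. (?Cb t * ?eb t) * (?Ca t * ?ea t) / (?C t * (?ea t * ?eb t)))
      \<longlongrightarrow> 2 * horo \<eta> y * (2 * horo \<xi> y) / (2 * (norm (\<xi> - \<eta>))\<^sup>2)) F"
    using pos by (intro tendsto_divide tendsto_mult C cosh_dist_bdry a b y) auto
  then have "((\<lambda>t. ln ((?Cb t * ?eb t) * (?Ca t * ?ea t) / (?C t * (?ea t * ?eb t))))
      \<longlongrightarrow> ln (2 * horo \<eta> y * (2 * horo \<xi> y) / (2 * (norm (\<xi> - \<eta>))\<^sup>2))) F"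
    using pos horo_pos[OF a(3) y] horo_pos[OF b(3) y] by (intro tendsto_ln) auto
  then have A: "((\<lambda>t. (hyp_dist y (b t) - ln (?Cb t)) - (hyp_dist (a t) (b t) - ln (?C t)) + (hyp_dist y (a t) - ln (?Ca t))
      + ln ((?Cb t * ?eb t) * (?Ca t * ?ea t) / (?C t * (?ea t * ?eb t))))
      \<longlongrightarrow> ln 2 - ln 2 + ln 2 + ln (2 * horo \<eta> y * (2 * horo \<xi> y) / (2 * (norm (\<xi> - \<eta>))\<^sup>2))) F"
    by (intro tendsto_add tendsto_diff ln_cosh_tendsto fl bdry_filterlim_at_top[OF a y] bdry_filterlim_at_top[OF b y])
  have eqL: "ln 2 - ln 2 + ln 2 + ln (2 * horo \<eta> y * (2 * horo \<xi> y) / (2 * (norm (\<xi> - \<eta>))\<^sup>2)) = ln (gromov y \<xi> \<eta>)"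
  proof -
    have p: "2 * horo \<eta> y * (2 * horo \<xi> y) / (2 * (norm (\<xi> - \<eta>))\<^sup>2) > 0"
      using pos horo_pos[OF a(3) y] horo_pos[OF b(3) y] by simp
    have "gromov y \<xi> \<eta> = 2 * (2 * horo \<eta> y * (2 * horo \<xi> y) / (2 * (norm (\<xi> - \<eta>))\<^sup>2))"
      by (simp add: gromov_def)
    then have "ln (gromov y \<xi> \<eta>) = ln 2 + ln (2 * horo \<eta> y * (2 * horo \<xi> y) / (2 * (norm (\<xi> - \<eta>))\<^sup>2))"
      using ln_mult_pos[OF _ p, of 2] by simp
    then show ?thesis by linarith
  qed
  have B: "\<forall>\<^sub>F t in F. (hyp_dist y (b t) - ln (?Cb t)) - (hyp_dist (a t) (b t) - ln (?C t)) + (hyp_dist y (a t) - ln (?Ca t))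
      + ln ((?Cb t * ?eb t) * (?Ca t * ?ea t) / (?C t * (?ea t * ?eb t)))
      = hyp_dist y (b t) - hyp_dist (a t) (b t) + hyp_dist (a t) y"
    using ev
  proof eventually_elim
    case (elim t)
    then have "(?Cb t * ?eb t) * (?Ca t * ?ea t) / (?C t * (?ea t * ?eb t)) = ?Cb t * ?Ca t / ?C t" by simp
    then show ?case by (simp add: ln_div ln_mult_pos cosh_real_pos hyp_dist_commute[of "a t" y])
  qed
  from Lim_transform_eventually[OF A B] show ?thesis unfolding eqL .
qed

lemma lor_vector_curve:
  fixes v :: "real \<Rightarrow> real \<times> (real ^ 'n)"
  assumes v: "\<And>s t. mink (v s) (v t) = cosh (s - t)" and pos: "\<And>t. t \<in> I \<Longrightarrow> fst (v t) > 0"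
  defines "c \<equiv> \<lambda>t. (1 / (1 + fst (v t))) *\<^sub>R snd (v t)"
  shows "geodesic_on I c" "\<And>t. t \<in> I \<Longrightarrow> lor (c t) = v t"
proof -
  have c: "c t \<in> hyp" "lor (c t) = v t" if "t \<in> I" for t
    using lor_surj[of "v t"] pos[OF that] v[of t t] by (auto simp: c_def)
  then show "\<And>t. t \<in> I \<Longrightarrow> lor (c t) = v t" by blast
  show "geodesic_on I c"
    unfolding geodesic_on_def
  proof (intro conjI ballI)
    fix s t assume st: "s \<in> I" "t \<in> I"
    show "hyp_dist (c s) (c t) = \<bar>s - t\<bar>"
      by (rule hyp_dist_eqI) (use st c v[of s t] in \<open>auto simp: cosh_real_abs\<close>)
  qed (use c in blast)
qed

text \<open>A witness ray is what pins down the definite descriptions in \<open>busemann\<close> and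
  \<open>bm_gap\<close>: without one, every real number would satisfy them.\<close>

lemma geodesic_ray_exists:
  fixes \<xi> :: "real ^ 'n"
  assumes \<xi>: "norm \<xi> = 1" shows "\<exists>c. geodesic_ray_to \<xi> c"
proof -
  define v where "v t = (cosh t, sinh t *\<^sub>R \<xi>)" for t
  have vv: "mink (v s) (v t) = cosh (s - t)" for s t
  proof -
    have "\<xi> \<bullet> \<xi> = 1" using \<xi> by (simp add: dot_square_norm)
    then show ?thesis by (simp add: mink_def v_def cosh_diff)
  qed
  define c where "c t = (1 / (1 + fst (v t))) *\<^sub>R snd (v t)" for t
  have "geodesic_on {0..} c"
    unfolding c_def by (rule lor_vector_curve(1)[OF vv]) (simp add: v_def cosh_real_pos)
  have "((\<lambda>t::real. sinh t / (1 + cosh t)) \<longlongrightarrow> 1) at_top" by real_asymp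
  then have "((\<lambda>t. (sinh t / (1 + cosh t)) *\<^sub>R \<xi>) \<longlongrightarrow> 1 *\<^sub>R \<xi>) at_top" by (intro tendsto_intros)
  moreover have "c = (\<lambda>t. (sinh t / (1 + cosh t)) *\<^sub>R \<xi>)" by (intro ext) (simp add: c_def v_def)
  ultimately have "(c \<longlongrightarrow> \<xi>) at_top" by simp
  with \<open>geodesic_on {0..} c\<close> show ?thesis unfolding geodesic_ray_to_def by blast
qed


lemma geodesic_ray_to_D:
  assumes "geodesic_ray_to \<xi> c"
  shows "(c \<longlongrightarrow> \<xi>) at_top" "\<forall>\<^sub>F t in at_top. c t \<in> hyp"
proof -
  show "(c \<longlongrightarrow> \<xi>) at_top" using assms by (simp add: geodesic_ray_to_def)
  show "\<forall>\<^sub>F t in at_top. c t \<in> hyp"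
    using eventually_ge_at_top[of 0] by eventually_elim (use assms in \<open>auto simp: geodesic_ray_to_def geodesic_on_def\<close>)
qed

lemma busemann_eq:
  assumes \<xi>: "norm \<xi> = 1" and y: "y \<in> hyp" and z: "z \<in> hyp"
  shows "busemann \<xi> y z = ln (horo \<xi> y / horo \<xi> z)"
  unfolding busemann_def
proof (rule the_equality)
  show "\<forall>c. geodesic_ray_to \<xi> c \<longrightarrow> ((\<lambda>t. hyp_dist y (c t) - hyp_dist z (c t)) \<longlongrightarrow> ln (horo \<xi> y / horo \<xi> z)) at_top"
    using dist_diff_tendsto[OF geodesic_ray_to_D \<xi> y z] by blast
  fix b assume b: "\<forall>c. geodesic_ray_to \<xi> c \<longrightarrow> ((\<lambda>t. hyp_dist y (c t) - hyp_dist z (c t)) \<longlongrightarrow> b) at_top"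
  obtain c where c: "geodesic_ray_to \<xi> c" using geodesic_ray_exists[OF \<xi>] by blast
  have "((\<lambda>t. hyp_dist y (c t) - hyp_dist z (c t)) \<longlongrightarrow> b) at_top" using b c by blast
  from tendsto_unique[OF trivial_limit_at_top_linorder this dist_diff_tendsto[OF geodesic_ray_to_D[OF c] \<xi> y z]]
  show "b = ln (horo \<xi> y / horo \<xi> z)" .
qed

lemma bm_gap_powr:
  assumes "norm \<xi> = 1" "norm \<eta> = 1" "\<xi> \<noteq> \<eta>" "y \<in> hyp"
  shows "bm_gap S y \<xi> \<eta> powr - 2 = gromov y \<xi> \<eta> powr critical_exponent S"
proof -
  have lim: "((\<lambda>t. hyp_dist y (b t) - hyp_dist (a t) (b t) + hyp_dist (a t) y) \<longlongrightarrow> ln (gromov y \<xi> \<eta>)) at_top"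
    if "geodesic_ray_to \<xi> a" "geodesic_ray_to \<eta> b" for a b
    by (rule gromov_tendsto[OF geodesic_ray_to_D[OF that(1)] assms(1) geodesic_ray_to_D[OF that(2)] assms(2-4)])
  have "(THE l. \<forall>a b. geodesic_ray_to \<xi> a \<and> geodesic_ray_to \<eta> b \<longrightarrow>
        ((\<lambda>t. hyp_dist y (b t) - hyp_dist (a t) (b t) + hyp_dist (a t) y) \<longlongrightarrow> l) at_top) = ln (gromov y \<xi> \<eta>)"
  proof (rule the_equality)
    show "\<forall>a b. geodesic_ray_to \<xi> a \<and> geodesic_ray_to \<eta> b \<longrightarrow>
        ((\<lambda>t. hyp_dist y (b t) - hyp_dist (a t) (b t) + hyp_dist (a t) y) \<longlongrightarrow> ln (gromov y \<xi> \<eta>)) at_top"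
      using lim by blast
    fix l assume l: "\<forall>a b. geodesic_ray_to \<xi> a \<and> geodesic_ray_to \<eta> b \<longrightarrow>
        ((\<lambda>t. hyp_dist y (b t) - hyp_dist (a t) (b t) + hyp_dist (a t) y) \<longlongrightarrow> l) at_top"
    obtain a b where ab: "geodesic_ray_to \<xi> a" "geodesic_ray_to \<eta> b" using geodesic_ray_exists assms by blast
    then have "((\<lambda>t. hyp_dist y (b t) - hyp_dist (a t) (b t) + hyp_dist (a t) y) \<longlongrightarrow> l) at_top" using l by blast
    from tendsto_unique[OF trivial_limit_at_top_linorder this lim[OF ab]] show "l = ln (gromov y \<xi> \<eta>)" .
  qed
  then show ?thesis using gromov_pos[OF assms] by (simp add: bm_gap_def powr_def)
qed

lemma isom_conformal_le:
  assumes f: "f \<in> hyp_isometries" and y: "y \<in> hyp"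
  shows "1 - (norm (f y))\<^sup>2 \<le> exp (disp 0 f) * (1 - (norm y)\<^sup>2)"
proof -
  have fy: "f y \<in> hyp" "f 0 \<in> hyp" using isom_in[OF f] y by auto
  have "cosh (hyp_dist 0 y) = cosh (hyp_dist (f 0) (f y))" using isom_dist[OF f zero_in_hyp y] by simp
  also have "\<dots> \<le> exp (hyp_dist (f 0) 0) * cosh (hyp_dist 0 (f y))" by (rule cosh_dist_le[OF fy(2) zero_in_hyp fy(1)])
  also have "hyp_dist (f 0) 0 = disp 0 f" by (simp add: disp_def hyp_dist_commute)
  finally have "cosh (hyp_dist 0 y) \<le> exp (disp 0 f) * cosh (hyp_dist 0 (f y))" .
  then have "1 + cosh (hyp_dist 0 y) \<le> exp (disp 0 f) * (1 + cosh (hyp_dist 0 (f y)))"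
  proof -
    assume le: "cosh (hyp_dist 0 y) \<le> exp (disp 0 f) * cosh (hyp_dist 0 (f y))"
    have "1 \<le> exp (disp 0 f)" using disp_nonneg[OF zero_in_hyp f] by simp
    with le show ?thesis unfolding distrib_left by linarith
  qed
  moreover have "1 + cosh (hyp_dist 0 y) > 0" "1 + cosh (hyp_dist 0 (f y)) > 0" by (auto intro!: add_pos_pos)
  ultimately show ?thesis
    unfolding one_minus_norm2_hyp[OF y] one_minus_norm2_hyp[OF fy(1)] by (simp add: field_simps)
qed

text \<open>Euclidean distance is a function of hyperbolic distance times the conformal factors at
  the two points, and an isometry enlarges each of these by at most \<open>exp (disp 0 f)\<close>.
  The Lipschitz bound yields the continuous extension to the sphere.\<close>

lemma isom_lipschitz:
  assumes f: "f \<in> hyp_isometries" and y: "y \<in> hyp" and z: "z \<in> hyp"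
  shows "norm (f y - f z) \<le> exp (disp 0 f) * norm (y - z)"
proof (rule power2_le_imp_le)
  have fh: "f y \<in> hyp" "f z \<in> hyp" using isom_in[OF f] y z by auto
  have "(norm (f y - f z))\<^sup>2 = (cosh (hyp_dist y z) - 1) / 2 * ((1 - (norm (f y))\<^sup>2) * (1 - (norm (f z))\<^sup>2))"
    using norm_diff_hyp[OF fh] isom_dist[OF f y z] by simp
  also have "\<dots> \<le> (cosh (hyp_dist y z) - 1) / 2 * ((exp (disp 0 f) * (1 - (norm y)\<^sup>2)) * (exp (disp 0 f) * (1 - (norm z)\<^sup>2)))"
    using cosh_real_ge_1[of "hyp_dist y z"] one_minus_norm2_pos[OF fh(1)] one_minus_norm2_pos[OF fh(2)]
      one_minus_norm2_pos[OF y] one_minus_norm2_pos[OF z]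
    by (intro mult_left_mono mult_mono isom_conformal_le f y z) auto
  also have "\<dots> = (exp (disp 0 f) * norm (y - z))\<^sup>2"
    unfolding power_mult_distrib norm_diff_hyp[OF y z] by (simp add: power2_eq_square)
  finally show "(norm (f y - f z))\<^sup>2 \<le> (exp (disp 0 f) * norm (y - z))\<^sup>2" .
qed simp

lemma bdry_islimpt: "norm (\<xi> :: real ^ 'n) = 1 \<Longrightarrow> at \<xi> within hyp \<noteq> bot"
  by (simp add: trivial_limit_within islimpt_ball)

lemma bdry_act_tendsto_at:
  assumes f: "f \<in> hyp_isometries" and \<xi>: "norm \<xi> = 1"
  shows "(f \<longlongrightarrow> bdry_act f \<xi>) (at \<xi> within hyp)"
proof -
  have "uniformly_continuous_on hyp f"
  proof (rule lipschitz_on_uniformly_continuous)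
    define E where "E = exp (disp 0 f)"
    show "E-lipschitz_on hyp f"
      using isom_lipschitz[OF f] by (intro lipschitz_onI) (auto simp: E_def dist_norm)
  qed
  moreover have "\<xi> \<in> closure hyp" using \<xi> by simp
  ultimately obtain l where l: "(f \<longlongrightarrow> l) (at \<xi> within hyp)"
    using uniformly_continuous_on_extension_at_closure by metis
  then have "bdry_act f \<xi> = l" unfolding bdry_act_def by (rule tendsto_Lim[OF bdry_islimpt[OF \<xi>]])
  with l show ?thesis by simp
qed

lemma bdry_act_tendsto:
  assumes f: "f \<in> hyp_isometries" and \<xi>: "norm \<xi> = 1" and s: "(s \<longlongrightarrow> \<xi>) F" "\<forall>\<^sub>F t in F. s t \<in> hyp"
  shows "((\<lambda>t. f (s t)) \<longlongrightarrow> bdry_act f \<xi>) F"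
proof (rule filterlim_compose[OF bdry_act_tendsto_at[OF f \<xi>]])
  have "\<forall>\<^sub>F t in F. s t \<in> hyp \<and> s t \<noteq> \<xi>" using s(2) by eventually_elim (use \<xi> in \<open>auto simp: mem_ball\<close>)
  then show "filterlim s (at \<xi> within hyp) F" using s(1) by (simp add: filterlim_at)
qed

text \<open>Interior points tending to \<xi>, along which identities for distances are carried to
  the sphere.\<close>

definition radial :: "real ^ 'n \<Rightarrow> nat \<Rightarrow> real ^ 'n" where
  "radial \<xi> n = (real n / (real n + 1)) *\<^sub>R \<xi>"

lemma radial:
  assumes "norm \<xi> = 1" shows "radial \<xi> \<longlonglongrightarrow> \<xi>" "radial \<xi> n \<in> hyp" "\<forall>\<^sub>F n in sequentially. radial \<xi> n \<in> hyp"
proof -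
  show "radial \<xi> n \<in> hyp" for n using assms by (simp add: radial_def mem_ball)
  then show "\<forall>\<^sub>F n in sequentially. radial \<xi> n \<in> hyp" by simp
  have "(\<lambda>n. real n / (real n + 1)) \<longlonglongrightarrow> 1" by real_asymp
  then have "(\<lambda>n. (real n / (real n + 1)) *\<^sub>R \<xi>) \<longlonglongrightarrow> 1 *\<^sub>R \<xi>" by (intro tendsto_intros)
  then show "radial \<xi> \<longlonglongrightarrow> \<xi>" unfolding radial_def[abs_def] by simp
qed

lemma bdry_act_radial:
  assumes f: "f \<in> hyp_isometries" and \<xi>: "norm \<xi> = 1"
  shows "(\<lambda>n. f (radial \<xi> n)) \<longlonglongrightarrow> bdry_act f \<xi>" "f (radial \<xi> n) \<in> hyp" "\<forall>\<^sub>F n in sequentially. f (radial \<xi> n) \<in> hyp"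
  using bdry_act_tendsto[OF f \<xi> radial(1)[OF \<xi>] radial(3)[OF \<xi>]] isom_in[OF f radial(2)[OF \<xi>]] by auto

lemma norm_bdry_act [simp]:
  assumes f: "f \<in> hyp_isometries" and \<xi>: "norm \<xi> = 1"
  shows "norm (bdry_act f \<xi>) = 1"
proof -
  have 1: "(\<lambda>n. 1 - (norm (f (radial \<xi> n)))\<^sup>2) \<longlonglongrightarrow> 1 - (norm (bdry_act f \<xi>))\<^sup>2"
    by (intro tendsto_intros bdry_act_radial f \<xi>)
  have 2: "(\<lambda>n. 1 - (norm (f (radial \<xi> n)))\<^sup>2) \<longlonglongrightarrow> 0"
  proof (rule tendsto_sandwich[OF _ _ tendsto_const])
    show "\<forall>\<^sub>F n in sequentially. 0 \<le> 1 - (norm (f (radial \<xi> n)))\<^sup>2"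
      using one_minus_norm2_pos[OF bdry_act_radial(2)[OF f \<xi>]] by (simp add: less_imp_le)
    show "\<forall>\<^sub>F n in sequentially. 1 - (norm (f (radial \<xi> n)))\<^sup>2 \<le> exp (disp 0 f) * (1 - (norm (radial \<xi> n))\<^sup>2)"
      using isom_conformal_le[OF f radial(2)[OF \<xi>]] by simp
    show "(\<lambda>n. exp (disp 0 f) * (1 - (norm (radial \<xi> n))\<^sup>2)) \<longlonglongrightarrow> 0"
      using tendsto_mult[OF tendsto_const norm_bdry_tendsto[OF radial(1)[OF \<xi>] \<xi>]] by simp
  qed
  from LIMSEQ_unique[OF 1 2] have "(norm (bdry_act f \<xi>))\<^sup>2 = 1" by simp
  then show ?thesis using norm_ge_zero[of "bdry_act f \<xi>"] by (simp add: power2_eq_1_iff)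
qed

lemma bdry_act_mult:
  assumes f: "f \<in> hyp_isometries" and g: "g \<in> hyp_isometries" and \<xi>: "norm \<xi> = 1"
  shows "bdry_act (f \<diamondop> g) \<xi> = bdry_act f (bdry_act g \<xi>)"
proof -
  have "(\<lambda>n. f (g (radial \<xi> n))) \<longlonglongrightarrow> bdry_act f (bdry_act g \<xi>)"
    by (rule bdry_act_tendsto[OF f norm_bdry_act[OF g \<xi>] bdry_act_radial(1,3)[OF g \<xi>]])
  moreover have "(\<lambda>n. f (g (radial \<xi> n))) \<longlonglongrightarrow> bdry_act (f \<diamondop> g) \<xi>"
    using bdry_act_radial(1)[OF isom_mult[OF f g] \<xi>] f g radial(2)[OF \<xi>] by simp
  ultimately show ?thesis using LIMSEQ_unique by blast
qed

lemma bdry_act_one [simp]: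
  assumes \<xi>: "norm \<xi> = 1" shows "bdry_act hone \<xi> = \<xi>"
proof -
  have "(\<lambda>n. hone (radial \<xi> n)) \<longlonglongrightarrow> bdry_act hone \<xi>" by (rule bdry_act_radial(1)[OF isom_one \<xi>])
  then have "radial \<xi> \<longlonglongrightarrow> bdry_act hone \<xi>" using radial(2)[OF \<xi>] by simp
  then show ?thesis using radial(1)[OF \<xi>] LIMSEQ_unique by blast
qed

lemma bdry_act_inv:
  assumes f: "f \<in> hyp_isometries" and \<xi>: "norm \<xi> = 1"
  shows "bdry_act f (bdry_act (hinv f) \<xi>) = \<xi>" "bdry_act (hinv f) (bdry_act f \<xi>) = \<xi>"
  using bdry_act_mult[OF f isom_inv[OF f] \<xi>] bdry_act_mult[OF isom_inv[OF f] f \<xi>] \<xi> f by (simp_all add: BG.l_inv BG.r_inv)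

lemma bdry_act_inj:
  assumes f: "f \<in> hyp_isometries" and "norm \<xi> = 1" "norm \<eta> = 1"
  shows "bdry_act f \<xi> = bdry_act f \<eta> \<longleftrightarrow> \<xi> = \<eta>"
  using bdry_act_inv(2)[OF f] assms by metis

lemma continuous_on_bdry_act:
  fixes f :: "real ^ 'n \<Rightarrow> real ^ 'n"
  assumes f: "f \<in> hyp_isometries"
  shows "continuous_on hyp_bdry (bdry_act f)"
proof (rule lipschitz_on_continuous_on)
  define E where "E = exp (disp 0 f)"
  show "E-lipschitz_on hyp_bdry (bdry_act f)"
  proof (rule lipschitz_onI)
    fix \<xi> \<eta> :: "real ^ 'n" assume "\<xi> \<in> hyp_bdry" "\<eta> \<in> hyp_bdry"
    then have n: "norm \<xi> = 1" "norm \<eta> = 1" by auto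
    have 1: "norm (f (radial \<xi> n) - f (radial \<eta> n)) \<le> exp (disp 0 f) * norm (radial \<xi> n - radial \<eta> n)" for n
      by (rule isom_lipschitz[OF f radial(2)[OF n(1)] radial(2)[OF n(2)]])
    have 2: "(\<lambda>n. norm (f (radial \<xi> n) - f (radial \<eta> n))) \<longlonglongrightarrow> norm (bdry_act f \<xi> - bdry_act f \<eta>)"
      by (intro tendsto_intros bdry_act_radial f n)
    have 3: "(\<lambda>n. exp (disp 0 f) * norm (radial \<xi> n - radial \<eta> n)) \<longlonglongrightarrow> exp (disp 0 f) * norm (\<xi> - \<eta>)"
      by (intro tendsto_intros radial n)
    have "norm (bdry_act f \<xi> - bdry_act f \<eta>) \<le> exp (disp 0 f) * norm (\<xi> - \<eta>)"
      by (rule LIMSEQ_le[OF 2 3]) (use 1 in blast)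
    then show "dist (bdry_act f \<xi>) (bdry_act f \<eta>) \<le> E * dist \<xi> \<eta>" by (simp add: E_def dist_norm)
  qed (simp add: E_def)
qed

lemma horo_ratio_isom:
  assumes f: "f \<in> hyp_isometries" and \<xi>: "norm \<xi> = 1" and y: "y \<in> hyp" and z: "z \<in> hyp"
  shows "horo (bdry_act f \<xi>) (f y) / horo (bdry_act f \<xi>) (f z) = horo \<xi> y / horo \<xi> z"
proof -
  have "(\<lambda>n. hyp_dist (f y) (f (radial \<xi> n)) - hyp_dist (f z) (f (radial \<xi> n))) \<longlonglongrightarrow>
      ln (horo (bdry_act f \<xi>) (f y) / horo (bdry_act f \<xi>) (f z))"
    by (rule dist_diff_tendsto[OF bdry_act_radial(1,3)[OF f \<xi>] norm_bdry_act[OF f \<xi>] isom_in[OF f y] isom_in[OF f z]])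
  moreover have "(\<lambda>n. hyp_dist y (radial \<xi> n) - hyp_dist z (radial \<xi> n)) \<longlonglongrightarrow> ln (horo \<xi> y / horo \<xi> z)"
    by (rule dist_diff_tendsto[OF radial(1,3)[OF \<xi>] \<xi> y z])
  ultimately have "ln (horo (bdry_act f \<xi>) (f y) / horo (bdry_act f \<xi>) (f z)) = ln (horo \<xi> y / horo \<xi> z)"
    using isom_dist[OF f y radial(2)[OF \<xi>]] isom_dist[OF f z radial(2)[OF \<xi>]] LIMSEQ_unique by simp
  then show ?thesis
    using horo_pos[OF \<xi> y] horo_pos[OF \<xi> z] horo_pos[OF norm_bdry_act[OF f \<xi>] isom_in[OF f y]]
      horo_pos[OF norm_bdry_act[OF f \<xi>] isom_in[OF f z]] by simp
qed

lemma gromov_isom: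
  assumes f: "f \<in> hyp_isometries" and n: "norm \<xi> = 1" "norm \<eta> = 1" "\<xi> \<noteq> \<eta>" and y: "y \<in> hyp"
  shows "gromov (f y) (bdry_act f \<xi>) (bdry_act f \<eta>) = gromov y \<xi> \<eta>"
proof -
  have ne: "bdry_act f \<xi> \<noteq> bdry_act f \<eta>" using bdry_act_inj[OF f n(1,2)] n(3) by simp
  have nf: "norm (bdry_act f \<xi>) = 1" "norm (bdry_act f \<eta>) = 1" using f n by auto
  have "(\<lambda>n. hyp_dist (f y) (f (radial \<eta> n)) - hyp_dist (f (radial \<xi> n)) (f (radial \<eta> n)) + hyp_dist (f (radial \<xi> n)) (f y))
      \<longlonglongrightarrow> ln (gromov (f y) (bdry_act f \<xi>) (bdry_act f \<eta>))"
    by (rule gromov_tendsto[OF bdry_act_radial(1,3)[OF f n(1)] nf(1) bdry_act_radial(1,3)[OF f n(2)] nf(2) ne isom_in[OF f y]])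
  moreover have "(\<lambda>n. hyp_dist y (radial \<eta> n) - hyp_dist (radial \<xi> n) (radial \<eta> n) + hyp_dist (radial \<xi> n) y) \<longlonglongrightarrow> ln (gromov y \<xi> \<eta>)"
    by (rule gromov_tendsto[OF radial(1,3)[OF n(1)] n(1) radial(1,3)[OF n(2)] n(2,3) y])
  ultimately have "ln (gromov (f y) (bdry_act f \<xi>) (bdry_act f \<eta>)) = ln (gromov y \<xi> \<eta>)"
    using isom_dist[OF f y radial(2)[OF n(2)]] isom_dist[OF f radial(2)[OF n(1)] radial(2)[OF n(2)]]
      isom_dist[OF f radial(2)[OF n(1)] y] LIMSEQ_unique by simp
  then show ?thesis using gromov_pos[OF n y] gromov_pos[OF nf ne isom_in[OF f y]] by simp
qed

lemma ln_horo_ratio_le: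
  assumes \<xi>: "norm \<xi> = 1" and y: "y \<in> hyp" and z: "z \<in> hyp"
  shows "horo \<xi> y / horo \<xi> z \<le> exp (hyp_dist y z)"
proof -
  have "hyp_dist y (radial \<xi> n) - hyp_dist z (radial \<xi> n) \<le> hyp_dist y z" for n
    using hyp_dist_triangle[OF y z radial(2)[OF \<xi>, of n]] by simp
  then have "ln (horo \<xi> y / horo \<xi> z) \<le> hyp_dist y z"
    by (intro tendsto_upperbound[OF dist_diff_tendsto[OF radial(1,3)[OF \<xi>] \<xi> y z]] always_eventually) auto
  then show ?thesis using horo_pos[OF \<xi> y] horo_pos[OF \<xi> z] by (metis divide_pos_pos exp_ln exp_le_cancel_iff)
qed

text \<open>Near the sphere the conformal factor tends to 0, so points at bounded hyperbolic
  distance become Euclidean close.\<close>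

lemma tendsto_bdry_bounded_dist:
  assumes s: "s \<longlonglongrightarrow> \<xi>" "\<And>n. s n \<in> hyp" and \<xi>: "norm \<xi> = 1" and s': "\<And>n. s' n \<in> hyp" "\<And>n. hyp_dist (s n) (s' n) \<le> C"
  shows "s' \<longlonglongrightarrow> \<xi>"
proof -
  have C: "C \<ge> 0" using s'(2)[of 0] cosh_hyp_dist(2)[OF s(2) s'(1), of 0 0] by linarith
  have "(\<lambda>n. (cosh C - 1) / 2 * (1 - (norm (s n))\<^sup>2)) \<longlonglongrightarrow> 0"
    using tendsto_mult[OF tendsto_const norm_bdry_tendsto[OF s(1) \<xi>]] by simp
  note lim0 = this
  have "(\<lambda>n. (norm (s n - s' n))\<^sup>2) \<longlonglongrightarrow> 0"
  proof (rule Lim_null_comparison[OF always_eventually[OF allI] lim0])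
    fix n
    have c: "cosh (hyp_dist (s n) (s' n)) \<le> cosh C"
      using s'(2)[of n] cosh_hyp_dist(2)[OF s(2) s'(1), of n n] C by (simp add: cosh_real_nonneg_le_iff)
    have "(norm (s n - s' n))\<^sup>2 \<le> (cosh C - 1) / 2 * ((1 - (norm (s n))\<^sup>2) * 1)"
      unfolding norm_diff_hyp[OF s(2) s'(1)]
      using c cosh_real_ge_1[of C] one_minus_norm2_pos[OF s(2), of n] one_minus_norm2_pos[OF s'(1), of n]
      by (intro mult_mono mult_left_mono) auto
    then show "norm ((norm (s n - s' n))\<^sup>2) \<le> (cosh C - 1) / 2 * (1 - (norm (s n))\<^sup>2)" by simp
  qed
  then have "(\<lambda>n. sqrt ((norm (s n - s' n))\<^sup>2)) \<longlonglongrightarrow> sqrt 0" by (intro tendsto_intros)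
  then have "(\<lambda>n. s n - s' n) \<longlonglongrightarrow> 0" by (simp add: tendsto_norm_zero_iff)
  from tendsto_diff[OF s(1) this] show ?thesis by simp
qed

section \<open>Geodesics by their endpoints and the Hopf parametrization\<close>

text \<open>The geodesic on the hyperboloid as a combination of the null vectors over its end
  points. The product of \<open>(1, \<xi>)\<close> and \<open>(1, \<eta>)\<close> is half the square
  of \<open>norm (\<xi> - \<eta>)\<close>, which explains the normalization. Parameter 0 is the
  point nearest to the centre of the ball.\<close>

definition line_vec :: "real ^ 'n \<Rightarrow> real ^ 'n \<Rightarrow> real \<Rightarrow> real \<times> (real ^ 'n)" where
  "line_vec \<xi> \<eta> t = (1 / norm (\<xi> - \<eta>)) *\<^sub>R (exp t + exp (- t), exp t *\<^sub>R \<eta> + exp (- t) *\<^sub>R \<xi>)"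

definition line_dvec :: "real ^ 'n \<Rightarrow> real ^ 'n \<Rightarrow> real \<Rightarrow> real \<times> (real ^ 'n)" where
  "line_dvec \<xi> \<eta> t = (1 / norm (\<xi> - \<eta>)) *\<^sub>R (exp t - exp (- t), exp t *\<^sub>R \<eta> - exp (- t) *\<^sub>R \<xi>)"

definition line :: "real ^ 'n \<Rightarrow> real ^ 'n \<Rightarrow> real \<Rightarrow> real ^ 'n" where
  "line \<xi> \<eta> t = (1 / (1 + fst (line_vec \<xi> \<eta> t))) *\<^sub>R snd (line_vec \<xi> \<eta> t)"

text \<open>The differential of the ball coordinate \<open>(a, b) \<mapsto> b / (1 + a)\<close> at \<open>v\<close>.\<close>

definition dcoord :: "real \<times> (real ^ 'n) \<Rightarrow> real \<times> (real ^ 'n) \<Rightarrow> real ^ 'n" where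
  "dcoord v w = (1 / (1 + fst v)) *\<^sub>R snd w - (fst w / (1 + fst v)\<^sup>2) *\<^sub>R snd v"

definition line_vel :: "real ^ 'n \<Rightarrow> real ^ 'n \<Rightarrow> real \<Rightarrow> real ^ 'n" where
  "line_vel \<xi> \<eta> t = dcoord (line_vec \<xi> \<eta> t) (line_dvec \<xi> \<eta> t)"

definition endpoints :: "real ^ 'n \<Rightarrow> real ^ 'n \<Rightarrow> bool" where
  "endpoints \<xi> \<eta> \<longleftrightarrow> norm \<xi> = 1 \<and> norm \<eta> = 1 \<and> \<xi> \<noteq> \<eta>"

lemma endpoints_norm_diff:
  assumes "endpoints \<xi> \<eta>"
  shows "norm (\<xi> - \<eta>) > 0" "(norm (\<xi> - \<eta>))\<^sup>2 = 2 - 2 * (\<xi> \<bullet> \<eta>)" "\<xi> \<bullet> \<xi> = 1" "\<eta> \<bullet> \<eta> = 1"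
proof -
  show s: "\<xi> \<bullet> \<xi> = 1" "\<eta> \<bullet> \<eta> = 1" using assms by (auto simp: endpoints_def dot_square_norm)
  then show "(norm (\<xi> - \<eta>))\<^sup>2 = 2 - 2 * (\<xi> \<bullet> \<eta>)"
    by (simp add: power2_norm_eq_inner inner_diff_left inner_diff_right inner_commute)
qed (use assms in \<open>auto simp: endpoints_def\<close>)

lemma mink_line:
  assumes e: "endpoints \<xi> \<eta>"
  shows "mink (line_vec \<xi> \<eta> s) (line_vec \<xi> \<eta> t) = cosh (s - t)"
    and "mink (line_vec \<xi> \<eta> t) (line_dvec \<xi> \<eta> t) = 0"
    and "mink (line_dvec \<xi> \<eta> t) (line_dvec \<xi> \<eta> t) = - 1"
proof -
  define k where "k = norm (\<xi> - \<eta>)"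
  note n = endpoints_norm_diff[OF e, folded k_def]
  have dot: "\<xi> \<bullet> \<eta> = 1 - k\<^sup>2 / 2" using n(2) by linarith
  moreover have "\<eta> \<bullet> \<xi> = \<xi> \<bullet> \<eta>" by (rule inner_commute)
  ultimately have dot: "\<xi> \<bullet> \<eta> = 1 - k\<^sup>2 / 2" "\<eta> \<bullet> \<xi> = 1 - k\<^sup>2 / 2" by auto
  have ee: "exp t * exp (- t) = 1" for t :: real by (simp flip: exp_add)
  show "mink (line_vec \<xi> \<eta> s) (line_vec \<xi> \<eta> t) = cosh (s - t)"
  proof -
    have "mink (line_vec \<xi> \<eta> s) (line_vec \<xi> \<eta> t) = (exp s * exp (- t) * k\<^sup>2 / 2 + exp (- s) * exp t * k\<^sup>2 / 2) / k\<^sup>2"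
      using n by (simp add: mink_def line_vec_def k_def[symmetric] inner_add_left inner_add_right dot power2_eq_square field_simps)
    also have "\<dots> = (exp s * exp (- t) + exp (- s) * exp t) / 2" using n(1) by (simp add: field_simps)
    finally show ?thesis by (simp add: cosh_def flip: exp_add)
  qed
  show "mink (line_vec \<xi> \<eta> t) (line_dvec \<xi> \<eta> t) = 0"
    using n ee[of t] by (simp add: mink_def line_vec_def line_dvec_def k_def[symmetric] inner_add_left inner_diff_right dot power2_eq_square field_simps)
  have "mink (line_dvec \<xi> \<eta> t) (line_dvec \<xi> \<eta> t) = - (exp t * exp (- t)) * k\<^sup>2 / k\<^sup>2"
    using n by (simp add: mink_def line_dvec_def k_def[symmetric] inner_diff_left inner_diff_right dot power2_eq_square field_simps)
  then show "mink (line_dvec \<xi> \<eta> t) (line_dvec \<xi> \<eta> t) = - 1" using n(1) unfolding ee by simp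
qed

lemma fst_line_vec_pos: "endpoints \<xi> \<eta> \<Longrightarrow> fst (line_vec \<xi> \<eta> t) > 0"
  using endpoints_norm_diff(1)[of \<xi> \<eta>] by (auto simp: line_vec_def intro!: divide_pos_pos add_pos_pos)

lemma line_geodesic:
  assumes e: "endpoints \<xi> \<eta>"
  shows "geodesic_on UNIV (line \<xi> \<eta>)" "lor (line \<xi> \<eta> t) = line_vec \<xi> \<eta> t" "line \<xi> \<eta> t \<in> hyp"
proof -
  note c = lor_vector_curve[where v = "line_vec \<xi> \<eta>" and I = UNIV, OF mink_line(1)[OF e] fst_line_vec_pos[OF e], folded line_def]
  show g: "geodesic_on UNIV (line \<xi> \<eta>)" by (rule c(1))
  show "lor (line \<xi> \<eta> t) = line_vec \<xi> \<eta> t" by (rule c(2)) simp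
  show "line \<xi> \<eta> t \<in> hyp" using g by (simp add: geodesic_on_def)
qed

lemma geodesic_shift: "geodesic_on UNIV c \<Longrightarrow> geodesic_on UNIV (\<lambda>t. c (T + t))"
  by (simp add: geodesic_on_def)

lemma line_eq:
  assumes "endpoints \<xi> \<eta>"
  shows "line \<xi> \<eta> t = (exp t / (norm (\<xi> - \<eta>) + exp t + exp (- t))) *\<^sub>R \<eta> + (exp (- t) / (norm (\<xi> - \<eta>) + exp t + exp (- t))) *\<^sub>R \<xi>"
proof -
  let ?k = "norm (\<xi> - \<eta>)"
  have k: "?k > 0" by (rule endpoints_norm_diff(1)[OF assms])
  have pos: "?k + exp t + exp (- t) > 0" using k by (intro add_pos_pos) auto
  have "1 / (1 + fst (line_vec \<xi> \<eta> t)) * (1 / ?k) = 1 / (?k + exp t + exp (- t))"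
    using k pos by (simp add: line_vec_def field_simps)
  then show ?thesis by (simp add: line_def) (simp add: line_vec_def scaleR_add_right)
qed

lemma line_tendsto:
  assumes "endpoints \<xi> \<eta>"
  shows "(line \<xi> \<eta> \<longlongrightarrow> \<eta>) at_top" "(line \<xi> \<eta> \<longlongrightarrow> \<xi>) at_bot"
proof -
  define k where "k = norm (\<xi> - \<eta>)"
  have eq: "line \<xi> \<eta> = (\<lambda>t. (exp t / (k + exp t + exp (- t))) *\<^sub>R \<eta> + (exp (- t) / (k + exp t + exp (- t))) *\<^sub>R \<xi>)"
    using line_eq[OF assms] by (intro ext) (simp add: k_def)
  have "((\<lambda>t. exp t / (k + exp t + exp (- t))) \<longlongrightarrow> 1) at_top" "((\<lambda>t. exp (- t) / (k + exp t + exp (- t))) \<longlongrightarrow> 0) at_top"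
    by real_asymp+
  then have "((\<lambda>t. (exp t / (k + exp t + exp (- t))) *\<^sub>R \<eta> + (exp (- t) / (k + exp t + exp (- t))) *\<^sub>R \<xi>) \<longlongrightarrow> 1 *\<^sub>R \<eta> + 0 *\<^sub>R \<xi>) at_top"
    by (intro tendsto_intros)
  then show "(line \<xi> \<eta> \<longlongrightarrow> \<eta>) at_top" unfolding eq by simp
  have "((\<lambda>t. exp t / (k + exp t + exp (- t))) \<longlongrightarrow> 0) at_bot" "((\<lambda>t. exp (- t) / (k + exp t + exp (- t))) \<longlongrightarrow> 1) at_bot"
    by real_asymp+
  then have "((\<lambda>t. (exp t / (k + exp t + exp (- t))) *\<^sub>R \<eta> + (exp (- t) / (k + exp t + exp (- t))) *\<^sub>R \<xi>) \<longlongrightarrow> 0 *\<^sub>R \<eta> + 1 *\<^sub>R \<xi>) at_bot"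
    by (intro tendsto_intros)
  then show "(line \<xi> \<eta> \<longlongrightarrow> \<xi>) at_bot" unfolding eq by simp
qed

lemma line_derivative:
  assumes e: "endpoints \<xi> \<eta>"
  shows "(line \<xi> \<eta> has_vector_derivative line_vel \<xi> \<eta> t) (at t)"
proof -
  define k where "k = norm (\<xi> - \<eta>)"
  have k: "k > 0" using endpoints_norm_diff(1)[OF e] by (simp add: k_def)
  define a where "a t = (exp t + exp (- t)) / k" for t
  define b where "b t = (1 / k) *\<^sub>R (exp t *\<^sub>R \<eta> + exp (- t) *\<^sub>R \<xi>)" for t
  define a' where "a' t = (exp t - exp (- t)) / k" for t
  define b' where "b' t = (1 / k) *\<^sub>R (exp t *\<^sub>R \<eta> - exp (- t) *\<^sub>R \<xi>)" for t
  have pos: "1 + a t > 0" using k by (auto simp: a_def intro!: add_pos_pos divide_pos_pos)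
  have da: "(a has_real_derivative a' t) (at t)"
    unfolding a_def a'_def using k by (auto intro!: derivative_eq_intros)
  have db: "(b has_vector_derivative b' t) (at t)"
    unfolding b_def b'_def by (auto intro!: derivative_eq_intros simp: scaleR_diff_right)
  have dr: "((\<lambda>t. 1 / (1 + a t)) has_real_derivative - (a' t / (1 + a t)\<^sup>2)) (at t)"
    using pos by (auto intro!: derivative_eq_intros da simp: power2_eq_square)
  have "((\<lambda>t. (1 / (1 + a t)) *\<^sub>R b t) has_vector_derivative (1 / (1 + a t)) *\<^sub>R b' t + (- (a' t / (1 + a t)\<^sup>2)) *\<^sub>R b t) (at t)"
    by (rule has_vector_derivative_scaleR[OF dr db])
  moreover have "line \<xi> \<eta> = (\<lambda>t. (1 / (1 + a t)) *\<^sub>R b t)"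
    by (intro ext) (simp add: line_def line_vec_def a_def b_def k_def)
  moreover have "line_vel \<xi> \<eta> t = (1 / (1 + a t)) *\<^sub>R b' t + (- (a' t / (1 + a t)\<^sup>2)) *\<^sub>R b t"
    by (simp add: line_vel_def dcoord_def line_vec_def line_dvec_def a_def b_def a'_def b'_def k_def)
  ultimately show ?thesis by simp
qed

text \<open>The ball chart is conformal. The value \<open>1 / (1 + fst v)\<close> is half of one
  minus the squared norm of the ball point, which is the normalization in
  \<open>unit_tangent\<close>.\<close>

lemma dcoord_norm:
  assumes "mink v v = 1" "mink v w = 0" "mink w w = - 1" "fst v > 0"
  shows "norm (dcoord v w) = 1 / (1 + fst v)"
proof -
  obtain a b where v: "v = (a, b)" by (cases v)
  obtain a' b' where w: "w = (a', b')" by (cases w)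
  have h: "b \<bullet> b = a * a - 1" "b \<bullet> b' = a * a'" "b' \<bullet> b' = 1 + a' * a'" and a: "a > 0"
    using assms by (auto simp: v w mink_def)
  have h': "b' \<bullet> b = a * a'" using h(2) by (simp add: inner_commute)
  define p where "p = 1 / (1 + a)"
  have p: "p > 0" using a by (simp add: p_def)
  have pa: "p * a = 1 - p" using a by (simp add: p_def field_simps)
  have d: "dcoord v w = p *\<^sub>R b' - (a' * p\<^sup>2) *\<^sub>R b" by (simp add: dcoord_def v w p_def power_divide)
  have "(norm (dcoord v w))\<^sup>2 = p * p * (b' \<bullet> b') - p * (a' * p\<^sup>2) * (b' \<bullet> b) - p * (a' * p\<^sup>2) * (b \<bullet> b') + (a' * p\<^sup>2) * (a' * p\<^sup>2) * (b \<bullet> b)"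
    unfolding d power2_norm_eq_inner inner_diff_left inner_diff_right inner_scaleR_left inner_scaleR_right by (simp only: ring_distribs ac_simps)
  also have "\<dots> = p\<^sup>2 + (p * a')\<^sup>2 * (1 - 2 * (p * a) + (p * a)\<^sup>2 - p\<^sup>2)"
    unfolding h h' power2_eq_square by (simp add: algebra_simps)
  also have "\<dots> = p\<^sup>2" unfolding pa by (simp add: power2_eq_square algebra_simps)
  finally show ?thesis using p by (simp add: v p_def power2_eq_iff_nonneg)
qed

text \<open>A tangent vector of the hyperboloid can be recovered from its ball coordinates:
  orthogonality to \<open>v\<close> supplies the time component.\<close>

lemma dcoord_inverse:
  assumes "mink v v = 1" "mink v w = 0" "fst v > 0"
  shows "fst w = (1 + fst v) * (dcoord v w \<bullet> snd v)"
    and "snd w = (1 + fst v) *\<^sub>R dcoord v w + (fst w / (1 + fst v)) *\<^sub>R snd v"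
proof -
  obtain a b where v: "v = (a, b)" by (cases v)
  obtain a' b' where w: "w = (a', b')" by (cases w)
  have h: "b \<bullet> b = (a - 1) * (1 + a)" "b' \<bullet> b = a * a'" and a: "a > 0"
    using assms by (auto simp: v w mink_def inner_commute algebra_simps)
  have "dcoord v w \<bullet> b = a * a' / (1 + a) - a' * ((a - 1) * (1 + a)) / (1 + a)\<^sup>2"
    by (simp add: dcoord_def v w inner_diff_left h)
  also have "\<dots> = (a * a' - a' * (a - 1)) / (1 + a)" using a by (simp add: power2_eq_square diff_divide_distrib)
  also have "a * a' - a' * (a - 1) = a'" by (simp add: algebra_simps)
  finally have "(1 + a) * (dcoord v w \<bullet> b) = a'" using a by simp
  then show "fst w = (1 + fst v) * (dcoord v w \<bullet> snd v)" by (simp add: v w)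
  show "snd w = (1 + fst v) *\<^sub>R dcoord v w + (fst w / (1 + fst v)) *\<^sub>R snd v"
    using a by (simp add: dcoord_def v w scaleR_diff_right power2_eq_square)
qed

lemma line_unit_tangent:
  assumes e: "endpoints \<xi> \<eta>"
  shows "(line \<xi> \<eta> t, line_vel \<xi> \<eta> t) \<in> unit_tangent"
proof -
  note g = line_geodesic(2,3)[OF e, of t]
  have "norm (line_vel \<xi> \<eta> t) = 1 / (1 + fst (line_vec \<xi> \<eta> t))"
    unfolding line_vel_def using mink_line(1)[OF e, of t t]
    by (intro dcoord_norm mink_line(2,3)[OF e] fst_line_vec_pos[OF e]) simp
  moreover have "1 + fst (line_vec \<xi> \<eta> t) = 2 / (1 - (norm (line \<xi> \<eta> t))\<^sup>2)"
    using one_plus_fst_lor[OF g(2)] by (simp add: g(1))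
  ultimately show ?thesis using g(2) one_minus_norm2_pos[OF g(2)] by (simp add: unit_tangent_def)
qed

text \<open>For null vectors, Cauchy-Schwarz bounds the space product by the absolute value of the
  time product, so a positive \<open>mink u v\<close> makes the time components have equal
  sign.\<close>

lemma null_vector_pos:
  assumes "mink u u = 0" "mink v v = 0" "mink u v > 0" "fst u + fst v > 0"
  shows "fst u > 0" "fst v > 0"
proof -
  obtain a b where u: "u = (a, b)" by (cases u)
  obtain c d where v: "v = (c, d)" by (cases v)
  have n: "norm b = \<bar>a\<bar>" "norm d = \<bar>c\<bar>"
  proof -
    have "b \<bullet> b = a * a" "d \<bullet> d = c * c" using assms(1,2) by (simp_all add: u v mink_def)
    then show "norm b = \<bar>a\<bar>" "norm d = \<bar>c\<bar>" by (simp_all add: norm_eq_sqrt_inner)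
  qed
  have "- (b \<bullet> d) \<le> \<bar>a\<bar> * \<bar>c\<bar>" using Cauchy_Schwarz_ineq2[of b d] n by simp
  then have "a * c + \<bar>a * c\<bar> > 0" using assms(3) by (simp add: u v mink_def abs_mult)
  then have "a * c > 0" by linarith
  then show "fst u > 0" "fst v > 0" using assms(4) by (auto simp: u v zero_less_mult_iff)
qed

text \<open>The end points are the directions of the two null vectors; \<open>T\<close> absorbs the
  ratio of their lengths, the product of which is fixed by \<open>mink u w\<close>.\<close>

lemma vector_curve_is_line:
  fixes u w :: "real \<times> (real ^ 'n)"
  assumes n: "mink u u = 0" "mink w w = 0" "mink u w = 1 / 2" and pos: "fst u + fst w > 0"
  obtains \<xi> \<eta> T where "endpoints \<xi> \<eta>" "\<And>t. exp t *\<^sub>R u + exp (- t) *\<^sub>R w = line_vec \<xi> \<eta> (T + t)"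
    "u - w = line_dvec \<xi> \<eta> T"
proof -
  have p: "fst u > 0" "fst w > 0" using null_vector_pos[OF n(1,2) _ pos] n(3) by auto
  define \<eta> where "\<eta> = (1 / fst u) *\<^sub>R snd u"
  define \<xi> where "\<xi> = (1 / fst w) *\<^sub>R snd w"
  have u: "u = fst u *\<^sub>R (1, \<eta>)" and w: "w = fst w *\<^sub>R (1, \<xi>)"
    using p by (auto simp: \<eta>_def \<xi>_def prod_eq_iff)
  have "snd u \<bullet> snd u = fst u * fst u" "snd w \<bullet> snd w = fst w * fst w" using n by (auto simp: mink_def)
  then have nn: "norm \<eta> = 1" "norm \<xi> = 1" using p by (auto simp: \<eta>_def \<xi>_def norm_eq_sqrt_inner)
  have "fst u * fst w * (1 - \<xi> \<bullet> \<eta>) = mink (fst u *\<^sub>R (1, \<eta>)) (fst w *\<^sub>R (1, \<xi>))"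
    by (simp add: mink_def inner_commute algebra_simps)
  then have dot: "fst u * fst w * (1 - \<xi> \<bullet> \<eta>) = 1 / 2" using n(3) u w by simp
  have ne: "\<xi> \<noteq> \<eta>"
  proof
    assume "\<xi> = \<eta>"
    then have "\<xi> \<bullet> \<eta> = 1" using nn by (simp add: dot_square_norm)
    with dot show False by simp
  qed
  have e: "endpoints \<xi> \<eta>" using nn ne by (simp add: endpoints_def)
  define k where "k = norm (\<xi> - \<eta>)"
  note k = endpoints_norm_diff[OF e, folded k_def]
  have "fst u * fst w * k\<^sup>2 = 2 * (fst u * fst w * (1 - \<xi> \<bullet> \<eta>))" unfolding k(2) by (simp add: algebra_simps)
  then have kk: "fst u * fst w * k\<^sup>2 = 1" using dot by simp
  define T where "T = ln (fst u * k)"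
  have eT: "exp T = fst u * k" using p k(1) by (simp add: T_def)
  have eT': "exp (- T) = fst w * k"
  proof -
    have "exp (- T) = 1 / (fst u * k)" by (simp add: exp_minus eT inverse_eq_divide)
    also have "\<dots> = fst w * k" using kk p k(1) by (simp add: field_simps power2_eq_square)
    finally show ?thesis .
  qed
  have e2: "exp (- T - t) = fst w * k * exp (- t)" "exp (T + t) = fst u * k * exp t" for t
    unfolding eT'[symmetric] eT[symmetric] by (simp_all flip: exp_add)
  show thesis
  proof (rule that[OF e])
    show "exp t *\<^sub>R u + exp (- t) *\<^sub>R w = line_vec \<xi> \<eta> (T + t)" for t
    proof -
      have f: "exp (T + t) = k * (exp t * fst u)" "exp (- (T + t)) = k * (exp (- t) * fst w)"
        using e2[of t] by (simp_all add: ac_simps)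
      show ?thesis unfolding line_vec_def k_def[symmetric] f
        using k(1) by (subst u, subst w) (simp add: scaleR_add_right add_divide_distrib)
    qed
    show "u - w = line_dvec \<xi> \<eta> T"
      using k(1) eT eT' by (subst u, subst w) (simp add: line_dvec_def k_def[symmetric] scaleR_diff_right field_simps)
  qed
qed

text \<open>By \<open>lor_on_geodesic_line\<close> all points are determined by those at times 0 and
  1.\<close>

lemma geodesic_is_line:
  assumes c: "geodesic_on UNIV c"
  obtains \<xi> \<eta> T where "endpoints \<xi> \<eta>" "c = (\<lambda>t. line \<xi> \<eta> (T + t))"
proof -
  have h: "c t \<in> hyp" and d: "hyp_dist (c s) (c t) = \<bar>s - t\<bar>" for s t using c by (auto simp: geodesic_on_def)
  define S where "S = sinh (1::real)"
  have S: "S > 0" by (simp add: S_def)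
  define E where "E = exp (1::real)"
  have E: "E > 0" "exp (- 1) = 1 / E" by (auto simp: E_def exp_minus inverse_eq_divide)
  have CE: "cosh 1 = (E + 1 / E) / 2" and SE: "S = (E - 1 / E) / 2"
    by (auto simp: cosh_def sinh_def S_def E_def exp_minus inverse_eq_divide)
  \<comment> \<open>The coefficients of \<open>exp t\<close> and \<open>exp (- t)\<close> when the
    hyperbolic sines of that formula are expanded; both turn out to be null vectors.\<close>
  define u where "u = (1 / (2 * S)) *\<^sub>R (lor (c 1) - (1 / E) *\<^sub>R lor (c 0))"
  define w where "w = (1 / (2 * S)) *\<^sub>R (E *\<^sub>R lor (c 0) - lor (c 1))"
  have m: "mink (lor (c 0)) (lor (c 1)) = cosh 1" "mink (lor (c 1)) (lor (c 0)) = cosh 1"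
    using mink_lor_cosh[OF h h] d by auto
  have eq: "lor (c t) = exp t *\<^sub>R u + exp (- t) *\<^sub>R w" for t
  proof -
    have "lor (c t) = (sinh (1 - t) / S) *\<^sub>R lor (c 0) + (sinh t / S) *\<^sub>R lor (c 1)"
      unfolding S_def by (rule lor_on_geodesic_line[OF h h h]) (auto simp: d)
    moreover have "sinh (1 - t) / S = exp (- t) * (1 / (2 * S)) * E - exp t * (1 / (2 * S)) * (1 / E)"
      using S E by (simp add: sinh_def exp_diff E_def exp_minus field_simps)
    moreover have "sinh t / S = exp t * (1 / (2 * S)) - exp (- t) * (1 / (2 * S))"
      using S by (simp add: sinh_def field_simps)
    ultimately show ?thesis by (simp add: u_def w_def algebra_simps)
  qed
  have uu: "mink u u = 0" and ww: "mink w w = 0" and uw: "mink u w = 1 / 2"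
  proof -
    define r where "r = 1 / (2 * S)"
    define e where "e = 1 / E"
    have Ee: "E * e = 1" using E by (simp add: e_def)
    have "mink (lor (c 0)) (lor (c 0)) = 1" "mink (lor (c 1)) (lor (c 1)) = 1" using h by simp_all
    then have "mink u u = r * r * (1 + e * e - 2 * e * cosh 1)" "mink w w = r * r * (1 + E * E - 2 * E * cosh 1)"
      unfolding u_def w_def r_def[symmetric] e_def[symmetric] using m by (simp_all add: algebra_simps)
    moreover have "1 + e * e - 2 * e * cosh 1 = 0" "1 + E * E - 2 * E * cosh 1 = 0"
      using Ee unfolding CE e_def[symmetric] by (simp_all add: algebra_simps)
    ultimately show "mink u u = 0" "mink w w = 0" by simp_all
    have "mink (lor (c 0)) (lor (c 0)) = 1" using h by simp
    then have "1 = mink (u + w) (u + w)" unfolding eq[of 0] by simp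
    also have "\<dots> = mink u u + mink w w + 2 * mink u w" by (simp add: mink_commute[of w u])
    finally show "mink u w = 1 / 2" using \<open>mink u u = 0\<close> \<open>mink w w = 0\<close> by simp
  qed
  have "fst (lor (c 0)) \<ge> 1" by (rule fst_lor_ge_1[OF h])
  then have "fst u + fst w > 0" unfolding eq[of 0] by simp
  from vector_curve_is_line[OF uu ww uw this] obtain \<xi> \<eta> T
    where e: "endpoints \<xi> \<eta>" and l: "\<And>t. exp t *\<^sub>R u + exp (- t) *\<^sub>R w = line_vec \<xi> \<eta> (T + t)" by metis
  have "c t = line \<xi> \<eta> (T + t)" for t
    using lor_inj[OF h line_geodesic(3)[OF e]] eq[of t] l[of t] line_geodesic(2)[OF e] by simp
  then show thesis using that[OF e] by blast
qed

text \<open>Sum and difference of position and velocity isolate the two null vectors, whose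
  directions and lengths give the end points and the parameter.\<close>

lemma line_vec_inj:
  assumes e: "endpoints \<xi> \<eta>" "endpoints \<xi>' \<eta>'"
    and eq: "line_vec \<xi> \<eta> T = line_vec \<xi>' \<eta>' T'" "line_dvec \<xi> \<eta> T = line_dvec \<xi>' \<eta>' T'"
  shows "\<xi> = \<xi>' \<and> \<eta> = \<eta>' \<and> T = T'"
proof -
  have w: "line_vec \<xi> \<eta> T + line_dvec \<xi> \<eta> T = (2 * exp T / norm (\<xi> - \<eta>)) *\<^sub>R (1, \<eta>)"
    "line_vec \<xi> \<eta> T - line_dvec \<xi> \<eta> T = (2 * exp (- T) / norm (\<xi> - \<eta>)) *\<^sub>R (1, \<xi>)" for \<xi> \<eta> :: "real ^ 'n" and T
    by (auto simp: line_vec_def line_dvec_def field_simps scaleR_add_right scaleR_diff_right simp flip: scaleR_2)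
       (simp_all add: divide_inverse algebra_simps)
  have "line_vec \<xi> \<eta> T + line_dvec \<xi> \<eta> T = line_vec \<xi>' \<eta>' T' + line_dvec \<xi>' \<eta>' T'"
    "line_vec \<xi> \<eta> T - line_dvec \<xi> \<eta> T = line_vec \<xi>' \<eta>' T' - line_dvec \<xi>' \<eta>' T'"
    using eq by simp_all
  note 1 = this[unfolded w]
  have inj: "c = c' \<and> \<zeta> = \<zeta>'" if "c *\<^sub>R (1::real, \<zeta> :: real ^ 'n) = c' *\<^sub>R (1, \<zeta>')" "c > 0" for c c' \<zeta> \<zeta>' using that by auto
  have k: "norm (\<xi> - \<eta>) > 0" using e(1) by (rule endpoints_norm_diff(1))
  have "2 * exp T / norm (\<xi> - \<eta>) = 2 * exp T' / norm (\<xi>' - \<eta>') \<and> \<eta> = \<eta>'" using k by (intro inj 1) simp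
  moreover have "2 * exp (- T) / norm (\<xi> - \<eta>) = 2 * exp (- T') / norm (\<xi>' - \<eta>') \<and> \<xi> = \<xi>'" using k by (intro inj 1) simp
  ultimately show ?thesis using k by auto
qed

lemma line_tangent_inj:
  assumes e: "endpoints \<xi> \<eta>" "endpoints \<xi>' \<eta>'"
    and eq: "line \<xi> \<eta> T = line \<xi>' \<eta>' T'" "line_vel \<xi> \<eta> T = line_vel \<xi>' \<eta>' T'"
  shows "\<xi> = \<xi>' \<and> \<eta> = \<eta>' \<and> T = T'"
proof (rule line_vec_inj[OF e])
  show v: "line_vec \<xi> \<eta> T = line_vec \<xi>' \<eta>' T'" using eq(1) line_geodesic(2)[OF e(1)] line_geodesic(2)[OF e(2)] by metis
  have vv: "mink (line_vec \<xi> \<eta> T) (line_vec \<xi> \<eta> T) = 1" using mink_line(1)[OF e(1), of T T] by simp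
  have vv': "mink (line_vec \<xi>' \<eta>' T') (line_vec \<xi>' \<eta>' T') = 1" using mink_line(1)[OF e(2), of T' T'] by simp
  note i = dcoord_inverse[OF vv mink_line(2)[OF e(1)] fst_line_vec_pos[OF e(1)], folded line_vel_def]
    dcoord_inverse[OF vv' mink_line(2)[OF e(2)] fst_line_vec_pos[OF e(2)], folded line_vel_def]
  have f: "fst (line_dvec \<xi> \<eta> T) = fst (line_dvec \<xi>' \<eta>' T')" using i(1,3) eq(2) v by simp
  moreover have "snd (line_dvec \<xi> \<eta> T) = snd (line_dvec \<xi>' \<eta>' T')" using i(2,4) eq(2) v f by simp
  ultimately show "line_dvec \<xi> \<eta> T = line_dvec \<xi>' \<eta>' T'" by (simp add: prod_eq_iff)
qed

text \<open>Any competitor in the definite description is itself a line by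
  \<open>geodesic_is_line\<close>, and lines with a common tangent vector coincide by
  \<open>line_tangent_inj\<close>.\<close>

lemma geodesic_of_line:
  assumes e: "endpoints \<xi> \<eta>"
  shows "geodesic_of (line \<xi> \<eta> T, line_vel \<xi> \<eta> T) = (\<lambda>t. line \<xi> \<eta> (T + t))"
  unfolding geodesic_of_def
proof (rule the_equality)
  have der: "((\<lambda>t. line \<xi> \<eta> (T + t)) has_vector_derivative line_vel \<xi> \<eta> T) (at 0)" if "endpoints \<xi> \<eta>" for \<xi> \<eta> :: "real ^ 'n" and T
  proof -
    have "((\<lambda>t. T + t) has_vector_derivative 1) (at 0)" by (auto intro!: derivative_eq_intros)
    from vector_diff_chain_at[OF this, of "line \<xi> \<eta>" "line_vel \<xi> \<eta> T"] line_derivative[OF that, of T]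
    show ?thesis by (simp add: o_def)
  qed
  show "geodesic_on UNIV (\<lambda>t. line \<xi> \<eta> (T + t)) \<and> line \<xi> \<eta> (T + 0) = fst (line \<xi> \<eta> T, line_vel \<xi> \<eta> T) \<and>
    ((\<lambda>t. line \<xi> \<eta> (T + t)) has_vector_derivative snd (line \<xi> \<eta> T, line_vel \<xi> \<eta> T)) (at 0)"
    using geodesic_shift[OF line_geodesic(1)[OF e]] der[OF e] by simp
  fix c assume c: "geodesic_on UNIV c \<and> c 0 = fst (line \<xi> \<eta> T, line_vel \<xi> \<eta> T) \<and>
    (c has_vector_derivative snd (line \<xi> \<eta> T, line_vel \<xi> \<eta> T)) (at 0)"
  then obtain \<xi>' \<eta>' T' where e': "endpoints \<xi>' \<eta>'" and ceq: "c = (\<lambda>t. line \<xi>' \<eta>' (T' + t))"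
    using geodesic_is_line by blast
  have "line_vel \<xi>' \<eta>' T' = line_vel \<xi> \<eta> T"
    using vector_derivative_unique_at[OF der[OF e', of T']] c unfolding ceq by simp
  moreover have "line \<xi>' \<eta>' T' = line \<xi> \<eta> T" using c unfolding ceq by simp
  ultimately have "\<xi>' = \<xi> \<and> \<eta>' = \<eta> \<and> T' = T" by (intro line_tangent_inj e e')
  then show "c = (\<lambda>t. line \<xi> \<eta> (T + t))" by (simp add: ceq)
qed

lemma unit_tangent_is_line:
  assumes "v \<in> unit_tangent"
  obtains \<xi> \<eta> T where "endpoints \<xi> \<eta>" "v = (line \<xi> \<eta> T, line_vel \<xi> \<eta> T)"
proof -
  obtain p u where v: "v = (p, u)" by (cases v)
  have p: "p \<in> hyp" and nu: "2 * norm u = 1 - (norm p)\<^sup>2" using assms by (auto simp: v unit_tangent_def)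
  define a b where "a = fst (lor p)" and "b = snd (lor p)"
  have lp: "lor p = (a, b)" by (simp add: a_def b_def)
  have a: "a \<ge> 1" unfolding a_def by (rule fst_lor_ge_1[OF p])
  have bb: "b \<bullet> b = (a - 1) * (1 + a)" using mink_lor_self[OF p] by (simp add: lp mink_def algebra_simps)
  have "1 + a = 2 / (1 - (norm p)\<^sup>2)" unfolding a_def by (rule one_plus_fst_lor[OF p])
  then have "1 / (1 + a) = (1 - (norm p)\<^sup>2) / 2" by simp
  moreover have "norm u = (1 - (norm p)\<^sup>2) / 2" using nu by simp
  ultimately have "norm u = 1 / (1 + a)" by (rule trans[rotated, OF sym])
  then have uu: "u \<bullet> u = 1 / (1 + a)\<^sup>2" by (simp add: dot_square_norm power_divide)
  \<comment> \<open>The lift of \<open>u\<close> to a tangent vector \<open>(a', b')\<close> of the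
    hyperboloid at \<open>lor p\<close>, read off from \<open>dcoord_inverse\<close>. Half the sum
    and half the difference of position and velocity are then null.\<close>
  define q where "q = u \<bullet> b"
  define a' where "a' = q * (1 + a)"
  define b' where "b' = (1 + a) *\<^sub>R u + q *\<^sub>R b"
  have ub: "u \<bullet> b = q" "b \<bullet> u = q" by (auto simp: q_def inner_commute)
  have bb': "b \<bullet> b' = a * a'" by (simp add: b'_def inner_add_right ub bb a'_def algebra_simps)
  have b'b': "b' \<bullet> b' = 1 + a' * a'"
  proof -
    have "b' \<bullet> b' = (1 + a) * (1 + a) * (u \<bullet> u) + 2 * (1 + a) * q * q + q * q * (b \<bullet> b)"
      unfolding b'_def inner_add_left inner_add_right inner_scaleR_left inner_scaleR_right ub by (simp add: algebra_simps)
    also have "(1 + a) * (1 + a) * (u \<bullet> u) = 1" using a by (simp add: uu power2_eq_square)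
    finally show ?thesis by (simp add: bb a'_def algebra_simps)
  qed
  define w1 where "w1 = ((a + a') / 2, (1 / 2) *\<^sub>R (b + b'))"
  define w2 where "w2 = ((a - a') / 2, (1 / 2) *\<^sub>R (b - b'))"
  have "b' \<bullet> b = a * a'" using bb' by (simp add: inner_commute)
  then have n: "mink w1 w1 = 0" "mink w2 w2 = 0" "mink w1 w2 = 1 / 2"
    using bb bb' b'b' by (auto simp: w1_def w2_def mink_def inner_add_left inner_add_right inner_diff_left inner_diff_right field_simps)
  have "fst w1 + fst w2 > 0" using a by (simp add: w1_def w2_def field_simps)
  from vector_curve_is_line[OF n this] obtain \<xi> \<eta> T where e: "endpoints \<xi> \<eta>"
    and l: "\<And>t. exp t *\<^sub>R w1 + exp (- t) *\<^sub>R w2 = line_vec \<xi> \<eta> (T + t)" and l': "w1 - w2 = line_dvec \<xi> \<eta> T" by metis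
  have lv: "line_vec \<xi> \<eta> T = (a, b)"
  proof -
    have "line_vec \<xi> \<eta> T = w1 + w2" using l[of 0] by simp
    also have "\<dots> = (a, b)"
      by (simp add: w1_def w2_def scaleR_2[symmetric] flip: scaleR_add_right) (simp add: field_simps)
    finally show ?thesis .
  qed
  have ld: "line_dvec \<xi> \<eta> T = (a', b')"
    unfolding l'[symmetric] by (simp add: w1_def w2_def scaleR_2[symmetric] flip: scaleR_diff_right) (simp add: field_simps)
  have "line \<xi> \<eta> T = p" using lor_inj[OF line_geodesic(3)[OF e] p] lv lp line_geodesic(2)[OF e] by simp
  moreover have "line_vel \<xi> \<eta> T = u"
    using a by (simp add: line_vel_def dcoord_def lv ld b'_def a'_def scaleR_add_right power2_eq_square)
  ultimately show thesis using that[OF e, of T] by (simp add: v)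
qed

text \<open>The parameter of the point of the line closest to \<open>y\<close>.\<close>

definition foot :: "real ^ 'n \<Rightarrow> real ^ 'n \<Rightarrow> real ^ 'n \<Rightarrow> real" where
  "foot y \<xi> \<eta> = ln (horo \<xi> y / horo \<eta> y) / 2"

text \<open>The product of \<open>lor y\<close> with a null vector over a boundary point is the
  horospherical function there, so \<open>cosh\<close> of the distance is a combination of
  \<open>exp t\<close> and \<open>exp (- t)\<close>; extracting the geometric mean of the
  coefficients leaves a shifted \<open>cosh\<close>, minimal at \<open>foot\<close>.\<close>

lemma cosh_dist_line:
  assumes e: "endpoints \<xi> \<eta>" and y: "y \<in> hyp"
  obtains C where "C > 0" "\<And>t. cosh (hyp_dist y (line \<xi> \<eta> t)) = C * cosh (t - foot y \<xi> \<eta>)"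
proof -
  have n: "norm \<xi> = 1" "norm \<eta> = 1" using e by (auto simp: endpoints_def)
  have horo: "horo \<zeta> y = fst (lor y) - snd (lor y) \<bullet> \<zeta>" if "norm \<zeta> = 1" for \<zeta>
  proof -
    have "(norm (\<zeta> - y))\<^sup>2 = 1 + (norm y)\<^sup>2 - 2 * (y \<bullet> \<zeta>)"
      using that by (simp add: power2_norm_eq_inner inner_diff_left inner_diff_right inner_commute) (simp add: dot_square_norm)
    then show ?thesis by (simp add: horo_def lor_def diff_divide_distrib)
  qed
  define k where "k = norm (\<xi> - \<eta>)"
  have k: "k > 0" using endpoints_norm_diff(1)[OF e] by (simp add: k_def)
  note h = horo_pos[OF n(1) y] horo_pos[OF n(2) y]
  define a b where "a = sqrt (horo \<xi> y)" and "b = sqrt (horo \<eta> y)"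
  have ab: "a > 0" "b > 0" "horo \<xi> y = a * a" "horo \<eta> y = b * b" using h by (auto simp: a_def b_def)
  define r where "r = a * b"
  have r: "r > 0" using ab by (simp add: r_def)
  have "foot y \<xi> \<eta> = ln (a / b)" using ab by (simp add: foot_def ln_div ln_mult_pos)
  then have ef: "exp (foot y \<xi> \<eta>) = a / b" using ab by simp
  have 1: "horo \<eta> y * exp (foot y \<xi> \<eta>) = r" using ab by (simp add: ef r_def)
  have 2: "horo \<xi> y * exp (- foot y \<xi> \<eta>) = r" using ab by (simp add: exp_minus ef r_def)
  show thesis
  proof (rule that)
    show "2 * r / k > 0" using r k by simp
    fix t
    have "cosh (hyp_dist y (line \<xi> \<eta> t)) = mink (lor y) (line_vec \<xi> \<eta> t)"
      using mink_lor_cosh[OF y line_geodesic(3)[OF e]] line_geodesic(2)[OF e] by metis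
    also have "\<dots> = (exp t * horo \<eta> y + exp (- t) * horo \<xi> y) / k"
      using k by (simp add: mink_def line_vec_def k_def[symmetric] horo[OF n(1)] horo[OF n(2)] inner_add_right field_simps)
    also have "exp t * horo \<eta> y = exp (t - foot y \<xi> \<eta>) * (horo \<eta> y * exp (foot y \<xi> \<eta>))" by (simp add: exp_diff)
    also have "exp (- t) * horo \<xi> y = exp (- (t - foot y \<xi> \<eta>)) * (horo \<xi> y * exp (- foot y \<xi> \<eta>))"
      by (simp flip: exp_add)
    finally show "cosh (hyp_dist y (line \<xi> \<eta> t)) = 2 * r / k * cosh (t - foot y \<xi> \<eta>)"
      unfolding 1 2 by (simp add: cosh_def field_simps)
  qed
qed

lemma cosh_gt_1: "t \<noteq> 0 \<Longrightarrow> cosh (t::real) > 1"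
  using cosh_real_nonneg_less_iff[of 0 "\<bar>t\<bar>"] by (simp add: cosh_real_abs)

lemma hopf_line:
  assumes e: "endpoints \<xi> \<eta>" and y: "y \<in> hyp"
  shows "hopf y (line \<xi> \<eta> T, line_vel \<xi> \<eta> T) = (\<xi>, \<eta>, T - foot y \<xi> \<eta>)"
proof -
  have lim: "((\<lambda>t. line \<xi> \<eta> (T + t)) \<longlongrightarrow> \<eta>) at_top" "((\<lambda>t. line \<xi> \<eta> (T + t)) \<longlongrightarrow> \<xi>) at_bot"
    by (rule filterlim_compose[OF line_tendsto(1)[OF e]], real_asymp)
       (rule filterlim_compose[OF line_tendsto(2)[OF e]], real_asymp)
  obtain C where C: "C > 0" "\<And>t. cosh (hyp_dist y (line \<xi> \<eta> t)) = C * cosh (t - foot y \<xi> \<eta>)"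
    using cosh_dist_line[OF e y] by blast
  have le: "hyp_dist y (line \<xi> \<eta> s) \<le> hyp_dist y (line \<xi> \<eta> t) \<longleftrightarrow> cosh (s - foot y \<xi> \<eta>) \<le> cosh (t - foot y \<xi> \<eta>)" for s t
    using cosh_real_nonneg_le_iff[OF cosh_hyp_dist(2)[OF y line_geodesic(3)[OF e]] cosh_hyp_dist(2)[OF y line_geodesic(3)[OF e]], of s t] C
    by simp
  have "hopf_time y (line \<xi> \<eta> T, line_vel \<xi> \<eta> T) = T - foot y \<xi> \<eta>"
    unfolding hopf_time_def geodesic_of_line[OF e]
  proof (rule the_equality)
    show "\<forall>s. hyp_dist y (line \<xi> \<eta> (T + - (T - foot y \<xi> \<eta>))) \<le> hyp_dist y (line \<xi> \<eta> (T + s))"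
      unfolding le by (simp add: cosh_real_ge_1)
    fix t assume "\<forall>s. hyp_dist y (line \<xi> \<eta> (T + - t)) \<le> hyp_dist y (line \<xi> \<eta> (T + s))"
    then have "hyp_dist y (line \<xi> \<eta> (T + - t)) \<le> hyp_dist y (line \<xi> \<eta> (T + (foot y \<xi> \<eta> - T)))" by blast
    then have "cosh (T - t - foot y \<xi> \<eta>) \<le> 1" unfolding le by simp
    then have "T - t - foot y \<xi> \<eta> = 0" using cosh_gt_1 by (meson not_le)
    then show "t = T - foot y \<xi> \<eta>" by simp
  qed
  moreover have "v_minus (line \<xi> \<eta> T, line_vel \<xi> \<eta> T) = \<xi>" "v_plus (line \<xi> \<eta> T, line_vel \<xi> \<eta> T) = \<eta>"
    unfolding v_minus_def v_plus_def geodesic_of_line[OF e]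
    using tendsto_Lim[OF trivial_limit_at_bot_linorder lim(2)] tendsto_Lim[OF trivial_limit_at_top_linorder lim(1)] by auto
  ultimately show ?thesis by (simp add: hopf_def)
qed

lemma inv_hopf:
  assumes e: "endpoints \<xi> \<eta>" and y: "y \<in> hyp"
  shows "inv_into unit_tangent (hopf y) (\<xi>, \<eta>, t) = (line \<xi> \<eta> (t + foot y \<xi> \<eta>), line_vel \<xi> \<eta> (t + foot y \<xi> \<eta>))"
proof -
  have inj: "inj_on (hopf y) unit_tangent"
  proof (rule inj_onI)
    fix v w assume vw: "v \<in> unit_tangent" "w \<in> unit_tangent" "hopf y v = hopf y w"
    obtain \<xi> \<eta> T where 1: "endpoints \<xi> \<eta>" "v = (line \<xi> \<eta> T, line_vel \<xi> \<eta> T)" using unit_tangent_is_line[OF vw(1)] .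
    obtain \<xi>' \<eta>' T' where 2: "endpoints \<xi>' \<eta>'" "w = (line \<xi>' \<eta>' T', line_vel \<xi>' \<eta>' T')" using unit_tangent_is_line[OF vw(2)] .
    have "\<xi> = \<xi>'" "\<eta> = \<eta>'" "T - foot y \<xi> \<eta> = T' - foot y \<xi>' \<eta>'"
      using vw(3) unfolding 1(2) 2(2) hopf_line[OF 1(1) y] hopf_line[OF 2(1) y] by auto
    then show "v = w" by (simp add: 1(2) 2(2))
  qed
  have "hopf y (line \<xi> \<eta> (t + foot y \<xi> \<eta>), line_vel \<xi> \<eta> (t + foot y \<xi> \<eta>)) = (\<xi>, \<eta>, t)" using hopf_line[OF e y] by simp
  from inv_into_f_eq[OF inj line_unit_tangent[OF e] this] show ?thesis .
qed

lemma endpoints_bdry_act: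
  "f \<in> hyp_isometries \<Longrightarrow> endpoints \<xi> \<eta> \<Longrightarrow> endpoints (bdry_act f \<xi>) (bdry_act f \<eta>)"
  using bdry_act_inj[of f \<xi> \<eta>] by (simp add: endpoints_def)

text \<open>The image curve is a geodesic, hence a line, and its end points are the limits at both
  ends. The shift of the parameter is found by comparing the distances to \<open>y\<close> and to
  \<open>f y\<close>.\<close>

lemma tangent_act_line:
  assumes f: "f \<in> hyp_isometries" and diff: "f differentiable (at (line \<xi> \<eta> T))" and e: "endpoints \<xi> \<eta>" and y: "y \<in> hyp"
  shows "tangent_act f (line \<xi> \<eta> T, line_vel \<xi> \<eta> T) =
    (let T' = T - foot y \<xi> \<eta> + foot (f y) (bdry_act f \<xi>) (bdry_act f \<eta>) in
      (line (bdry_act f \<xi>) (bdry_act f \<eta>) T', line_vel (bdry_act f \<xi>) (bdry_act f \<eta>) T'))"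
proof -
  define c where "c t = f (line \<xi> \<eta> (T + t))" for t
  note lh = line_geodesic(3)[OF e]
  have "geodesic_on UNIV c"
    using line_geodesic(1)[OF e] isom_in[OF f lh] isom_dist[OF f lh lh] by (simp add: geodesic_on_def c_def)
  then obtain \<xi>' \<eta>' T' where e': "endpoints \<xi>' \<eta>'" and ceq: "c = (\<lambda>t. line \<xi>' \<eta>' (T' + t))"
    by (rule geodesic_is_line)
  have n: "norm \<xi> = 1" "norm \<eta> = 1" using e by (auto simp: endpoints_def)
  have "((\<lambda>t. line \<xi> \<eta> (T + t)) \<longlongrightarrow> \<eta>) at_top" by (rule filterlim_compose[OF line_tendsto(1)[OF e]], real_asymp)
  from bdry_act_tendsto[OF f n(2) this] have "(c \<longlongrightarrow> bdry_act f \<eta>) at_top" using lh by (simp add: c_def[abs_def])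
  moreover have "((\<lambda>t. line \<xi>' \<eta>' (T' + t)) \<longlongrightarrow> \<eta>') at_top" by (rule filterlim_compose[OF line_tendsto(1)[OF e']], real_asymp)
  ultimately have \<eta>': "\<eta>' = bdry_act f \<eta>" unfolding ceq using tendsto_unique trivial_limit_at_top_linorder by metis
  have "((\<lambda>t. line \<xi> \<eta> (T + t)) \<longlongrightarrow> \<xi>) at_bot" by (rule filterlim_compose[OF line_tendsto(2)[OF e]], real_asymp)
  from bdry_act_tendsto[OF f n(1) this] have "(c \<longlongrightarrow> bdry_act f \<xi>) at_bot" using lh by (simp add: c_def[abs_def])
  moreover have "((\<lambda>t. line \<xi>' \<eta>' (T' + t)) \<longlongrightarrow> \<xi>') at_bot" by (rule filterlim_compose[OF line_tendsto(2)[OF e']], real_asymp)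
  ultimately have \<xi>': "\<xi>' = bdry_act f \<xi>" unfolding ceq using tendsto_unique trivial_limit_at_bot_linorder by metis
  have sh: "((\<lambda>t. T + t) has_vector_derivative 1) (at 0)" for T :: real by (auto intro!: derivative_eq_intros)
  have lv: "((\<lambda>t. line \<xi> \<eta> (T + t)) has_vector_derivative line_vel \<xi> \<eta> T) (at 0)"
    using vector_diff_chain_at[OF sh, of "line \<xi> \<eta>" "line_vel \<xi> \<eta> T" T] line_derivative[OF e, of T] by (simp add: o_def)
  have lv': "(c has_vector_derivative line_vel \<xi>' \<eta>' T') (at 0)"
    using vector_diff_chain_at[OF sh, of "line \<xi>' \<eta>'" "line_vel \<xi>' \<eta>' T'" T'] line_derivative[OF e', of T'] by (simp add: o_def ceq)
  have "(f has_derivative frechet_derivative f (at (line \<xi> \<eta> T))) (at (line \<xi> \<eta> (T + 0)))"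
    using diff by (simp add: frechet_derivative_works)
  from diff_chain_at[OF lv[unfolded has_vector_derivative_def] this]
  have "(c has_derivative (frechet_derivative f (at (line \<xi> \<eta> T)) \<circ> (\<lambda>h. h *\<^sub>R line_vel \<xi> \<eta> T))) (at 0)"
    by (simp add: o_def c_def[abs_def])
  moreover have "frechet_derivative f (at (line \<xi> \<eta> T)) \<circ> (\<lambda>h. h *\<^sub>R line_vel \<xi> \<eta> T)
    = (\<lambda>h. h *\<^sub>R frechet_derivative f (at (line \<xi> \<eta> T)) (line_vel \<xi> \<eta> T))"
    using linear_frechet_derivative[OF diff] by (intro ext) (simp add: linear_cmul)
  ultimately have "(c has_vector_derivative frechet_derivative f (at (line \<xi> \<eta> T)) (line_vel \<xi> \<eta> T)) (at 0)"
    by (simp add: has_vector_derivative_def)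
  from vector_derivative_unique_at[OF this lv']
  have 1: "tangent_act f (line \<xi> \<eta> T, line_vel \<xi> \<eta> T) = (line \<xi>' \<eta>' T', line_vel \<xi>' \<eta>' T')"
    using fun_cong[OF ceq, of 0] by (simp add: tangent_act_def c_def)
  obtain C where C: "C > 0" "\<And>t. cosh (hyp_dist y (line \<xi> \<eta> t)) = C * cosh (t - foot y \<xi> \<eta>)"
    using cosh_dist_line[OF e y] by blast
  obtain C' where C': "C' > 0" "\<And>t. cosh (hyp_dist (f y) (line \<xi>' \<eta>' t)) = C' * cosh (t - foot (f y) \<xi>' \<eta>')"
    using cosh_dist_line[OF e' isom_in[OF f y]] by blast
  have same: "C * cosh (T + t - foot y \<xi> \<eta>) = C' * cosh (T' + t - foot (f y) \<xi>' \<eta>')" for t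
  proof -
    have "hyp_dist (f y) (line \<xi>' \<eta>' (T' + t)) = hyp_dist y (line \<xi> \<eta> (T + t))"
      using fun_cong[OF ceq, of t] isom_dist[OF f y lh[of "T + t"]] by (simp add: c_def)
    then show ?thesis using C(2)[of "T + t"] C'(2)[of "T' + t"] by simp
  qed
  \<comment> \<open>The discrepancy between the two minima. Evaluating \<open>same\<close> at each
    of them gives \<open>C = C' * cosh D\<close> and \<open>C * cosh D = C'\<close>, hence
    \<open>cosh D = 1\<close>.\<close>
  define D where "D = (T' - foot (f y) \<xi>' \<eta>') - (T - foot y \<xi> \<eta>)"
  have "C = C' * cosh D" using same[of "foot y \<xi> \<eta> - T"] by (simp add: D_def algebra_simps)
  moreover have "C * cosh (- D) = C'" using same[of "foot (f y) \<xi>' \<eta>' - T'"] by (simp add: D_def algebra_simps)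
  ultimately have "C * (cosh D * cosh D) = C * 1" by (metis cosh_minus mult.assoc mult.commute mult.right_neutral)
  then have "cosh D * cosh D = 1" using C(1) by simp
  moreover have "cosh D > 1 \<Longrightarrow> cosh D * cosh D > 1" by (simp add: less_1_mult)
  ultimately have "D = 0" using cosh_gt_1[of D] by (metis less_irrefl)
  then have "T' = T - foot y \<xi> \<eta> + foot (f y) \<xi>' \<eta>'" by (simp add: D_def)
  then show ?thesis unfolding 1 \<xi>' \<eta>' Let_def by simp
qed

section \<open>The limit set and its coding\<close>

text \<open>Limit points for an arbitrary set of isometries and base point; needed because
  \<open>limit_set\<close> is based at 0, the crossing property at \<open>x\<close>, and
  \<open>Gam b\<close> is not a group.\<close>

definition accum :: "real ^ 'n \<Rightarrow> (real ^ 'n \<Rightarrow> real ^ 'n) set \<Rightarrow> (real ^ 'n) set" where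
  "accum x S = hyp_bdry \<inter> closure ((\<lambda>g. g x) ` S)"

lemma accum_iff:
  "\<xi> \<in> accum x S \<longleftrightarrow> norm \<xi> = 1 \<and> (\<exists>\<gamma>. (\<forall>n::nat. \<gamma> n \<in> S) \<and> (\<lambda>n. \<gamma> n x) \<longlonglongrightarrow> \<xi>)"
proof -
  have "(\<exists>s. (\<forall>n::nat. s n \<in> (\<lambda>g. g x) ` S) \<and> s \<longlonglongrightarrow> \<xi>) \<longleftrightarrow> (\<exists>\<gamma>. (\<forall>n::nat. \<gamma> n \<in> S) \<and> (\<lambda>n. \<gamma> n x) \<longlonglongrightarrow> \<xi>)"
  proof
    assume "\<exists>s. (\<forall>n::nat. s n \<in> (\<lambda>g. g x) ` S) \<and> s \<longlonglongrightarrow> \<xi>"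
    then obtain s where s: "\<forall>n::nat. s n \<in> (\<lambda>g. g x) ` S" "s \<longlonglongrightarrow> \<xi>" by blast
    then have "\<forall>n. \<exists>g. g \<in> S \<and> s n = g x" by blast
    then obtain \<gamma> where \<gamma>: "\<forall>n. \<gamma> n \<in> S \<and> s n = \<gamma> n x" by metis
    then have "s = (\<lambda>n. \<gamma> n x)" by blast
    with s(2) \<gamma> show "\<exists>\<gamma>. (\<forall>n::nat. \<gamma> n \<in> S) \<and> (\<lambda>n. \<gamma> n x) \<longlonglongrightarrow> \<xi>" by blast
  next
    assume "\<exists>\<gamma>. (\<forall>n::nat. \<gamma> n \<in> S) \<and> (\<lambda>n. \<gamma> n x) \<longlonglongrightarrow> \<xi>"
    then obtain \<gamma> where "\<forall>n::nat. \<gamma> n \<in> S" "(\<lambda>n. \<gamma> n x) \<longlonglongrightarrow> \<xi>" by blast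
    then show "\<exists>s. (\<forall>n::nat. s n \<in> (\<lambda>g. g x) ` S) \<and> s \<longlonglongrightarrow> \<xi>"
      by (intro exI[of _ "\<lambda>n. \<gamma> n x"]) auto
  qed
  then show ?thesis unfolding accum_def Int_iff bdry_norm closure_sequential by simp
qed

lemma compact_accum: "compact (accum x S)"
  unfolding accum_def by (intro compact_Int_closed) auto

lemma accum_subset_bdry: "accum x S \<subseteq> hyp_bdry" by (simp add: accum_def)

lemma accum_norm: "\<xi> \<in> accum x S \<Longrightarrow> norm \<xi> = 1" by (simp add: accum_iff)

lemma accum_base_change:
  assumes S: "S \<subseteq> hyp_isometries" and x: "x \<in> hyp" and y: "y \<in> hyp"
  shows "accum y S \<subseteq> accum x S"
proof
  fix \<xi> assume "\<xi> \<in> accum y S"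
  then obtain \<gamma> where n: "norm \<xi> = 1" and \<gamma>: "\<forall>n::nat. \<gamma> n \<in> S" "(\<lambda>n. \<gamma> n y) \<longlonglongrightarrow> \<xi>" unfolding accum_iff by blast
  have i: "\<gamma> k \<in> hyp_isometries" for k using \<gamma>(1) S by blast
  have "(\<lambda>n. \<gamma> n x) \<longlonglongrightarrow> \<xi>"
  proof (rule tendsto_bdry_bounded_dist[OF \<gamma>(2) _ n])
    show "\<gamma> k y \<in> hyp" "\<gamma> k x \<in> hyp" for k by (rule isom_in[OF i y], rule isom_in[OF i x])
    show "hyp_dist (\<gamma> k y) (\<gamma> k x) \<le> hyp_dist y x" for k using isom_dist[OF i y x, of k] by simp
  qed
  then show "\<xi> \<in> accum x S" unfolding accum_iff using n \<gamma>(1) by blast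
qed

lemma accum_bdry_act:
  assumes f: "f \<in> hyp_isometries" and S: "S \<subseteq> hyp_isometries" and x: "x \<in> hyp" and \<xi>: "\<xi> \<in> accum x S"
    and T: "\<And>g. g \<in> S \<Longrightarrow> f \<diamondop> g \<in> T"
  shows "bdry_act f \<xi> \<in> accum x T"
proof -
  obtain \<gamma> where n: "norm \<xi> = 1" and \<gamma>: "\<forall>n::nat. \<gamma> n \<in> S" "(\<lambda>n. \<gamma> n x) \<longlonglongrightarrow> \<xi>" using \<xi> unfolding accum_iff by blast
  have i: "\<gamma> k \<in> hyp_isometries" for k using \<gamma>(1) S by blast
  have "(\<lambda>n. f (\<gamma> n x)) \<longlonglongrightarrow> bdry_act f \<xi>"
    by (rule bdry_act_tendsto[OF f n \<gamma>(2) always_eventually[OF allI]]) (rule isom_in[OF i x])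
  moreover have "f (\<gamma> k x) = (f \<diamondop> \<gamma> k) x" for k using hmult_apply[OF isom_Bij[OF f] isom_Bij[OF i] x] by simp
  ultimately have "(\<lambda>n. (f \<diamondop> \<gamma> n) x) \<longlonglongrightarrow> bdry_act f \<xi>" by simp
  moreover have "norm (bdry_act f \<xi>) = 1" by (rule norm_bdry_act[OF f n])
  ultimately show ?thesis unfolding accum_iff using T \<gamma>(1) by (intro conjI exI[of _ "\<lambda>n. f \<diamondop> \<gamma> n"]) auto
qed

text \<open>The Euclidean counterpart of \<open>klein_chart_close\<close>, with the centre of the
  ball as reference point.\<close>

lemma norm_diff_sq_le:
  assumes x: "x \<in> hyp" and p: "p \<in> hyp" and q: "q \<in> hyp" and le: "hyp_dist p q \<le> hyp_dist x q - hyp_dist x p + C"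
  shows "(norm (q - p))\<^sup>2 \<le> 8 * exp (2 * hyp_dist 0 x) * exp (C - 2 * hyp_dist x p)"
proof -
  let ?d = "hyp_dist 0 x"
  have "exp (- 2 * ?d) * visual 0 p q \<le> visual x p q" by (rule visual_base_change[OF zero_in_hyp x p q])
  then have "exp (2 * ?d) * (exp (- 2 * ?d) * visual 0 p q) \<le> exp (2 * ?d) * visual x p q" by (intro mult_left_mono) auto
  moreover have "exp (2 * ?d) * (exp (- 2 * ?d) * visual 0 p q) = visual 0 p q" by (simp flip: mult.assoc exp_add)
  ultimately have V: "visual 0 p q \<le> exp (2 * ?d) * visual x p q" by (rule ord_eq_le_trans[OF sym, rotated])
  have "visual x p q \<le> 4 * exp (hyp_dist p q - hyp_dist x p - hyp_dist x q)" by (rule visual_le_exp[OF p q])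
  then have "visual x p q \<le> 4 * exp (C - 2 * hyp_dist x p)" by (rule order_trans) (use le in simp)
  then have V': "exp (2 * ?d) * visual x p q \<le> exp (2 * ?d) * (4 * exp (C - 2 * hyp_dist x p))" by (intro mult_left_mono) auto
  have "visual 0 p q \<ge> (norm (p - q))\<^sup>2 / 2" by (rule visual_zero_ge[OF p q])
  with V V' show ?thesis unfolding norm_minus_commute[of q p] by linarith
qed

lemma foot_swap: "foot y \<eta> \<xi> = - foot y \<xi> \<eta>"
proof -
  have "horo \<eta> y / horo \<xi> y = inverse (horo \<xi> y / horo \<eta> y)" by simp
  then show ?thesis unfolding foot_def by (simp only: ln_inverse)
qed

lemma foot_diff:
  assumes "norm \<xi> = 1" "norm \<eta> = 1" "y \<in> hyp" "z \<in> hyp"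
  shows "foot y \<xi> \<eta> - foot z \<xi> \<eta> = (ln (horo \<xi> y / horo \<xi> z) + ln (horo \<eta> z / horo \<eta> y)) / 2"
  using horo_pos[OF assms(1,3)] horo_pos[OF assms(1,4)] horo_pos[OF assms(2,3)] horo_pos[OF assms(2,4)]
  by (simp add: foot_def ln_div diff_divide_distrib add_divide_distrib)

lemma foot_isom:
  assumes f: "f \<in> hyp_isometries" and n: "norm \<xi> = 1" "norm \<eta> = 1" and y: "y \<in> hyp" and z: "z \<in> hyp"
  shows "foot (f y) (bdry_act f \<xi>) (bdry_act f \<eta>) - foot (f z) (bdry_act f \<xi>) (bdry_act f \<eta>) = foot y \<xi> \<eta> - foot z \<xi> \<eta>"
  by (simp add: foot_diff n y z isom_in[OF f y] isom_in[OF f z] norm_bdry_act[OF f] horo_ratio_isom[OF f])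

lemma ln_horo_ratio_le_dist:
  assumes "norm \<xi> = 1" "y \<in> hyp" "z \<in> hyp"
  shows "ln (horo \<xi> y / horo \<xi> z) \<le> hyp_dist y z"
proof -
  have "ln (horo \<xi> y / horo \<xi> z) \<le> ln (exp (hyp_dist y z))"
    using assms by (subst ln_le_cancel_iff) (auto simp: horo_pos ln_horo_ratio_le)
  then show ?thesis by simp
qed

text \<open>By \<open>foot_diff\<close> the left-hand side is the mean of two Busemann differences,
  each at most the distance.\<close>

lemma foot_lipschitz:
  assumes n: "norm \<xi> = 1" "norm \<eta> = 1" and y: "y \<in> hyp" and z: "z \<in> hyp"
  shows "foot y \<xi> \<eta> - foot z \<xi> \<eta> \<le> hyp_dist y z"
  using ln_horo_ratio_le_dist[OF n(1) y z] ln_horo_ratio_le_dist[OF n(2) z y]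
  unfolding foot_diff[OF n y z] by (simp add: hyp_dist_commute[of z y])

section \<open>Ping-pong on the limit points\<close>

context crossing_pair
begin

text \<open>The ping-pong sets: nontrivial letters of \<open>K b\<close> map
  \<open>Lam (\<not> b)\<close> into \<open>Lam b\<close>, and the two sets are disjoint. The limit
  points \<open>Lam0 b\<close> of the factor itself are those at which a coding stops.\<close>

definition Lam :: "bool \<Rightarrow> (real ^ 'n) set" where "Lam b = accum x (Gam b)"

definition Lam0 :: "bool \<Rightarrow> (real ^ 'n) set" where "Lam0 b = accum x (K b)"

lemma Gam_sub_isom: "Gam b \<subseteq> hyp_isometries" using Gam_isom by blast

lemma K_sub_isom: "K b \<subseteq> hyp_isometries" using K_isom by blast

lemma star_isom: "a \<in> star (K b) \<Longrightarrow> a \<in> hyp_isometries" using K_isom by blast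

lemma Lam_norm: "\<xi> \<in> Lam b \<Longrightarrow> norm \<xi> = 1" by (simp add: Lam_def accum_norm)

lemma Lam0_norm: "\<xi> \<in> Lam0 b \<Longrightarrow> norm \<xi> = 1" by (simp add: Lam0_def accum_norm)

lemma Lam_seq:
  assumes "\<xi> \<in> Lam b"
  obtains \<gamma> where "\<And>n::nat. \<gamma> n \<in> Gam b" "(\<lambda>n. \<gamma> n x) \<longlonglongrightarrow> \<xi>" "norm \<xi> = 1"
  using assms unfolding Lam_def accum_iff by blast

text \<open>The limit of \<open>dist_Gam\<close> along orbit points tending to \<xi> and \<eta>,
  after multiplication by the conformal factors; it is what makes disjointness and the bound on
  \<open>gromov\<close> quantitative.\<close>

lemma Lam_sep:
  assumes \<xi>: "\<xi> \<in> Lam b" and \<eta>: "\<eta> \<in> Lam (\<not> b)"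
  shows "(norm (\<xi> - \<eta>))\<^sup>2 \<ge> exp (- 2 * R) * horo \<xi> x * horo \<eta> x"
proof -
  obtain g where g: "\<And>n::nat. g n \<in> Gam b" "(\<lambda>n. g n x) \<longlonglongrightarrow> \<xi>" and n1: "norm \<xi> = 1" by (rule Lam_seq[OF \<xi>]) blast
  obtain h where h: "\<And>n::nat. h n \<in> Gam (\<not> b)" "(\<lambda>n. h n x) \<longlonglongrightarrow> \<eta>" and n2: "norm \<eta> = 1" by (rule Lam_seq[OF \<eta>]) blast
  have gi: "g n x \<in> hyp" for n by (rule isom_in[OF Gam_isom[OF g(1)] x])
  have hi: "h n x \<in> hyp" for n by (rule isom_in[OF Gam_isom[OF h(1)] x])
  let ?e = "\<lambda>p :: real ^ 'n. 1 - (norm p)\<^sup>2"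
  have le: "exp (- 2 * R) / 2 * ((cosh (hyp_dist x (g n x)) * ?e (g n x)) * (cosh (hyp_dist x (h n x)) * ?e (h n x)))
    \<le> ?e (g n x) * ?e (h n x) + 2 * (norm (g n x - h n x))\<^sup>2" for n
  proof -
    define p q where "p = g n x" and "q = h n x"
    have p: "p \<in> hyp" and q: "q \<in> hyp" using gi hi by (auto simp: p_def q_def)
    have e: "?e p > 0" "?e q > 0" using one_minus_norm2_pos p q by auto
    have "hyp_dist p q \<ge> hyp_dist x p + hyp_dist x q - 2 * R"
      using dist_Gam[OF g(1) h(1), of n n] by (simp add: p_def q_def disp_def)
    then have "exp (- 2 * R) * (exp (hyp_dist x p) * exp (hyp_dist x q)) \<le> exp (hyp_dist p q)" by (simp flip: exp_add)
    moreover have "cosh (hyp_dist x p) * cosh (hyp_dist x q) \<le> exp (hyp_dist x p) * exp (hyp_dist x q)"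
      by (intro mult_mono cosh_le_exp cosh_hyp_dist(2) x p q) (auto simp: cosh_real_nonneg)
    then have "exp (- 2 * R) * (cosh (hyp_dist x p) * cosh (hyp_dist x q)) \<le> exp (- 2 * R) * (exp (hyp_dist x p) * exp (hyp_dist x q))"
      by (intro mult_left_mono) auto
    ultimately have "exp (- 2 * R) / 2 * (cosh (hyp_dist x p) * cosh (hyp_dist x q)) \<le> cosh (hyp_dist p q)"
      using exp_le_2_cosh[of "hyp_dist p q"] by linarith
    then have "exp (- 2 * R) / 2 * (cosh (hyp_dist x p) * cosh (hyp_dist x q)) * (?e p * ?e q) \<le> cosh (hyp_dist p q) * (?e p * ?e q)"
      by (rule mult_right_mono) (use e in simp)
    also have "\<dots> = ?e p * ?e q + 2 * (norm (p - q))\<^sup>2"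
      unfolding cosh_hyp_dist(1)[OF p q] using e by (simp add: distrib_right)
    finally show ?thesis by (simp add: p_def q_def ac_simps)
  qed
  have L1: "(\<lambda>n. exp (- 2 * R) / 2 * ((cosh (hyp_dist x (g n x)) * ?e (g n x)) * (cosh (hyp_dist x (h n x)) * ?e (h n x))))
    \<longlonglongrightarrow> exp (- 2 * R) / 2 * ((2 * horo \<xi> x) * (2 * horo \<eta> x))"
    by (intro tendsto_mult tendsto_const cosh_dist_bdry g(2) h(2) n1 n2 x always_eventually allI gi hi)
  have L2: "(\<lambda>n. ?e (g n x) * ?e (h n x) + 2 * (norm (g n x - h n x))\<^sup>2) \<longlonglongrightarrow> 0 * 0 + 2 * (norm (\<xi> - \<eta>))\<^sup>2"
    by (intro tendsto_add tendsto_mult tendsto_const tendsto_power tendsto_norm tendsto_diff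
        norm_bdry_tendsto[OF g(2) n1] norm_bdry_tendsto[OF h(2) n2] g(2) h(2))
  have "exp (- 2 * R) / 2 * ((2 * horo \<xi> x) * (2 * horo \<eta> x)) \<le> 0 * 0 + 2 * (norm (\<xi> - \<eta>))\<^sup>2"
    by (rule LIMSEQ_le[OF L1 L2]) (use le in blast)
  then show ?thesis by (simp add: ac_simps)
qed

lemma Lam_disjoint: "Lam b \<inter> Lam (\<not> b) = {}"
proof -
  have False if "\<xi> \<in> Lam b" "\<xi> \<in> Lam (\<not> b)" for \<xi>
    using Lam_sep[OF that] horo_pos[OF Lam_norm[OF that(1)] x] by (simp add: mult_le_0_iff)
  then show ?thesis by blast
qed

lemma gromov_le:
  assumes \<xi>: "\<xi> \<in> Lam b" and \<eta>: "\<eta> \<in> Lam (\<not> b)"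
  shows "gromov x \<xi> \<eta> \<le> 4 * exp (2 * R)"
proof -
  have "\<xi> \<noteq> \<eta>" using Lam_disjoint \<xi> \<eta> by blast
  then have pos: "(norm (\<xi> - \<eta>))\<^sup>2 > 0" by simp
  have le: "exp (2 * R) * (exp (- 2 * R) * horo \<xi> x * horo \<eta> x) \<le> exp (2 * R) * (norm (\<xi> - \<eta>))\<^sup>2"
    by (rule mult_left_mono[OF Lam_sep[OF \<xi> \<eta>]]) simp
  have eq: "exp (2 * R) * (exp (- 2 * R) * horo \<xi> x * horo \<eta> x) = horo \<xi> x * horo \<eta> x"
  proof -
    have "exp (2 * R) * exp (- 2 * R) = 1" by (simp flip: exp_add)
    moreover have "exp (2 * R) * (exp (- 2 * R) * horo \<xi> x * horo \<eta> x) = exp (2 * R) * exp (- 2 * R) * (horo \<xi> x * horo \<eta> x)"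
      by (simp only: ac_simps)
    ultimately show ?thesis by simp
  qed
  show ?thesis using le[unfolded eq] pos by (simp add: gromov_def divide_le_eq)
qed

text \<open>The limit of \<open>dist_Gam\<close> in its second argument only.\<close>

lemma Lam_horo:
  assumes \<xi>: "\<xi> \<in> Lam (\<not> b)" and \<gamma>: "\<gamma> \<in> Gam b"
  shows "ln (horo \<xi> (\<gamma> x) / horo \<xi> x) \<ge> disp x \<gamma> - 2 * R"
proof -
  obtain h where h: "\<And>n::nat. h n \<in> Gam (\<not> b)" "(\<lambda>n. h n x) \<longlonglongrightarrow> \<xi>" and n: "norm \<xi> = 1" by (rule Lam_seq[OF \<xi>]) blast
  have hi: "h n x \<in> hyp" for n by (rule isom_in[OF Gam_isom[OF h(1)] x])
  have "(\<lambda>n. hyp_dist (\<gamma> x) (h n x) - hyp_dist x (h n x)) \<longlonglongrightarrow> ln (horo \<xi> (\<gamma> x) / horo \<xi> x)"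
    by (rule dist_diff_tendsto[OF h(2) always_eventually[OF allI[OF hi]] n isom_in[OF Gam_isom[OF \<gamma>] x] x])
  then show ?thesis
  proof (rule LIMSEQ_le_const)
    show "\<exists>N. \<forall>n\<ge>N. disp x \<gamma> - 2 * R \<le> hyp_dist (\<gamma> x) (h n x) - hyp_dist x (h n x)"
      using dist_Gam[OF \<gamma> h(1)] by (intro exI[of _ 0]) (auto simp: disp_def algebra_simps)
  qed
qed

lemma Lam_act: "a \<in> star (K b) \<Longrightarrow> \<xi> \<in> Lam (\<not> b) \<Longrightarrow> bdry_act a \<xi> \<in> Lam b"
  unfolding Lam_def by (rule accum_bdry_act[OF star_isom Gam_sub_isom x _ star_mult_Gam])

lemma Lam0_act: "g \<in> K b \<Longrightarrow> \<xi> \<in> Lam0 b \<Longrightarrow> bdry_act g \<xi> \<in> Lam0 b"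
  unfolding Lam0_def by (rule accum_bdry_act[OF K_isom K_sub_isom x _ K_mult])

lemma Lam0_subset: "Lam0 b \<subseteq> Lam b"
proof
  fix \<xi> assume "\<xi> \<in> Lam0 b"
  then obtain g where n: "norm \<xi> = 1" and g: "\<forall>n::nat. g n \<in> K b" "(\<lambda>n. g n x) \<longlonglongrightarrow> \<xi>"
    unfolding Lam0_def accum_iff by blast
  have "\<xi> \<noteq> x" using x n by (auto simp: mem_ball)
  from tendsto_imp_eventually_ne[OF g(2) this] have ev: "\<forall>\<^sub>F n in sequentially. g n \<noteq> hone"
    by eventually_elim (use x in auto)
  \<comment> \<open>The identity is not a reduced word beginning in \<open>K b\<close>. It occurs
    only finitely often, since the sequence leaves \<open>x\<close>, so an arbitrary letter may
    replace it.\<close>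
  define h where "h n = (if g n = hone then far b else g n)" for n
  have "h n \<in> Gam b" for n using g(1) far(1)[of b] by (intro star_in_Gam) (auto simp: h_def)
  moreover have "\<forall>\<^sub>F n in sequentially. g n x = h n x" using ev by eventually_elim (simp add: h_def)
  from Lim_transform_eventually[OF g(2) this] have "(\<lambda>n. h n x) \<longlonglongrightarrow> \<xi>" .
  ultimately show "\<xi> \<in> Lam b" unfolding Lam_def accum_iff using n by blast
qed

text \<open>For distinct \<open>a\<close> and \<open>a'\<close> the quotient
  \<open>hinv a \<diamondop> a'\<close> is a letter, which would map a point of
  \<open>Lam (\<not> b)\<close> into \<open>Lam b\<close> and into \<open>Lam (\<not> b)\<close> at
  once.\<close>

lemma Lam_images_disjoint:
  assumes "a \<in> K b" "a' \<in> K b" "\<xi> \<in> Lam (\<not> b)" "\<eta> \<in> Lam (\<not> b)" "bdry_act a \<xi> = bdry_act a' \<eta>"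
  shows "a = a'"
proof (rule ccontr)
  assume ne: "a \<noteq> a'"
  note i = K_isom[OF assms(1)] K_isom[OF assms(2)]
  note n = Lam_norm[OF assms(3)] Lam_norm[OF assms(4)]
  have "\<xi> = bdry_act (hinv a) (bdry_act a' \<eta>)" using bdry_act_inv(2)[OF i(1) n(1)] assms(5) by simp
  also have "\<dots> = bdry_act (hinv a \<diamondop> a') \<eta>" using bdry_act_mult[OF isom_inv[OF i(1)] i(2) n(2)] by simp
  also have "\<dots> \<in> Lam b"
  proof (rule Lam_act[OF star_mult assms(4)])
    show "hinv a \<in> K b" "a' \<in> K b" using K_inv assms by auto
    show "hinv a \<noteq> hinv a'"
      using ne i BG.inv_inv isom_Bij carrier_hyp by metis
  qed
  finally show False using Lam_disjoint assms(3) by blast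
qed

lemma Lam0_images_disjoint:
  assumes "g \<in> K b" "\<xi> \<in> Lam0 b" "\<eta> \<in> Lam (\<not> b)"
  shows "\<xi> \<noteq> bdry_act g \<eta>"
proof
  assume "\<xi> = bdry_act g \<eta>"
  then have "bdry_act (hinv g) \<xi> = \<eta>" using bdry_act_inv(2)[OF K_isom[OF assms(1)] Lam_norm[OF assms(3)]] by simp
  moreover have "bdry_act (hinv g) \<xi> \<in> Lam b" using Lam0_act[OF K_inv[OF assms(1)] assms(2)] Lam0_subset by blast
  ultimately show False using Lam_disjoint assms(3) by blast
qed

lemma words_close:
  assumes w: "alt b (u @ v)"
  shows "(norm (word_val (u @ v) x - word_val u x))\<^sup>2 \<le> 8 * exp (2 * hyp_dist 0 x) * exp (2 * R - 2 * disp x (word_val u))"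
proof -
  have iu: "set u \<subseteq> hyp_isometries" and iv: "set v \<subseteq> hyp_isometries" using alt_isom[OF w] by auto
  note i = word_val_isom[OF iu] word_val_isom[OF iv]
  have eq: "word_val (u @ v) x = word_val u (word_val v x)"
    unfolding word_val_append[OF iu iv] using hmult_apply[OF isom_Bij isom_Bij x, OF i] .
  have "hyp_dist (word_val u x) (word_val (u @ v) x) = disp x (word_val v)"
    unfolding eq disp_def by (rule isom_dist[OF i(1) x isom_in[OF i(2) x]])
  then have "hyp_dist (word_val u x) (word_val (u @ v) x) \<le> hyp_dist x (word_val (u @ v) x) - hyp_dist x (word_val u x) + 2 * R"
    using disp_append[OF w] by (simp add: disp_def)
  from norm_diff_sq_le[OF x isom_in[OF i(1) x] isom_in[OF alt_val_isom[OF w] x] this] show ?thesis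
    by (simp add: disp_def)
qed

text \<open>Consider the first letters of the approximating words. If one of them recurs infinitely
  often, it can be stripped off. Otherwise their displacements tend to infinity, and by
  \<open>words_close\<close> the words converge to the same point as their first letters.\<close>

lemma Lam_decomp:
  assumes \<xi>: "\<xi> \<in> Lam b"
  shows "\<xi> \<in> Lam0 b \<or> (\<exists>a\<in>star (K b). \<exists>\<eta>\<in>Lam (\<not> b). \<xi> = bdry_act a \<eta>)"
proof -
  obtain g where g: "\<And>n::nat. g n \<in> Gam b" "(\<lambda>n. g n x) \<longlonglongrightarrow> \<xi>" and n: "norm \<xi> = 1" by (rule Lam_seq[OF \<xi>]) blast
  have "\<forall>n. \<exists>a v. alt b (a # v) \<and> g n = word_val (a # v)"
  proof
    fix n obtain w where "w \<noteq> []" "alt b w" "g n = word_val w" using g(1)[of n] unfolding Gam_eq by blast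
    then show "\<exists>a v. alt b (a # v) \<and> g n = word_val (a # v)" by (cases w) auto
  qed
  then obtain a v where av: "\<And>n. alt b (a n # v n)" "\<And>n. g n = word_val (a n # v n)" by metis
  have as: "a n \<in> star (K b)" and vs: "alt (\<not> b) (v n)" for n using av(1)[of n] by auto
  have geq: "g n = a n \<diamondop> word_val (v n)" for n using av(2)[of n] by simp
  show ?thesis
  proof (cases "\<exists>c. infinite {n. a n = c}")
    case True
    then obtain c where c: "infinite {n. a n = c}" by blast
    then obtain m where "a m = c" by (metis (mono_tags, lifting) Collect_empty_eq finite.emptyI)
    then have cs: "c \<in> star (K b)" using as by blast
    note ci = star_isom[OF cs]
    \<comment> \<open>A word consisting of \<open>c\<close> alone always gives the interior point
      \<open>c x\<close>, which cannot be a limit on the sphere.\<close>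
    have fin: "finite {n. a n = c \<and> v n = []}"
    proof (rule ccontr)
      assume "infinite {n. a n = c \<and> v n = []}"
      from infinite_enumerate[OF this] obtain r where r: "strict_mono r" "\<And>k::nat. r k \<in> {n. a n = c \<and> v n = []}" by blast
      have "(\<lambda>k. g (r k) x) \<longlonglongrightarrow> \<xi>" using LIMSEQ_subseq_LIMSEQ[OF g(2) r(1)] by (simp add: o_def)
      moreover have "g (r k) x = (c \<diamondop> hone) x" for k using r(2)[of k] geq[of "r k"] by simp
      ultimately have "(\<lambda>k::nat. (c \<diamondop> hone) x) \<longlonglongrightarrow> \<xi>" by simp
      then have "\<xi> = (c \<diamondop> hone) x" using LIMSEQ_const_iff by metis
      moreover have "(c \<diamondop> hone) x \<in> hyp" by (rule isom_in[OF isom_mult[OF ci isom_one] x])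
      ultimately show False using n by (simp add: mem_ball)
    qed
    have "{n. a n = c} \<subseteq> {n. a n = c \<and> v n = []} \<union> {n. a n = c \<and> v n \<noteq> []}" by blast
    then have "finite {n. a n = c \<and> v n \<noteq> []} \<Longrightarrow> finite {n. a n = c}" by (rule finite_subset) (rule finite_UnI[OF fin])
    then have "infinite {n. a n = c \<and> v n \<noteq> []}" using c by (rule contrapos_nn[rotated])
    from infinite_enumerate[OF this] obtain r where r: "strict_mono r" "\<And>k::nat. r k \<in> {n. a n = c \<and> v n \<noteq> []}" by blast
    have vi: "word_val (v k) \<in> hyp_isometries" for k by (rule alt_val_isom[OF vs])
    have "(\<lambda>k. g (r k) x) \<longlonglongrightarrow> \<xi>" using LIMSEQ_subseq_LIMSEQ[OF g(2) r(1)] by (simp add: o_def)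
    from bdry_act_tendsto[OF isom_inv[OF ci] n this always_eventually[OF allI]]
    have "(\<lambda>k. hinv c (g (r k) x)) \<longlonglongrightarrow> bdry_act (hinv c) \<xi>" using isom_in[OF Gam_isom[OF g(1)] x] by blast
    moreover have "hinv c (g (r k) x) = word_val (v (r k)) x" for k
    proof -
      have "g (r k) x = c (word_val (v (r k)) x)"
        using geq[of "r k"] r(2)[of k] hmult_apply[OF isom_Bij[OF ci] isom_Bij[OF vi] x] by simp
      then show ?thesis using isom_hinv_apply(2)[OF ci isom_in[OF vi x]] by simp
    qed
    ultimately have "(\<lambda>k. word_val (v (r k)) x) \<longlonglongrightarrow> bdry_act (hinv c) \<xi>" by simp
    moreover have "word_val (v (r k)) \<in> Gam (\<not> b)" for k using r(2)[of k] by (intro val_in_Gam vs) simp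
    ultimately have "bdry_act (hinv c) \<xi> \<in> Lam (\<not> b)"
      unfolding Lam_def accum_iff using norm_bdry_act[OF isom_inv[OF ci] n]
      by (intro conjI exI[of _ "\<lambda>k. word_val (v (r k))"]) auto
    moreover have "\<xi> = bdry_act c (bdry_act (hinv c) \<xi>)" using bdry_act_inv(1)[OF ci n] by simp
    ultimately show ?thesis using cs by blast
  next
    case False
    have fin: "finite {n. disp x (a n) \<le> Z}" for Z
    proof (rule finite_subset)
      show "{n. disp x (a n) \<le> Z} \<subseteq> (\<Union>c\<in>{c \<in> K b. hyp_dist x (c x) \<le> Z}. {n. a n = c})"
        using as by (auto simp: disp_def)
      show "finite (\<Union>c\<in>{c \<in> K b. hyp_dist x (c x) \<le> Z}. {n. a n = c})"
        using False by (intro finite_UN_I kleinian_finite_bounded_displacement[OF kleinian x]) auto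
    qed
    have "filterlim (\<lambda>n. disp x (a n)) at_top sequentially"
      unfolding filterlim_at_top_gt[where c = 0]
    proof (intro allI impI)
      fix Z :: real
      have "\<forall>\<^sub>F n in cofinite. \<not> disp x (a n) \<le> Z" unfolding eventually_cofinite using fin[of Z] by simp
      then show "\<forall>\<^sub>F n in sequentially. Z \<le> disp x (a n)" unfolding cofinite_eq_sequentially by eventually_elim simp
    qed
    then have lim0: "((\<lambda>n. 8 * exp (2 * hyp_dist 0 x) * exp (2 * R - 2 * disp x (a n))) \<longlongrightarrow> 0) sequentially"
    proof (rule filterlim_compose[rotated])
      show "((\<lambda>t. 8 * exp (2 * hyp_dist 0 x) * exp (2 * R - 2 * t)) \<longlongrightarrow> 0) at_top" by real_asymp
    qed
    have bd: "(norm (g k x - a k x))\<^sup>2 \<le> 8 * exp (2 * hyp_dist 0 x) * exp (2 * R - 2 * disp x (a k))" for k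
    proof -
      have one: "word_val [a k] = a k" using star_isom[OF as] by simp
      show ?thesis using words_close[of b "[a k]" "v k"] av(1)[of k] unfolding one av(2) by simp
    qed
    have "(\<lambda>n. (norm (g n x - a n x))\<^sup>2) \<longlonglongrightarrow> 0"
      by (rule Lim_null_comparison[OF always_eventually[OF allI] lim0]) (use bd in simp)
    then have "(\<lambda>n. sqrt ((norm (g n x - a n x))\<^sup>2)) \<longlonglongrightarrow> sqrt 0" by (rule tendsto_real_sqrt)
    then have "(\<lambda>n. g n x - a n x) \<longlonglongrightarrow> 0" by (simp add: tendsto_norm_zero_iff)
    from tendsto_diff[OF g(2) this] have "(\<lambda>n. a n x) \<longlonglongrightarrow> \<xi>" by simp
    then have "\<xi> \<in> Lam0 b" unfolding Lam0_def accum_iff using n as by blast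
    then show ?thesis ..
  qed
qed

lemma limit_set_subset: "limit_set \<Gamma> \<subseteq> Lam True \<union> Lam False"
proof -
  have sub: "(\<lambda>g. g x) ` \<Gamma> \<subseteq> {x} \<union> ((\<lambda>g. g x) ` Gam True \<union> (\<lambda>g. g x) ` Gam False)"
  proof
    fix p assume "p \<in> (\<lambda>g. g x) ` \<Gamma>"
    then obtain g where g: "g \<in> \<Gamma>" "p = g x" by blast
    then consider "g = hone" | b where "g \<in> Gam b" using \<Gamma>_cases by blast
    then show "p \<in> {x} \<union> ((\<lambda>g. g x) ` Gam True \<union> (\<lambda>g. g x) ` Gam False)"
    proof cases
      case 1 then show ?thesis using g(2) x by simp
    next
      case (2 b) then show ?thesis using g(2) by (cases b) auto
    qed
  qed
  have "limit_set \<Gamma> = accum 0 \<Gamma>" by (simp add: limit_set_def accum_def)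
  also have "\<dots> \<subseteq> accum x \<Gamma>" by (rule accum_base_change[OF \<Gamma>_isom x zero_in_hyp])
  also have "\<dots> \<subseteq> hyp_bdry \<inter> ({x} \<union> (closure ((\<lambda>g. g x) ` Gam True) \<union> closure ((\<lambda>g. g x) ` Gam False)))"
    using closure_mono[OF sub] unfolding accum_def closure_Un by auto
  also have "\<dots> \<subseteq> Lam True \<union> Lam False" using x by (auto simp: Lam_def accum_def mem_ball)
  finally show ?thesis .
qed

section \<open>Coding by infinite reduced words\<close>

text \<open>The exceptional points, made invariant under \<Gamma>. Off this set the first
  alternative of \<open>Lam_decomp\<close> never occurs, so the coding continues forever.\<close>

definition N :: "(real ^ 'n) set" where "N = (\<Union>\<gamma>\<in>\<Gamma>. bdry_act \<gamma> ` (Lam0 True \<union> Lam0 False))"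

definition Z :: "bool \<Rightarrow> (real ^ 'n) set" where "Z b = Lam b - N"

lemma \<Gamma>_isom': "\<gamma> \<in> \<Gamma> \<Longrightarrow> \<gamma> \<in> hyp_isometries" using \<Gamma>_isom by blast

lemma \<Gamma>_mult: "g \<in> \<Gamma> \<Longrightarrow> h \<in> \<Gamma> \<Longrightarrow> g \<diamondop> h \<in> \<Gamma>" by (rule subgroup.m_closed[OF \<Gamma>_sub])

lemma \<Gamma>_inv: "g \<in> \<Gamma> \<Longrightarrow> hinv g \<in> \<Gamma>" by (rule subgroup.m_inv_closed[OF \<Gamma>_sub])

lemma \<Gamma>_one: "hone \<in> \<Gamma>" by (rule subgroup.one_closed[OF \<Gamma>_sub])

lemma alt_\<Gamma>: "alt b w \<Longrightarrow> word_val w \<in> \<Gamma>" using \<Gamma>_words by blast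

lemma N_act: "\<gamma> \<in> \<Gamma> \<Longrightarrow> \<xi> \<in> N \<Longrightarrow> bdry_act \<gamma> \<xi> \<in> N"
proof -
  assume \<gamma>: "\<gamma> \<in> \<Gamma>" and "\<xi> \<in> N"
  then obtain g \<zeta> where g: "g \<in> \<Gamma>" "\<zeta> \<in> Lam0 True \<union> Lam0 False" "\<xi> = bdry_act g \<zeta>" unfolding N_def by blast
  have n: "norm \<zeta> = 1" using g(2) Lam0_norm by blast
  have "bdry_act \<gamma> \<xi> = bdry_act (\<gamma> \<diamondop> g) \<zeta>" unfolding g(3) using bdry_act_mult[OF \<Gamma>_isom'[OF \<gamma>] \<Gamma>_isom'[OF g(1)] n] by simp
  then show ?thesis unfolding N_def using \<Gamma>_mult[OF \<gamma> g(1)] g(2) by blast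
qed

lemma N_act_iff:
  assumes "\<gamma> \<in> \<Gamma>" "norm \<xi> = 1" shows "bdry_act \<gamma> \<xi> \<in> N \<longleftrightarrow> \<xi> \<in> N"
  using N_act[OF assms(1)] N_act[OF \<Gamma>_inv[OF assms(1)], of "bdry_act \<gamma> \<xi>"] bdry_act_inv(2)[OF \<Gamma>_isom'[OF assms(1)] assms(2)] by auto

lemma Lam0_N: "Lam0 b \<subseteq> N"
proof
  fix \<xi> assume \<xi>: "\<xi> \<in> Lam0 b"
  then have "\<xi> \<in> Lam0 True \<union> Lam0 False" by (cases b) auto
  moreover have "\<xi> = bdry_act hone \<xi>" using bdry_act_one[OF Lam0_norm[OF \<xi>]] by simp
  ultimately show "\<xi> \<in> N" unfolding N_def using \<Gamma>_one by blast
qed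

lemma Z_norm: "\<xi> \<in> Z b \<Longrightarrow> norm \<xi> = 1" using Lam_norm by (auto simp: Z_def)

lemma Z_Lam: "\<xi> \<in> Z b \<Longrightarrow> \<xi> \<in> Lam b" by (simp add: Z_def)

lemma star_\<Gamma>: "a \<in> star (K b) \<Longrightarrow> a \<in> \<Gamma>" using K_\<Gamma> by blast

lemma Z_act: "a \<in> star (K b) \<Longrightarrow> \<xi> \<in> Z (\<not> b) \<Longrightarrow> bdry_act a \<xi> \<in> Z b"
  using Lam_act[of a b \<xi>] N_act_iff[OF star_\<Gamma>, of a b \<xi>] Lam_norm[of \<xi>] by (auto simp: Z_def)

lemma Z_decomp:
  assumes "\<xi> \<in> Z b" obtains a \<eta> where "a \<in> star (K b)" "\<eta> \<in> Z (\<not> b)" "\<xi> = bdry_act a \<eta>"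
proof -
  have "\<xi> \<notin> Lam0 b" using assms Lam0_N by (auto simp: Z_def)
  then obtain a \<eta> where a: "a \<in> star (K b)" "\<eta> \<in> Lam (\<not> b)" "\<xi> = bdry_act a \<eta>" using Lam_decomp[OF Z_Lam[OF assms]] by blast
  then have "\<eta> \<in> Z (\<not> b)" using assms N_act_iff[OF star_\<Gamma>[OF a(1)] Lam_norm[OF a(2)]] by (simp add: Z_def)
  with a that show thesis by blast
qed

lemma Z_word_act: "alt b w \<Longrightarrow> \<xi> \<in> Z (b \<longleftrightarrow> even (length w)) \<Longrightarrow> bdry_act (word_val w) \<xi> \<in> Z b"
proof (induction w arbitrary: b)
  case Nil then show ?case by (simp add: Z_norm)
next
  case (Cons a w)
  have t: "(\<not> b \<longleftrightarrow> even (length w)) = (b \<longleftrightarrow> even (length (a # w)))" by auto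
  have w: "alt (\<not> b) w" and a: "a \<in> star (K b)" using Cons.prems(1) by auto
  have "bdry_act (word_val w) \<xi> \<in> Z (\<not> b)" using Cons.IH[OF w] Cons.prems(2) unfolding t .
  from Z_act[OF a this] show ?case
    using bdry_act_mult[OF star_isom[OF a] alt_val_isom[OF w] Z_norm[OF Cons.prems(2)]] by simp
qed

lemma Z_coding:
  "\<xi> \<in> Z b \<Longrightarrow> \<exists>w \<eta>. alt b w \<and> length w = k \<and> \<eta> \<in> Z (b \<longleftrightarrow> even k) \<and> \<xi> = bdry_act (word_val w) \<eta>"
proof (induction k arbitrary: b \<xi>)
  case 0
  then have "\<xi> = bdry_act (word_val []) \<xi>" using Z_norm[of \<xi> b] by simp
  with 0 show ?case by (intro exI[of _ "[]"] exI[of _ \<xi>]) simp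
next
  case (Suc k)
  obtain a \<eta> where a: "a \<in> star (K b)" "\<eta> \<in> Z (\<not> b)" "\<xi> = bdry_act a \<eta>" by (rule Z_decomp[OF Suc.prems])
  obtain w \<zeta> where w: "alt (\<not> b) w" "length w = k" "\<zeta> \<in> Z (\<not> b \<longleftrightarrow> even k)" "\<eta> = bdry_act (word_val w) \<zeta>"
    using Suc.IH[OF a(2)] by blast
  have "(\<not> b \<longleftrightarrow> even k) = (b \<longleftrightarrow> even (Suc k))" by auto
  with w(3) have z: "\<zeta> \<in> Z (b \<longleftrightarrow> even (Suc k))" by (simp only:)
  have "\<xi> = bdry_act (word_val (a # w)) \<zeta>"
    using bdry_act_mult[OF star_isom[OF a(1)] alt_val_isom[OF w(1)] Z_norm[OF w(3)]] a(3) w(4) by simp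
  with a w z show ?case by (intro exI[of _ "a # w"] exI[of _ \<zeta>]) simp
qed

text \<open>The words are distinct and so are their values, by freeness; only finitely many elements
  have bounded displacement.\<close>

lemma long_words:
  assumes W: "\<And>k. alt b (W k)" "\<And>k. length (W k) = k"
  shows "\<exists>k>0. disp x (word_val (W k)) > D"
proof (rule ccontr)
  assume no: "\<not> ?thesis"
  have "inj_on (\<lambda>k. word_val (W k)) {0<..}"
    by (rule inj_onI) (metis word_val_inj W)
  moreover have "(\<lambda>k. word_val (W k)) ` {0<..} \<subseteq> {g \<in> \<Gamma>. hyp_dist x (g x) \<le> D}"
  proof -
    have "disp x (word_val (W k)) \<le> D" if "k > 0" for k using no that not_less by blast
    then show ?thesis using alt_\<Gamma>[OF W(1)] by (auto simp: disp_def)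
  qed
  ultimately have "finite {0::nat<..}" using finite_\<Gamma>[OF x] by (meson finite_imageD finite_subset)
  then show False by (simp add: infinite_Ioi)
qed

lemma Z_long_coding:
  assumes "\<xi> \<in> Z b"
  obtains w \<eta> where "alt b w" "w \<noteq> []" "disp x (word_val w) > D" "\<eta> \<in> Z (b \<longleftrightarrow> even (length w))" "\<xi> = bdry_act (word_val w) \<eta>"
proof -
  have "\<forall>k. \<exists>w \<eta>. alt b w \<and> length w = k \<and> \<eta> \<in> Z (b \<longleftrightarrow> even k) \<and> \<xi> = bdry_act (word_val w) \<eta>"
    using Z_coding[OF assms] by blast
  then obtain W E where W: "\<And>k. alt b (W k)" "\<And>k. length (W k) = k" "\<And>k. E k \<in> Z (b \<longleftrightarrow> even k)" "\<And>k. \<xi> = bdry_act (word_val (W k)) (E k)"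
    by metis
  obtain k where k: "k > 0" "disp x (word_val (W k)) > D" using long_words[OF W(1,2)] by blast
  have "W k \<noteq> []" using W(2)[of k] k(1) by auto
  moreover have "E k \<in> Z (b \<longleftrightarrow> even (length (W k)))" using W(2,3)[of k] by simp
  ultimately show thesis using that[OF W(1) _ k(2) _ W(4)] by blast
qed

lemma Lam_word_close:
  assumes w: "alt b w" and \<eta>: "\<eta> \<in> Lam (b \<longleftrightarrow> even (length w))"
  shows "(norm (bdry_act (word_val w) \<eta> - word_val w x))\<^sup>2 \<le> 8 * exp (2 * hyp_dist 0 x) * exp (2 * R - 2 * disp x (word_val w))"
proof -
  obtain h where h: "\<And>n::nat. h n \<in> Gam (b \<longleftrightarrow> even (length w))" "(\<lambda>n. h n x) \<longlonglongrightarrow> \<eta>" and n: "norm \<eta> = 1" by (rule Lam_seq[OF \<eta>]) blast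
  note i = alt_val_isom[OF w]
  have hi: "h n x \<in> hyp" for n by (rule isom_in[OF Gam_isom[OF h(1)] x])
  have le: "(norm (word_val w (h n x) - word_val w x))\<^sup>2 \<le> 8 * exp (2 * hyp_dist 0 x) * exp (2 * R - 2 * disp x (word_val w))" for n
  proof -
    obtain v where v: "alt (b \<longleftrightarrow> even (length w)) v" "h n = word_val v" using h(1)[of n] unfolding Gam_eq by blast
    have wv: "alt b (w @ v)" using w v(1) by (simp add: alt_append)
    have "word_val (w @ v) x = word_val w (h n x)"
      unfolding word_val_append[OF alt_isom[OF w] alt_isom[OF v(1)]] v(2)
      by (rule hmult_apply[OF isom_Bij[OF i] isom_Bij[OF alt_val_isom[OF v(1)]] x])
    with words_close[OF wv] show ?thesis by simp
  qed
  have "(\<lambda>n. word_val w (h n x)) \<longlonglongrightarrow> bdry_act (word_val w) \<eta>"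
    by (rule bdry_act_tendsto[OF i n h(2) always_eventually[OF allI[OF hi]]])
  then have "(\<lambda>n. (norm (word_val w (h n x) - word_val w x))\<^sup>2) \<longlonglongrightarrow> (norm (bdry_act (word_val w) \<eta> - word_val w x))\<^sup>2"
    by (intro tendsto_intros)
  then show ?thesis by (rule LIMSEQ_le_const2) (use le in blast)
qed

text \<open>The common prefix of the two codings is removed. It cannot have arbitrary length,
  because by \<open>Lam_word_close\<close> long prefixes determine the point. Once the first letters
  \<open>a\<close> and \<open>a'\<close> of the remainders differ, removing \<open>a\<close> from
  both leaves points of opposite type.\<close>

lemma opposite_types:
  assumes \<xi>: "\<xi> \<in> Z b" and \<eta>: "\<eta> \<in> Z c" and ne: "\<xi> \<noteq> \<eta>"
  obtains \<gamma> t \<xi>' \<eta>' where "\<gamma> \<in> \<Gamma>" "\<xi>' \<in> Z (\<not> t)" "\<eta>' \<in> Z t" "\<xi> = bdry_act \<gamma> \<xi>'" "\<eta> = bdry_act \<gamma> \<eta>'"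
proof (cases "b = c")
  case False
  then have "\<xi> \<in> Z (\<not> c)" using \<xi> by (cases b; cases c) auto
  from that[OF \<Gamma>_one this \<eta>] show thesis using Z_norm[OF \<xi>] Z_norm[OF \<eta>] by simp
next
  case True
  define same where "same k w \<xi>' \<eta>' \<longleftrightarrow> alt b w \<and> length w = k \<and> \<xi>' \<in> Z (b \<longleftrightarrow> even k) \<and> \<eta>' \<in> Z (b \<longleftrightarrow> even k) \<and>
      \<xi> = bdry_act (word_val w) \<xi>' \<and> \<eta> = bdry_act (word_val w) \<eta>'" for k w \<xi>' \<eta>'
  have no: "\<not> (\<forall>k. \<exists>w \<xi>' \<eta>'. same k w \<xi>' \<eta>')"
  proof
    assume "\<forall>k. \<exists>w \<xi>' \<eta>'. same k w \<xi>' \<eta>'"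
    then obtain W X Y where S: "\<And>k. same k (W k) (X k) (Y k)" by metis
    then have W: "\<And>k. alt b (W k)" "\<And>k. length (W k) = k" by (auto simp: same_def)
    define A where "A = 8 * exp (2 * hyp_dist 0 x) * exp (2 * R)"
    have A: "A > 0" by (simp add: A_def)
    have pos: "(norm (\<xi> - \<eta>))\<^sup>2 > 0" using ne by simp
    have le: "(norm (\<xi> - \<eta>))\<^sup>2 \<le> 4 * A * exp (- 2 * disp x (word_val (W k)))" for k
    proof -
      let ?p = "word_val (W k) x"
      have c: "(norm (\<zeta> - ?p))\<^sup>2 \<le> A * exp (- 2 * disp x (word_val (W k)))"
        if "\<zeta>' \<in> Z (b \<longleftrightarrow> even k)" "\<zeta> = bdry_act (word_val (W k)) \<zeta>'" for \<zeta> \<zeta>'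
      proof -
        have "\<zeta>' \<in> Lam (b \<longleftrightarrow> even (length (W k)))" using Z_Lam[OF that(1)] W(2) by simp
        from Lam_word_close[OF W(1) this] show ?thesis by (simp add: that(2) A_def exp_diff exp_minus field_simps)
      qed
      have 1: "(norm (\<xi> - ?p))\<^sup>2 \<le> A * exp (- 2 * disp x (word_val (W k)))"
        using S[of k] by (intro c[of "X k"]) (auto simp: same_def)
      have 2: "(norm (\<eta> - ?p))\<^sup>2 \<le> A * exp (- 2 * disp x (word_val (W k)))"
        using S[of k] by (intro c[of "Y k"]) (auto simp: same_def)
      have "norm (\<xi> - \<eta>) \<le> norm (\<xi> - ?p) + norm (\<eta> - ?p)" using norm_triangle_ineq4[of "\<xi> - ?p" "\<eta> - ?p"] by simp
      then have "(norm (\<xi> - \<eta>))\<^sup>2 \<le> (norm (\<xi> - ?p) + norm (\<eta> - ?p))\<^sup>2" by (rule power_mono) simp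
      also have "\<dots> \<le> 2 * (norm (\<xi> - ?p))\<^sup>2 + 2 * (norm (\<eta> - ?p))\<^sup>2"
        using sum_squares_bound[of "norm (\<xi> - ?p)" "norm (\<eta> - ?p)"] by (simp add: power2_sum)
      finally show ?thesis using 1 2 by simp
    qed
    obtain k where k: "disp x (word_val (W k)) > ln (4 * A / (norm (\<xi> - \<eta>))\<^sup>2) / 2" using long_words[OF W] by blast
    have "exp (- 2 * disp x (word_val (W k))) < exp (- ln (4 * A / (norm (\<xi> - \<eta>))\<^sup>2))" using k by simp
    also have "\<dots> = (norm (\<xi> - \<eta>))\<^sup>2 / (4 * A)" using A pos by (simp add: exp_minus)
    finally have "4 * A * exp (- 2 * disp x (word_val (W k))) < (norm (\<xi> - \<eta>))\<^sup>2" using A by (simp add: field_simps)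
    with le[of k] show False by simp
  qed
  have zero: "same 0 [] \<xi> \<eta>" using \<xi> \<eta> True Z_norm[OF \<xi>] Z_norm[OF \<eta>] by (simp add: same_def)
  have "\<exists>k. (\<exists>w \<xi>' \<eta>'. same k w \<xi>' \<eta>') \<and> \<not> (\<exists>w \<xi>' \<eta>'. same (Suc k) w \<xi>' \<eta>')"
  proof (rule ccontr)
    assume step: "\<not> ?thesis"
    have "\<exists>w \<xi>' \<eta>'. same k w \<xi>' \<eta>'" for k
    proof (induction k)
      case 0 show ?case using zero by blast
    next
      case (Suc k) then show ?case using step by blast
    qed
    with no show False by blast
  qed
  then obtain k where k: "\<exists>w \<xi>' \<eta>'. same k w \<xi>' \<eta>'" and nk: "\<not> (\<exists>w \<xi>' \<eta>'. same (Suc k) w \<xi>' \<eta>')" by blast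
  from k obtain w \<xi>' \<eta>' where s: "same k w \<xi>' \<eta>'" by blast
  define t where "t \<longleftrightarrow> (b \<longleftrightarrow> even k)"
  have w: "alt b w" "length w = k" "\<xi>' \<in> Z t" "\<eta>' \<in> Z t" "\<xi> = bdry_act (word_val w) \<xi>'" "\<eta> = bdry_act (word_val w) \<eta>'"
    using s by (auto simp: same_def t_def)
  obtain a \<xi>'' where a: "a \<in> star (K t)" "\<xi>'' \<in> Z (\<not> t)" "\<xi>' = bdry_act a \<xi>''" by (rule Z_decomp[OF w(3)])
  obtain a' \<eta>'' where a': "a' \<in> star (K t)" "\<eta>'' \<in> Z (\<not> t)" "\<eta>' = bdry_act a' \<eta>''" by (rule Z_decomp[OF w(4)])
  note ai = star_isom[OF a(1)] star_isom[OF a'(1)] and wi = alt_val_isom[OF w(1)]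
  have act: "bdry_act (word_val w) (bdry_act g \<zeta>) = bdry_act (word_val w \<diamondop> g) \<zeta>" if "g \<in> hyp_isometries" "norm \<zeta> = 1" for g \<zeta>
    using bdry_act_mult[OF wi that] by simp
  have ne: "a \<noteq> a'"
  proof
    assume aa: "a = a'"
    have wa: "alt b (w @ [a])" using w(1,2) a(1) by (simp add: alt_append t_def)
    have "word_val (w @ [a]) = word_val w \<diamondop> a"
      using word_val_append[OF alt_isom[OF w(1)], of "[a]"] ai by simp
    moreover have "(b \<longleftrightarrow> even (Suc k)) = (\<not> t)" by (auto simp: t_def)
    ultimately have "same (Suc k) (w @ [a]) \<xi>'' \<eta>''"
      unfolding same_def using wa w a a' aa act[OF ai(1) Z_norm[OF a(2)]] act[OF ai(1) Z_norm[OF a'(2)]] by simp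
    with nk show False by blast
  qed
  have aa: "hinv a \<diamondop> a' \<in> star (K t)"
  proof (rule star_mult)
    show "hinv a \<noteq> hinv a'" using ne ai BG.inv_inv isom_Bij carrier_hyp by metis
  qed (use K_inv a a' in auto)
  have i: "hinv a \<diamondop> a' \<in> hyp_isometries" using ai by simp
  show thesis
  proof (rule that[of "word_val w \<diamondop> a" \<xi>'' t "bdry_act (hinv a \<diamondop> a') \<eta>''"])
    show "word_val w \<diamondop> a \<in> \<Gamma>" by (rule \<Gamma>_mult[OF alt_\<Gamma>[OF w(1)] star_\<Gamma>[OF a(1)]])
    show "bdry_act (hinv a \<diamondop> a') \<eta>'' \<in> Z t" by (rule Z_act[OF aa a'(2)])
    show "\<xi> = bdry_act (word_val w \<diamondop> a) \<xi>''" using act[OF ai(1) Z_norm[OF a(2)]] w(5) a(3) by simp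
    have "\<eta>' = bdry_act a (bdry_act (hinv a \<diamondop> a') \<eta>'')"
      unfolding a'(3) bdry_act_mult[OF isom_inv[OF ai(1)] ai(2) Z_norm[OF a'(2)]]
      using bdry_act_inv(1)[OF ai(1) norm_bdry_act[OF ai(2) Z_norm[OF a'(2)]]] by simp
    then show "\<eta> = bdry_act (word_val w \<diamondop> a) (bdry_act (hinv a \<diamondop> a') \<eta>'')"
      using act[OF ai(1) norm_bdry_act[OF i Z_norm[OF a'(2)]]] w(6) by simp
  qed (use a in auto)
qed

section \<open>Cutting a line at its crossings\<close>

text \<open>The increase of \<open>foot\<close> is the mean of two Busemann differences, one at each
  end of the line; \<open>Lam_horo\<close> bounds the first for \<gamma> and the second for its
  inverse.\<close>

lemma foot_growth:
  assumes w: "alt b w" "w \<noteq> []" and \<xi>: "\<xi> \<in> Lam (\<not> b)" and \<eta>: "\<eta> \<in> Lam (b \<longleftrightarrow> even (length w))"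
  defines "\<gamma> \<equiv> word_val w"
  shows "foot (\<gamma> x) \<xi> (bdry_act \<gamma> \<eta>) - foot x \<xi> (bdry_act \<gamma> \<eta>) \<ge> disp x \<gamma> - 2 * R"
proof -
  note n = Lam_norm[OF \<xi>] Lam_norm[OF \<eta>]
  have i: "\<gamma> \<in> hyp_isometries" unfolding \<gamma>_def by (rule alt_val_isom[OF w(1)])
  have n2: "norm (bdry_act \<gamma> \<eta>) = 1" by (rule norm_bdry_act[OF i n(2)])
  have 1: "ln (horo \<xi> (\<gamma> x) / horo \<xi> x) \<ge> disp x \<gamma> - 2 * R"
    unfolding \<gamma>_def by (rule Lam_horo[OF \<xi> val_in_Gam[OF w]])
  have t: "(b \<longleftrightarrow> odd (length w)) = (\<not> (b \<longleftrightarrow> even (length w)))" by auto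
  have "hinv \<gamma> \<in> Gam (\<not> (b \<longleftrightarrow> even (length w)))"
    unfolding \<gamma>_def word_val_inv[OF w(1), symmetric] t[symmetric] using w by (intro val_in_Gam alt_rev_inv) auto
  from Lam_horo[OF _ this, of \<eta>] \<eta> have "ln (horo \<eta> (hinv \<gamma> x) / horo \<eta> x) \<ge> disp x (hinv \<gamma>) - 2 * R" by simp
  also have "horo \<eta> (hinv \<gamma> x) / horo \<eta> x = horo (bdry_act \<gamma> \<eta>) x / horo (bdry_act \<gamma> \<eta>) (\<gamma> x)"
    using horo_ratio_isom[OF i n(2) isom_in[OF isom_inv[OF i] x] x] isom_hinv_apply(1)[OF i x] by simp
  finally have 2: "ln (horo (bdry_act \<gamma> \<eta>) x / horo (bdry_act \<gamma> \<eta>) (\<gamma> x)) \<ge> disp x \<gamma> - 2 * R"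
    using i x by simp
  show ?thesis unfolding foot_diff[OF n(1) n2 isom_in[OF i x] x] using 1 2 by simp
qed

text \<open>The lines from \<open>\<xi>\<close> to \<open>\<eta>\<close> that pass from \<open>x\<close> to \<open>a x\<close>; the parameter is the one of \<open>line\<close>.\<close>

definition crossing :: "bool \<Rightarrow> (real ^ 'n \<Rightarrow> real ^ 'n) \<Rightarrow> real ^ 'n \<Rightarrow> real ^ 'n \<Rightarrow> real \<Rightarrow> bool" where
  "crossing b a \<xi> \<eta> t \<longleftrightarrow> \<xi> \<in> Lam (\<not> b) \<and> \<eta> \<in> bdry_act a ` Lam (\<not> b) \<and> foot x \<xi> \<eta> \<le> t \<and> t < foot (a x) \<xi> \<eta>"

text \<open>The line through (\<xi>, \<eta>) at parameter \<open>t\<close> is a translate of a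
  crossing. The origin of a line is fixed by the centre of the ball and not equivariant, whereas
  \<open>foot\<close> is, which explains the correction of the parameter.\<close>

definition reach :: "real ^ 'n \<Rightarrow> real ^ 'n \<Rightarrow> real \<Rightarrow> bool" where
  "reach \<xi> \<eta> t \<longleftrightarrow> (\<exists>\<gamma>\<in>\<Gamma>. \<exists>\<xi>' \<eta>' b. \<exists>a\<in>star (K b). norm \<xi>' = 1 \<and> norm \<eta>' = 1 \<and> \<xi> = bdry_act \<gamma> \<xi>' \<and> \<eta> = bdry_act \<gamma> \<eta>' \<and>
    crossing b a \<xi>' \<eta>' (t - foot (\<gamma> x) \<xi> \<eta> + foot x \<xi>' \<eta>'))"

lemma reach_shift:
  assumes g: "g \<in> \<Gamma>" and n: "norm \<xi> = 1" "norm \<eta> = 1"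
    and r: "reach \<xi> \<eta> (t - foot (g x) (bdry_act g \<xi>) (bdry_act g \<eta>) + foot x \<xi> \<eta>)"
  shows "reach (bdry_act g \<xi>) (bdry_act g \<eta>) t"
proof -
  obtain \<gamma> \<xi>' \<eta>' b a where \<gamma>: "\<gamma> \<in> \<Gamma>" and n': "norm \<xi>' = 1" "norm \<eta>' = 1" and a: "a \<in> star (K b)" and eq: "\<xi> = bdry_act \<gamma> \<xi>'" "\<eta> = bdry_act \<gamma> \<eta>'"
    and c: "crossing b a \<xi>' \<eta>' (t - foot (g x) (bdry_act g \<xi>) (bdry_act g \<eta>) + foot x \<xi> \<eta> - foot (\<gamma> x) \<xi> \<eta> + foot x \<xi>' \<eta>')"
    using r unfolding reach_def by blast
  note i = \<Gamma>_isom'[OF g] \<Gamma>_isom'[OF \<gamma>]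
  have "foot ((g \<diamondop> \<gamma>) x) (bdry_act g \<xi>) (bdry_act g \<eta>) - foot (g x) (bdry_act g \<xi>) (bdry_act g \<eta>) = foot (\<gamma> x) \<xi> \<eta> - foot x \<xi> \<eta>"
    using foot_isom[OF i(1) n isom_in[OF i(2) x] x] hmult_apply[OF isom_Bij[OF i(1)] isom_Bij[OF i(2)] x] by simp
  then have shift: "t - foot ((g \<diamondop> \<gamma>) x) (bdry_act g \<xi>) (bdry_act g \<eta>) + foot x \<xi>' \<eta>'
    = t - foot (g x) (bdry_act g \<xi>) (bdry_act g \<eta>) + foot x \<xi> \<eta> - foot (\<gamma> x) \<xi> \<eta> + foot x \<xi>' \<eta>'" by linarith
  with c have c': "crossing b a \<xi>' \<eta>' (t - foot ((g \<diamondop> \<gamma>) x) (bdry_act g \<xi>) (bdry_act g \<eta>) + foot x \<xi>' \<eta>')" by (simp only: shift)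
  have e: "bdry_act g \<xi> = bdry_act (g \<diamondop> \<gamma>) \<xi>'" "bdry_act g \<eta> = bdry_act (g \<diamondop> \<gamma>) \<eta>'"
    unfolding eq bdry_act_mult[OF i n'(1)] bdry_act_mult[OF i n'(2)] by simp_all
  show ?thesis unfolding reach_def
    by (rule bexI[OF _ \<Gamma>_mult[OF g \<gamma>]], intro exI[of _ \<xi>'] exI[of _ \<eta>'] exI[of _ b] bexI[OF _ a]) (use n' e c' in simp)
qed

text \<open>Splits the interval at the foot of \<open>a x\<close>. The first part is a crossing of
  \<open>a\<close>; applying \<open>hinv a\<close> turns the second into the same statement for the
  remaining word.\<close>

lemma reach_forward:
  "alt b w \<Longrightarrow> \<xi> \<in> Z (\<not> b) \<Longrightarrow> \<eta> \<in> Z (b \<longleftrightarrow> even (length w)) \<Longrightarrow>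
   foot x \<xi> (bdry_act (word_val w) \<eta>) \<le> t \<Longrightarrow> t < foot (word_val w x) \<xi> (bdry_act (word_val w) \<eta>) \<Longrightarrow>
   reach \<xi> (bdry_act (word_val w) \<eta>) t"
proof (induction w arbitrary: b \<xi> t)
  case Nil then show ?case using x by simp
next
  case (Cons a w)
  have a: "a \<in> star (K b)" and w: "alt (\<not> b) w" using Cons.prems(1) by auto
  note ai = star_isom[OF a] and wi = alt_val_isom[OF w]
  define \<eta>\<^sub>1 where "\<eta>\<^sub>1 = bdry_act (word_val w) \<eta>"
  have tt: "(b \<longleftrightarrow> even (length (a # w))) = (\<not> b \<longleftrightarrow> even (length w))" by auto
  have \<eta>: "\<eta> \<in> Z (\<not> b \<longleftrightarrow> even (length w))" using Cons.prems(3) unfolding tt .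
  have \<eta>\<^sub>1: "\<eta>\<^sub>1 \<in> Z (\<not> b)" unfolding \<eta>\<^sub>1_def by (rule Z_word_act[OF w \<eta>])
  have eq: "bdry_act (word_val (a # w)) \<eta> = bdry_act a \<eta>\<^sub>1"
    using bdry_act_mult[OF ai wi Z_norm[OF \<eta>]] by (simp add: \<eta>\<^sub>1_def)
  have wx: "word_val (a # w) x = a (word_val w x)" using hmult_apply[OF isom_Bij[OF ai] isom_Bij[OF wi] x] by simp
  note n = Z_norm[OF Cons.prems(2)]
  show ?case
  proof (cases "t < foot (a x) \<xi> (bdry_act a \<eta>\<^sub>1)")
    case True
    have "crossing b a \<xi> (bdry_act a \<eta>\<^sub>1) t"
      using True Cons.prems(2,4) Z_Lam \<eta>\<^sub>1 unfolding crossing_def eq by blast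
    then have c: "crossing b a \<xi> (bdry_act a \<eta>\<^sub>1) (t - foot (hone x) \<xi> (bdry_act a \<eta>\<^sub>1) + foot x \<xi> (bdry_act a \<eta>\<^sub>1))"
      using x by simp
    have n2: "norm (bdry_act a \<eta>\<^sub>1) = 1" by (rule norm_bdry_act[OF ai Z_norm[OF \<eta>\<^sub>1]])
    show ?thesis unfolding eq reach_def
      by (rule bexI[OF _ \<Gamma>_one], intro exI[of _ \<xi>] exI[of _ "bdry_act a \<eta>\<^sub>1"] exI[of _ b] bexI[OF _ a]) (use n n2 c in simp)
  next
    case False
    define \<xi>\<^sub>1 where "\<xi>\<^sub>1 = bdry_act (hinv a) \<xi>"
    have \<xi>\<^sub>1: "\<xi>\<^sub>1 \<in> Z (\<not> \<not> b)" unfolding \<xi>\<^sub>1_def not_not by (rule Z_act[OF star_inv[OF a] Cons.prems(2)])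
    have \<xi>: "\<xi> = bdry_act a \<xi>\<^sub>1" unfolding \<xi>\<^sub>1_def using bdry_act_inv(1)[OF ai n] by simp
    note n1 = Z_norm[OF \<xi>\<^sub>1] Z_norm[OF \<eta>\<^sub>1]
    have sh: "foot (a (word_val w x)) \<xi> (bdry_act a \<eta>\<^sub>1) - foot (a x) \<xi> (bdry_act a \<eta>\<^sub>1) = foot (word_val w x) \<xi>\<^sub>1 \<eta>\<^sub>1 - foot x \<xi>\<^sub>1 \<eta>\<^sub>1"
      unfolding \<xi> by (rule foot_isom[OF ai n1 isom_in[OF wi x] x])
    have lt: "t < foot (a (word_val w x)) \<xi> (bdry_act a \<eta>\<^sub>1)" using Cons.prems(5) unfolding eq wx .
    have "reach \<xi>\<^sub>1 \<eta>\<^sub>1 (t - foot (a x) (bdry_act a \<xi>\<^sub>1) (bdry_act a \<eta>\<^sub>1) + foot x \<xi>\<^sub>1 \<eta>\<^sub>1)"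
      unfolding \<eta>\<^sub>1_def
      by (rule Cons.IH[OF w \<xi>\<^sub>1 \<eta>]) (use False lt sh in \<open>simp_all add: \<eta>\<^sub>1_def[symmetric] \<xi>[symmetric]\<close>)
    from reach_shift[OF star_\<Gamma>[OF a] n1 this] show ?thesis unfolding eq \<xi>[symmetric] .
  qed
qed

text \<open>With end points of opposite types, a long prefix of the coding of \<xi> moves the foot
  of \<open>x\<close> to before the given time, and a long prefix of the coding of \<eta> then moves
  it beyond. In between \<open>reach_forward\<close> applies. The term \<open>2 * R\<close> in both
  thresholds is the loss in \<open>foot_growth\<close>.\<close>

lemma reach_all:
  assumes \<xi>: "\<xi> \<in> Z b" and \<eta>: "\<eta> \<in> Z c" and ne: "\<xi> \<noteq> \<eta>"
  shows "reach \<xi> \<eta> t"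
proof -
  obtain \<gamma> p \<xi>\<^sub>0 \<eta>\<^sub>0 where \<gamma>: "\<gamma> \<in> \<Gamma>" and \<xi>\<^sub>0: "\<xi>\<^sub>0 \<in> Z (\<not> p)" and \<eta>\<^sub>0: "\<eta>\<^sub>0 \<in> Z p" and eq: "\<xi> = bdry_act \<gamma> \<xi>\<^sub>0" "\<eta> = bdry_act \<gamma> \<eta>\<^sub>0"
    by (rule opposite_types[OF \<xi> \<eta> ne])
  define t\<^sub>0 where "t\<^sub>0 = t - foot (\<gamma> x) \<xi> \<eta> + foot x \<xi>\<^sub>0 \<eta>\<^sub>0"
  obtain w \<xi>\<^sub>1 where w: "alt (\<not> p) w" "w \<noteq> []" and D: "disp x (word_val w) > foot x \<xi>\<^sub>0 \<eta>\<^sub>0 - t\<^sub>0 + 2 * R"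
    and \<xi>\<^sub>1: "\<xi>\<^sub>1 \<in> Z (\<not> p \<longleftrightarrow> even (length w))" and e1: "\<xi>\<^sub>0 = bdry_act (word_val w) \<xi>\<^sub>1" by (rule Z_long_coding[OF \<xi>\<^sub>0])
  let ?g = "word_val w"
  note gi = alt_val_isom[OF w(1)]
  define q where "q \<longleftrightarrow> (\<not> p \<longleftrightarrow> odd (length w))"
  have q: "(\<not> p \<longleftrightarrow> even (length w)) = (\<not> q)" by (auto simp: q_def)
  define \<eta>\<^sub>1 where "\<eta>\<^sub>1 = bdry_act (hinv ?g) \<eta>\<^sub>0"
  have \<eta>\<^sub>1: "\<eta>\<^sub>1 \<in> Z q"
    unfolding \<eta>\<^sub>1_def word_val_inv[OF w(1), symmetric]
  proof (rule Z_word_act)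
    show "alt q (rev (map (m_inv (BijGroup hyp)) w))" unfolding q_def by (rule alt_rev_inv[OF w(1)])
    have "(q \<longleftrightarrow> even (length (rev (map (m_inv (BijGroup hyp)) w)))) = p" by (auto simp: q_def)
    then show "\<eta>\<^sub>0 \<in> Z (q \<longleftrightarrow> even (length (rev (map (m_inv (BijGroup hyp)) w))))" using \<eta>\<^sub>0 by simp
  qed
  have e2: "\<eta>\<^sub>0 = bdry_act ?g \<eta>\<^sub>1" unfolding \<eta>\<^sub>1_def using bdry_act_inv(1)[OF gi Z_norm[OF \<eta>\<^sub>0]] by simp
  have "foot (?g x) \<eta>\<^sub>0 (bdry_act ?g \<xi>\<^sub>1) - foot x \<eta>\<^sub>0 (bdry_act ?g \<xi>\<^sub>1) \<ge> disp x ?g - 2 * R"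
    by (rule foot_growth[OF w]) (use Z_Lam[OF \<eta>\<^sub>0] Z_Lam[OF \<xi>\<^sub>1] in simp_all)
  then have before: "foot (?g x) \<xi>\<^sub>0 \<eta>\<^sub>0 \<le> t\<^sub>0"
    using D unfolding e1[symmetric] foot_swap[of _ \<eta>\<^sub>0 \<xi>\<^sub>0] by linarith
  define t\<^sub>1 where "t\<^sub>1 = t\<^sub>0 - foot (?g x) \<xi>\<^sub>0 \<eta>\<^sub>0 + foot x \<xi>\<^sub>1 \<eta>\<^sub>1"
  obtain v \<eta>\<^sub>2 where v: "alt q v" "v \<noteq> []" and D': "disp x (word_val v) > t\<^sub>1 - foot x \<xi>\<^sub>1 \<eta>\<^sub>1 + 2 * R"
    and \<eta>\<^sub>2: "\<eta>\<^sub>2 \<in> Z (q \<longleftrightarrow> even (length v))" and e3: "\<eta>\<^sub>1 = bdry_act (word_val v) \<eta>\<^sub>2" by (rule Z_long_coding[OF \<eta>\<^sub>1])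
  have \<xi>\<^sub>1': "\<xi>\<^sub>1 \<in> Z (\<not> q)" using \<xi>\<^sub>1 unfolding q .
  have "foot (word_val v x) \<xi>\<^sub>1 \<eta>\<^sub>1 - foot x \<xi>\<^sub>1 \<eta>\<^sub>1 \<ge> disp x (word_val v) - 2 * R"
    unfolding e3 by (rule foot_growth[OF v Z_Lam[OF \<xi>\<^sub>1'] Z_Lam[OF \<eta>\<^sub>2]])
  then have "t\<^sub>1 < foot (word_val v x) \<xi>\<^sub>1 \<eta>\<^sub>1" using D' by linarith
  moreover have "foot x \<xi>\<^sub>1 \<eta>\<^sub>1 \<le> t\<^sub>1" using before by (simp add: t\<^sub>1_def)
  ultimately have "reach \<xi>\<^sub>1 \<eta>\<^sub>1 t\<^sub>1" using reach_forward[OF v(1) \<xi>\<^sub>1' \<eta>\<^sub>2, of t\<^sub>1] unfolding e3[symmetric] by blast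
  then have "reach \<xi>\<^sub>0 \<eta>\<^sub>0 t\<^sub>0"
    unfolding t\<^sub>1_def e1 e2 by (rule reach_shift[OF alt_\<Gamma>[OF w(1)] Z_norm[OF \<xi>\<^sub>1] Z_norm[OF \<eta>\<^sub>1]])
  then show ?thesis
    unfolding t\<^sub>0_def eq by (rule reach_shift[OF \<gamma> Z_norm[OF \<xi>\<^sub>0] Z_norm[OF \<eta>\<^sub>0]])
qed

end

section \<open>The Bowen-Margulis measure\<close>

text \<open>As a \<open>measure_of\<close>, \<open>distr\<close> assigns either the intended value
  or 0, so this inequality holds for every map. For the inverse Hopf map this takes the place of a
  proof of measurability.\<close>

lemma emeasure_distr_le: "emeasure (distr M N f) A \<le> emeasure M (f -` A \<inter> space M)"
proof -
  have "emeasure (distr M N f) A \<le> (if A \<in> sets N then emeasure M (f -` A \<inter> space M) else 0)"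
    unfolding distr_def emeasure_measure_of_conv by (auto simp: sets.sigma_sets_eq)
  then show ?thesis by (auto split: if_splits)
qed

text \<open>The sets \<open>E i\<close> of points of \<open>E\<close> that \<open>\<psi> i\<close> moves into \<open>F\<close>, made disjoint, pull back under \<open>\<phi> i\<close>
  to disjoint subsets of \<open>F\<close> of the same measure.\<close>

lemma emeasure_le_if_moved_into:
  fixes \<phi> \<psi> :: "nat \<Rightarrow> 'a \<Rightarrow> 'a"
  assumes E: "E \<in> sets M" and F: "F \<in> sets M"
    and \<phi>: "\<And>i. \<phi> i \<in> M \<rightarrow>\<^sub>M M" "\<And>i A. A \<in> sets M \<Longrightarrow> emeasure M (\<phi> i -` A \<inter> space M) = emeasure M A"
    and \<psi>: "\<And>i. \<psi> i \<in> M \<rightarrow>\<^sub>M M" "\<And>i y. y \<in> space M \<Longrightarrow> \<psi> i (\<phi> i y) = y"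
    and cover: "AE y in M. y \<in> E \<longrightarrow> (\<exists>i. \<psi> i y \<in> F)"
    and inj: "\<And>i j y. y \<in> space M \<Longrightarrow> \<phi> i y \<in> E \<Longrightarrow> \<phi> j y \<in> E \<Longrightarrow> \<phi> i y = \<phi> j y"
  shows "emeasure M E \<le> emeasure M F"
proof -
  define A where "A i = E \<inter> (\<psi> i -` F \<inter> space M)" for i
  have "A i \<in> sets M" for i unfolding A_def by (intro sets.Int E measurable_sets[OF \<psi>(1) F])
  then have A: "range A \<subseteq> sets M" by blast
  then have dA: "range (disjointed A) \<subseteq> sets M" by (rule sets.range_disjointed_sets)
  define D where "D i = \<phi> i -` disjointed A i \<inter> space M" for i
  have "D i \<in> sets M" for i
  proof -
    have "disjointed A i \<in> sets M" using dA by blast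
    then show ?thesis unfolding D_def by (rule measurable_sets[OF \<phi>(1)])
  qed
  then have D: "range D \<subseteq> sets M" by blast
  have in_A: "y \<in> A i" if "y \<in> disjointed A i" for y i by (rule subsetD[OF disjointed_subset that])
  have "disjoint_family D"
    unfolding disjoint_family_on_def
  proof (intro ballI impI)
    fix i j :: nat assume ij: "i \<noteq> j"
    have False if y: "y \<in> D i" "y \<in> D j" for y
    proof -
      have yi: "\<phi> i y \<in> disjointed A i" "\<phi> j y \<in> disjointed A j" and sp: "y \<in> space M" using y by (auto simp: D_def)
      then have "\<phi> i y \<in> E" "\<phi> j y \<in> E" using in_A by (auto simp: A_def)
      then have "\<phi> i y = \<phi> j y" by (rule inj[OF sp])
      moreover have "disjointed A i \<inter> disjointed A j = {}" by (rule disjoint_family_onD[OF disjoint_family_disjointed _ _ ij]) auto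
      ultimately show False using yi by auto
    qed
    then show "D i \<inter> D j = {}" by blast
  qed
  then have UD: "(\<Sum>i. emeasure M (D i)) = emeasure M (\<Union>i. D i)" by (rule suminf_emeasure[OF D])
  have "(\<Union>i. D i) \<subseteq> F"
  proof
    fix y assume "y \<in> (\<Union>i. D i)"
    then obtain i where i: "\<phi> i y \<in> disjointed A i" "y \<in> space M" by (auto simp: D_def)
    then have "\<psi> i (\<phi> i y) \<in> F" using in_A by (auto simp: A_def)
    then show "y \<in> F" using \<psi>(2)[OF i(2)] by simp
  qed
  then have le: "emeasure M (\<Union>i. D i) \<le> emeasure M F" by (rule emeasure_mono[OF _ F])
  have "emeasure M E \<le> emeasure M (\<Union>i. A i)"
  proof (rule emeasure_mono_AE)
    show "AE y in M. y \<in> E \<longrightarrow> y \<in> (\<Union>i. A i)"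
      using cover AE_space by eventually_elim (auto simp: A_def)
    show "(\<Union>i. A i) \<in> sets M" by (rule sets.countable_UN[OF A])
  qed
  also have "\<dots> = (\<Sum>i. emeasure M (disjointed A i))"
    using suminf_emeasure[OF dA disjoint_family_disjointed] by (simp add: UN_disjointed_eq)
  also have "\<dots> = (\<Sum>i. emeasure M (D i))" unfolding D_def by (intro suminf_cong \<phi>(2)[symmetric]) (use dA in blast)
  finally show ?thesis using UD le by simp
qed

lemma (in crossing_pair) \<Gamma>_differentiable:
  assumes "\<gamma> \<in> \<Gamma>" "y \<in> hyp" shows "\<gamma> differentiable (at y)"
proof -
  have K: "f differentiable (at y)" if "f \<in> K b" "y \<in> hyp" for f b y
    using kleinian[of b] that by (fastforce simp: kleinian_def orientation_preserving_isometries_def differentiable_def)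
  have op: "open (hyp :: (real ^ 'n) set)" by simp
  have one: "hone differentiable (at y)" if "y \<in> hyp" for y :: "real ^ 'n"
  proof -
    \<comment> \<open>The identity of the group agrees with the identity map on the open set
      \<open>hyp\<close>, which suffices for derivatives there.\<close>
    have "((\<lambda>y. y) has_derivative (\<lambda>y. y)) (at y)" by (rule has_derivative_ident)
    from has_derivative_transform_within_open[OF this op that] have "(hone has_derivative (\<lambda>y. y)) (at y)" by simp
    then show ?thesis by (auto simp: differentiable_def)
  qed
  have mult: "f \<diamondop> g differentiable (at y)"
    if f: "f \<in> hyp_isometries" "\<And>y. y \<in> hyp \<Longrightarrow> f differentiable (at y)"
      and g: "g \<in> hyp_isometries" "\<And>y. y \<in> hyp \<Longrightarrow> g differentiable (at y)" and y: "y \<in> hyp" for f g :: "real ^ 'n \<Rightarrow> real ^ 'n" and y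
  proof -
    obtain g' where g': "(g has_derivative g') (at y)" using g(2)[OF y] by (auto simp: differentiable_def)
    obtain f' where f': "(f has_derivative f') (at (g y))" using f(2)[OF isom_in[OF g(1) y]] by (auto simp: differentiable_def)
    have "(f \<circ> g has_derivative (f' \<circ> g')) (at y)" by (rule diff_chain_at[OF g' f'])
    from has_derivative_transform_within_open[OF this op y]
    have "(f \<diamondop> g has_derivative (f' \<circ> g')) (at y)" using hmult_apply[OF isom_Bij[OF f(1)] isom_Bij[OF g(1)]] by simp
    then show ?thesis by (auto simp: differentiable_def)
  qed
  have "word_val w differentiable (at y)" if "alt b w" "y \<in> hyp" for b w y
    using that
  proof (induction w arbitrary: b y)
    case Nil then show ?case using one by simp
  next
    case (Cons a w)
    then have a: "a \<in> star (K b)" and w: "alt (\<not> b) w" by auto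
    have "a \<in> K b" using a by blast
    show ?case unfolding word_val_simps
      by (rule mult[OF star_isom[OF a] K[OF \<open>a \<in> K b\<close>] alt_val_isom[OF w] Cons.IH[OF w] Cons.prems(2)])
  qed
  moreover obtain b w where "alt b w" "\<gamma> = word_val w" using assms(1) \<Gamma>_words by blast
  ultimately show ?thesis using assms(2) by simp
qed

section \<open>The Patterson-Sullivan measure of the coded sets\<close>

text \<open>\<open>z\<close> is the base point of the measures and \<open>x\<close> that of the
  crossing property; the factors in \<open>hyp_dist x z\<close> below come from comparing the
  two.\<close>

locale ps_pair = divergent_pair K x R
  for K :: "bool \<Rightarrow> (real ^ 'n \<Rightarrow> real ^ 'n) set" and x :: "real ^ 'n" and R :: real +
  fixes \<mu> :: "real ^ 'n \<Rightarrow> (real ^ 'n) measure" and z :: "real ^ 'n"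
  assumes z: "z \<in> hyp" and ps: "patterson_sullivan_density \<Gamma> \<mu>"
begin

lemma ps_at_z:
  "finite_measure (\<mu> z)" "sets (\<mu> z) = sets (restrict_space borel hyp_bdry)" "emeasure (\<mu> z) (hyp_bdry - limit_set \<Gamma>) = 0"
proof -
  have "\<forall>y\<in>hyp. finite_measure (\<mu> y) \<and> sets (\<mu> y) = sets (restrict_space borel hyp_bdry) \<and>
      emeasure (\<mu> y) hyp_bdry \<noteq> 0 \<and> emeasure (\<mu> y) (hyp_bdry - limit_set \<Gamma>) = 0"
    using ps unfolding patterson_sullivan_density_def by (elim conjE)
  from bspec[OF this z] show "finite_measure (\<mu> z)" "sets (\<mu> z) = sets (restrict_space borel hyp_bdry)"
    "emeasure (\<mu> z) (hyp_bdry - limit_set \<Gamma>) = 0" by auto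
qed

lemmas sets_\<mu> = ps_at_z(2)

lemma space_\<mu> [simp]: "space (\<mu> z) = hyp_bdry"
  using sets_eq_imp_space_eq[OF sets_\<mu>] by (simp add: space_restrict_space)

sublocale \<mu>: finite_measure "\<mu> z" by (rule ps_at_z(1))

lemma borel_measurable_if_\<mu>: "f \<in> A \<rightarrow>\<^sub>M \<mu> z \<Longrightarrow> f \<in> borel_measurable A"
proof -
  assume "f \<in> A \<rightarrow>\<^sub>M \<mu> z"
  then have "f \<in> A \<rightarrow>\<^sub>M restrict_space borel hyp_bdry" by (simp only: measurable_cong_sets[OF refl sets_\<mu>])
  then show ?thesis unfolding measurable_restrict_space2_iff by simp
qed

lemma horo_measurable [measurable (raw)]:
  "f \<in> A \<rightarrow>\<^sub>M \<mu> z \<Longrightarrow> (\<lambda>\<omega>. horo (f \<omega>) y) \<in> borel_measurable A"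
proof -
  assume "f \<in> A \<rightarrow>\<^sub>M \<mu> z"
  note [measurable] = borel_measurable_if_\<mu>[OF this]
  show ?thesis unfolding horo_def by measurable
qed

lemma foot_measurable [measurable (raw)]:
  assumes [measurable]: "f \<in> A \<rightarrow>\<^sub>M \<mu> z" "g \<in> A \<rightarrow>\<^sub>M \<mu> z"
  shows "(\<lambda>\<omega>. foot y (f \<omega>) (g \<omega>)) \<in> borel_measurable A"
  unfolding foot_def by measurable

lemma gromov_measurable [measurable (raw)]:
  "f \<in> A \<rightarrow>\<^sub>M \<mu> z \<Longrightarrow> g \<in> A \<rightarrow>\<^sub>M \<mu> z \<Longrightarrow> (\<lambda>\<omega>. gromov y (f \<omega>) (g \<omega>)) \<in> borel_measurable A"
proof -
  assume f[measurable]: "f \<in> A \<rightarrow>\<^sub>M \<mu> z" and g[measurable]: "g \<in> A \<rightarrow>\<^sub>M \<mu> z"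
  have "(\<lambda>\<omega>. norm (f \<omega> - g \<omega>)) \<in> borel_measurable A"
    using borel_measurable_if_\<mu>[OF f] borel_measurable_if_\<mu>[OF g] by measurable
  then show ?thesis unfolding gromov_def by measurable
qed

lemma bdry_act_measurable [measurable (raw)]:
  assumes f: "\<gamma> \<in> hyp_isometries"
  shows "bdry_act \<gamma> \<in> \<mu> z \<rightarrow>\<^sub>M \<mu> z"
proof -
  have "bdry_act \<gamma> \<in> restrict_space borel hyp_bdry \<rightarrow>\<^sub>M restrict_space borel hyp_bdry"
    by (rule measurable_restrict_space2[OF _ borel_measurable_continuous_on_restrict[OF continuous_on_bdry_act[OF f]]])
       (use norm_bdry_act[OF f] in \<open>auto simp: space_restrict_space\<close>)
  then show ?thesis by (simp only: measurable_cong_sets[OF sets_\<mu> sets_\<mu>])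
qed

text \<open>The density with respect to \<open>\<mu> z\<close> of the image of
  \<open>\<mu> z\<close> under \<gamma>, with the Busemann function written out.\<close>

definition jac :: "(real ^ 'n \<Rightarrow> real ^ 'n) \<Rightarrow> real ^ 'n \<Rightarrow> real" where
  "jac \<gamma> \<xi> = exp (- \<delta> * ln (horo \<xi> (\<gamma> z) / horo \<xi> z))"

lemma jac_measurable [measurable]: "jac \<gamma> \<in> borel_measurable (\<mu> z)"
  unfolding jac_def[abs_def] by measurable

lemma nn_integral_bdry_act:
  assumes \<gamma>: "\<gamma> \<in> \<Gamma>" and h[measurable]: "h \<in> borel_measurable (\<mu> z)"
  shows "(\<integral>\<^sup>+ \<xi>. h (bdry_act \<gamma> \<xi>) \<partial>\<mu> z) = (\<integral>\<^sup>+ \<xi>. ennreal (jac \<gamma> \<xi>) * h \<xi> \<partial>\<mu> z)"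
proof -
  note i = \<Gamma>_isom'[OF \<gamma>]
  let ?D = "distr (\<mu> z) (restrict_space borel hyp_bdry) (bdry_act \<gamma>)"
  let ?d = "\<lambda>\<xi>. ennreal (exp (- \<delta> * busemann \<xi> (\<gamma> z) z))"
  have eq: "?d \<xi> = ennreal (jac \<gamma> \<xi>)" if "\<xi> \<in> space (\<mu> z)" for \<xi>
    using busemann_eq[OF _ isom_in[OF i z] z, of \<xi>] that by (simp add: jac_def)
  have m: "bdry_act \<gamma> \<in> \<mu> z \<rightarrow>\<^sub>M restrict_space borel hyp_bdry"
    using bdry_act_measurable[OF i] by (simp only: measurable_cong_sets[OF refl sets_\<mu>])
  have h': "h \<in> borel_measurable ?D"
    using h by (simp only: measurable_cong_sets[OF sets_\<mu> refl] measurable_cong_sets[OF sets_distr refl])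
  have d: "?d \<in> borel_measurable (\<mu> z)"
    by (subst measurable_cong[OF eq]) measurable
  have eqv: "\<forall>g\<in>\<Gamma>. \<forall>y\<in>hyp. distr (\<mu> y) (restrict_space borel hyp_bdry) (bdry_act g) = \<mu> (g y)"
    using ps unfolding patterson_sullivan_density_def by (elim conjE)
  have conf: "\<forall>y\<in>hyp. \<forall>w\<in>hyp. \<mu> y = density (\<mu> w) (\<lambda>\<xi>. ennreal (exp (- \<delta> * busemann \<xi> y w)))"
    using ps unfolding patterson_sullivan_density_def by (elim conjE)
  from bspec[OF bspec[OF eqv \<gamma>] z] bspec[OF bspec[OF conf isom_in[OF i z]] z]
  have "?D = density (\<mu> z) ?d" by (rule trans)
  then have "(\<integral>\<^sup>+ \<xi>. h \<xi> \<partial>?D) = (\<integral>\<^sup>+ \<xi>. ?d \<xi> * h \<xi> \<partial>\<mu> z)"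
    using nn_integral_density[OF d h] by simp
  also have "\<dots> = (\<integral>\<^sup>+ \<xi>. ennreal (jac \<gamma> \<xi>) * h \<xi> \<partial>\<mu> z)"
    by (intro nn_integral_cong) (simp only: eq)
  finally show ?thesis unfolding nn_integral_distr[OF m h'] .
qed

lemma image_eq_vimage:
  assumes \<gamma>: "\<gamma> \<in> hyp_isometries" and X: "X \<subseteq> hyp_bdry"
  shows "bdry_act \<gamma> ` X = bdry_act (hinv \<gamma>) -` X \<inter> space (\<mu> z)"
proof (rule subset_antisym; rule subsetI)
  fix \<eta> assume "\<eta> \<in> bdry_act \<gamma> ` X"
  then obtain \<xi> where \<xi>: "\<xi> \<in> X" "\<eta> = bdry_act \<gamma> \<xi>" by blast
  then have n: "norm \<xi> = 1" using X by auto
  show "\<eta> \<in> bdry_act (hinv \<gamma>) -` X \<inter> space (\<mu> z)"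
    using bdry_act_inv(2)[OF \<gamma> n] norm_bdry_act[OF \<gamma> n] \<xi> by simp
next
  fix \<eta> assume "\<eta> \<in> bdry_act (hinv \<gamma>) -` X \<inter> space (\<mu> z)"
  then have "bdry_act (hinv \<gamma>) \<eta> \<in> X" and n: "norm \<eta> = 1" by auto
  then show "\<eta> \<in> bdry_act \<gamma> ` X" using bdry_act_inv(1)[OF \<gamma> n] by force
qed

lemma sets_bdry: "X \<in> sets (\<mu> z) \<Longrightarrow> X \<subseteq> hyp_bdry" using sets.sets_into_space[of X "\<mu> z"] by simp

lemma image_sets [measurable]:
  assumes "\<gamma> \<in> hyp_isometries" "X \<in> sets (\<mu> z)" shows "bdry_act \<gamma> ` X \<in> sets (\<mu> z)"
  unfolding image_eq_vimage[OF assms(1) sets_bdry[OF assms(2)]]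
  by (rule measurable_sets[OF bdry_act_measurable[OF isom_inv[OF assms(1)]] assms(2)])

lemma emeasure_image:
  assumes \<gamma>: "\<gamma> \<in> \<Gamma>" and X[measurable]: "X \<in> sets (\<mu> z)"
  shows "emeasure (\<mu> z) (bdry_act \<gamma> ` X) = (\<integral>\<^sup>+ \<xi>. ennreal (jac (hinv \<gamma>) \<xi>) * indicator X \<xi> \<partial>\<mu> z)"
proof -
  note i = \<Gamma>_isom'[OF \<gamma>]
  have "emeasure (\<mu> z) (bdry_act \<gamma> ` X) = (\<integral>\<^sup>+ \<xi>. indicator (bdry_act \<gamma> ` X) \<xi> \<partial>\<mu> z)"
    using image_sets[OF i X] by simp
  also have "\<dots> = (\<integral>\<^sup>+ \<xi>. indicator X (bdry_act (hinv \<gamma>) \<xi>) \<partial>\<mu> z)"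
    by (rule nn_integral_cong) (simp add: image_eq_vimage[OF i sets_bdry[OF X]] indicator_def)
  also have "\<dots> = (\<integral>\<^sup>+ \<xi>. ennreal (jac (hinv \<gamma>) \<xi>) * indicator X \<xi> \<partial>\<mu> z)"
    by (rule nn_integral_bdry_act[OF \<Gamma>_inv[OF \<gamma>]]) measurable
  finally show ?thesis .
qed

text \<open>Busemann functions are 1-Lipschitz, which bounds the density from below on the whole
  sphere.\<close>

lemma emeasure_image_ge:
  assumes \<gamma>: "\<gamma> \<in> \<Gamma>" and X[measurable]: "X \<in> sets (\<mu> z)"
  shows "emeasure (\<mu> z) (bdry_act \<gamma> ` X) \<ge> ennreal (exp (- \<delta> * disp z \<gamma>)) * emeasure (\<mu> z) X"
proof -
  note i = \<Gamma>_isom'[OF \<gamma>]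
  have le: "ennreal (exp (- \<delta> * disp z \<gamma>)) \<le> ennreal (jac (hinv \<gamma>) \<xi>)" if "\<xi> \<in> hyp_bdry" for \<xi>
  proof -
    have "norm \<xi> = 1" using that by simp
    from ln_horo_ratio_le_dist[OF this isom_in[OF isom_inv[OF i] z] z]
    have "ln (horo \<xi> (hinv \<gamma> z) / horo \<xi> z) \<le> disp z \<gamma>"
      using disp_inv[OF z i] by (simp add: disp_def hyp_dist_commute[of "hinv \<gamma> z"])
    then show ?thesis using \<delta>_pos by (simp add: jac_def)
  qed
  have "ennreal (exp (- \<delta> * disp z \<gamma>)) * emeasure (\<mu> z) X = (\<integral>\<^sup>+ \<xi>. ennreal (exp (- \<delta> * disp z \<gamma>)) * indicator X \<xi> \<partial>\<mu> z)"
    by (simp add: nn_integral_cmult_indicator)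
  also have "\<dots> \<le> (\<integral>\<^sup>+ \<xi>. ennreal (jac (hinv \<gamma>) \<xi>) * indicator X \<xi> \<partial>\<mu> z)"
    by (intro nn_integral_mono mult_right_mono) (use le in auto)
  finally show ?thesis unfolding emeasure_image[OF \<gamma> X] .
qed

text \<open>The upper half of a shadow estimate. On \<open>Lam (\<not> b)\<close> the crossing
  property, in the form of \<open>Lam_horo\<close>, makes the Busemann function of
  \<open>hinv a x\<close> nearly as large as the displacement.\<close>

lemma emeasure_image_le:
  assumes a: "a \<in> star (K b)" and X[measurable]: "X \<in> sets (\<mu> z)" and XL: "X \<subseteq> Lam (\<not> b)"
  shows "emeasure (\<mu> z) (bdry_act a ` X) \<le> ennreal (exp (\<delta> * (2 * R + 2 * hyp_dist x z)) * exp (- \<delta> * disp x a)) * emeasure (\<mu> z) X"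
proof -
  note i = star_isom[OF a]
  note hi = isom_inv[OF i]
  let ?c = "exp (\<delta> * (2 * R + 2 * hyp_dist x z)) * exp (- \<delta> * disp x a)"
  have le: "ennreal (jac (hinv a) \<xi>) \<le> ennreal ?c" if "\<xi> \<in> X" for \<xi>
  proof -
    have L: "\<xi> \<in> Lam (\<not> b)" using that XL by blast
    note n = Lam_norm[OF L]
    note h = horo_pos[OF n x] horo_pos[OF n z] horo_pos[OF n isom_in[OF hi x]] horo_pos[OF n isom_in[OF hi z]]
    have 1: "ln (horo \<xi> (hinv a x) / horo \<xi> x) \<ge> disp x a - 2 * R"
      using Lam_horo[OF L star_in_Gam[OF star_inv[OF a]]] disp_inv[OF x i] by simp
    have 2: "ln (horo \<xi> (hinv a x) / horo \<xi> (hinv a z)) \<le> hyp_dist x z"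
      using ln_horo_ratio_le_dist[OF n isom_in[OF hi x] isom_in[OF hi z]] isom_dist[OF hi x z] by simp
    have 3: "ln (horo \<xi> z / horo \<xi> x) \<le> hyp_dist x z"
      using ln_horo_ratio_le_dist[OF n z x] hyp_dist_commute[of z x] by simp
    have "ln (horo \<xi> (hinv a z) / horo \<xi> z) \<ge> disp x a - 2 * R - 2 * hyp_dist x z"
      using 1 2 3 h by (simp add: ln_div)
    then have "\<delta> * (disp x a - 2 * R - 2 * hyp_dist x z) \<le> \<delta> * ln (horo \<xi> (hinv a z) / horo \<xi> z)"
      using \<delta>_pos by (intro mult_left_mono) auto
    then have "jac (hinv a) \<xi> \<le> ?c" unfolding jac_def by (simp flip: exp_add) (simp add: algebra_simps)
    then show ?thesis by (rule ennreal_leI)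
  qed
  have "emeasure (\<mu> z) (bdry_act a ` X) \<le> (\<integral>\<^sup>+ \<xi>. ennreal ?c * indicator X \<xi> \<partial>\<mu> z)"
    unfolding emeasure_image[OF star_\<Gamma>[OF a] X]
    by (intro nn_integral_mono) (use le in \<open>auto simp: indicator_def\<close>)
  then show ?thesis by (simp add: nn_integral_cmult_indicator)
qed

lemma compact_sets: "X \<subseteq> hyp_bdry \<Longrightarrow> compact X \<Longrightarrow> X \<in> sets (\<mu> z)"
  unfolding sets_\<mu> by (subst sets_restrict_space_iff) (auto intro: borel_compact)

lemma Lam_sets [measurable]: "Lam b \<in> sets (\<mu> z)" "Lam0 b \<in> sets (\<mu> z)"
  unfolding Lam_def Lam0_def by (intro compact_sets compact_accum accum_subset_bdry)+

lemma flat_act: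
  assumes "ps \<in> lists pairs" "\<xi> \<in> Lam True"
  shows "bdry_act (word_val (flat ps)) \<xi> \<in> Lam True"
    and "p \<in> pairs \<Longrightarrow> bdry_act (word_val (flat (p # ps))) \<xi> = bdry_act (fst p) (bdry_act (snd p) (bdry_act (word_val (flat ps)) \<xi>))"
proof -
  note n = Lam_norm[OF assms(2)]
  have step: "bdry_act (word_val (flat (p # ps))) \<xi> = bdry_act (fst p) (bdry_act (snd p) (bdry_act (word_val (flat ps)) \<xi>))"
    if p: "p \<in> pairs" and ps: "ps \<in> lists pairs" for p ps
  proof -
    obtain g h where gh: "p = (g, h)" "g \<in> star (K True)" "h \<in> star (K False)" using p by (auto simp: pairs_def)
    note i = star_isom[OF gh(2)] star_isom[OF gh(3)] alt_val_isom[OF alt_flat[OF ps]]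
    show ?thesis
      using bdry_act_mult[OF i(1) isom_mult[OF i(2,3)] n] bdry_act_mult[OF i(2,3) n] by (simp add: gh(1))
  qed
  then show "p \<in> pairs \<Longrightarrow> bdry_act (word_val (flat (p # ps))) \<xi> = bdry_act (fst p) (bdry_act (snd p) (bdry_act (word_val (flat ps)) \<xi>))"
    using assms(1) by blast
  show "bdry_act (word_val (flat ps)) \<xi> \<in> Lam True"
    using assms(1)
  proof (induction ps rule: list.induct)
    case Nil then show ?case using assms(2) n by (simp add: flat_def)
  next
    case (Cons p ps)
    then have p: "p \<in> pairs" and ps: "ps \<in> lists pairs" by auto
    obtain g h where gh: "p = (g, h)" "g \<in> star (K True)" "h \<in> star (K False)" using p by (auto simp: pairs_def)
    have "bdry_act h (bdry_act (word_val (flat ps)) \<xi>) \<in> Lam (\<not> True)"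
      using Lam_act[OF gh(3), of "bdry_act (word_val (flat ps)) \<xi>"] Cons.IH[OF ps] by simp
    from Lam_act[OF gh(2) this] show ?case unfolding step[OF p ps] by (simp add: gh(1))
  qed
qed

text \<open>Common first pairs are stripped off by means of \<open>Lam_images_disjoint\<close>. If
  one word is exhausted first, a point of \<open>X\<close> lies in the image of
  \<open>Lam True\<close> under a pair, which \<open>avoid\<close> excludes.\<close>

lemma flat_images_disjoint:
  assumes X: "X \<subseteq> Lam True" and avoid: "\<And>p \<xi> \<eta>. p \<in> pairs \<Longrightarrow> \<xi> \<in> X \<Longrightarrow> \<eta> \<in> Lam True \<Longrightarrow> \<xi> \<noteq> bdry_act (fst p) (bdry_act (snd p) \<eta>)"
  shows "ps \<in> lists pairs \<Longrightarrow> qs \<in> lists pairs \<Longrightarrow> \<xi> \<in> X \<Longrightarrow> \<eta> \<in> X \<Longrightarrow>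
    bdry_act (word_val (flat ps)) \<xi> = bdry_act (word_val (flat qs)) \<eta> \<Longrightarrow> ps = qs"
proof (induction ps arbitrary: qs)
  case Nil
  show ?case
  proof (cases qs)
    case (Cons q qs')
    then have q: "q \<in> pairs" "qs' \<in> lists pairs" using Nil.prems(2) by auto
    have L: "\<eta> \<in> Lam True" "\<xi> \<in> Lam True" using X Nil.prems by auto
    have "\<xi> = bdry_act (fst q) (bdry_act (snd q) (bdry_act (word_val (flat qs')) \<eta>))"
      using Nil.prems(5) Lam_norm[OF L(2)] unfolding Cons flat_act(2)[OF q(2) L(1) q(1)] by (simp add: flat_def)
    then show ?thesis using avoid[OF q(1) Nil.prems(3) flat_act(1)[OF q(2) L(1)]] by blast
  qed simp
next
  case (Cons p ps')
  have p: "p \<in> pairs" "ps' \<in> lists pairs" using Cons.prems(1) by auto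
  have L: "\<eta> \<in> Lam True" "\<xi> \<in> Lam True" using X Cons.prems by auto
  define \<xi>' where "\<xi>' = bdry_act (word_val (flat ps')) \<xi>"
  have \<xi>': "\<xi>' \<in> Lam True" unfolding \<xi>'_def by (rule flat_act(1)[OF p(2) L(2)])
  have e1: "bdry_act (word_val (flat (p # ps'))) \<xi> = bdry_act (fst p) (bdry_act (snd p) \<xi>')"
    unfolding \<xi>'_def by (rule flat_act(2)[OF p(2) L(2) p(1)])
  show ?case
  proof (cases qs)
    case Nil
    then have "\<eta> = bdry_act (fst p) (bdry_act (snd p) \<xi>')"
      using Cons.prems(5) Lam_norm[OF L(1)] unfolding e1 by (simp add: flat_def)
    then show ?thesis using avoid[OF p(1) Cons.prems(4) \<xi>'] by blast
  next
    case q: (Cons q qs')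
    have qp: "q \<in> pairs" "qs' \<in> lists pairs" using Cons.prems(2) q by auto
    define \<eta>' where "\<eta>' = bdry_act (word_val (flat qs')) \<eta>"
    have \<eta>': "\<eta>' \<in> Lam True" unfolding \<eta>'_def by (rule flat_act(1)[OF qp(2) L(1)])
    have e2: "bdry_act (word_val (flat (q # qs'))) \<eta> = bdry_act (fst q) (bdry_act (snd q) \<eta>')"
      unfolding \<eta>'_def by (rule flat_act(2)[OF qp(2) L(1) qp(1)])
    have eq: "bdry_act (fst p) (bdry_act (snd p) \<xi>') = bdry_act (fst q) (bdry_act (snd q) \<eta>')"
      using Cons.prems(5) unfolding q e1 e2 .
    have fp: "fst p \<in> star (K True)" "snd p \<in> star (K False)" "fst q \<in> star (K True)" "snd q \<in> star (K False)"
      using p(1) qp(1) by (auto simp: pairs_def)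
    have LF: "bdry_act (snd p) \<xi>' \<in> Lam (\<not> True)" "bdry_act (snd q) \<eta>' \<in> Lam (\<not> True)"
      using Lam_act[OF fp(2), of \<xi>'] Lam_act[OF fp(4), of \<eta>'] \<xi>' \<eta>' by auto
    have f: "fst p = fst q" using Lam_images_disjoint[OF _ _ LF eq] fp by blast
    have "bdry_act (snd p) \<xi>' = bdry_act (snd q) \<eta>'"
      using eq bdry_act_inj[OF star_isom[OF fp(3)] Lam_norm[OF LF(1)] Lam_norm[OF LF(2)]] unfolding f by blast
    note eq2 = this
    have s: "snd p = snd q" using Lam_images_disjoint[of "snd p" False "snd q" \<xi>' \<eta>'] fp \<xi>' \<eta>' eq2 by simp
    have "\<xi>' = \<eta>'"
      using eq2 bdry_act_inj[OF star_isom[OF fp(4)] Lam_norm[OF \<xi>'] Lam_norm[OF \<eta>']] unfolding s by blast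
    then have "ps' = qs'" unfolding \<xi>'_def \<eta>'_def by (rule Cons.IH[OF p(2) qp(2) Cons.prems(3,4)])
    then show ?thesis using f s q by (simp add: prod_eq_iff)
  qed
qed

text \<open>The translates of \<open>X\<close> are disjoint, and their masses are bounded below by the terms of a divergent series.\<close>

lemma null_if_avoiding:
  assumes X[measurable]: "X \<in> sets (\<mu> z)" and XL: "X \<subseteq> Lam True"
    and avoid: "\<And>p \<xi> \<eta>. p \<in> pairs \<Longrightarrow> \<xi> \<in> X \<Longrightarrow> \<eta> \<in> Lam True \<Longrightarrow> \<xi> \<noteq> bdry_act (fst p) (bdry_act (snd p) \<eta>)"
  shows "X \<in> null_sets (\<mu> z)"
proof (rule ccontr)
  assume "X \<notin> null_sets (\<mu> z)"
  then have "emeasure (\<mu> z) X \<noteq> 0" using X by (auto simp: null_sets_def)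
  then have m: "measure (\<mu> z) X > 0" by (simp add: \<mu>.emeasure_eq_measure zero_less_measure_iff)
  define T where "T ps = bdry_act (word_val (flat ps)) ` X" for ps
  have Ts: "T ps \<in> sets (\<mu> z)" if "ps \<in> lists pairs" for ps
    unfolding T_def by (rule image_sets[OF alt_val_isom[OF alt_flat[OF that]] X])
  define c where "c = exp (- 2 * \<delta> * hyp_dist z x) * measure (\<mu> z) X"
  have c: "c > 0" using m by (simp add: c_def)
  have ge: "measure (\<mu> z) (T ps) \<ge> exp (- \<delta> * plen ps) * c" if ps: "ps \<in> lists pairs" for ps
  proof -
    note g = flat_val_\<Gamma>[OF ps]
    have "disp z (word_val (flat ps)) \<le> plen ps + 2 * hyp_dist z x"
      unfolding plen_def by (rule disp_base_change[OF z x \<Gamma>_isom'[OF g]])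
    then have "\<delta> * disp z (word_val (flat ps)) \<le> \<delta> * (plen ps + 2 * hyp_dist z x)"
      using \<delta>_pos by (intro mult_left_mono) auto
    then have "exp (- \<delta> * plen ps) * exp (- 2 * \<delta> * hyp_dist z x) \<le> exp (- \<delta> * disp z (word_val (flat ps)))"
      by (simp flip: exp_add) (simp add: algebra_simps)
    then have "exp (- \<delta> * plen ps) * exp (- 2 * \<delta> * hyp_dist z x) * measure (\<mu> z) X \<le> exp (- \<delta> * disp z (word_val (flat ps))) * measure (\<mu> z) X"
      by (rule mult_right_mono) simp
    also have "ennreal (exp (- \<delta> * disp z (word_val (flat ps))) * measure (\<mu> z) X) \<le> ennreal (measure (\<mu> z) (T ps))"
      using emeasure_image_ge[OF g X] unfolding T_def by (simp add: \<mu>.emeasure_eq_measure ennreal_mult)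
    then have "exp (- \<delta> * disp z (word_val (flat ps))) * measure (\<mu> z) X \<le> measure (\<mu> z) (T ps)" by (simp add: ennreal_le_iff)
    finally show ?thesis by (simp add: c_def mult.assoc)
  qed
  have dis: "T ps \<inter> T qs = {}" if "ps \<in> lists pairs" "qs \<in> lists pairs" "ps \<noteq> qs" for ps qs
    using flat_images_disjoint[OF XL avoid that(1,2)] that(3) unfolding T_def by blast
  have bound: "(\<Sum>ps\<in>F. exp (- \<delta> * plen ps)) \<le> measure (\<mu> z) hyp_bdry / c" if F: "F \<subseteq> lists pairs" "finite F" for F
  proof -
    have "(\<Sum>ps\<in>F. exp (- \<delta> * plen ps)) * c \<le> (\<Sum>ps\<in>F. measure (\<mu> z) (T ps))"
      unfolding sum_distrib_right by (intro sum_mono ge) (use F in blast)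
    also have "\<dots> = measure (\<mu> z) (\<Union>ps\<in>F. T ps)"
    proof (rule \<mu>.finite_measure_finite_Union[symmetric])
      show "T ` F \<subseteq> sets (\<mu> z)" using F(1) Ts by blast
      show "disjoint_family_on T F" unfolding disjoint_family_on_def using F(1) dis by blast
    qed (rule F(2))
    also have "\<dots> \<le> measure (\<mu> z) (space (\<mu> z))" by (rule \<mu>.bounded_measure)
    finally show ?thesis using c by (simp add: field_simps)
  qed
  have "(\<lambda>ps. exp (- \<delta> * plen ps)) summable_on lists pairs"
    by (rule nonneg_bdd_above_summable_on) (auto intro!: bdd_aboveI[of _ "measure (\<mu> z) hyp_bdry / c"] bound[simplified])
  with not_summable_lists show False by blast
qed

lemma null_image:
  assumes \<gamma>: "\<gamma> \<in> \<Gamma>" and X: "X \<in> null_sets (\<mu> z)"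
  shows "bdry_act \<gamma> ` X \<in> null_sets (\<mu> z)"
proof -
  have s: "X \<in> sets (\<mu> z)" "emeasure (\<mu> z) X = 0" using X by auto
  have "emeasure (\<mu> z) (bdry_act \<gamma> ` X) = 0"
    unfolding emeasure_image[OF \<gamma> s(1)] using AE_not_in[OF X]
    by (subst nn_integral_0_iff_AE) (use s(1) in \<open>auto simp: indicator_def elim!: eventually_mono\<close>)
  then show ?thesis using image_sets[OF \<Gamma>_isom'[OF \<gamma>] s(1)] by auto
qed

text \<open>Points of \<open>Lam0 True\<close> are not in the image of \<open>Lam True\<close> under
  a pair, so \<open>null_if_avoiding\<close> applies to them directly.\<close>

lemma Lam0_null: "Lam0 b \<in> null_sets (\<mu> z)"
proof (cases b)
  case True
  have "Lam0 True \<in> null_sets (\<mu> z)"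
  proof (rule null_if_avoiding)
    fix p \<xi> \<eta> assume p: "p \<in> pairs" and \<xi>: "\<xi> \<in> Lam0 True" and \<eta>: "\<eta> \<in> Lam True"
    have f: "fst p \<in> star (K True)" "snd p \<in> star (K False)" using p by (auto simp: pairs_def)
    have "bdry_act (snd p) \<eta> \<in> Lam (\<not> True)" using Lam_act[OF f(2), of \<eta>] \<eta> by simp
    from Lam0_images_disjoint[OF _ \<xi> this] f show "\<xi> \<noteq> bdry_act (fst p) (bdry_act (snd p) \<eta>)" by blast
  qed (use Lam0_subset in auto)
  with True show ?thesis by simp
next
  case False
  \<comment> \<open>\<open>Lam0 False\<close> lies in the wrong ping-pong set; a letter of
    \<open>K True\<close> moves it into \<open>Lam True\<close>, and nullity is carried back by
    invariance.\<close>
  define g where "g = far True"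
  have g: "g \<in> star (K True)" unfolding g_def by (rule far(1))
  have "bdry_act g ` Lam0 False \<in> null_sets (\<mu> z)"
  proof (rule null_if_avoiding)
    show "bdry_act g ` Lam0 False \<in> sets (\<mu> z)" by (rule image_sets[OF star_isom[OF g] Lam_sets(2)])
    show "bdry_act g ` Lam0 False \<subseteq> Lam True" using Lam_act[OF g] Lam0_subset[of False] by auto
    fix p \<xi> \<eta> assume p: "p \<in> pairs" and "\<xi> \<in> bdry_act g ` Lam0 False" and \<eta>: "\<eta> \<in> Lam True"
    then obtain \<zeta> where \<zeta>: "\<zeta> \<in> Lam0 False" "\<xi> = bdry_act g \<zeta>" by blast
    have f: "fst p \<in> star (K True)" "snd p \<in> star (K False)" using p by (auto simp: pairs_def)
    have L: "bdry_act (snd p) \<eta> \<in> Lam (\<not> True)" "\<zeta> \<in> Lam (\<not> True)"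
      using Lam_act[OF f(2), of \<eta>] \<eta> \<zeta>(1) Lam0_subset[of False] by auto
    show "\<xi> \<noteq> bdry_act (fst p) (bdry_act (snd p) \<eta>)"
    proof
      assume eq: "\<xi> = bdry_act (fst p) (bdry_act (snd p) \<eta>)"
      have "g \<in> K True" "fst p \<in> K True" using g f by auto
      moreover have "bdry_act g \<zeta> = bdry_act (fst p) (bdry_act (snd p) \<eta>)" using eq \<zeta>(2) by simp
      ultimately have "g = fst p" by (rule Lam_images_disjoint[OF _ _ L(2) L(1)])
      then have "\<zeta> = bdry_act (snd p) \<eta>"
        using eq \<zeta>(2) bdry_act_inj[OF star_isom[OF g] Lam_norm[OF L(2)] Lam_norm[OF L(1)]] by simp
      then show False using Lam0_images_disjoint[of "snd p" False \<zeta> \<eta>] f \<zeta>(1) \<eta> by simp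
    qed
  qed
  from null_image[OF \<Gamma>_inv[OF star_\<Gamma>[OF g]] this]
  have "bdry_act (hinv g) ` bdry_act g ` Lam0 False \<in> null_sets (\<mu> z)" .
  moreover have "bdry_act (hinv g) ` bdry_act g ` Lam0 False = Lam0 False"
    unfolding image_image using bdry_act_inv(2)[OF star_isom[OF g] Lam0_norm] by simp
  ultimately show ?thesis using False by simp
qed

lemma countable_\<Gamma>: "countable \<Gamma>"
proof -
  have "\<Gamma> = (\<Union>n::nat. {g \<in> \<Gamma>. hyp_dist x (g x) \<le> real n})" by (auto intro: real_arch_simple)
  moreover have "countable (\<Union>n::nat. {g \<in> \<Gamma>. hyp_dist x (g x) \<le> real n})"
    by (rule countable_UN[OF _ countable_finite[OF finite_\<Gamma>[OF x]]]) simp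
  ultimately show ?thesis by simp
qed

lemma N_null: "N \<in> null_sets (\<mu> z)"
  unfolding N_def by (intro null_sets_UN' countable_\<Gamma> null_image null_sets.Un Lam0_null)

lemma outside_Z_null: "hyp_bdry - (Z True \<union> Z False) \<in> null_sets (\<mu> z)"
proof -
  have cl: "closed (limit_set \<Gamma>)" unfolding limit_set_def by (intro closed_Int) auto
  have sub: "limit_set \<Gamma> \<subseteq> hyp_bdry" by (simp add: limit_set_def)
  have ls: "limit_set \<Gamma> \<in> sets (\<mu> z)"
    using compact_Int_closed[OF compact_sphere cl, of 0 1] sub by (intro compact_sets) (auto simp: Int_absorb1)
  note ps_at_z(3)
  moreover have "hyp_bdry - limit_set \<Gamma> \<in> sets (\<mu> z)" using sets.compl_sets[OF ls] by simp
  ultimately have "(hyp_bdry - limit_set \<Gamma>) \<union> N \<in> null_sets (\<mu> z)" using N_null by (intro null_sets.Un) auto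
  moreover have "hyp_bdry - (Z True \<union> Z False) \<subseteq> (hyp_bdry - limit_set \<Gamma>) \<union> N"
    using limit_set_subset by (auto simp: Z_def)
  moreover have "hyp_bdry - (Z True \<union> Z False) \<in> sets (\<mu> z)"
  proof -
    have "hyp_bdry \<in> sets (\<mu> z)" using sets.top[of "\<mu> z"] by simp
    then show ?thesis using N_null Lam_sets(1) unfolding Z_def by (intro sets.Diff sets.Un) auto
  qed
  ultimately show ?thesis using null_sets_subset by blast
qed

end

section \<open>The invariant measure in Hopf coordinates\<close>

context ps_pair
begin

abbreviation prod3 :: "((real ^ 'n) \<times> (real ^ 'n) \<times> real) measure" where
  "prod3 \<equiv> \<mu> z \<Otimes>\<^sub>M (\<mu> z \<Otimes>\<^sub>M lborel)"

text \<open>The weight vanishes on the diagonal, where \<open>gromov\<close> is a division by zero.\<close>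

definition bm :: "((real ^ 'n) \<times> (real ^ 'n) \<times> real) measure" where
  "bm = density prod3 (\<lambda>(\<xi>, \<eta>, t). ennreal (gromov z \<xi> \<eta> powr \<delta>))"

lemma sigma_finite_\<mu>: "sigma_finite_measure (\<mu> z)" by (rule \<mu>.sigma_finite_measure_axioms)

lemma sigma_finite_prod2: "sigma_finite_measure (\<mu> z \<Otimes>\<^sub>M (lborel :: real measure))"
  by (rule sigma_finite_pair_measure[OF sigma_finite_\<mu> sigma_finite_lborel])

lemma space_prod3: "space prod3 = hyp_bdry \<times> hyp_bdry \<times> UNIV"
  by (simp add: space_pair_measure)

lemma weight_measurable [measurable]:
  "(\<lambda>(\<xi>, \<eta>, t). ennreal (gromov y \<xi> \<eta> powr \<delta>)) \<in> borel_measurable prod3"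
  by measurable

lemma nn_integral_prod3:
  assumes [measurable]: "f \<in> borel_measurable prod3"
  shows "integral\<^sup>N prod3 f = (\<integral>\<^sup>+ \<xi>. \<integral>\<^sup>+ \<eta>. \<integral>\<^sup>+ t. f (\<xi>, \<eta>, t) \<partial>lborel \<partial>\<mu> z \<partial>\<mu> z)"
proof -
  have "integral\<^sup>N prod3 f = (\<integral>\<^sup>+ \<xi>. \<integral>\<^sup>+ \<omega>. f (\<xi>, \<omega>) \<partial>(\<mu> z \<Otimes>\<^sub>M lborel) \<partial>\<mu> z)"
    by (rule sigma_finite_measure.nn_integral_fst[OF sigma_finite_prod2 assms, symmetric])
  also have "\<dots> = (\<integral>\<^sup>+ \<xi>. \<integral>\<^sup>+ \<eta>. \<integral>\<^sup>+ t. f (\<xi>, \<eta>, t) \<partial>lborel \<partial>\<mu> z \<partial>\<mu> z)"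
  proof (rule nn_integral_cong)
    fix \<xi> assume "\<xi> \<in> space (\<mu> z)"
    then have "(\<lambda>\<omega>. f (\<xi>, \<omega>)) \<in> borel_measurable (\<mu> z \<Otimes>\<^sub>M lborel)" by measurable
    from sigma_finite_measure.nn_integral_fst[OF sigma_finite_lborel this]
    show "(\<integral>\<^sup>+ \<omega>. f (\<xi>, \<omega>) \<partial>(\<mu> z \<Otimes>\<^sub>M lborel)) = (\<integral>\<^sup>+ \<eta>. \<integral>\<^sup>+ t. f (\<xi>, \<eta>, t) \<partial>lborel \<partial>\<mu> z)" by simp
  qed
  finally show ?thesis .
qed

lemma emeasure_bm:
  assumes [measurable]: "A \<in> sets prod3"
  shows "emeasure bm A = (\<integral>\<^sup>+ \<xi>. \<integral>\<^sup>+ \<eta>. \<integral>\<^sup>+ t. ennreal (gromov z \<xi> \<eta> powr \<delta>) * indicator A (\<xi>, \<eta>, t) \<partial>lborel \<partial>\<mu> z \<partial>\<mu> z)"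
proof -
  have m: "(\<lambda>\<omega>. (case \<omega> of (\<xi>, \<eta>, t) \<Rightarrow> ennreal (gromov z \<xi> \<eta> powr \<delta>)) * indicator A \<omega>) \<in> borel_measurable prod3" by measurable
  have "emeasure bm A = (\<integral>\<^sup>+ \<omega>. (case \<omega> of (\<xi>, \<eta>, t) \<Rightarrow> ennreal (gromov z \<xi> \<eta> powr \<delta>)) * indicator A \<omega> \<partial>prod3)"
    unfolding bm_def by (rule emeasure_density[OF weight_measurable assms])
  then show ?thesis unfolding nn_integral_prod3[OF m] by simp
qed

text \<open>The action on tangent vectors in Hopf coordinates. Time is counted from the foot of
  \<open>z\<close>, which \<gamma> carries to the foot of \<open>\<gamma> z\<close>; the last
  coordinate corrects for this.\<close>

definition act :: "(real ^ 'n \<Rightarrow> real ^ 'n) \<Rightarrow> (real ^ 'n) \<times> (real ^ 'n) \<times> real \<Rightarrow> (real ^ 'n) \<times> (real ^ 'n) \<times> real" where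
  "act \<gamma> = (\<lambda>(\<xi>, \<eta>, t). (bdry_act \<gamma> \<xi>, bdry_act \<gamma> \<eta>,
    t + (foot (\<gamma> z) (bdry_act \<gamma> \<xi>) (bdry_act \<gamma> \<eta>) - foot z (bdry_act \<gamma> \<xi>) (bdry_act \<gamma> \<eta>))))"

lemma act_measurable:
  assumes "\<gamma> \<in> \<Gamma>" shows "act \<gamma> \<in> prod3 \<rightarrow>\<^sub>M prod3"
proof -
  note [measurable] = bdry_act_measurable[OF \<Gamma>_isom'[OF assms]]
  show ?thesis unfolding act_def by measurable
qed

lemma act_mult:
  assumes g: "g \<in> \<Gamma>" and h: "h \<in> \<Gamma>" and \<omega>: "\<omega> \<in> space prod3"
  shows "act (g \<diamondop> h) \<omega> = act g (act h \<omega>)"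
proof -
  obtain \<xi> \<eta> t where w: "\<omega> = (\<xi>, \<eta>, t)" by (cases \<omega>) auto
  have n: "norm \<xi> = 1" "norm \<eta> = 1" using \<omega> unfolding space_prod3 w by auto
  note i = \<Gamma>_isom'[OF g] \<Gamma>_isom'[OF h]
  note n' = norm_bdry_act[OF i(2) n(1)] norm_bdry_act[OF i(2) n(2)]
  have "(g \<diamondop> h) z = g (h z)" by (rule hmult_apply[OF isom_Bij[OF i(1)] isom_Bij[OF i(2)] z])
  then show ?thesis
    using foot_isom[OF i(1) n' isom_in[OF i(2) z] z]
    by (simp add: w act_def bdry_act_mult[OF i n(1)] bdry_act_mult[OF i n(2)])
qed

lemma act_inv:
  assumes g: "g \<in> \<Gamma>" and \<omega>: "\<omega> \<in> space prod3"
  shows "act (hinv g) (act g \<omega>) = \<omega>" "act g (act (hinv g) \<omega>) = \<omega>"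
proof -
  have gB: "g \<in> carrier (BijGroup hyp)" using \<Gamma>_isom'[OF g] by simp
  have one: "act hone \<omega> = \<omega>"
  proof -
    obtain \<xi> \<eta> t where w: "\<omega> = (\<xi>, \<eta>, t)" by (cases \<omega>) auto
    have n: "norm \<xi> = 1" "norm \<eta> = 1" using \<omega> unfolding space_prod3 w by auto
    show ?thesis using n z by (simp add: w act_def)
  qed
  show "act (hinv g) (act g \<omega>) = \<omega>"
    using act_mult[OF \<Gamma>_inv[OF g] g \<omega>] BG.l_inv[OF gB] one by simp
  show "act g (act (hinv g) \<omega>) = \<omega>"
    using act_mult[OF g \<Gamma>_inv[OF g] \<omega>] BG.r_inv[OF gB] one by simp
qed

text \<open>Changing the base point of \<open>gromov\<close> multiplies it by the two horospherical
  ratios, of which the densities are powers with exponent -\<delta>. On the diagonal both sides are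
  0, by division by zero.\<close>

lemma gromov_jac:
  assumes \<gamma>: "\<gamma> \<in> \<Gamma>" and n: "norm \<xi> = 1" "norm \<eta> = 1"
  shows "jac \<gamma> \<xi> * (jac \<gamma> \<eta> * gromov (\<gamma> z) \<xi> \<eta> powr \<delta>) = gromov z \<xi> \<eta> powr \<delta>"
proof (cases "\<xi> = \<eta>")
  case True then show ?thesis by (simp add: gromov_def)
next
  case False
  note gz = isom_in[OF \<Gamma>_isom'[OF \<gamma>] z]
  note h = horo_pos[OF n(1) z] horo_pos[OF n(2) z] horo_pos[OF n(1) gz] horo_pos[OF n(2) gz]
  note g = gromov_pos[OF n False z] gromov_pos[OF n False gz]
  have "ln (gromov (\<gamma> z) \<xi> \<eta>) - ln (gromov z \<xi> \<eta>) = ln (horo \<xi> (\<gamma> z) / horo \<xi> z) + ln (horo \<eta> (\<gamma> z) / horo \<eta> z)"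
    using h False by (simp add: gromov_def ln_div ln_mult_pos)
  moreover have "- \<delta> * a + (- \<delta> * b + \<delta> * p) = \<delta> * q" if "p - q = a + b" for a b p q :: real
  proof -
    have "p = a + b + q" using that by simp
    then show ?thesis by (simp add: algebra_simps)
  qed
  ultimately have "- \<delta> * ln (horo \<xi> (\<gamma> z) / horo \<xi> z) + (- \<delta> * ln (horo \<eta> (\<gamma> z) / horo \<eta> z) + \<delta> * ln (gromov (\<gamma> z) \<xi> \<eta>)) = \<delta> * ln (gromov z \<xi> \<eta>)"
    by blast
  then show ?thesis using g unfolding jac_def powr_def by (simp flip: exp_add)
qed

text \<open>The shift in time is absorbed by Lebesgue measure. The substitutions in \<eta> and then
  in \<xi> produce the two densities, and by \<open>gromov_jac\<close> these restore the weight at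
  \<open>z\<close>.\<close>

lemma emeasure_bm_act:
  assumes \<gamma>: "\<gamma> \<in> \<Gamma>" and A[measurable]: "A \<in> sets prod3"
  shows "emeasure bm (act \<gamma> -` A \<inter> space prod3) = emeasure bm A"
proof -
  note i = \<Gamma>_isom'[OF \<gamma>]
  note [measurable] = bdry_act_measurable[OF i]
  define c where "c \<xi> \<eta> = foot (\<gamma> z) \<xi> \<eta> - foot z \<xi> \<eta>" for \<xi> \<eta>
  define G where "G = (\<lambda>(\<xi>, \<eta>). \<integral>\<^sup>+ t. ennreal (gromov (\<gamma> z) \<xi> \<eta> powr \<delta>) * indicator A (\<xi>, \<eta>, t) \<partial>lborel)"
  interpret L: sigma_finite_measure "lborel :: real measure" by (rule sigma_finite_lborel)
  interpret U: sigma_finite_measure "\<mu> z" by (rule sigma_finite_\<mu>)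
  have G[measurable]: "G \<in> borel_measurable (\<mu> z \<Otimes>\<^sub>M \<mu> z)" unfolding G_def by measurable
  have inner: "(\<integral>\<^sup>+ t. ennreal (gromov z \<xi> \<eta> powr \<delta>) * indicator (act \<gamma> -` A \<inter> space prod3) (\<xi>, \<eta>, t) \<partial>lborel)
      = G (bdry_act \<gamma> \<xi>, bdry_act \<gamma> \<eta>)" if s: "\<xi> \<in> space (\<mu> z)" "\<eta> \<in> space (\<mu> z)" for \<xi> \<eta>
  proof -
    have n: "norm \<xi> = 1" "norm \<eta> = 1" using s by auto
    have s': "bdry_act \<gamma> \<xi> \<in> space (\<mu> z)" "bdry_act \<gamma> \<eta> \<in> space (\<mu> z)" using norm_bdry_act[OF i] n by auto
    have w: "gromov z \<xi> \<eta> = gromov (\<gamma> z) (bdry_act \<gamma> \<xi>) (bdry_act \<gamma> \<eta>)"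
    proof (cases "\<xi> = \<eta>")
      case True then show ?thesis by (simp add: gromov_def)
    next
      case False then show ?thesis by (rule gromov_isom[OF i n _ z, symmetric])
    qed
    have ind: "indicator (act \<gamma> -` A \<inter> space prod3) (\<xi>, \<eta>, t) = (indicator A (bdry_act \<gamma> \<xi>, bdry_act \<gamma> \<eta>, c (bdry_act \<gamma> \<xi>) (bdry_act \<gamma> \<eta>) + 1 * t) :: ennreal)" for t
      using n by (simp add: indicator_def act_def c_def space_prod3 add.commute)
    have m: "(\<lambda>t. indicator A (bdry_act \<gamma> \<xi>, bdry_act \<gamma> \<eta>, t) :: ennreal) \<in> borel_measurable borel" using s' by measurable
    have tr: "(\<integral>\<^sup>+ t. indicator A (bdry_act \<gamma> \<xi>, bdry_act \<gamma> \<eta>, c (bdry_act \<gamma> \<xi>) (bdry_act \<gamma> \<eta>) + 1 * t) \<partial>lborel)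
        = (\<integral>\<^sup>+ t. indicator A (bdry_act \<gamma> \<xi>, bdry_act \<gamma> \<eta>, t) \<partial>lborel)"
      using nn_integral_real_affine[OF m, of 1 "c (bdry_act \<gamma> \<xi>) (bdry_act \<gamma> \<eta>)"] by simp
    have m1: "(\<lambda>t. indicator A (bdry_act \<gamma> \<xi>, bdry_act \<gamma> \<eta>, c (bdry_act \<gamma> \<xi>) (bdry_act \<gamma> \<eta>) + 1 * t) :: ennreal) \<in> borel_measurable lborel"
      and m2: "(\<lambda>t. indicator A (bdry_act \<gamma> \<xi>, bdry_act \<gamma> \<eta>, t) :: ennreal) \<in> borel_measurable lborel" using s' by measurable
    show ?thesis unfolding G_def prod.case w ind nn_integral_cmult[OF m1] nn_integral_cmult[OF m2] tr ..
  qed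
  have "emeasure bm (act \<gamma> -` A \<inter> space prod3) = (\<integral>\<^sup>+ \<xi>. \<integral>\<^sup>+ \<eta>. G (bdry_act \<gamma> \<xi>, bdry_act \<gamma> \<eta>) \<partial>\<mu> z \<partial>\<mu> z)"
    unfolding emeasure_bm[OF measurable_sets[OF act_measurable[OF \<gamma>] A]]
    by (intro nn_integral_cong inner)
  also have "\<dots> = (\<integral>\<^sup>+ \<xi>. \<integral>\<^sup>+ \<eta>. ennreal (jac \<gamma> \<eta>) * G (bdry_act \<gamma> \<xi>, \<eta>) \<partial>\<mu> z \<partial>\<mu> z)"
  proof (rule nn_integral_cong)
    fix \<xi> assume "\<xi> \<in> space (\<mu> z)"
    then have s: "bdry_act \<gamma> \<xi> \<in> space (\<mu> z)" using norm_bdry_act[OF i, of \<xi>] by simp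
    have "(\<lambda>\<eta>. G (bdry_act \<gamma> \<xi>, \<eta>)) \<in> borel_measurable (\<mu> z)" using s by measurable
    from nn_integral_bdry_act[OF \<gamma> this]
    show "(\<integral>\<^sup>+ \<eta>. G (bdry_act \<gamma> \<xi>, bdry_act \<gamma> \<eta>) \<partial>\<mu> z) = (\<integral>\<^sup>+ \<eta>. ennreal (jac \<gamma> \<eta>) * G (bdry_act \<gamma> \<xi>, \<eta>) \<partial>\<mu> z)" .
  qed
  also have "\<dots> = (\<integral>\<^sup>+ \<xi>. ennreal (jac \<gamma> \<xi>) * (\<integral>\<^sup>+ \<eta>. ennreal (jac \<gamma> \<eta>) * G (\<xi>, \<eta>) \<partial>\<mu> z) \<partial>\<mu> z)"
    by (rule nn_integral_bdry_act[OF \<gamma>, of "\<lambda>\<xi>. \<integral>\<^sup>+ \<eta>. ennreal (jac \<gamma> \<eta>) * G (\<xi>, \<eta>) \<partial>\<mu> z"]) measurable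
  also have "\<dots> = (\<integral>\<^sup>+ \<xi>. \<integral>\<^sup>+ \<eta>. \<integral>\<^sup>+ t. ennreal (gromov z \<xi> \<eta> powr \<delta>) * indicator A (\<xi>, \<eta>, t) \<partial>lborel \<partial>\<mu> z \<partial>\<mu> z)"
  proof (rule nn_integral_cong)
    fix \<xi> assume s1: "\<xi> \<in> space (\<mu> z)"
    have "(\<lambda>\<eta>. ennreal (jac \<gamma> \<eta>) * G (\<xi>, \<eta>)) \<in> borel_measurable (\<mu> z)" using s1 by measurable
    then have "ennreal (jac \<gamma> \<xi>) * (\<integral>\<^sup>+ \<eta>. ennreal (jac \<gamma> \<eta>) * G (\<xi>, \<eta>) \<partial>\<mu> z) = (\<integral>\<^sup>+ \<eta>. ennreal (jac \<gamma> \<xi>) * (ennreal (jac \<gamma> \<eta>) * G (\<xi>, \<eta>)) \<partial>\<mu> z)"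
      by (rule nn_integral_cmult[symmetric])
    also have "\<dots> = (\<integral>\<^sup>+ \<eta>. \<integral>\<^sup>+ t. ennreal (gromov z \<xi> \<eta> powr \<delta>) * indicator A (\<xi>, \<eta>, t) \<partial>lborel \<partial>\<mu> z)"
    proof (rule nn_integral_cong)
      fix \<eta> assume s2: "\<eta> \<in> space (\<mu> z)"
      have m: "(\<lambda>t. indicator A (\<xi>, \<eta>, t) :: ennreal) \<in> borel_measurable lborel" using s1 s2 by measurable
      have n: "norm \<xi> = 1" "norm \<eta> = 1" using s1 s2 by auto
      have "ennreal (jac \<gamma> \<xi>) * (ennreal (jac \<gamma> \<eta>) * ennreal (gromov (\<gamma> z) \<xi> \<eta> powr \<delta>)) = ennreal (gromov z \<xi> \<eta> powr \<delta>)"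
        unfolding gromov_jac[OF \<gamma> n, symmetric] by (simp add: ennreal_mult jac_def)
      then show "ennreal (jac \<gamma> \<xi>) * (ennreal (jac \<gamma> \<eta>) * G (\<xi>, \<eta>)) = (\<integral>\<^sup>+ t. ennreal (gromov z \<xi> \<eta> powr \<delta>) * indicator A (\<xi>, \<eta>, t) \<partial>lborel)"
        unfolding G_def prod.case nn_integral_cmult[OF m] by (simp flip: mult.assoc)
    qed
    finally show "ennreal (jac \<gamma> \<xi>) * (\<integral>\<^sup>+ \<eta>. ennreal (jac \<gamma> \<eta>) * G (\<xi>, \<eta>) \<partial>\<mu> z)
      = (\<integral>\<^sup>+ \<eta>. \<integral>\<^sup>+ t. ennreal (gromov z \<xi> \<eta> powr \<delta>) * indicator A (\<xi>, \<eta>, t) \<partial>lborel \<partial>\<mu> z)" .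
  qed
  also have "\<dots> = emeasure bm A" by (rule emeasure_bm[OF A, symmetric])
  finally show ?thesis .
qed

text \<open>\<open>crossing\<close> in Hopf coordinates: \<open>t + foot z \<xi> \<eta>\<close> is
  the parameter of \<open>line\<close>.\<close>

definition piece :: "bool \<Rightarrow> (real ^ 'n \<Rightarrow> real ^ 'n) \<Rightarrow> ((real ^ 'n) \<times> (real ^ 'n) \<times> real) set" where
  "piece b a = {(\<xi>, \<eta>, t). crossing b a \<xi> \<eta> (t + foot z \<xi> \<eta>)}"

lemma piece_eq:
  "piece b a = {\<omega> \<in> space prod3. fst \<omega> \<in> Lam (\<not> b) \<and> fst (snd \<omega>) \<in> bdry_act a ` Lam (\<not> b) \<and>
    foot x (fst \<omega>) (fst (snd \<omega>)) \<le> snd (snd \<omega>) + foot z (fst \<omega>) (fst (snd \<omega>)) \<and>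
    snd (snd \<omega>) + foot z (fst \<omega>) (fst (snd \<omega>)) < foot (a x) (fst \<omega>) (fst (snd \<omega>))}"
  if "a \<in> hyp_isometries"
  using sets_bdry[OF Lam_sets(1), of "\<not> b"] sets_bdry[OF image_sets[OF that Lam_sets(1)], of "\<not> b"]
  unfolding piece_def crossing_def space_prod3 by fastforce

lemma piece_sets [measurable]:
  assumes a: "a \<in> hyp_isometries" shows "piece b a \<in> sets prod3"
proof -
  note [measurable] = image_sets[OF a Lam_sets(1), of "\<not> b"]
  show ?thesis unfolding piece_eq[OF a] by measurable
qed

text \<open>Three bounds multiply: the weight is bounded because the end points have opposite types,
  the time interval has length at most \<open>disp x a\<close> by \<open>foot_lipschitz\<close>, and
  the image of \<open>Lam (\<not> b)\<close> has mass of order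
  \<open>exp (- \<delta> * disp x a)\<close>.\<close>

lemma emeasure_piece_le:
  obtains s C where "s > critical_exponent (K True)" "C \<ge> 0"
    "\<And>b a. a \<in> K b \<Longrightarrow> emeasure bm (piece b a) \<le> ennreal (C * exp (- s * disp x a))"
proof -
  \<comment> \<open>Midway between the two exponents: above that of \<open>K True\<close> for
    convergence, below \<delta> to absorb the linear factor.\<close>
  define s where "s = (critical_exponent (K True) + \<delta>) / 2"
  have s: "s > critical_exponent (K True)" "\<delta> - s > 0" using exponent_gap by (auto simp: s_def)
  define W where "W = (4 * exp (2 * R) * exp (2 * hyp_dist x z)) powr \<delta>"
  define c where "c = exp (\<delta> * (2 * R + 2 * hyp_dist x z))"
  define m where "m = measure (\<mu> z) hyp_bdry"
  define C where "C = W * (m * (c * m)) / (\<delta> - s)"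
  have C0: "C \<ge> 0" using s by (simp add: C_def W_def c_def m_def)
  have le: "emeasure bm (piece b a) \<le> ennreal (C * exp (- s * disp x a))" if aK: "a \<in> K b" for b a
  proof (cases "a = hone")
    case True
    have "piece b a = {}" using x by (auto simp: piece_def crossing_def True)
    then show ?thesis by simp
  next
    case False
    then have a: "a \<in> star (K b)" using aK by blast
    note ai = star_isom[OF a]
    note [measurable] = image_sets[OF ai Lam_sets(1), of "\<not> b"]
    let ?L = "Lam (\<not> b)" and ?aL = "bdry_act a ` Lam (\<not> b)"
    have w: "gromov z \<xi> \<eta> powr \<delta> \<le> W" if \<xi>: "\<xi> \<in> ?L" and \<eta>: "\<eta> \<in> ?aL" for \<xi> \<eta>
    proof -
      have "\<eta> \<in> Lam b" using \<eta> Lam_act[OF a] by blast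
      then have le: "gromov x \<xi> \<eta> \<le> 4 * exp (2 * R)" using gromov_le[OF \<xi>, of \<eta>] by simp
      note n = Lam_norm[OF \<xi>] Lam_norm[OF \<open>\<eta> \<in> Lam b\<close>]
      have ne: "\<xi> \<noteq> \<eta>" using Lam_disjoint[of b] \<xi> \<open>\<eta> \<in> Lam b\<close> by blast
      have h: "horo \<zeta> z \<le> exp (hyp_dist x z) * horo \<zeta> x" if "norm \<zeta> = 1" for \<zeta>
        using ln_horo_ratio_le[OF that z x] horo_pos[OF that x] by (simp add: divide_le_eq hyp_dist_commute[of z x])
      have "gromov z \<xi> \<eta> \<le> 4 * (exp (hyp_dist x z) * horo \<xi> x) * (exp (hyp_dist x z) * horo \<eta> x) / (norm (\<xi> - \<eta>))\<^sup>2"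
        unfolding gromov_def using h[OF n(1)] h[OF n(2)] horo_pos[OF n(1) z] horo_pos[OF n(2) z] horo_pos[OF n(1) x]
        by (intro divide_right_mono mult_mono) auto
      also have "\<dots> = gromov x \<xi> \<eta> * exp (2 * hyp_dist x z)" by (simp add: gromov_def mult_exp_exp)
      also have "\<dots> \<le> 4 * exp (2 * R) * exp (2 * hyp_dist x z)" by (rule mult_right_mono[OF le]) simp
      finally show ?thesis unfolding W_def using \<delta>_pos gromov_pos[OF n ne z] by (intro powr_mono2) auto
    qed
    define I where "I \<xi> \<eta> = {foot x \<xi> \<eta> - foot z \<xi> \<eta> ..< foot (a x) \<xi> \<eta> - foot z \<xi> \<eta>}" for \<xi> \<eta>
    have len: "emeasure lborel (I \<xi> \<eta>) \<le> ennreal (disp x a)" if "\<xi> \<in> ?L" "\<eta> \<in> ?aL" for \<xi> \<eta>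
    proof (cases "foot x \<xi> \<eta> \<le> foot (a x) \<xi> \<eta>")
      case True
      have n: "norm \<xi> = 1" "norm \<eta> = 1" using that Lam_norm Lam_act[OF a] by blast+
      have "foot (a x) \<xi> \<eta> - foot x \<xi> \<eta> \<le> disp x a"
        using foot_lipschitz[OF n isom_in[OF ai x] x] by (simp add: disp_def hyp_dist_commute[of "a x"])
      then show ?thesis using True by (simp add: I_def ennreal_leI)
    next
      case False then show ?thesis by (simp add: I_def)
    qed
    have "emeasure bm (piece b a) \<le> (\<integral>\<^sup>+ \<xi>. \<integral>\<^sup>+ \<eta>. (ennreal W * ennreal (disp x a) * indicator ?aL \<eta>) * indicator ?L \<xi> \<partial>\<mu> z \<partial>\<mu> z)"
      unfolding emeasure_bm[OF piece_sets[OF ai]]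
    proof (intro nn_integral_mono)
      fix \<xi> \<eta>
      show "(\<integral>\<^sup>+ t. ennreal (gromov z \<xi> \<eta> powr \<delta>) * indicator (piece b a) (\<xi>, \<eta>, t) \<partial>lborel)
        \<le> (ennreal W * ennreal (disp x a) * indicator ?aL \<eta>) * indicator ?L \<xi>"
      proof (cases "\<xi> \<in> ?L \<and> \<eta> \<in> ?aL")
        case True
        have "(\<integral>\<^sup>+ t. ennreal (gromov z \<xi> \<eta> powr \<delta>) * indicator (piece b a) (\<xi>, \<eta>, t) \<partial>lborel)
          \<le> (\<integral>\<^sup>+ t. ennreal W * indicator (I \<xi> \<eta>) t \<partial>lborel)"
          by (intro nn_integral_mono mult_mono)
             (use True w in \<open>auto simp: indicator_def piece_def crossing_def I_def ennreal_leI\<close>)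
        also have "\<dots> = ennreal W * emeasure lborel (I \<xi> \<eta>)"
          by (rule nn_integral_cmult_indicator) (simp add: I_def)
        also have "\<dots> \<le> ennreal W * ennreal (disp x a)" by (intro mult_left_mono len) (use True in auto)
        finally show ?thesis using True by simp
      next
        case False
        then have "indicator (piece b a) (\<xi>, \<eta>, t) = (0 :: ennreal)" for t by (auto simp: indicator_def piece_def crossing_def)
        then show ?thesis by simp
      qed
    qed
    also have "\<dots> = (\<integral>\<^sup>+ \<xi>. (ennreal W * ennreal (disp x a) * emeasure (\<mu> z) ?aL) * indicator ?L \<xi> \<partial>\<mu> z)"
      by (intro nn_integral_cong) (simp add: nn_integral_multc nn_integral_cmult_indicator)
    also have "\<dots> = ennreal W * ennreal (disp x a) * emeasure (\<mu> z) ?aL * emeasure (\<mu> z) ?L"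
      by (rule nn_integral_cmult_indicator) (rule Lam_sets(1))
    also have "\<dots> \<le> ennreal W * ennreal (disp x a) * (ennreal (c * exp (- \<delta> * disp x a)) * ennreal m) * ennreal m"
    proof (intro mult_mono mult_left_mono)
      have L: "emeasure (\<mu> z) ?L \<le> ennreal m"
        unfolding m_def \<mu>.emeasure_eq_measure using \<mu>.bounded_measure[of ?L] by (simp add: ennreal_leI)
      then show "emeasure (\<mu> z) ?L \<le> ennreal m" .
      have "emeasure (\<mu> z) ?aL \<le> ennreal (c * exp (- \<delta> * disp x a)) * emeasure (\<mu> z) ?L"
        unfolding c_def by (rule emeasure_image_le[OF a Lam_sets(1)]) simp
      also have "\<dots> \<le> ennreal (c * exp (- \<delta> * disp x a)) * ennreal m" by (rule mult_left_mono[OF L]) simp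
      finally show "emeasure (\<mu> z) ?aL \<le> ennreal (c * exp (- \<delta> * disp x a)) * ennreal m" .
    qed auto
    also have "\<dots> = ennreal (W * disp x a * (c * exp (- \<delta> * disp x a) * m) * m)"
      using disp_nonneg[OF x ai] by (simp add: ennreal_mult[symmetric] W_def c_def m_def)
    also have "\<dots> \<le> ennreal (C * exp (- s * disp x a))"
    proof (rule ennreal_leI)
      have "disp x a * exp (- \<delta> * disp x a) \<le> exp ((\<delta> - s) * disp x a) / (\<delta> - s) * exp (- \<delta> * disp x a)"
        by (rule mult_right_mono[OF linear_exp_le[OF s(2)]]) simp
      also have "\<dots> = exp (- s * disp x a) / (\<delta> - s)" by (simp add: algebra_simps flip: exp_add)
      finally have "W * (m * (c * m)) * (disp x a * exp (- \<delta> * disp x a)) \<le> W * (m * (c * m)) * (exp (- s * disp x a) / (\<delta> - s))"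
        by (rule mult_left_mono) (simp add: W_def m_def c_def)
      then show "W * disp x a * (c * exp (- \<delta> * disp x a) * m) * m \<le> C * exp (- s * disp x a)" by (simp add: C_def ac_simps)
    qed
    finally show ?thesis .
  qed
  from that[OF s(1) C0 le] show thesis .
qed

definition domain :: "((real ^ 'n) \<times> (real ^ 'n) \<times> real) set" where
  "domain = (\<Union>b. \<Union>a\<in>K b. piece b a)"

lemma countable_K: "countable (K b)" using countable_\<Gamma> K_\<Gamma> countable_subset by blast

lemma domain_eq: "domain = (\<Union>a\<in>K True. piece True a) \<union> (\<Union>a\<in>K False. piece False a)"
  by (auto simp: domain_def UNIV_bool)

lemma pieces_sets: "(\<Union>a\<in>K b. piece b a) \<in> sets prod3"
proof (rule sets.countable_UN'[OF countable_K])
  show "piece b ` K b \<subseteq> sets prod3" using piece_sets[OF K_isom] by blast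
qed

lemma domain_sets: "domain \<in> sets prod3"
  unfolding domain_eq by (intro sets.Un pieces_sets)

text \<open>The bounds of \<open>emeasure_piece_le\<close> sum to a convergent series over either
  factor, since \<open>s\<close> exceeds both critical exponents.\<close>

lemma finite_domain: "emeasure bm domain < \<infinity>"
proof -
  obtain s C where s: "s > critical_exponent (K True)" and C: "C \<ge> 0"
    and le: "\<And>b a. a \<in> K b \<Longrightarrow> emeasure bm (piece b a) \<le> ennreal (C * exp (- s * disp x a))" by (rule emeasure_piece_le) blast
  have sets_bm: "sets bm = sets prod3" by (simp add: bm_def)
  have fin: "emeasure bm (\<Union>a\<in>K b. piece b a) < \<infinity>" for b
  proof -
    define e where "e = from_nat_into (K b)"
    have e: "bij_betw e UNIV (K b)" unfolding e_def by (rule bij_betw_from_nat_into[OF countable_K infinite_K])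
    have eK: "e n \<in> K b" for n using e by (auto simp: bij_betw_def)
    have re: "K b = range e" using e by (simp add: bij_betw_def)
    have "(\<Union>a\<in>K b. piece b a) = (\<Union>n. piece b (e n))" unfolding re by simp
    also have "emeasure bm \<dots> \<le> (\<Sum>n. emeasure bm (piece b (e n)))"
      by (rule emeasure_subadditive_countably) (use piece_sets[OF K_isom[OF eK]] sets_bm in auto)
    also have "\<dots> \<le> (\<Sum>n. ennreal (C * exp (- s * disp x (e n))))" by (intro suminf_le le eK) auto
    also have "\<dots> < \<infinity>"
    proof -
      have "(\<lambda>n. exp (- s * disp x (e n))) summable_on UNIV"
        using summable_on_reindex_bij_betw[OF e, of "\<lambda>g. exp (- s * disp x g)"] summable_K[OF s] by simp
      then have "summable (\<lambda>n. exp (- s * disp x (e n)))" by (subst (asm) summable_on_UNIV_nonneg_real_iff) auto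
      then have "summable (\<lambda>n. C * exp (- s * disp x (e n)))" by (rule summable_mult)
      then have "(\<Sum>n. ennreal (C * exp (- s * disp x (e n)))) \<noteq> \<infinity>"
        unfolding infinity_ennreal_def by (rule ennreal_suminf_neq_top) (use C in simp)
      then show ?thesis by (simp add: top.not_eq_extremum)
    qed
    finally show ?thesis .
  qed
  have S: "(\<Union>a\<in>K b. piece b a) \<in> sets bm" for b
    unfolding sets_bm by (rule pieces_sets)
  have "emeasure bm domain \<le> emeasure bm (\<Union>a\<in>K True. piece True a) + emeasure bm (\<Union>a\<in>K False. piece False a)"
    unfolding domain_eq by (rule emeasure_subadditive[OF S S])
  also have "\<dots> < \<infinity>" using fin[of True] fin[of False] by simp
  finally show ?thesis .
qed

lemma moved_into_domain:
  assumes \<xi>: "\<xi> \<in> Z True \<union> Z False" and \<eta>: "\<eta> \<in> Z True \<union> Z False" and ne: "\<xi> \<noteq> \<eta>"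
  shows "\<exists>\<gamma>\<in>\<Gamma>. act (hinv \<gamma>) (\<xi>, \<eta>, t) \<in> domain"
proof -
  have "reach \<xi> \<eta> (t + foot z \<xi> \<eta>)" using reach_all[OF _ _ ne] \<xi> \<eta> by blast
  then obtain \<gamma> \<xi>' \<eta>' b a where \<gamma>: "\<gamma> \<in> \<Gamma>" and n: "norm \<xi>' = 1" "norm \<eta>' = 1" and a: "a \<in> star (K b)"
    and eq: "\<xi> = bdry_act \<gamma> \<xi>'" "\<eta> = bdry_act \<gamma> \<eta>'"
    and c: "crossing b a \<xi>' \<eta>' (t + foot z \<xi> \<eta> - foot (\<gamma> x) \<xi> \<eta> + foot x \<xi>' \<eta>')"
    unfolding reach_def by blast
  note i = \<Gamma>_isom'[OF \<gamma>]
  note hi = isom_inv[OF i]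
  have inv: "bdry_act (hinv \<gamma>) \<xi> = \<xi>'" "bdry_act (hinv \<gamma>) \<eta> = \<eta>'" unfolding eq using bdry_act_inv(2)[OF i] n by auto
  have "foot z \<xi> \<eta> - foot (\<gamma> x) \<xi> \<eta> = foot (hinv \<gamma> z) \<xi>' \<eta>' - foot x \<xi>' \<eta>'"
    using foot_isom[OF i n isom_in[OF hi z] x] isom_hinv_apply(1)[OF i z] unfolding eq by simp
  then have t: "t + foot z \<xi> \<eta> - foot (\<gamma> x) \<xi> \<eta> + foot x \<xi>' \<eta>' = t + (foot (hinv \<gamma> z) \<xi>' \<eta>' - foot z \<xi>' \<eta>') + foot z \<xi>' \<eta>'" by linarith
  have "act (hinv \<gamma>) (\<xi>, \<eta>, t) \<in> piece b a" using c unfolding t by (simp add: act_def inv piece_def)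
  then show ?thesis using \<gamma> a unfolding domain_def by blast
qed

lemma bm_cover: "AE \<omega> in bm. \<exists>\<gamma>\<in>\<Gamma>. act (hinv \<gamma>) \<omega> \<in> domain"
proof -
  let ?X = "hyp_bdry - (Z True \<union> Z False)"
  have s: "hyp_bdry \<in> sets (\<mu> z)" using sets.top[of "\<mu> z"] by simp
  have u: "UNIV \<in> sets (lborel :: real measure)" by simp
  note X = outside_Z_null
  have "?X \<times> (hyp_bdry \<times> UNIV) \<in> null_sets prod3"
    by (rule sigma_finite_measure.times_in_null_sets1[OF sigma_finite_prod2 X pair_measureI[OF s u]])
  moreover have "hyp_bdry \<times> (?X \<times> UNIV) \<in> null_sets prod3"
    by (rule sigma_finite_measure.times_in_null_sets2[OF sigma_finite_prod2 s
      sigma_finite_measure.times_in_null_sets1[OF sigma_finite_lborel X u]])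
  ultimately have "(?X \<times> (hyp_bdry \<times> UNIV)) \<union> (hyp_bdry \<times> (?X \<times> UNIV)) \<in> null_sets prod3" by (rule null_sets.Un)
  then have "AE \<omega> in prod3. fst \<omega> \<in> Z True \<union> Z False \<and> fst (snd \<omega>) \<in> Z True \<union> Z False"
    by (rule AE_I') (auto simp: space_prod3)
  then have "AE \<omega> in prod3. 0 < (case \<omega> of (\<xi>, \<eta>, t) \<Rightarrow> ennreal (gromov z \<xi> \<eta> powr \<delta>)) \<longrightarrow> (\<exists>\<gamma>\<in>\<Gamma>. act (hinv \<gamma>) \<omega> \<in> domain)"
  proof eventually_elim
    case (elim \<omega>)
    obtain \<xi> \<eta> t where w: "\<omega> = (\<xi>, \<eta>, t)" by (cases \<omega>) auto
    show ?case
    proof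
      assume "0 < (case \<omega> of (\<xi>, \<eta>, t) \<Rightarrow> ennreal (gromov z \<xi> \<eta> powr \<delta>))"
      then have "\<xi> \<noteq> \<eta>" by (auto simp: w gromov_def)
      then show "\<exists>\<gamma>\<in>\<Gamma>. act (hinv \<gamma>) \<omega> \<in> domain" unfolding w using elim by (intro moved_into_domain) (auto simp: w)
    qed
  qed
  then show ?thesis unfolding bm_def by (subst AE_density[OF weight_measurable])
qed

lemma emeasure_bm_hopf:
  assumes E: "E \<in> sets (bm_hopf \<Gamma> \<mu> z)"
  shows "E \<in> sets prod3" "E \<subseteq> {(\<xi>, \<eta>, t). \<xi> \<noteq> \<eta>}" "emeasure (bm_hopf \<Gamma> \<mu> z) E = emeasure bm E"
proof -
  let ?O = "{(\<xi> :: real ^ 'n, \<eta> :: real ^ 'n, t :: real). \<xi> \<noteq> \<eta>}"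
  let ?f = "\<lambda>(\<xi>, \<eta>, t :: real). ennreal (bm_gap \<Gamma> z \<xi> \<eta> powr - 2)" and ?w = "\<lambda>(\<xi>, \<eta>, t :: real). ennreal (gromov z \<xi> \<eta> powr \<delta>)"
  have O: "?O \<inter> space prod3 \<in> sets prod3"
  proof -
    \<comment> \<open>Off-diagonality expressed by the nonvanishing of \<open>gromov\<close>, whose
      measurability for the product is already known.\<close>
    have "?O \<inter> space prod3 = {\<omega> \<in> space prod3. gromov z (fst \<omega>) (fst (snd \<omega>)) \<noteq> 0}"
    proof (rule subset_antisym; rule subsetI)
      fix \<omega> assume "\<omega> \<in> ?O \<inter> space prod3"
      then show "\<omega> \<in> {\<omega> \<in> space prod3. gromov z (fst \<omega>) (fst (snd \<omega>)) \<noteq> 0}"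
        using gromov_pos[OF _ _ _ z, of "fst \<omega>" "fst (snd \<omega>)"] by (auto simp: space_prod3)
    qed (auto simp: gromov_def)
    also have "\<dots> \<in> sets prod3" by measurable
    finally show ?thesis .
  qed
  have fw: "?f \<omega> = ?w \<omega>" if "\<omega> \<in> space (restrict_space prod3 ?O)" for \<omega>
    using that bm_gap_powr[OF _ _ _ z] by (auto simp: space_restrict_space space_prod3)
  have wm: "?w \<in> borel_measurable (restrict_space prod3 ?O)" by (rule measurable_restrict_space1[OF weight_measurable])
  have fm: "?f \<in> borel_measurable (restrict_space prod3 ?O)" by (rule measurable_cong[THEN iffD2, OF fw wm])
  have E': "E \<in> sets (restrict_space prod3 ?O)" using E by (simp add: bm_hopf_def)
  then have "E \<subseteq> ?O \<and> E \<in> sets prod3" using sets_restrict_space_iff[OF O] by blast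
  then show sub: "E \<in> sets prod3" "E \<subseteq> ?O" by auto
  have "emeasure (bm_hopf \<Gamma> \<mu> z) E = (\<integral>\<^sup>+ \<omega>. ?f \<omega> * indicator E \<omega> \<partial>restrict_space prod3 ?O)"
    unfolding bm_hopf_def by (rule emeasure_density[OF fm E'])
  also have "\<dots> = (\<integral>\<^sup>+ \<omega>. ?w \<omega> * indicator E \<omega> \<partial>restrict_space prod3 ?O)"
    by (rule nn_integral_cong) (simp only: fw)
  also have "\<dots> = (\<integral>\<^sup>+ \<omega>. ?w \<omega> * indicator E \<omega> * indicator ?O \<omega> \<partial>prod3)"
    by (rule nn_integral_restrict_space[OF O])
  also have "\<dots> = (\<integral>\<^sup>+ \<omega>. ?w \<omega> * indicator E \<omega> \<partial>prod3)"
    by (rule nn_integral_cong) (use sub(2) in \<open>auto simp: indicator_def\<close>)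
  also have "\<dots> = emeasure bm E" unfolding bm_def by (rule emeasure_density[OF weight_measurable sub(1), symmetric])
  finally show "emeasure (bm_hopf \<Gamma> \<mu> z) E = emeasure bm E" .
qed

section \<open>Passage to the quotient\<close>

definition vec :: "(real ^ 'n) \<times> (real ^ 'n) \<times> real \<Rightarrow> (real ^ 'n) \<times> (real ^ 'n)" where
  "vec = inv_into unit_tangent (hopf z)"

definition orbit :: "(real ^ 'n) \<times> (real ^ 'n) \<Rightarrow> ((real ^ 'n) \<times> (real ^ 'n)) set" where
  "orbit v = (\<lambda>g. tangent_act g v) ` \<Gamma>"

lemma vec_eq:
  "endpoints \<xi> \<eta> \<Longrightarrow> vec (\<xi>, \<eta>, t) = (line \<xi> \<eta> (t + foot z \<xi> \<eta>), line_vel \<xi> \<eta> (t + foot z \<xi> \<eta>))"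
  unfolding vec_def by (rule inv_hopf[OF _ z])

lemma endpoints_iff: "(\<xi>, \<eta>, t) \<in> space prod3 \<Longrightarrow> endpoints \<xi> \<eta> \<longleftrightarrow> \<xi> \<noteq> \<eta>"
  by (simp add: endpoints_def space_prod3)

lemma hopf_vec: "endpoints \<xi> \<eta> \<Longrightarrow> hopf z (vec (\<xi>, \<eta>, t)) = (\<xi>, \<eta>, t)"
  unfolding vec_eq using hopf_line[OF _ z] by simp

lemma tangent_act_vec:
  assumes \<gamma>: "\<gamma> \<in> \<Gamma>" and e: "endpoints \<xi> \<eta>"
  shows "tangent_act \<gamma> (vec (\<xi>, \<eta>, t)) = vec (act \<gamma> (\<xi>, \<eta>, t))"
proof -
  note i = \<Gamma>_isom'[OF \<gamma>]
  show ?thesis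
    unfolding vec_eq[OF e] tangent_act_line[OF i \<Gamma>_differentiable[OF \<gamma> line_geodesic(3)[OF e]] e z] act_def prod.case
      vec_eq[OF endpoints_bdry_act[OF i e]] by (simp add: Let_def)
qed

lemma orbit_act:
  assumes \<gamma>: "\<gamma> \<in> \<Gamma>" and \<omega>: "\<omega> \<in> space prod3" and e: "endpoints (fst \<omega>) (fst (snd \<omega>))"
  shows "orbit (vec (act \<gamma> \<omega>)) = orbit (vec \<omega>)"
proof -
  have or: "orbit (vec \<omega>') = (\<lambda>g. vec (act g \<omega>')) ` \<Gamma>" if "endpoints (fst \<omega>') (fst (snd \<omega>'))" for \<omega>'
    unfolding orbit_def using that by (intro image_cong refl) (cases \<omega>', simp add: tangent_act_vec)
  have e': "endpoints (fst (act \<gamma> \<omega>)) (fst (snd (act \<gamma> \<omega>)))"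
    using endpoints_bdry_act[OF \<Gamma>_isom'[OF \<gamma>] e] by (cases \<omega>) (simp add: act_def)
  have "orbit (vec (act \<gamma> \<omega>)) = (\<lambda>g. vec (act (g \<diamondop> \<gamma>) \<omega>)) ` \<Gamma>"
    unfolding or[OF e'] by (intro image_cong refl) (simp add: act_mult[OF _ \<gamma> \<omega>])
  also have "\<dots> = (\<lambda>g. vec (act g \<omega>)) ` ((\<lambda>g. g \<diamondop> \<gamma>) ` \<Gamma>)" by (simp add: image_image)
  also have "(\<lambda>g. g \<diamondop> \<gamma>) ` \<Gamma> = \<Gamma>"
  proof (rule subset_antisym; rule subsetI)
    fix h assume h: "h \<in> \<Gamma>"
    have "h = (h \<diamondop> hinv \<gamma>) \<diamondop> \<gamma>"
      using BG.m_assoc[of h "hinv \<gamma>" \<gamma>] BG.l_inv[of \<gamma>] BG.r_one[of h] BG.inv_closed[of \<gamma>] \<Gamma>_isom'[OF h] \<Gamma>_isom'[OF \<gamma>] by simp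
    then show "h \<in> (\<lambda>g. g \<diamondop> \<gamma>) ` \<Gamma>" using \<Gamma>_mult[OF h \<Gamma>_inv[OF \<gamma>]] by blast
  qed (use \<Gamma>_mult[OF _ \<gamma>] in blast)
  also have "(\<lambda>g. vec (act g \<omega>)) ` \<Gamma> = orbit (vec \<omega>)" by (rule or[OF e, symmetric])
  finally show ?thesis .
qed

text \<open>The sets in the supremum that defines the quotient measure. If two elements of \<Gamma>
  carry a point into \<open>E\<close>, both images have the same orbit, so injectivity of
  \<open>orbit\<close> on \<open>A\<close> and of the Hopf parametrization makes them equal; this is
  the injectivity condition of \<open>emeasure_le_if_moved_into\<close>.\<close>

lemma emeasure_bm_lift_le:
  assumes inj: "inj_on orbit A"
  shows "emeasure (bm_lift \<Gamma> \<mu> z) A \<le> emeasure bm domain"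
proof -
  define E where "E = vec -` A \<inter> space (bm_hopf \<Gamma> \<mu> z)"
  have "emeasure (bm_lift \<Gamma> \<mu> z) A \<le> emeasure (bm_hopf \<Gamma> \<mu> z) E"
    unfolding bm_lift_def E_def vec_def by (rule emeasure_distr_le)
  also have "\<dots> \<le> emeasure bm domain"
  proof (cases "E \<in> sets (bm_hopf \<Gamma> \<mu> z)")
    case False then show ?thesis by (simp add: emeasure_notin_sets)
  next
    case True
    note h = emeasure_bm_hopf[OF True]
    define e where "e = from_nat_into \<Gamma>"
    have e: "range e = \<Gamma>" unfolding e_def using \<Gamma>_one by (intro range_from_nat_into countable_\<Gamma>) auto
    have e\<Gamma>: "e n \<in> \<Gamma>" for n using e by blast
    have sets_bm: "sets bm = sets prod3" and space_bm: "space bm = space prod3" by (simp_all add: bm_def)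
    have meas: "act \<gamma> \<in> bm \<rightarrow>\<^sub>M bm" if "\<gamma> \<in> \<Gamma>" for \<gamma>
      using act_measurable[OF that] by (simp only: measurable_cong_sets[OF sets_bm sets_bm])
    have "emeasure bm E \<le> emeasure bm domain"
    proof (rule emeasure_le_if_moved_into[where \<phi> = "\<lambda>n. act (e n)" and \<psi> = "\<lambda>n. act (hinv (e n))"])
      show "E \<in> sets bm" "domain \<in> sets bm" unfolding sets_bm by (rule h(1), rule domain_sets)
      show "act (e n) \<in> bm \<rightarrow>\<^sub>M bm" "act (hinv (e n)) \<in> bm \<rightarrow>\<^sub>M bm" for n by (intro meas e\<Gamma> \<Gamma>_inv)+
      show "emeasure bm (act (e n) -` B \<inter> space bm) = emeasure bm B" if "B \<in> sets bm" for n B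
        using emeasure_bm_act[OF e\<Gamma>, of B n] that unfolding sets_bm space_bm .
      show "act (hinv (e n)) (act (e n) y) = y" if "y \<in> space bm" for n y
        using act_inv(1)[OF e\<Gamma>, of y n] that unfolding space_bm .
      have "\<exists>n. act (hinv (e n)) y \<in> domain" if "\<exists>\<gamma>\<in>\<Gamma>. act (hinv \<gamma>) y \<in> domain" for y
        using that unfolding e[symmetric] by auto
      note ex = this
      show "AE y in bm. y \<in> E \<longrightarrow> (\<exists>n. act (hinv (e n)) y \<in> domain)"
        by (rule eventually_mono[OF bm_cover]) (use ex in blast)
      show "act (e i) y = act (e j) y" if y: "y \<in> space bm" "act (e i) y \<in> E" "act (e j) y \<in> E" for i j y
      proof -
        obtain \<xi> \<eta> t where w: "y = (\<xi>, \<eta>, t)" by (cases y) auto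
        have sp: "y \<in> space prod3" using y(1) unfolding space_bm .
        have "\<xi> \<noteq> \<eta>" using y(2) h(2) by (auto simp: w act_def)
        then have ep: "endpoints \<xi> \<eta>" using endpoints_iff sp unfolding w by blast
        then have ep': "endpoints (fst y) (fst (snd y))" by (simp add: w)
        have "orbit (vec (act (e i) y)) = orbit (vec (act (e j) y))"
          unfolding orbit_act[OF e\<Gamma> sp ep'] ..
        then have "vec (act (e i) y) = vec (act (e j) y)"
          by (rule inj_onD[OF inj]) (use y in \<open>auto simp: E_def\<close>)
        then have "hopf z (vec (act (e i) y)) = hopf z (vec (act (e j) y))" by simp
        moreover have "hopf z (vec (act \<gamma> y)) = act \<gamma> y" if "\<gamma> \<in> \<Gamma>" for \<gamma>
          using hopf_vec[OF endpoints_bdry_act[OF \<Gamma>_isom'[OF that] ep]] by (simp add: w act_def)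
        ultimately show ?thesis using e\<Gamma> by simp
      qed
    qed
    then show ?thesis unfolding h(3) .
  qed
  finally show ?thesis .
qed

lemma finite_bowen_margulis: "finite_measure (bowen_margulis \<Gamma> \<mu> z)"
proof (rule finite_measureI)
  have "emeasure (bowen_margulis \<Gamma> \<mu> z) (space (bowen_margulis \<Gamma> \<mu> z)) \<le> emeasure bm domain"
    unfolding bowen_margulis_def orbit_def[abs_def, symmetric] emeasure_quotient_measure[OF sets.top]
    by (rule SUP_least) (use emeasure_bm_lift_le in auto)
  then show "emeasure (bowen_margulis \<Gamma> \<mu> z) (space (bowen_margulis \<Gamma> \<mu> z)) \<noteq> \<infinity>"
    using finite_domain by auto
qed

end

theorem proposition8p3:
  fixes G H \<Gamma> :: "(real ^ 'n \<Rightarrow> real ^ 'n) set" and x :: "real ^ 'n" and R :: real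
  assumes "CARD('n) \<ge> 2"
    and "kleinian G" and "kleinian H"
    and "schottky_position G H"
    and "\<Gamma> = generated_group G H"
    and "critical_exponent G > critical_exponent H"
    and "divergent_group G"
    and "x \<in> hyp" and "R > 0"
    and "hyp_ball x R \<inter> fst ` Omega \<Gamma> \<noteq> {}"
    and "\<forall>g\<in>words_beginning_in G H. \<forall>h\<in>words_beginning_in H G.
           geodesic_segment (g x) (h x) \<inter> hyp_ball x R \<noteq> {}"
  shows "positive_recurrent \<Gamma> x (hyp_ball x R) \<and>
    (\<forall>\<mu> x\<^sub>0. patterson_sullivan_density \<Gamma> \<mu> \<and> x\<^sub>0 \<in> hyp
       \<longrightarrow> finite_measure (bowen_margulis \<Gamma> \<mu> x\<^sub>0))"
proof -
  define K where "K b = (if b then G else H)" for b :: bool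
  have cp: "crossing_pair K x R"
  proof
    show "kleinian (K b)" for b using assms(2,3) by (simp add: K_def)
    show "x \<in> hyp" "R > 0" by (rule assms)+
    show "geodesic_segment (g x) (h x) \<inter> hyp_ball x R \<noteq> {}"
      if "g \<in> words_beginning_in (K b) (K (\<not> b))" "h \<in> words_beginning_in (K (\<not> b)) (K b)" for b g h
      using that assms(11) geodesic_segment_commute[of "g x" "h x"] by (cases b) (auto simp: K_def)
  qed
  have dp: "divergent_pair K x R"
    using cp assms(6,7) by (auto simp: divergent_pair_def divergent_pair_axioms_def K_def)
  have \<Gamma>: "crossing_pair.\<Gamma> K = \<Gamma>"
    using crossing_pair.\<Gamma>_def[OF cp] assms(5) by (simp add: K_def)
  have "finite_measure (bowen_margulis \<Gamma> \<mu> x\<^sub>0)" if "patterson_sullivan_density \<Gamma> \<mu>" "x\<^sub>0 \<in> hyp" for \<mu> x\<^sub>0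
  proof -
    have "ps_pair K x R \<mu> x\<^sub>0" using dp that by (simp add: ps_pair_def ps_pair_axioms_def \<Gamma>)
    from ps_pair.finite_bowen_margulis[OF this] show ?thesis unfolding \<Gamma> .
  qed
  with divergent_pair.positive_recurrent_\<Gamma>[OF dp] show ?thesis unfolding \<Gamma> by blast
qed

end
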